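(* Let $G$ be a finite group, let $\mathbf{C}$ be a cocomplete stable $\infty$-category, and let $E\colon G\mathbf{BornCoarse}_{tr}\to\mathbf{C}$ be an equivariant coarse homology theory with transfers. The functor $EM:=E\circ M\circ D\colon A^{\mathrm{eff}}(G)^{op}\to\mathbf{C}$ preserves coproducts, i.e., it belongs to the full subcategory $\mathbf{Mack}_{\mathbf{C}}(G)$ of $\mathrm{Fun}(A^{\mathrm{eff}}(G)^{op},\mathbf{C})$.
   Context: **Coarse spaces.** A coarse structure on a set $X$ is a collection $\mathcal{C}_X$ of subsets of $X\times X$ (entourages) containing the diagonal and closed under subsets, finite unions, inverses and compositions. A bornology is a collection of subsets of $X$ (bounded sets) covering $X$ and closed under subsets and finite unions. For $U\subseteq X\times X$, $A\subseteq X$ put $U[A]=\{x\mid\exists a\in A:(x,a)\in U\}$. A $G$-coarse space is a $G$-set with a $G$-invariant coarse structure in which the set $\mathcal{C}_X^G$ of $G$-invariant entourages is cofinal. A $G$-bornological coarse space is a $G$-coarse space with a $G$-invariant bornology such that $U[B]$ is bounded for every entourage $U$ and bounded $B$. An equivariant map is controlled if it sends entourages to entourages, proper if preimages of bounded sets are bounded, bornological if images of bounded sets are bounded. $G\mathbf{BornCoarse}$ is the category of $G$-bornological coarse spaces and equivariant controlled proper maps; $\widetilde{G\mathbf{BornCoarse}}$ has the same objects and all equivariant controlled maps as morphisms. $X\otimes Y$ is the product $G$-set with the coarse structure generated by products of entourages and bornology generated by products of bounded sets. $S_{min,min}$ is the $G$-set $S$ with the minimal coarse structure (subsets of the diagonal)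 and minimal bornology (finite subsets); $max$ denotes maximal structures. For $U\in\mathcal{C}_X^G$, $X_U$ is $X$ with the coarse structure replaced by the one generated by $U$. **Bounded coverings.** Coarse components of $X$ are the equivalence classes of $R_X=\bigcup_{U\in\mathcal{C}_X}U$; $\pi_0(X)$ is the $G$-set of them; $[A]$ is the union of the components meeting $A$; $A,B$ are coarsely disjoint if $[A]\cap[B]=\emptyset$. A morphism $w\colon W\to Z$ of $G$-coarse spaces is a bounded coarse covering if (1) $\mathcal{C}_W$ is generated by the sets $F\cap\bigsqcup_{W_0\in\pi_0(W)}W_0\times W_0$ with $F\in w^{-1}\mathcal{C}_Z$, where $w^{-1}\mathcal{C}_Z$ is the maximal coarse structure making $w$ controlled, and (2) for every $W_0\in\pi_0(W)$ the map $w_{|W_0}\colon W_0\to w(W_0)$ is an isomorphism between coarse components. A morphism $u\colon X\to Y$ in $\widetilde{G\mathbf{BornCoarse}}$ is a bounded covering if it is a bounded coarse covering, is bornological, and every bounded $B\subseteq X$ has a finite coarsely disjoint partition $(B_a)_a$ such that each $u_{|[B_a]}\colon[B_a]\to[u(B_a)]$ is an isomorphism of coarse spaces. A square in $\widetilde{G\mathbf{BornCoarse}}$ with horizontal maps $f\colon W\to U$, $g\colon V\to Z$ and vertical maps $w\colon W\to V$, $u\colon U\to Z$ is admissible if it is cartesian, $f$ and $g$ are proper and bornological, and $u$ is a bounded covering. **$G\mathbf{BornCoarse}_{tr}$.** Let $\mathrm{Tw}[n]$ be the poset of pairs $(i,j)$, $0\le i\le j\le n$, with $(i,j)\le(i',j')$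 iff $i\le i'\le j'\le j$. $G\mathbf{BornCoarse}_{tr}$ is the quasi-category whose $n$-simplices are the functors $X\colon\mathrm{Tw}[n]\to\widetilde{G\mathbf{BornCoarse}}$ such that the maps $X_{i,j}\to X_{i,j-1}$ are bounded coverings, the maps $X_{i,j}\to X_{i+1,j}$ are proper and bornological, and for $1\le i\le j\le n-1$ the square formed by $X_{i-1,j+1},X_{i,j+1},X_{i-1,j},X_{i,j}$ is admissible (with $X_{i,j+1}\to X_{i,j}$ the bounded covering $u$). The embedding $\iota\colon G\mathbf{BornCoarse}\to G\mathbf{BornCoarse}_{tr}$ is the identity on objects and sends a chain $X_0\to\dots\to X_n$ to the simplex whose $(i,j)$ entry is $X_i$ with its bornology replaced by the pull-back of the bornology of $X_j$; the maps $(i,j)\to(i,j-1)$ are identities of underlying sets and the maps $(i,j)\to(i+1,j)$ are induced by $X_i\to X_{i+1}$. **Coarse homology theories.** An equivariant big family on $X$ is a family $\mathcal{Y}=(Y_i)_{i\in I}$ of invariant subsets indexed by a filtered poset, increasing in $i$, such that for every $i$ and entourage $U$ there is $j$ with $U[Y_i]\subseteq Y_j$. An equivariant complementary pair $(Z,\mathcal{Y})$ consists of an invariant subset $Z$ and an equivariant big family with $Z\cup Y_i=X$ for some $i$. Put $E(\mathcal{Y})=\mathrm{colim}_iE(Y_i)$. $X$ is flasque if there is a morphism $f\colon X\to X$ with $(f,\mathrm{id})(\mathrm{diag}_X)\in\mathcal{C}_X$, with $\bigcup_n(f^n\times f^n)(U)\in\mathcal{C}_X$ for all $U\in\mathcal{C}_X$,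 and such that for every bounded $B$ there is $n$ with $f^n(X)\cap B=\emptyset$. A functor $E\colon G\mathbf{BornCoarse}\to\mathbf{C}$ is an equivariant coarse homology theory if: $E(\emptyset)\simeq0$ and for each equivariant complementary pair the square with corners $E(Z\cap\mathcal{Y}),E(Z),E(\mathcal{Y}),E(X)$ is a push-out; $E(\{0,1\}_{max,max}\otimes X)\to E(X)$ is an equivalence for all $X$; $E(X)\simeq0$ for $X$ flasque; and $\mathrm{colim}_{U\in\mathcal{C}_X^G}E(X_U)\to E(X)$ is an equivalence for all $X$. An equivariant coarse homology theory with transfers is a functor $E\colon G\mathbf{BornCoarse}_{tr}\to\mathbf{C}$ such that $E\circ\iota$ is an equivariant coarse homology theory. **Mackey functors.** $G\mathbf{Fin}$ is the category of finite $G$-sets. $A^{\mathrm{eff}}(G)$ is the $\infty$-category whose $n$-simplices are the functors $X\colon\mathrm{Tw}[n]\to G\mathbf{Fin}$ such that for all $0\le i\le i'\le j'\le j\le n$ the square formed by $X_{i,j},X_{i',j},X_{i,j'},X_{i',j'}$ is a pull-back. $D\colon A^{\mathrm{eff}}(G)^{op}\to A^{\mathrm{eff}}(G)$ is the canonical duality (identity on objects, reversing spans). $\mathbf{Mack}_{\mathbf{C}}(G)\subseteq\mathrm{Fun}(A^{\mathrm{eff}}(G)^{op},\mathbf{C})$ is the full subcategory of coproduct preserving (equivalently, additive) functors. The functor $G\mathbf{Fin}\to G\mathbf{BornCoarse}$, $S\mapsto S_{min,min}$, sends every morphism to a bounded covering and pull-back squares to admissible squares, and hence induces (by applying it to all entries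 of simplices) the functor $M\colon A^{\mathrm{eff}}(G)\to G\mathbf{BornCoarse}_{tr}$. *)

theory Defs
  imports "HOL-Algebra.Group_Action" "HOL-Library.FuncSet"
begin

section \<open>Simplicial sets\<close>

text \<open>
  A monotone map \<open>\<alpha> : [m] \<rightarrow> [n]\<close> is represented by the list \<open>[\<alpha> 0, \<dots>, \<alpha> m]\<close>;
  \<open>opr X n \<alpha>\<close> is the induced operator from the \<open>n\<close>-simplices to the \<open>m\<close>-simplices,
  where \<open>m + 1\<close> is the length of \<open>\<alpha>\<close>.
\<close>

record 'a sset =
  splx :: "nat \<Rightarrow> 'a set"
  opr :: "nat \<Rightarrow> nat list \<Rightarrow> 'a \<Rightarrow> 'a"

definition pnerve :: "'p set \<Rightarrow> ('p \<Rightarrow> 'p \<Rightarrow> bool) \<Rightarrow> 'p list sset" where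
  "pnerve P po = \<lparr>splx = (\<lambda>n. {l. length l = Suc n \<and> set l \<subseteq> P \<and> sorted_wrt po l}),
                  opr = (\<lambda>n \<alpha> l. map (nth l) \<alpha>)\<rparr>"

abbreviation Delta :: "nat \<Rightarrow> nat list sset" where
  "Delta n \<equiv> pnerve {..n} (\<le>)"

definition is_sset :: "'a sset \<Rightarrow> bool" where
  "is_sset X \<longleftrightarrow> (\<forall>n. \<forall>x\<in>splx X n.
     opr X n [0..<Suc n] x = x \<and>
     (\<forall>m. \<forall>\<alpha>\<in>splx (Delta n) m. opr X n \<alpha> x \<in> splx X m \<and>
       (\<forall>k. \<forall>\<beta>\<in>splx (Delta m) k. opr X m \<beta> (opr X n \<alpha> x) = opr X n (map (nth \<alpha>) \<beta>) x)))"

definition sset_map :: "'a sset \<Rightarrow> 'b sset \<Rightarrow> (nat \<Rightarrow> 'a \<Rightarrow> 'b) \<Rightarrow> bool" where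
  "sset_map K L f \<longleftrightarrow> (\<forall>n. \<forall>x\<in>splx K n. f n x \<in> splx L n \<and>
     (\<forall>m. \<forall>\<alpha>\<in>splx (Delta n) m. f m (opr K n \<alpha> x) = opr L n \<alpha> (f n x)))"

definition sub_sset :: "'a sset \<Rightarrow> (nat \<Rightarrow> 'a \<Rightarrow> bool) \<Rightarrow> 'a sset" where
  "sub_sset X Q = X\<lparr>splx := (\<lambda>n. {x \<in> splx X n. Q n x})\<rparr>"

definition boundary :: "nat \<Rightarrow> nat list sset" where
  "boundary n = sub_sset (Delta n) (\<lambda>_ \<alpha>. set \<alpha> \<noteq> {..n})"

definition horn :: "nat \<Rightarrow> nat \<Rightarrow> nat list sset" where
  "horn n k = sub_sset (Delta n) (\<lambda>_ \<alpha>. \<not> {..n} - {k} \<subseteq> set \<alpha>)"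

definition quasi_category :: "'a sset \<Rightarrow> bool" where
  "quasi_category C \<longleftrightarrow> is_sset C \<and>
     (\<forall>n k h. 0 < k \<and> k < n \<and> sset_map (horn n k) C h \<longrightarrow>
       (\<exists>s\<in>splx C n. \<forall>m. \<forall>\<alpha>\<in>splx (horn n k) m. opr C n \<alpha> s = h m \<alpha>))"

text \<open>The entry at position \<open>i\<close> of the second list below is \<open>n - \<alpha> (m - i)\<close>.\<close>

definition op_sset :: "'a sset \<Rightarrow> 'a sset" where
  "op_sset X = \<lparr>splx = splx X, opr = (\<lambda>n \<alpha>. opr X n (rev (map (\<lambda>i. n - i) \<alpha>)))\<rparr>"

definition discrete :: "'j set \<Rightarrow> 'j sset" where
  "discrete J = \<lparr>splx = (\<lambda>n. J), opr = (\<lambda>n \<alpha> x. x)\<rparr>"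

text \<open>
  The join: \<open>JMix i x y\<close> is the \<open>n\<close>-simplex whose first \<open>i + 1\<close> vertices span the \<open>i\<close>-simplex \<open>x\<close>
  of \<open>K\<close> and whose last \<open>n - i\<close> vertices span the \<open>(n - 1 - i)\<close>-simplex \<open>y\<close> of \<open>L\<close>.
\<close>

datatype ('a, 'b) join = JLeft 'a | JRight 'b | JMix nat 'a 'b

fun join_opr :: "'a sset \<Rightarrow> 'b sset \<Rightarrow> nat \<Rightarrow> nat list \<Rightarrow> ('a, 'b) join \<Rightarrow> ('a, 'b) join" where
  "join_opr K L n \<alpha> (JLeft x) = JLeft (opr K n \<alpha> x)"
| "join_opr K L n \<alpha> (JRight y) = JRight (opr L n \<alpha> y)"
| "join_opr K L n \<alpha> (JMix i x y) =
    (let \<beta> = filter (\<lambda>t. t \<le> i) \<alpha>; \<gamma> = map (\<lambda>t. t - Suc i) (filter (\<lambda>t. i < t) \<alpha>) in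
     if \<gamma> = [] then JLeft (opr K i \<beta> x)
     else if \<beta> = [] then JRight (opr L (n - Suc i) \<gamma> y)
     else JMix (length \<beta> - 1) (opr K i \<beta> x) (opr L (n - Suc i) \<gamma> y))"

definition sjoin :: "'a sset \<Rightarrow> 'b sset \<Rightarrow> ('a, 'b) join sset" where
  "sjoin K L = \<lparr>splx = (\<lambda>n. JLeft ` splx K n \<union> JRight ` splx L n \<union>
                   {JMix i x y | i x y. i < n \<and> x \<in> splx K i \<and> y \<in> splx L (n - Suc i)}),
                opr = join_opr K L\<rparr>"

definition restrict_sset :: "'a sset \<Rightarrow> (nat \<Rightarrow> 'a \<Rightarrow> 'b) \<Rightarrow> nat \<Rightarrow> 'a \<Rightarrow> 'b" where
  "restrict_sset K f = (\<lambda>n. restrict (f n) (splx K n))"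

text \<open>
  The slice \<open>C\<^bsub>p/\<^esub>\<close> under a diagram \<open>p : K \<rightarrow> C\<close>: its \<open>n\<close>-simplices are the maps
  \<open>K \<star> \<Delta>\<^sup>n \<rightarrow> C\<close> extending \<open>p\<close>.
\<close>

definition under_slice ::
    "'k sset \<Rightarrow> 'c sset \<Rightarrow> (nat \<Rightarrow> 'k \<Rightarrow> 'c) \<Rightarrow> (nat \<Rightarrow> ('k, nat list) join \<Rightarrow> 'c) sset" where
  "under_slice K C p =
    \<lparr>splx = (\<lambda>n. {f. sset_map (sjoin K (Delta n)) C f \<and> restrict_sset (sjoin K (Delta n)) f = f \<and>
                    (\<forall>m. \<forall>x\<in>splx K m. f m (JLeft x) = p m x)}),
     opr = (\<lambda>n \<alpha> f. restrict_sset (sjoin K (Delta (length \<alpha> - 1)))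
              (\<lambda>m z. f m (map_join id (map (nth \<alpha>)) z)))\<rparr>"


section \<open>Colimits and stability\<close>

text \<open>
  An object \<open>x\<close> of a quasi-category is initial if \<open>S\<^bsub>x/\<^esub> \<rightarrow> S\<close> is a trivial fibration, that is, if
  every sphere in \<open>S\<close> with vertex \<open>0\<close> at \<open>x\<close> can be filled.
\<close>

definition initial :: "'a sset \<Rightarrow> 'a \<Rightarrow> bool" where
  "initial S x \<longleftrightarrow> x \<in> splx S 0 \<and>
     (\<forall>n b. 0 < n \<and> sset_map (boundary n) S b \<and> b 0 [0] = x \<longrightarrow>
       (\<exists>s\<in>splx S n. \<forall>m. \<forall>\<alpha>\<in>splx (boundary n) m. opr S n \<alpha> s = b m \<alpha>))"

definition zero_object :: "'a sset \<Rightarrow> 'a \<Rightarrow> bool" where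
  "zero_object C x \<longleftrightarrow> initial C x \<and> initial (op_sset C) x"

definition equivalence :: "'a sset \<Rightarrow> 'a \<Rightarrow> bool" where
  "equivalence C e \<longleftrightarrow> e \<in> splx C 1 \<and> (\<exists>g\<in>splx C 1. \<exists>s\<in>splx C 2. \<exists>t\<in>splx C 2.
     opr C 2 [0,1] s = e \<and> opr C 2 [1,2] s = g \<and> opr C 2 [0,2] s = opr C 1 [0,0] e \<and>
     opr C 2 [0,1] t = g \<and> opr C 2 [1,2] t = e \<and> opr C 2 [0,2] t = opr C 1 [1,1] e)"

definition colimit_cocone ::
    "'k sset \<Rightarrow> 'c sset \<Rightarrow> (nat \<Rightarrow> ('k, nat list) join \<Rightarrow> 'c) \<Rightarrow> bool" where
  "colimit_cocone K C c \<longleftrightarrow>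
     initial (under_slice K C (\<lambda>n x. c n (JLeft x))) (restrict_sset (sjoin K (Delta 0)) c)"

definition cocomplete :: "'k itself \<Rightarrow> 'c sset \<Rightarrow> bool" where
  "cocomplete (_ :: 'k itself) C \<longleftrightarrow>
     (\<forall>(K :: 'k sset) p. is_sset K \<and> sset_map K C p \<longrightarrow>
       (\<exists>c. (\<forall>n. \<forall>x\<in>splx K n. c n (JLeft x) = p n x) \<and> colimit_cocone K C c))"

text \<open>
  A family \<open>H\<close> defined on chains of a poset, a monotone \<open>\<phi>\<close> into that poset and an upper bound \<open>t\<close>
  of the image of \<open>\<phi>\<close> give a cocone with apex \<open>t\<close>.
\<close>

fun chain_cocone :: "('p \<Rightarrow> 'q) \<Rightarrow> 'q \<Rightarrow> (nat \<Rightarrow> 'q list \<Rightarrow> 'c) \<Rightarrow> nat \<Rightarrow> ('p list, nat list) join \<Rightarrow> 'c" where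
  "chain_cocone \<phi> t H n (JLeft l) = H n (map \<phi> l)"
| "chain_cocone \<phi> t H n (JRight y) = H n (map (\<lambda>_. t) y)"
| "chain_cocone \<phi> t H n (JMix i l y) = H n (map \<phi> l @ map (\<lambda>_. t) y)"

text \<open>Squares are maps from \<open>\<Delta>\<^sup>1 \<times> \<Delta>\<^sup>1\<close>, the nerve of the poset \<open>[1] \<times> [1]\<close>.\<close>

definition prod_le :: "('p \<Rightarrow> 'p \<Rightarrow> bool) \<Rightarrow> ('q \<Rightarrow> 'q \<Rightarrow> bool) \<Rightarrow> 'p \<times> 'q \<Rightarrow> 'p \<times> 'q \<Rightarrow> bool" where
  "prod_le po po' p q \<longleftrightarrow> po (fst p) (fst q) \<and> po' (snd p) (snd q)"

abbreviation square_le :: "nat \<times> nat \<Rightarrow> nat \<times> nat \<Rightarrow> bool" where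
  "square_le \<equiv> prod_le (\<le>) (\<le>)"

definition square :: "'c sset \<Rightarrow> (nat \<Rightarrow> (nat \<times> nat) list \<Rightarrow> 'c) \<Rightarrow> bool" where
  "square C q \<longleftrightarrow> sset_map (pnerve ({..1} \<times> {..1}) square_le) C q"

definition pushout_square :: "'c sset \<Rightarrow> (nat \<Rightarrow> (nat \<times> nat) list \<Rightarrow> 'c) \<Rightarrow> bool" where
  "pushout_square C q \<longleftrightarrow> square C q \<and>
     colimit_cocone (pnerve {(0,0),(0,1),(1,0)} square_le) C (chain_cocone id (1,1) q)"

definition pullback_square :: "'c sset \<Rightarrow> (nat \<Rightarrow> (nat \<times> nat) list \<Rightarrow> 'c) \<Rightarrow> bool" where
  "pullback_square C q \<longleftrightarrow>
     pushout_square (op_sset C) (\<lambda>n l. q n (rev (map (\<lambda>(a, b). (1 - a, 1 - b)) l)))"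

definition triangle :: "'c sset \<Rightarrow> (nat \<Rightarrow> (nat \<times> nat) list \<Rightarrow> 'c) \<Rightarrow> bool" where
  "triangle C q \<longleftrightarrow> square C q \<and> zero_object C (q 0 [(1,0)])"

definition stable :: "'c sset \<Rightarrow> bool" where
  "stable C \<longleftrightarrow> quasi_category C \<and> (\<exists>z. zero_object C z) \<and>
     (\<forall>e\<in>splx C 1. \<exists>q. triangle C q \<and> pullback_square C q \<and> q 1 [(0,1),(1,1)] = e) \<and>
     (\<forall>e\<in>splx C 1. \<exists>q. triangle C q \<and> pushout_square C q \<and> q 1 [(0,0),(0,1)] = e) \<and>
     (\<forall>q. triangle C q \<longrightarrow> (pullback_square C q \<longleftrightarrow> pushout_square C q))"


section \<open>Categories and diagrams indexed by posets\<close>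

text \<open>\<open>Cmp C a g f\<close> is the composite \<open>g \<circ> f\<close>, where \<open>a\<close> is the source of \<open>f\<close>.\<close>

record ('o, 'm) cat =
  Ob :: "'o set"
  Hom :: "'o \<Rightarrow> 'o \<Rightarrow> 'm set"
  Idn :: "'o \<Rightarrow> 'm"
  Cmp :: "'o \<Rightarrow> 'm \<Rightarrow> 'm \<Rightarrow> 'm"

type_synonym ('p, 'o, 'm) diag = "('p \<Rightarrow> 'o) \<times> ('p \<Rightarrow> 'p \<Rightarrow> 'm)"

text \<open>Values outside the indexing poset are fixed, so that equal functors are equal terms.\<close>

definition mk_diag ::
    "'p set \<Rightarrow> ('p \<Rightarrow> 'p \<Rightarrow> bool) \<Rightarrow> ('p \<Rightarrow> 'o) \<Rightarrow> ('p \<Rightarrow> 'p \<Rightarrow> 'm) \<Rightarrow> ('p, 'o, 'm) diag" where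
  "mk_diag P po F0 F1 =
     ((\<lambda>p. if p \<in> P then F0 p else undefined),
      (\<lambda>p q. if p \<in> P \<and> q \<in> P \<and> po p q then F1 p q else undefined))"

definition is_functor ::
    "'p set \<Rightarrow> ('p \<Rightarrow> 'p \<Rightarrow> bool) \<Rightarrow> ('o, 'm) cat \<Rightarrow> ('p, 'o, 'm) diag \<Rightarrow> bool" where
  "is_functor P po C F \<longleftrightarrow>
     mk_diag P po (fst F) (snd F) = F \<and>
     (\<forall>p\<in>P. fst F p \<in> Ob C \<and> snd F p p = Idn C (fst F p)) \<and>
     (\<forall>p\<in>P. \<forall>q\<in>P. po p q \<longrightarrow> snd F p q \<in> Hom C (fst F p) (fst F q)) \<and>
     (\<forall>p\<in>P. \<forall>q\<in>P. \<forall>r\<in>P. po p q \<and> po q r \<longrightarrow>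
        snd F p r = Cmp C (fst F p) (snd F q r) (snd F p q))"

definition reindex ::
    "'p set \<Rightarrow> ('p \<Rightarrow> 'p \<Rightarrow> bool) \<Rightarrow> ('p \<Rightarrow> 'q) \<Rightarrow> ('q, 'o, 'm) diag \<Rightarrow> ('p, 'o, 'm) diag" where
  "reindex P po \<phi> F = mk_diag P po (\<lambda>p. fst F (\<phi> p)) (\<lambda>p q. snd F (\<phi> p) (\<phi> q))"

definition nerve :: "('o, 'm) cat \<Rightarrow> (nat, 'o, 'm) diag sset" where
  "nerve C = \<lparr>splx = (\<lambda>n. {F. is_functor {..n} (\<le>) C F}),
              opr = (\<lambda>n \<alpha>. reindex {..length \<alpha> - 1} (\<le>) (nth \<alpha>))\<rparr>"

definition Tw :: "nat \<Rightarrow> (nat \<times> nat) set" where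
  "Tw n = {(i, j). i \<le> j \<and> j \<le> n}"

definition tw_le :: "nat \<times> nat \<Rightarrow> nat \<times> nat \<Rightarrow> bool" where
  "tw_le p q \<longleftrightarrow> fst p \<le> fst q \<and> fst q \<le> snd q \<and> snd q \<le> snd p"

definition tw_sset ::
    "('o, 'm) cat \<Rightarrow> (nat \<Rightarrow> (nat \<times> nat, 'o, 'm) diag \<Rightarrow> bool) \<Rightarrow> (nat \<times> nat, 'o, 'm) diag sset" where
  "tw_sset C Q =
     \<lparr>splx = (\<lambda>n. {F. is_functor (Tw n) tw_le C F \<and> Q n F}),
      opr = (\<lambda>n \<alpha>. reindex (Tw (length \<alpha> - 1)) tw_le (map_prod (nth \<alpha>) (nth \<alpha>)))\<rparr>"

text \<open>
  \<open>cartesian C W U V Z f w u g\<close>: the square with \<open>f : W \<rightarrow> U\<close> on top, \<open>g : V \<rightarrow> Z\<close> at the bottom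
  and vertical maps \<open>w : W \<rightarrow> V\<close>, \<open>u : U \<rightarrow> Z\<close> is cartesian.
\<close>

definition cartesian ::
    "('o, 'm) cat \<Rightarrow> 'o \<Rightarrow> 'o \<Rightarrow> 'o \<Rightarrow> 'o \<Rightarrow> 'm \<Rightarrow> 'm \<Rightarrow> 'm \<Rightarrow> 'm \<Rightarrow> bool" where
  "cartesian C W U V Z f w u g \<longleftrightarrow>
     {W, U, V, Z} \<subseteq> Ob C \<and>
     f \<in> Hom C W U \<and> w \<in> Hom C W V \<and> u \<in> Hom C U Z \<and> g \<in> Hom C V Z \<and>
     Cmp C W u f = Cmp C W g w \<and>
     (\<forall>T\<in>Ob C. \<forall>a\<in>Hom C T U. \<forall>b\<in>Hom C T V. Cmp C T u a = Cmp C T g b \<longrightarrow>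
        (\<exists>!h. h \<in> Hom C T W \<and> Cmp C T f h = a \<and> Cmp C T w h = b))"


section \<open>Equivariant bornological coarse spaces\<close>

record ('g, 'x) gset =
  car :: "'x set"
  act :: "'g \<Rightarrow> 'x \<Rightarrow> 'x"

record ('g, 'x) gspace = "('g, 'x) gset" +
  ent :: "('x \<times> 'x) set set"
  bdd :: "'x set set"

definition is_gset :: "('g, 'r) monoid_scheme \<Rightarrow> ('g, 'x, 'z) gset_scheme \<Rightarrow> bool" where
  "is_gset G X \<longleftrightarrow> group_action G (car X) (act X) \<and> act X \<in> extensional (carrier G)"

definition coarse_structure :: "'x set \<Rightarrow> ('x \<times> 'x) set set \<Rightarrow> bool" where
  "coarse_structure X \<C> \<longleftrightarrow> \<C> \<subseteq> Pow (X \<times> X) \<and> Id_on X \<in> \<C> \<and>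
     (\<forall>U\<in>\<C>. \<forall>V. V \<subseteq> U \<longrightarrow> V \<in> \<C>) \<and> (\<forall>U\<in>\<C>. \<forall>V\<in>\<C>. U \<union> V \<in> \<C>) \<and>
     (\<forall>U\<in>\<C>. U\<inverse> \<in> \<C>) \<and> (\<forall>U\<in>\<C>. \<forall>V\<in>\<C>. U O V \<in> \<C>)"

definition bornology :: "'x set \<Rightarrow> 'x set set \<Rightarrow> bool" where
  "bornology X \<B> \<longleftrightarrow> \<B> \<subseteq> Pow X \<and> \<Union>\<B> = X \<and> {} \<in> \<B> \<and>
     (\<forall>B\<in>\<B>. \<forall>A. A \<subseteq> B \<longrightarrow> A \<in> \<B>) \<and> (\<forall>A\<in>\<B>. \<forall>B\<in>\<B>. A \<union> B \<in> \<B>)"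

definition gen_coarse :: "'x set \<Rightarrow> ('x \<times> 'x) set set \<Rightarrow> ('x \<times> 'x) set set" where
  "gen_coarse X S = \<Inter>{\<C>. coarse_structure X \<C> \<and> S \<subseteq> \<C>}"

definition gen_born :: "'x set \<Rightarrow> 'x set set \<Rightarrow> 'x set set" where
  "gen_born X S = \<Inter>{\<B>. bornology X \<B> \<and> S \<subseteq> \<B>}"

definition thicken :: "('x \<times> 'x) set \<Rightarrow> 'x set \<Rightarrow> 'x set" where
  "thicken U A = {x. \<exists>a\<in>A. (x, a) \<in> U}"

definition inv_ent :: "('g, 'r) monoid_scheme \<Rightarrow> ('g, 'x) gspace \<Rightarrow> ('x \<times> 'x) set set" where
  "inv_ent G X = {U \<in> ent X. \<forall>g\<in>carrier G. map_prod (act X g) (act X g) ` U = U}"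

definition is_gspace :: "('g, 'r) monoid_scheme \<Rightarrow> ('g, 'x) gspace \<Rightarrow> bool" where
  "is_gspace G X \<longleftrightarrow> is_gset G X \<and>
     coarse_structure (car X) (ent X) \<and>
     (\<forall>g\<in>carrier G. \<forall>U\<in>ent X. map_prod (act X g) (act X g) ` U \<in> ent X) \<and>
     (\<forall>U\<in>ent X. \<exists>V\<in>inv_ent G X. U \<subseteq> V) \<and>
     bornology (car X) (bdd X) \<and>
     (\<forall>g\<in>carrier G. \<forall>B\<in>bdd X. act X g ` B \<in> bdd X) \<and>
     (\<forall>U\<in>ent X. \<forall>B\<in>bdd X. thicken U B \<in> bdd X)"

definition equivariant_maps ::
    "('g, 'r) monoid_scheme \<Rightarrow> ('g, 'x, 'z) gset_scheme \<Rightarrow> ('g, 'y, 'w) gset_scheme \<Rightarrow> ('x \<Rightarrow> 'y) set" where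
  "equivariant_maps G X Y =
     {f \<in> car X \<rightarrow>\<^sub>E car Y. \<forall>g\<in>carrier G. \<forall>x\<in>car X. f (act X g x) = act Y g (f x)}"

definition controlled :: "('g, 'x) gspace \<Rightarrow> ('g, 'y) gspace \<Rightarrow> ('x \<Rightarrow> 'y) \<Rightarrow> bool" where
  "controlled X Y f \<longleftrightarrow> (\<forall>U\<in>ent X. map_prod f f ` U \<in> ent Y)"

definition proper :: "('g, 'x) gspace \<Rightarrow> ('g, 'y) gspace \<Rightarrow> ('x \<Rightarrow> 'y) \<Rightarrow> bool" where
  "proper X Y f \<longleftrightarrow> (\<forall>B\<in>bdd Y. f -` B \<inter> car X \<in> bdd X)"

definition bornological :: "('g, 'x) gspace \<Rightarrow> ('g, 'y) gspace \<Rightarrow> ('x \<Rightarrow> 'y) \<Rightarrow> bool" where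
  "bornological X Y f \<longleftrightarrow> (\<forall>B\<in>bdd X. f ` B \<in> bdd Y)"

text \<open>
  The type \<open>'u\<close> plays the role of the universe: the small sets underlying spaces and \<open>G\<close>-sets
  are its subsets.
\<close>

definition GFin :: "('g, 'r) monoid_scheme \<Rightarrow> (('g, 'u) gset, 'u \<Rightarrow> 'u) cat" where
  "GFin G = \<lparr>Ob = {S. is_gset G S \<and> finite (car S)}, Hom = equivariant_maps G,
             Idn = (\<lambda>S. restrict id (car S)), Cmp = (\<lambda>S. compose (car S))\<rparr>"

definition GBornCoarse :: "('g, 'r) monoid_scheme \<Rightarrow> (('g, 'u) gspace, 'u \<Rightarrow> 'u) cat" where
  "GBornCoarse G = \<lparr>Ob = {X. is_gspace G X},
     Hom = (\<lambda>X Y. {f \<in> equivariant_maps G X Y. controlled X Y f \<and> proper X Y f}),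
     Idn = (\<lambda>X. restrict id (car X)), Cmp = (\<lambda>X. compose (car X))\<rparr>"

definition GBornCoarse_wide :: "('g, 'r) monoid_scheme \<Rightarrow> (('g, 'u) gspace, 'u \<Rightarrow> 'u) cat" where
  "GBornCoarse_wide G = \<lparr>Ob = {X. is_gspace G X},
     Hom = (\<lambda>X Y. {f \<in> equivariant_maps G X Y. controlled X Y f}),
     Idn = (\<lambda>X. restrict id (car X)), Cmp = (\<lambda>X. compose (car X))\<rparr>"

definition tensor :: "('g, 'x) gspace \<Rightarrow> ('g, 'y) gspace \<Rightarrow> ('g, 'x \<times> 'y) gspace" where
  "tensor X Y = \<lparr>car = car X \<times> car Y,
     act = (\<lambda>g. restrict (map_prod (act X g) (act Y g)) (car X \<times> car Y)),
     ent = gen_coarse (car X \<times> car Y)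
             {{((x, y), (x', y')) | x y x' y'. (x, x') \<in> U \<and> (y, y') \<in> V} | U V. U \<in> ent X \<and> V \<in> ent Y},
     bdd = gen_born (car X \<times> car Y) {A \<times> B | A B. A \<in> bdd X \<and> B \<in> bdd Y}\<rparr>"

definition max_max_two :: "('g, bool) gspace" where
  "max_max_two = \<lparr>car = UNIV, act = (\<lambda>g. id), ent = UNIV, bdd = UNIV\<rparr>"

definition min_min :: "('g, 'x) gset \<Rightarrow> ('g, 'x) gspace" where
  "min_min S = \<lparr>car = car S, act = act S, ent = Pow (Id_on (car S)), bdd = Fpow (car S)\<rparr>"

definition subspace :: "('g, 'r) monoid_scheme \<Rightarrow> ('g, 'x) gspace \<Rightarrow> 'x set \<Rightarrow> ('g, 'x) gspace" where
  "subspace G X A = \<lparr>car = A, act = (\<lambda>g\<in>carrier G. restrict (act X g) A),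
     ent = {U \<in> ent X. U \<subseteq> A \<times> A}, bdd = {B \<in> bdd X. B \<subseteq> A}\<rparr>"

definition pull_born :: "('x \<Rightarrow> 'y) \<Rightarrow> ('g, 'x) gspace \<Rightarrow> ('g, 'y) gspace \<Rightarrow> ('g, 'x) gspace" where
  "pull_born f X Y = X\<lparr>bdd := {B. B \<subseteq> car X \<and> f ` B \<in> bdd Y}\<rparr>"

definition coarsen_to :: "('g, 'x) gspace \<Rightarrow> ('x \<times> 'x) set \<Rightarrow> ('g, 'x) gspace" where
  "coarsen_to X U = X\<lparr>ent := gen_coarse (car X) {U}\<rparr>"

text \<open>An isomorphism whose source and target may live over different types.\<close>

definition gspace_iso ::
    "('g, 'r) monoid_scheme \<Rightarrow> ('g, 'x) gspace \<Rightarrow> ('g, 'y) gspace \<Rightarrow> ('x \<Rightarrow> 'y) \<Rightarrow> bool" where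
  "gspace_iso G X Y f \<longleftrightarrow> f \<in> equivariant_maps G X Y \<and> bij_betw f (car X) (car Y) \<and>
     ent Y = image (map_prod f f) ` ent X \<and> bdd Y = image f ` bdd X"


section \<open>Bounded coverings and the category with transfers\<close>

definition comp_rel :: "('g, 'x) gspace \<Rightarrow> ('x \<times> 'x) set" where
  "comp_rel X = \<Union>(ent X)"

definition components :: "('g, 'x) gspace \<Rightarrow> 'x set set" where
  "components X = car X // comp_rel X"

definition comp_hull :: "('g, 'x) gspace \<Rightarrow> 'x set \<Rightarrow> 'x set" where
  "comp_hull X A = \<Union>{K \<in> components X. K \<inter> A \<noteq> {}}"

text \<open>\<open>f\<close> restricts to an isomorphism of coarse spaces between the subspaces \<open>A\<close> and \<open>B\<close>.\<close>

definition coarse_iso_on ::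
    "('g, 'x) gspace \<Rightarrow> ('g, 'y) gspace \<Rightarrow> ('x \<Rightarrow> 'y) \<Rightarrow> 'x set \<Rightarrow> 'y set \<Rightarrow> bool" where
  "coarse_iso_on X Y f A B \<longleftrightarrow> bij_betw f A B \<and>
     (\<forall>U\<in>ent X. U \<subseteq> A \<times> A \<longrightarrow> map_prod f f ` U \<in> ent Y) \<and>
     (\<forall>V\<in>ent Y. V \<subseteq> B \<times> B \<longrightarrow> map_prod (inv_into A f) (inv_into A f) ` V \<in> ent X)"

definition max_coarse :: "'x set \<Rightarrow> ('g, 'y) gspace \<Rightarrow> ('x \<Rightarrow> 'y) \<Rightarrow> ('x \<times> 'x) set set" where
  "max_coarse W Z w = {F. F \<subseteq> W \<times> W \<and> map_prod w w ` F \<in> ent Z}"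

definition bounded_coarse_covering :: "('g, 'x) gspace \<Rightarrow> ('g, 'y) gspace \<Rightarrow> ('x \<Rightarrow> 'y) \<Rightarrow> bool" where
  "bounded_coarse_covering W Z w \<longleftrightarrow>
     ent W = gen_coarse (car W)
       {F \<inter> (\<Union>W0\<in>components W. W0 \<times> W0) | F. F \<in> max_coarse (car W) Z w} \<and>
     (\<forall>W0\<in>components W. w ` W0 \<in> components Z \<and> coarse_iso_on W Z w W0 (w ` W0))"

definition bounded_covering ::
    "('g, 'r) monoid_scheme \<Rightarrow> ('g, 'u) gspace \<Rightarrow> ('g, 'u) gspace \<Rightarrow> ('u \<Rightarrow> 'u) \<Rightarrow> bool" where
  "bounded_covering G X Y u \<longleftrightarrow>
     u \<in> Hom (GBornCoarse_wide G) X Y \<and> bounded_coarse_covering X Y u \<and> bornological X Y u \<and>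
     (\<forall>B\<in>bdd X. \<exists>\<P>. finite \<P> \<and> \<Union>\<P> = B \<and>
        (\<forall>A\<in>\<P>. \<forall>A'\<in>\<P>. A \<noteq> A' \<longrightarrow> comp_hull X A \<inter> comp_hull X A' = {}) \<and>
        (\<forall>A\<in>\<P>. coarse_iso_on X Y u (comp_hull X A) (comp_hull Y (u ` A))))"

definition admissible ::
    "('g, 'r) monoid_scheme \<Rightarrow> ('g, 'u) gspace \<Rightarrow> ('g, 'u) gspace \<Rightarrow> ('g, 'u) gspace \<Rightarrow> ('g, 'u) gspace \<Rightarrow>
     ('u \<Rightarrow> 'u) \<Rightarrow> ('u \<Rightarrow> 'u) \<Rightarrow> ('u \<Rightarrow> 'u) \<Rightarrow> ('u \<Rightarrow> 'u) \<Rightarrow> bool" where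
  "admissible G W U V Z f w u g \<longleftrightarrow>
     cartesian (GBornCoarse_wide G) W U V Z f w u g \<and>
     proper W U f \<and> bornological W U f \<and> proper V Z g \<and> bornological V Z g \<and>
     bounded_covering G U Z u"

type_synonym ('g, 'u) space_chain = "(nat, ('g, 'u) gspace, 'u \<Rightarrow> 'u) diag"
type_synonym ('g, 'u) tr_simplex = "(nat \<times> nat, ('g, 'u) gspace, 'u \<Rightarrow> 'u) diag"
type_synonym ('g, 'u) span_simplex = "(nat \<times> nat, ('g, 'u) gset, 'u \<Rightarrow> 'u) diag"

definition GBornCoarse_tr :: "('g, 'r) monoid_scheme \<Rightarrow> ('g, 'u) tr_simplex sset" where
  "GBornCoarse_tr G = tw_sset (GBornCoarse_wide G) (\<lambda>n (X, f).
     (\<forall>i j. i < j \<and> j \<le> n \<longrightarrow>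
        bounded_covering G (X (i, j)) (X (i, j - 1)) (f (i, j) (i, j - 1)) \<and>
        proper (X (i, j)) (X (i + 1, j)) (f (i, j) (i + 1, j)) \<and>
        bornological (X (i, j)) (X (i + 1, j)) (f (i, j) (i + 1, j))) \<and>
     (\<forall>i j. 1 \<le> i \<and> i \<le> j \<and> j + 1 \<le> n \<longrightarrow>
        admissible G (X (i - 1, j + 1)) (X (i, j + 1)) (X (i - 1, j)) (X (i, j))
          (f (i - 1, j + 1) (i, j + 1)) (f (i - 1, j + 1) (i - 1, j))
          (f (i, j + 1) (i, j)) (f (i - 1, j) (i, j))))"

definition iota :: "nat \<Rightarrow> ('g, 'u) space_chain \<Rightarrow> ('g, 'u) tr_simplex" where
  "iota n F = mk_diag (Tw n) tw_le
     (\<lambda>(i, j). pull_born (snd F i j) (fst F i) (fst F j))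
     (\<lambda>(i, j) (i', j'). snd F i i')"


section \<open>Coarse homology theories\<close>

text \<open>The chain in the nerve given by a list of spaces and maps that are the identity on points.\<close>

definition incl_chain :: "('g, 'u) gspace list \<Rightarrow> ('g, 'u) space_chain" where
  "incl_chain Xs = mk_diag {..<length Xs} (\<le>) (nth Xs) (\<lambda>i j. restrict id (car (Xs ! i)))"

definition edge :: "('g, 'u) gspace \<Rightarrow> ('g, 'u) gspace \<Rightarrow> ('u \<Rightarrow> 'u) \<Rightarrow> ('g, 'u) space_chain" where
  "edge X Y f = mk_diag {..1} (\<le>) (\<lambda>i. if i = 0 then X else Y)
     (\<lambda>i j. if i = 0 \<and> j = 1 then f else restrict id (car (if i = 0 then X else Y)))"

definition invariant_subset ::
    "('g, 'r) monoid_scheme \<Rightarrow> ('g, 'x) gspace \<Rightarrow> 'x set \<Rightarrow> bool" where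
  "invariant_subset G X A \<longleftrightarrow> A \<subseteq> car X \<and> (\<forall>g\<in>carrier G. act X g ` A \<subseteq> A)"

definition filtered_poset :: "'i set \<Rightarrow> ('i \<Rightarrow> 'i \<Rightarrow> bool) \<Rightarrow> bool" where
  "filtered_poset I po \<longleftrightarrow> I \<noteq> {} \<and> reflp_on I po \<and> antisymp_on I po \<and> transp_on I po \<and>
     (\<forall>i\<in>I. \<forall>j\<in>I. \<exists>k\<in>I. po i k \<and> po j k)"

definition big_family ::
    "('g, 'r) monoid_scheme \<Rightarrow> ('g, 'x) gspace \<Rightarrow> 'i set \<Rightarrow> ('i \<Rightarrow> 'i \<Rightarrow> bool) \<Rightarrow> ('i \<Rightarrow> 'x set) \<Rightarrow> bool" where
  "big_family G X I po Y \<longleftrightarrow> filtered_poset I po \<and>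
     (\<forall>i\<in>I. invariant_subset G X (Y i)) \<and>
     (\<forall>i\<in>I. \<forall>j\<in>I. po i j \<longrightarrow> Y i \<subseteq> Y j) \<and>
     (\<forall>i\<in>I. \<forall>U\<in>ent X. \<exists>j\<in>I. thicken U (Y i) \<subseteq> Y j)"

definition complementary_pair ::
    "('g, 'r) monoid_scheme \<Rightarrow> ('g, 'x) gspace \<Rightarrow> 'x set \<Rightarrow> 'i set \<Rightarrow> ('i \<Rightarrow> 'i \<Rightarrow> bool) \<Rightarrow> ('i \<Rightarrow> 'x set) \<Rightarrow> bool" where
  "complementary_pair G X Z I po Y \<longleftrightarrow>
     invariant_subset G X Z \<and> big_family G X I po Y \<and> (\<exists>i\<in>I. Z \<union> Y i = car X)"

text \<open>
  The poset \<open>I\<close> with two further elements \<open>At i < Colim < Top\<close> adjoined. In the excision square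
  below, a diagram on its product with \<open>{False < True}\<close> takes the values
  \<open>E (Z \<inter> Y i)\<close>, \<open>E (Z \<inter> \<Y>)\<close>, \<open>E Z\<close> at \<open>(At i, False)\<close>, \<open>(Colim, False)\<close>, \<open>(Top, False)\<close> and
  \<open>E (Y i)\<close>, \<open>E \<Y>\<close>, \<open>E X\<close> at \<open>(At i, True)\<close>, \<open>(Colim, True)\<close>, \<open>(Top, True)\<close>. The values at \<open>Colim\<close>
  are colimits, so this diagram is a left Kan extension of the remaining part and hence unique up to
  a contractible choice; it carries the maps between the corners of the square.
\<close>

datatype 'i adjoin2 = At 'i | Colim | Top

fun adjoin2_le :: "('i \<Rightarrow> 'i \<Rightarrow> bool) \<Rightarrow> 'i adjoin2 \<Rightarrow> 'i adjoin2 \<Rightarrow> bool" where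
  "adjoin2_le po (At i) (At j) = po i j"
| "adjoin2_le po (At i) Colim = True"
| "adjoin2_le po Colim Colim = True"
| "adjoin2_le po s Top = True"
| "adjoin2_le po s t = False"

fun excision_space ::
    "('g, 'r) monoid_scheme \<Rightarrow> ('g, 'x) gspace \<Rightarrow> 'x set \<Rightarrow> ('i \<Rightarrow> 'x set) \<Rightarrow> 'i adjoin2 \<times> bool \<Rightarrow> ('g, 'x) gspace" where
  "excision_space G X Z Y (At i, False) = subspace G X (Z \<inter> Y i)"
| "excision_space G X Z Y (At i, True) = subspace G X (Y i)"
| "excision_space G X Z Y (Top, False) = subspace G X Z"
| "excision_space G X Z Y (Top, True) = X"
| "excision_space G X Z Y (Colim, a) = undefined"

definition excision_square ::
    "('g, 'r) monoid_scheme \<Rightarrow> 'c sset \<Rightarrow> (nat \<Rightarrow> ('g, 'u) space_chain \<Rightarrow> 'c) \<Rightarrow>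
     ('g, 'u) gspace \<Rightarrow> 'u set \<Rightarrow> 'i set \<Rightarrow> ('i \<Rightarrow> 'i \<Rightarrow> bool) \<Rightarrow> ('i \<Rightarrow> 'u set) \<Rightarrow>
     (nat \<Rightarrow> (nat \<times> nat) list \<Rightarrow> 'c) \<Rightarrow> bool" where
  "excision_square G C E X Z I po Y q \<longleftrightarrow>
     (\<exists>H. let R = pnerve ((At ` I \<union> {Colim, Top}) \<times> UNIV) (prod_le (adjoin2_le po) (\<le>)) in
        sset_map R C H \<and>
        (\<forall>n. \<forall>l\<in>splx R n. Colim \<notin> fst ` set l \<longrightarrow>
           H n l = E n (incl_chain (map (excision_space G X Z Y) l))) \<and>
        (\<forall>a. colimit_cocone (pnerve I po) C (chain_cocone (\<lambda>i. (At i, a)) (Colim, a) H)) \<and>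
        q = (\<lambda>n l. H n (map (\<lambda>(a, b). (if b = 0 then Colim else Top, a \<noteq> 0)) l)))"

definition flasque :: "('g, 'r) monoid_scheme \<Rightarrow> ('g, 'u) gspace \<Rightarrow> bool" where
  "flasque G X \<longleftrightarrow> (\<exists>f\<in>Hom (GBornCoarse G) X X.
     {(f x, x) | x. x \<in> car X} \<in> ent X \<and>
     (\<forall>U\<in>ent X. (\<Union>n. map_prod (f ^^ n) (f ^^ n) ` U) \<in> ent X) \<and>
     (\<forall>B\<in>bdd X. \<exists>n. (f ^^ n) ` car X \<inter> B = {}))"

text \<open>
  Index posets of big families are drawn from the subsets of \<open>('u \<times> 'u) set\<close>, the type of
  entourages. Since \<open>{0,1} \<otimes> X\<close> does not live over \<open>'u\<close> literally, homotopy invariance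
  is stated for all its isomorphic copies \<open>P\<close>.
\<close>

definition coarse_homology ::
    "('g, 'r) monoid_scheme \<Rightarrow> 'c sset \<Rightarrow> (nat \<Rightarrow> ('g, 'u) space_chain \<Rightarrow> 'c) \<Rightarrow> bool" where
  "coarse_homology G C E \<longleftrightarrow>
     sset_map (nerve (GBornCoarse G)) C E \<and>
     (\<forall>X\<in>Ob (GBornCoarse G). car X = {} \<longrightarrow> zero_object C (E 0 (incl_chain [X]))) \<and>
     (\<forall>X\<in>Ob (GBornCoarse G). \<forall>Z (I :: ('u \<times> 'u) set set) po Y.
        complementary_pair G X Z I po Y \<longrightarrow>
        (\<exists>q. excision_square G C E X Z I po Y q \<and> pushout_square C q)) \<and>
     (\<forall>X\<in>Ob (GBornCoarse G). \<forall>P\<in>Ob (GBornCoarse G). \<forall>h.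
        gspace_iso G P (tensor max_max_two X) h \<longrightarrow>
        equivalence C (E 1 (edge P X (restrict (snd \<circ> h) (car P))))) \<and>
     (\<forall>X\<in>Ob (GBornCoarse G). flasque G X \<longrightarrow> zero_object C (E 0 (incl_chain [X]))) \<and>
     (\<forall>X\<in>Ob (GBornCoarse G).
        colimit_cocone (pnerve (inv_ent G X) (\<subseteq>)) C
          (chain_cocone (coarsen_to X) X (\<lambda>n Xs. E n (incl_chain Xs))))"

definition coarse_homology_with_transfers ::
    "('g, 'r) monoid_scheme \<Rightarrow> 'c sset \<Rightarrow> (nat \<Rightarrow> ('g, 'u) tr_simplex \<Rightarrow> 'c) \<Rightarrow> bool" where
  "coarse_homology_with_transfers G C E \<longleftrightarrow>
     sset_map (GBornCoarse_tr G) C E \<and> coarse_homology G C (\<lambda>n F. E n (iota n F))"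


section \<open>Mackey functors\<close>

definition A_eff :: "('g, 'r) monoid_scheme \<Rightarrow> ('g, 'u) span_simplex sset" where
  "A_eff G = tw_sset (GFin G) (\<lambda>n (X, f).
     \<forall>i i' j' j. i \<le> i' \<and> i' \<le> j' \<and> j' \<le> j \<and> j \<le> n \<longrightarrow>
       cartesian (GFin G) (X (i, j)) (X (i', j)) (X (i, j')) (X (i', j'))
         (f (i, j) (i', j)) (f (i, j) (i, j')) (f (i', j) (i', j')) (f (i, j') (i', j')))"

definition duality :: "nat \<Rightarrow> ('g, 'u) span_simplex \<Rightarrow> ('g, 'u) span_simplex" where
  "duality n = reindex (Tw n) tw_le (\<lambda>(i, j). (n - j, n - i))"

definition M_functor :: "nat \<Rightarrow> ('g, 'u) span_simplex \<Rightarrow> ('g, 'u) tr_simplex" where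
  "M_functor n F = mk_diag (Tw n) tw_le (\<lambda>p. min_min (fst F p)) (snd F)"

text \<open>
  Simplices of small simplicial sets are taken from this type. It contains the chains of
  entourages of a space over \<open>'u\<close>.
\<close>

type_synonym 'u small = "('u \<times> 'u) set list"

definition preserves_coproducts ::
    "'k itself \<Rightarrow> 'a sset \<Rightarrow> 'c sset \<Rightarrow> (nat \<Rightarrow> 'a \<Rightarrow> 'c) \<Rightarrow> bool" where
  "preserves_coproducts (_ :: 'k itself) A C F \<longleftrightarrow>
     (\<forall>(J :: 'k set) c. colimit_cocone (discrete J) A c \<longrightarrow>
        colimit_cocone (discrete J) C (\<lambda>n x. F n (c n x)))"

definition Mack ::
    "('g, 'r) monoid_scheme \<Rightarrow> 'c sset \<Rightarrow> (nat \<Rightarrow> ('g, 'u) span_simplex \<Rightarrow> 'c) set" where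
  "Mack G C = {F. sset_map (op_sset (A_eff G)) C F \<and>
                  preserves_coproducts TYPE('u small) (op_sset (A_eff G)) C F}"

definition EM ::
    "(nat \<Rightarrow> ('g, 'u) tr_simplex \<Rightarrow> 'c) \<Rightarrow> nat \<Rightarrow> ('g, 'u) span_simplex \<Rightarrow> 'c" where
  "EM E n = E n \<circ> M_functor n \<circ> duality n"

end

theory Submission imports Defs begin

text \<open>
  In the opposite of the effective Burnside category, a cocone on a family of finite \<open>G\<close>-sets \<open>S j\<close> is
  a family of spans \<open>X \<leftarrow> A j \<rightarrow> S j\<close>. If it is a coproduct cocone, then mapping to the cocones that are
  the identity at one \<open>S k\<close> and empty elsewhere, and comparing the span formed by the disjoint union of
  the \<open>A j\<close> with the identity of \<open>X\<close>, shows that every \<open>A j \<rightarrow> S j\<close> is bijective and that \<open>X\<close> is the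
  disjoint union of the \<open>A j\<close>. Hence only finitely many \<open>S j\<close> are non-empty. Excision for two disjoint
  subsets of a discrete space, applied finitely often, presents the value at \<open>X\<close> as the coproduct of the
  values at the non-empty \<open>A j\<close>, and the empty \<open>S j\<close> contribute zero objects.

  On the side of quasi-categories, being a coproduct cocone is expressed by simultaneous filling of
  simplices, which makes coproducts accessible to direct horn-filling arguments.
\<close>

section \<open>Maps from finite simplicial complexes\<close>

text \<open>A coproduct has to be tested on spheres of every dimension, so an argument with maps up
  to homotopy does not suffice: each comparison of cocones becomes an extension problem along an
  inclusion of ordered complexes. The missing cells are added one at a time, by an inner horn, by an
  initial least vertex, or by the universal property already known, and most of the work is to find
  an order in which every cell meets one of these three situations.

  Excision yields the inclusions of the images \<open>Y j\<close> into \<open>X\<close> as legs,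
  whereas the given legs start at \<open>S j\<close> and involve transfers. Two triangles of spans
  exhibit \<open>S j\<close> as a retract of \<open>Y j\<close> over \<open>X\<close>, so transfers
  enter through functoriality alone. In the Burnside category itself the universal property is used
  in dimensions 1 and 2, as existence of a map and as uniqueness up to a triangle. The fibre
  products and disjoint unions serving as test objects there are finite, and an infinite
  \<open>'u\<close> has room for copies of them.\<close>

definition subcomplex :: "nat set set => bool" where
  "subcomplex K \<longleftrightarrow> (\<forall>\<sigma>\<in>K. finite \<sigma> \<and> \<sigma> \<noteq> {} \<and> (\<forall>\<tau>\<subseteq>\<sigma>. \<tau> \<noteq> {} \<longrightarrow> \<tau> \<in> K))"

text \<open>All simplices of the simplicial set attached to the ordered complex; repeated vertices
  are allowed because degenerate simplices belong to it.\<close>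

definition chains :: "nat set set => nat list set" where
  "chains K = {l. l \<noteq> [] \<and> sorted l \<and> set l \<in> K}"

text \<open>A simplicial map in which the length of the chain takes over the dimension argument of
  \<open>sset_map\<close>. Values off \<open>chains K\<close> are arbitrary, so equality of such
  maps is always stated on chains.\<close>

definition cmap :: "'c sset => nat set set => (nat list => 'c) => bool" where
  "cmap C K f \<longleftrightarrow> (\<forall>l\<in>chains K. f l \<in> splx C (length l - 1) \<and>
     (\<forall>m. \<forall>\<alpha>\<in>splx (Delta (length l - 1)) m. f (map (nth l) \<alpha>) = opr C (length l - 1) \<alpha> (f l)))"

definition full :: "nat set => nat set set" where
  "full \<sigma> = {\<tau>. \<tau> \<subseteq> \<sigma> \<and> \<tau> \<noteq> {}}"

text \<open>The rank in \<sigma>. On \<sigma> it inverts \<open>sorted_list_of_set \<sigma>\<close>,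
  so it is the order isomorphism onto the vertices of a standard simplex.\<close>

definition pos :: "nat set => nat => nat" where
  "pos \<sigma> v = card {w \<in> \<sigma>. w < v}"

text \<open>The simplex wins on faces of \<sigma>; that the result extends \<open>f\<close> is a
  separate obligation, met by comparing the two on the overlap.\<close>

definition attach :: "'c sset => nat set => 'c => (nat list => 'c) => nat list => 'c" where
  "attach C \<sigma> t f l = (if set l \<subseteq> \<sigma> then opr C (card \<sigma> - 1) (map (pos \<sigma>) l) t else f l)"

section \<open>Chains and maps on ordered complexes\<close>

lemma Delta_iff: "\<alpha> \<in> splx (Delta n) m \<longleftrightarrow> length \<alpha> = Suc m \<and> set \<alpha> \<subseteq> {..n} \<and> sorted \<alpha>"
  by (auto simp: pnerve_def)

lemma chainsD: "l \<in> chains K ==> l \<noteq> []" "l \<in> chains K ==> sorted l" "l \<in> chains K ==> set l \<in> K"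
  by (auto simp: chains_def)

lemma sorted_map_nth:
  assumes "sorted l" "sorted \<alpha>" "\<forall>i\<in>set \<alpha>. i < length l"
  shows "sorted (map (nth l) \<alpha>)"
  using assms by (auto simp: sorted_iff_nth_mono)

lemma Delta_len: "\<alpha> \<in> splx (Delta (length l - 1)) m ==> l \<noteq> [] ==> i \<in> set \<alpha> ==> i < length l"
  by (cases l) (auto simp: Delta_iff less_Suc_eq_le)

lemma set_map_nth_subset:
  assumes "\<forall>i\<in>set \<alpha>. i < length l" shows "set (map (nth l) \<alpha>) \<subseteq> set l"
  using assms by auto

lemma chains_restrict:
  assumes "subcomplex K" "l \<in> chains K" "\<alpha> \<in> splx (Delta (length l - 1)) m"
  shows "map (nth l) \<alpha> \<in> chains K"
proof -
  have i: "\<forall>i\<in>set \<alpha>. i < length l" using Delta_len[OF assms(3)] assms(2) by (auto simp: chains_def)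
  have "sorted (map (nth l) \<alpha>)" by (rule sorted_map_nth) (use assms i in \<open>auto simp: chains_def Delta_iff\<close>)
  moreover have "\<alpha> \<noteq> []" using assms(3) by (auto simp: Delta_iff)
  ultimately show ?thesis
    using assms(1,2) set_map_nth_subset[OF i] unfolding chains_def subcomplex_def by auto
qed

lemma cmapI:
  assumes "\<And>l. l \<in> chains K ==> f l \<in> splx C (length l - 1)"
    and "\<And>l m \<alpha>. l \<in> chains K ==> \<alpha> \<in> splx (Delta (length l - 1)) m ==>
      f (map (nth l) \<alpha>) = opr C (length l - 1) \<alpha> (f l)"
  shows "cmap C K f"
  using assms by (auto simp: cmap_def)

lemma cmapD:
  assumes "cmap C K f" "l \<in> chains K"
  shows "f l \<in> splx C (length l - 1)"
    and "\<alpha> \<in> splx (Delta (length l - 1)) m ==> f (map (nth l) \<alpha>) = opr C (length l - 1) \<alpha> (f l)"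
  using assms by (auto simp: cmap_def)

lemma cmap_cong:
  assumes "cmap C K f" "subcomplex K" "\<And>l. l \<in> chains K ==> f' l = f l"
  shows "cmap C K f'"
  using assms chains_restrict[OF assms(2)] by (auto simp: cmap_def)

lemma cmap_mono: "cmap C K f ==> L \<subseteq> K ==> cmap C L f"
  by (auto simp: cmap_def chains_def)

lemma subcomplex_full: "finite \<sigma> ==> subcomplex (full \<sigma>)"
  by (auto simp: subcomplex_def full_def intro: finite_subset)

lemma subcomplex_Un: "subcomplex K ==> subcomplex L ==> subcomplex (K \<union> L)"
  by (auto simp: subcomplex_def)

lemma chains_Un: "chains (K \<union> L) = chains K \<union> chains L"
  by (auto simp: chains_def)

lemma subcomplexD: "subcomplex K ==> \<sigma> \<in> K ==> \<tau> \<subseteq> \<sigma> ==> \<tau> \<noteq> {} ==> \<tau> \<in> K"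
  "subcomplex K ==> \<sigma> \<in> K ==> finite \<sigma>" "subcomplex K ==> \<sigma> \<in> K ==> \<sigma> \<noteq> {}"
  unfolding subcomplex_def by blast+

lemma cmap_glue:
  assumes K: "subcomplex K" and L: "subcomplex L" and f: "cmap C K f" and g: "cmap C L g"
    and eq: "\<And>l. l \<in> chains K ==> l \<in> chains L ==> f l = g l"
  shows "cmap C (K \<union> L) (\<lambda>l. if set l \<in> K then f l else g l)"
proof -
  have h: "(if set l \<in> K then f l else g l) = g l" if "l \<in> chains L" for l
    using eq[OF _ that] that by (auto simp: chains_def)
  show ?thesis
  proof (rule cmapI, goal_cases)
    case (1 l)
    then show ?case using cmapD(1)[OF f] cmapD(1)[OF g] by (auto simp: chains_def)
  next
    case (2 l m \<alpha>)
    show ?case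
    proof (cases "set l \<in> K")
      case True
      then have "l \<in> chains K" using 2 by (auto simp: chains_def)
      then show ?thesis using cmapD(2)[OF f _ 2(2)] chains_restrict[OF K _ 2(2)] True
        by (auto simp: chains_def)
    next
      case False
      then have l: "l \<in> chains L" using 2 by (auto simp: chains_def)
      then show ?thesis
        using cmapD(2)[OF g l 2(2)] h[OF l] h[OF chains_restrict[OF L l 2(2)]] by presburger
    qed
  qed
qed

text \<open>A monotone vertex map may collapse vertices; the repeated entries then give degenerate
  values. This is how a constant direction is put into given data.\<close>

lemma cmap_relabel:
  assumes f: "cmap C K f" and \<psi>: "mono_on (\<Union>L) \<psi>" and L: "\<And>\<tau>. \<tau> \<in> L ==> \<psi> ` \<tau> \<in> K"
  shows "cmap C L (\<lambda>l. f (map \<psi> l))"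
proof -
  have c: "map \<psi> l \<in> chains K" if "l \<in> chains L" for l
    using that L \<psi> unfolding chains_def
    by (auto simp: sorted_iff_nth_mono intro!: mono_onD[OF \<psi>])
  show ?thesis
  proof (rule cmapI, goal_cases)
    case (1 l)
    then show ?case using cmapD(1)[OF f c[OF 1]] by simp
  next
    case (2 l m \<alpha>)
    have "map \<psi> (map (nth l) \<alpha>) = map (nth (map \<psi> l)) \<alpha>"
      using Delta_len[OF 2(2)] chainsD(1)[OF 2(1)] by auto
    then show ?case using cmapD(2)[OF f c[OF 2(1)], of \<alpha> m] 2(2) by (simp del: map_map)
  qed
qed

section \<open>Ranks and the attachment of a simplex\<close>

lemma pos_mono: "finite \<sigma> ==> v \<le> w ==> pos \<sigma> v \<le> pos \<sigma> w"
  unfolding pos_def by (rule card_mono) auto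

lemma pos_less: "finite \<sigma> ==> v \<in> \<sigma> ==> pos \<sigma> v < card \<sigma>"
  unfolding pos_def by (rule psubset_card_mono) auto

lemma pos_nth:
  assumes "finite \<sigma>" "i < card \<sigma>" shows "pos \<sigma> (sorted_list_of_set \<sigma> ! i) = i"
proof -
  let ?L = "sorted_list_of_set \<sigma>"
  have L: "sorted_wrt (<) ?L" "length ?L = card \<sigma>" "set ?L = \<sigma>"
    using assms by auto
  have "{w \<in> \<sigma>. w < ?L ! i} = (nth ?L) ` {..<i}"
  proof (safe, goal_cases)
    case (1 w)
    then obtain k where k: "k < card \<sigma>" "w = ?L ! k" using L by (metis in_set_conv_nth)
    have "k < i"
    proof (rule ccontr)
      assume "\<not> k < i"
      then have "?L ! i \<le> ?L ! k" using sorted_nth_mono[OF sorted_sorted_list_of_set[of \<sigma>]] k(1) L(2) by simp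
      then show False using 1 k by simp
    qed
    then show ?case using k by auto
  next
    case (2 _ k)
    then show ?case using assms L by (metis less_trans nth_mem)
  next
    case (3 _ k)
    then show ?case using assms L sorted_wrt_nth_less[OF L(1)] by auto
  qed
  moreover have "inj_on (nth ?L) {..<i}"
    using assms L by (intro inj_on_nth) auto
  ultimately show ?thesis unfolding pos_def by (simp add: card_image)
qed

lemma nth_pos:
  assumes "finite \<sigma>" "v \<in> \<sigma>" shows "sorted_list_of_set \<sigma> ! pos \<sigma> v = v"
proof -
  have "v \<in> set (sorted_list_of_set \<sigma>)" using assms by simp
  then obtain i where i: "i < card \<sigma>" "v = sorted_list_of_set \<sigma> ! i"
    by (metis in_set_conv_nth length_sorted_list_of_set)
  show ?thesis using pos_nth[OF assms(1) i(1)] i(2) by simp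
qed

lemma pos_Delta:
  assumes "finite \<sigma>" "l \<in> chains (full \<sigma>)"
  shows "map (pos \<sigma>) l \<in> splx (Delta (card \<sigma> - 1)) (length l - 1)"
proof -
  have "set (map (pos \<sigma>) l) \<subseteq> {..card \<sigma> - 1}"
  proof
    fix x assume "x \<in> set (map (pos \<sigma>) l)"
    then obtain v where "v \<in> \<sigma>" "x = pos \<sigma> v" using assms by (auto simp: chains_def full_def)
    then show "x \<in> {..card \<sigma> - 1}" using pos_less[OF assms(1), of v] by auto
  qed
  moreover have "sorted (map (pos \<sigma>) l)"
    using assms(2) pos_mono[OF assms(1)] by (auto simp: chains_def sorted_iff_nth_mono)
  ultimately show ?thesis using assms(2) by (auto simp: Delta_iff chains_def)
qed

lemma is_ssetD:
  assumes "is_sset X" "x \<in> splx X n"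
  shows "opr X n [0..<Suc n] x = x"
    and "\<alpha> \<in> splx (Delta n) m ==> opr X n \<alpha> x \<in> splx X m"
    and "\<alpha> \<in> splx (Delta n) m ==> \<beta> \<in> splx (Delta m) k ==>
      opr X m \<beta> (opr X n \<alpha> x) = opr X n (map (nth \<alpha>) \<beta>) x"
  using assms by (auto simp: is_sset_def)

text \<open>The Yoneda map of \<open>t\<close>, with the vertices of \<sigma> named by their
  ranks.\<close>

lemma cmap_simplex:
  assumes C: "is_sset C" and \<sigma>: "finite \<sigma>" and t: "t \<in> splx C (card \<sigma> - 1)"
  shows "cmap C (full \<sigma>) (\<lambda>l. opr C (card \<sigma> - 1) (map (pos \<sigma>) l) t)"
proof (rule cmapI, goal_cases)
  case (1 l)
  then show ?case using is_ssetD(2)[OF C t pos_Delta[OF \<sigma>]] by simp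
next
  case (2 l m \<alpha>)
  have "map (pos \<sigma>) (map (nth l) \<alpha>) = map (nth (map (pos \<sigma>) l)) \<alpha>"
    using Delta_len[OF 2(2)] chainsD(1)[OF 2(1)] by auto
  then show ?case using is_ssetD(3)[OF C t pos_Delta[OF \<sigma> 2(1)] 2(2)] by (simp del: map_map)
qed

lemma cmap_attach:
  assumes C: "is_sset C" and K: "subcomplex K" and f: "cmap C K f"
    and \<sigma>: "finite \<sigma>" and t: "t \<in> splx C (card \<sigma> - 1)"
    and eq: "\<And>l. l \<in> chains K ==> set l \<subseteq> \<sigma> ==> opr C (card \<sigma> - 1) (map (pos \<sigma>) l) t = f l"
  shows "cmap C (K \<union> full \<sigma>) (attach C \<sigma> t f)"
    and "\<And>l. l \<in> chains K ==> attach C \<sigma> t f l = f l"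
proof -
  show ex: "\<And>l. l \<in> chains K ==> attach C \<sigma> t f l = f l"
    using eq by (auto simp: attach_def)
  have "cmap C (full \<sigma> \<union> K) (\<lambda>l. if set l \<in> full \<sigma> then opr C (card \<sigma> - 1) (map (pos \<sigma>) l) t else f l)"
    by (rule cmap_glue[OF subcomplex_full[OF \<sigma>] K cmap_simplex[OF C \<sigma> t] f])
       (use eq in \<open>auto simp: chains_def full_def\<close>)
  then show "cmap C (K \<union> full \<sigma>) (attach C \<sigma> t f)"
    unfolding Un_commute[of K]
    by (rule cmap_cong) (use subcomplex_Un subcomplex_full \<sigma> K in \<open>auto simp: attach_def chains_def full_def\<close>)
qed

lemma attach_top:
  assumes "is_sset C" "finite \<sigma>" "\<sigma> \<noteq> {}" "t \<in> splx C (card \<sigma> - 1)"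
  shows "attach C \<sigma> t f (sorted_list_of_set \<sigma>) = t"
proof -
  have "map (pos \<sigma>) (sorted_list_of_set \<sigma>) = [0..<card \<sigma>]"
    by (rule nth_equalityI) (use assms in \<open>auto simp: pos_nth\<close>)
  moreover have "Suc (card \<sigma> - 1) = card \<sigma>" using assms by (simp add: card_gt_0_iff)
  ultimately show ?thesis using assms is_ssetD(1)[OF assms(1,4)] by (simp add: attach_def)
qed

lemma nth_Delta_chains:
  assumes "finite \<sigma>" "\<alpha> \<in> splx (Delta (card \<sigma> - 1)) m" "\<sigma> \<noteq> {}"
  shows "map (nth (sorted_list_of_set \<sigma>)) \<alpha> \<in> chains (full \<sigma>)"
  using chains_restrict[OF subcomplex_full[OF assms(1)], of "sorted_list_of_set \<sigma>" \<alpha> m] assms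
  by (auto simp: chains_def full_def)

lemma pos_nth_list:
  assumes "finite \<sigma>" "\<sigma> \<noteq> {}" "\<alpha> \<in> splx (Delta (card \<sigma> - 1)) m"
  shows "map (pos \<sigma>) (map (nth (sorted_list_of_set \<sigma>)) \<alpha>) = \<alpha>"
proof -
  have "i < card \<sigma>" if "i \<in> set \<alpha>" for i
    using that assms card_gt_0_iff[of \<sigma>] by (auto simp: Delta_iff)
  then show ?thesis using assms(1) by (auto simp: pos_nth intro!: map_idI)
qed

lemma nth_pos_list:
  assumes "finite \<sigma>" "set l \<subseteq> \<sigma>"
  shows "map (nth (sorted_list_of_set \<sigma>)) (map (pos \<sigma>) l) = l"
  using assms nth_pos by (auto intro!: map_idI)

text \<open>The elementary inner extension. As \<open>u < v < w\<close>, the rank of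
  \<open>v\<close> is an interior vertex, and the faces in \<open>K\<close> form the horn at it.
  Since \<sigma> minus \<open>v\<close> is absent from \<open>K\<close>, its value is free to be
  dictated by the filler.\<close>

lemma inner_pair:
  assumes Q: "quasi_category C" and K: "subcomplex K" and f: "cmap C K f"
    and \<sigma>: "finite \<sigma>" "v \<in> \<sigma>" "u \<in> \<sigma>" "u < v" "w \<in> \<sigma>" "v < w"
    and nin: "\<sigma> - {v} \<notin> K"
    and faces: "\<And>\<tau>. \<tau> \<subset> \<sigma> ==> \<tau> \<noteq> {} ==> \<tau> \<noteq> \<sigma> - {v} ==> \<tau> \<in> K"
  shows "\<exists>f'. cmap C (insert \<sigma> (insert (\<sigma> - {v}) K)) f' \<and> subcomplex (insert \<sigma> (insert (\<sigma> - {v}) K)) \<and>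
    (\<forall>l\<in>chains K. f' l = f l)"
proof -
  let ?n = "card \<sigma> - 1" and ?L = "sorted_list_of_set \<sigma>" and ?k = "pos \<sigma> v"
  have C: "is_sset C" using Q by (simp add: quasi_category_def)
  have ne: "\<sigma> \<noteq> {}" using \<sigma> by auto
  have K': "\<sigma> \<notin> K" using nin subcomplexD(1)[OF K, of \<sigma> "\<sigma> - {v}"] \<sigma> by auto
  have "pos \<sigma> u < ?k" unfolding pos_def by (rule psubset_card_mono) (use \<sigma> in auto)
  moreover have "?k < pos \<sigma> w" unfolding pos_def by (rule psubset_card_mono) (use \<sigma> in auto)
  ultimately have k: "0 < ?k" "?k < ?n" using pos_less[OF \<sigma>(1,5)] by linarith+
  have setL: "?L ! i = v \<longleftrightarrow> i = ?k" if "i < card \<sigma>" for i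
    using that pos_nth[OF \<sigma>(1)] nth_pos[OF \<sigma>(1,2)] by auto
  have horn: "map (nth ?L) \<alpha> \<in> chains K" if "\<alpha> \<in> splx (horn ?n ?k) m" for \<alpha> m
  proof -
    have a: "\<alpha> \<in> splx (Delta ?n) m" "\<not> {..?n} - {?k} \<subseteq> set \<alpha>"
      using that by (auto simp: horn_def sub_sset_def)
    let ?\<tau> = "set (map (nth ?L) \<alpha>)"
    have c: "map (nth ?L) \<alpha> \<in> chains (full \<sigma>)" using nth_Delta_chains[OF \<sigma>(1) a(1) ne] .
    obtain i where i: "i \<le> ?n" "i \<noteq> ?k" "i \<notin> set \<alpha>" using a by auto
    have ic: "i < card \<sigma>" using i \<sigma>(1) ne card_gt_0_iff[of \<sigma>] by linarith
    have "?L ! i \<notin> ?\<tau>"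
    proof
      assume "?L ! i \<in> ?\<tau>"
      then obtain i' where i': "i' \<in> set \<alpha>" "?L ! i = ?L ! i'" by auto
      have "i' < card \<sigma>" using i' a(1) ne \<sigma>(1) card_gt_0_iff[of \<sigma>] by (auto simp: Delta_iff)
      then have "i = i'" using pos_nth[OF \<sigma>(1) ic] pos_nth[OF \<sigma>(1)] i'(2) by metis
      then show False using i' i by blast
    qed
    moreover have "?L ! i \<noteq> v" using setL[OF ic] i by auto
    moreover have "?L ! i \<in> \<sigma>" using ic \<sigma>(1) by (metis nth_mem length_sorted_list_of_set set_sorted_list_of_set)
    ultimately have "?\<tau> \<noteq> \<sigma> - {v}" "?\<tau> \<noteq> \<sigma>" by blast+
    then show ?thesis using c faces[of ?\<tau>] unfolding chains_def full_def by auto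
  qed
  have "sset_map (horn ?n ?k) C (\<lambda>m \<alpha>. f (map (nth ?L) \<alpha>))"
    unfolding sset_map_def
  proof (safe, goal_cases)
    case (1 m \<alpha>)
    have "length \<alpha> = Suc m" using 1 by (auto simp: horn_def sub_sset_def Delta_iff)
    then show ?case using cmapD(1)[OF f horn[OF 1]] by simp
  next
    case (2 m \<alpha> m' \<beta>)
    have la: "length \<alpha> = Suc m" using 2 by (auto simp: horn_def sub_sset_def Delta_iff)
    have "map (nth ?L) (map (nth \<alpha>) \<beta>) = map (nth (map (nth ?L) \<alpha>)) \<beta>"
      using la 2(2) by (auto simp: Delta_iff)
    then show ?case using cmapD(2)[OF f horn[OF 2(1)], of \<beta> m'] la 2(2)
      by (simp add: horn_def sub_sset_def pnerve_def del: map_map)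
  qed
  then have "\<exists>s\<in>splx C ?n. \<forall>m. \<forall>\<alpha>\<in>splx (horn ?n ?k) m. opr C ?n \<alpha> s = f (map (nth ?L) \<alpha>)"
    by (rule Q[unfolded quasi_category_def, THEN conjunct2, rule_format, OF conjI[OF k(1) conjI[OF k(2)]]])
  then obtain s where s: "s \<in> splx C ?n" "\<And>m \<alpha>. \<alpha> \<in> splx (horn ?n ?k) m ==> opr C ?n \<alpha> s = f (map (nth ?L) \<alpha>)"
    by blast
  have eq: "opr C ?n (map (pos \<sigma>) l) s = f l" if l: "l \<in> chains K" "set l \<subseteq> \<sigma>" for l
  proof -
    have d: "map (pos \<sigma>) l \<in> splx (Delta ?n) (length l - 1)"
      by (rule pos_Delta) (use l \<sigma> in \<open>auto simp: chains_def full_def\<close>)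
    \<comment> \<open>The support misses a vertex other than \<open>v\<close>, so the chain lies in
      the horn, where the filler is known to restrict to \<open>f\<close>.\<close>
    have "set l \<noteq> \<sigma>" "set l \<noteq> \<sigma> - {v}" using l K' nin by (auto simp: chains_def)
    then obtain w where w: "w \<in> \<sigma>" "w \<noteq> v" "w \<notin> set l" using l by blast
    have "pos \<sigma> w \<notin> set (map (pos \<sigma>) l)"
    proof
      assume "pos \<sigma> w \<in> set (map (pos \<sigma>) l)"
      then obtain x where "x \<in> set l" "pos \<sigma> w = pos \<sigma> x" by auto
      then show False using nth_pos[OF \<sigma>(1)] w l(2) by (metis subsetD)
    qed
    moreover have "pos \<sigma> w \<noteq> ?k" using nth_pos[OF \<sigma>(1)] w \<sigma>(2) by metis
    moreover have "pos \<sigma> w \<le> ?n" using pos_less[OF \<sigma>(1) w(1)] by linarith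
    ultimately have "map (pos \<sigma>) l \<in> splx (horn ?n ?k) (length l - 1)"
      using d unfolding horn_def sub_sset_def by auto
    then show ?thesis using s(2) nth_pos_list[OF \<sigma>(1) l(2)] by simp
  qed
  have "K \<union> full \<sigma> = insert \<sigma> (insert (\<sigma> - {v}) K)"
  proof -
    have "\<sigma> - {v} \<noteq> {}" using \<sigma> by auto
    then show ?thesis using faces ne unfolding full_def by blast
  qed
  then show ?thesis using cmap_attach[OF C K f \<sigma>(1) s(1) eq] subcomplex_Un[OF K subcomplex_full[OF \<sigma>(1)]] by metis
qed

text \<open>Reads the boundary of a cell as a sphere through the increasing enumeration of its
  vertices: non-surjective operators are the ones that reach proper faces.\<close>

lemma boundary_fill:
  assumes K: "subcomplex K" and f: "cmap C K f" and \<sigma>: "finite \<sigma>" "\<sigma> \<noteq> {}"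
    and faces: "\<And>\<tau>. \<tau> \<subset> \<sigma> ==> \<tau> \<noteq> {} ==> \<tau> \<in> K"
  shows "sset_map (boundary (card \<sigma> - 1)) C (\<lambda>m \<alpha>. f (map (nth (sorted_list_of_set \<sigma>)) \<alpha>))"
    and "\<And>\<alpha> m. \<alpha> \<in> splx (boundary (card \<sigma> - 1)) m ==> map (nth (sorted_list_of_set \<sigma>)) \<alpha> \<in> chains K"
proof -
  let ?n = "card \<sigma> - 1" and ?L = "sorted_list_of_set \<sigma>"
  show bd: "map (nth ?L) \<alpha> \<in> chains K" if "\<alpha> \<in> splx (boundary ?n) m" for \<alpha> m
  proof -
    have a: "\<alpha> \<in> splx (Delta ?n) m" "set \<alpha> \<noteq> {..?n}"
      using that by (auto simp: boundary_def sub_sset_def)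
    have c: "map (nth ?L) \<alpha> \<in> chains (full \<sigma>)" using nth_Delta_chains[OF \<sigma>(1) a(1) \<sigma>(2)] .
    have "set (map (nth ?L) \<alpha>) \<noteq> \<sigma>"
    proof
      assume h: "set (map (nth ?L) \<alpha>) = \<sigma>"
      have "{..?n} \<subseteq> set \<alpha>"
      proof
        fix i assume "i \<in> {..?n}"
        then have i: "i < card \<sigma>" using \<sigma> card_gt_0_iff[of \<sigma>] by auto
        then have "?L ! i \<in> \<sigma>" using \<sigma>(1) by (metis nth_mem length_sorted_list_of_set set_sorted_list_of_set)
        then have "pos \<sigma> (?L ! i) \<in> set (map (pos \<sigma>) (map (nth ?L) \<alpha>))" using h
          by (metis image_eqI set_map)
        then show "i \<in> set \<alpha>" using pos_nth_list[OF \<sigma> a(1)] pos_nth[OF \<sigma>(1) i] by (simp del: map_map)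
      qed
      then show False using a by (auto simp: Delta_iff)
    qed
    then show ?thesis using c faces[of "set (map (nth ?L) \<alpha>)"] unfolding chains_def full_def by auto
  qed
  show "sset_map (boundary ?n) C (\<lambda>m \<alpha>. f (map (nth ?L) \<alpha>))"
    unfolding sset_map_def
  proof (safe, goal_cases)
    case (1 m \<alpha>)
    have "length \<alpha> = Suc m" using 1 by (auto simp: boundary_def sub_sset_def Delta_iff)
    then show ?case using cmapD(1)[OF f bd[OF 1]] by simp
  next
    case (2 m \<alpha> m' \<beta>)
    have la: "length \<alpha> = Suc m" using 2 by (auto simp: boundary_def sub_sset_def Delta_iff)
    have "map (nth ?L) (map (nth \<alpha>) \<beta>) = map (nth (map (nth ?L) \<alpha>)) \<beta>"
      using la 2(2) by (auto simp: Delta_iff)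
    then show ?case using cmapD(2)[OF f bd[OF 2(1)], of \<beta> m'] la 2(2)
      by (simp add: boundary_def sub_sset_def pnerve_def del: map_map)
  qed
qed

lemma pos_boundary:
  assumes "finite \<sigma>" "l \<in> chains (full \<sigma>)" "set l \<noteq> \<sigma>"
  shows "map (pos \<sigma>) l \<in> splx (boundary (card \<sigma> - 1)) (length l - 1)"
proof -
  have l: "set l \<subseteq> \<sigma>" using assms by (auto simp: chains_def full_def)
  then obtain w where w: "w \<in> \<sigma>" "w \<notin> set l" using assms by blast
  have "pos \<sigma> w \<notin> set (map (pos \<sigma>) l)"
  proof
    assume "pos \<sigma> w \<in> set (map (pos \<sigma>) l)"
    then obtain x where "x \<in> set l" "pos \<sigma> w = pos \<sigma> x" by auto
    then show False using nth_pos[OF assms(1)] w l by (metis subsetD)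
  qed
  moreover have "pos \<sigma> w \<le> card \<sigma> - 1" using pos_less[OF assms(1) w(1)] by linarith
  ultimately have "set (map (pos \<sigma>) l) \<noteq> {..card \<sigma> - 1}" by blast
  then show ?thesis using pos_Delta[OF assms(1,2)] unfolding boundary_def sub_sset_def by auto
qed

text \<open>Initiality fills spheres whose zeroth vertex is the initial object, so \<open>u\<close>
  must be the least vertex of the cell. The second vertex \<open>w\<close> makes the cell
  positive-dimensional.\<close>

lemma initial_cell:
  assumes C: "is_sset C" and K: "subcomplex K" and f: "cmap C K f"
    and \<sigma>: "finite \<sigma>" "u \<in> \<sigma>" "w \<in> \<sigma>" "u < w" and min: "\<And>v. v \<in> \<sigma> ==> u \<le> v"
    and nin: "\<sigma> \<notin> K"
    and faces: "\<And>\<tau>. \<tau> \<subset> \<sigma> ==> \<tau> \<noteq> {} ==> \<tau> \<in> K"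
    and ini: "initial C (f [u])"
  shows "\<exists>f'. cmap C (insert \<sigma> K) f' \<and> subcomplex (insert \<sigma> K) \<and> (\<forall>l\<in>chains K. f' l = f l)"
proof -
  let ?n = "card \<sigma> - 1" and ?L = "sorted_list_of_set \<sigma>"
  have ne: "\<sigma> \<noteq> {}" using \<sigma> by auto
  have "card {u,w} \<le> card \<sigma>" by (rule card_mono) (use \<sigma> in auto)
  then have n: "0 < ?n" using \<sigma> by auto
  have p0: "pos \<sigma> u = 0" unfolding pos_def using min by (auto simp: \<sigma> leD)
  have "?L ! 0 = u" using nth_pos[OF \<sigma>(1,2)] p0 by simp
  then have "map (nth ?L) [0] = [u]" by simp
  then obtain s where s: "s \<in> splx C ?n"
    "\<And>m \<alpha>. \<alpha> \<in> splx (boundary ?n) m ==> opr C ?n \<alpha> s = f (map (nth ?L) \<alpha>)"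
    using ini boundary_fill(1)[OF K f \<sigma>(1) ne faces] n unfolding initial_def by metis
  have eq: "opr C ?n (map (pos \<sigma>) l) s = f l" if l: "l \<in> chains K" "set l \<subseteq> \<sigma>" for l
  proof -
    have "map (pos \<sigma>) l \<in> splx (boundary ?n) (length l - 1)"
      by (rule pos_boundary) (use l nin \<sigma> in \<open>auto simp: chains_def full_def\<close>)
    then show ?thesis using s(2) nth_pos_list[OF \<sigma>(1) l(2)] by simp
  qed
  have "K \<union> full \<sigma> = insert \<sigma> K" using faces ne unfolding full_def by blast
  then show ?thesis using cmap_attach[OF C K f \<sigma>(1) s(1) eq] subcomplex_Un[OF K subcomplex_full[OF \<sigma>(1)]] by metis
qed

text \<open>Cells have to be attached in an order in which faces come first. The induction peels off
  a member of maximal cardinality, which no other member strictly contains, so what is left is again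
  closed under smaller members of \<A>.\<close>

lemma downset_induct:
  assumes "finite \<A>" "\<And>\<phi>. \<phi> \<in> \<A> ==> finite \<phi>"
    and "P {}"
    and step: "\<And>\<B> \<phi>. \<B> \<subseteq> \<A> ==> \<phi> \<in> \<A> ==> \<phi> \<notin> \<B> ==> (\<And>\<psi>. \<psi> \<subset> \<phi> ==> \<psi> \<in> \<A> ==> \<psi> \<in> \<B>)
       ==> (\<And>\<psi> \<chi>. \<psi> \<in> \<B> ==> \<chi> \<subseteq> \<psi> ==> \<chi> \<in> \<A> ==> \<chi> \<in> \<B>) ==> P \<B> ==> P (insert \<phi> \<B>)"
  shows "P (\<A> :: nat set set)"
proof -
  have *: "P \<B>" if "\<B> \<subseteq> \<A>" "\<And>\<psi> \<chi>. \<psi> \<in> \<B> ==> \<chi> \<subseteq> \<psi> ==> \<chi> \<in> \<A> ==> \<chi> \<in> \<B>" for \<B>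
    using finite_subset[OF that(1) assms(1)] that
  proof (induction "card \<B>" arbitrary: \<B>)
    case 0
    then show ?case using assms(3) by simp
  next
    case (Suc n)
    then have "\<B> \<noteq> {}" by auto
    then obtain \<phi> where \<phi>: "\<phi> \<in> \<B>" "\<And>\<psi>. \<psi> \<in> \<B> ==> card \<psi> \<le> card \<phi>"
      using obtains_MAX[OF Suc.prems(1), of card]
      by (metis Max_ge Suc.prems(1) finite_imageI image_eqI)
    let ?B = "\<B> - {\<phi>}"
    have max: "\<not> \<phi> \<subset> \<psi>" if "\<psi> \<in> \<B>" for \<psi>
      using \<phi>(2)[OF that] psubset_card_mono[of \<psi> \<phi>] assms(2)[of \<psi>] that Suc.prems(2) by auto
    have dc: "\<And>\<psi> \<chi>. \<psi> \<in> ?B ==> \<chi> \<subseteq> \<psi> ==> \<chi> \<in> \<A> ==> \<chi> \<in> ?B"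
      using Suc.prems max by blast
    have "n = card ?B" using Suc \<phi> by (metis card_Diff_singleton diff_Suc_1)
    then have "P ?B" using Suc.hyps(1)[of ?B] Suc.prems(1,2) dc by (metis Diff_subset finite_Diff subset_trans)
    moreover have "\<psi> \<in> ?B" if "\<psi> \<subset> \<phi>" "\<psi> \<in> \<A>" for \<psi>
      using Suc.prems(3)[OF \<phi>(1) _ that(2)] that(1) by blast
    moreover have "?B \<subseteq> \<A>" "\<phi> \<in> \<A>" "\<phi> \<notin> ?B" using Suc.prems(2) \<phi>(1) by blast+
    ultimately have "P (insert \<phi> ?B)"
      using dc by (intro step)
    moreover have "insert \<phi> ?B = \<B>" using \<phi>(1) by blast
    ultimately show ?case by (rule back_subst)
  qed
  show ?thesis by (rule *[OF subset_refl])
qed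

section \<open>Coproduct cocones\<close>

declare upt_Suc [simp del]

text \<open>The cone with apex 0 over the boundary of the simplex on \<open>1..n+1\<close>. It is
  the outer horn at 0 of the simplex on \<open>0..n+1\<close>, so in a quasi-category the existence
  of a filler is a genuine condition.\<close>

definition hcx :: "nat => nat set set" where
  "hcx n = {\<tau>. \<tau> \<subseteq> {..Suc n} \<and> \<tau> \<noteq> {} \<and> \<not> {1..Suc n} \<subseteq> \<tau>}"

text \<open>The base of that cone, on which the data of all indices have to agree.\<close>

definition bcx :: "nat => nat set set" where
  "bcx n = {\<tau>. \<tau> \<subset> {1..Suc n} \<and> \<tau> \<noteq> {}}"

text \<open>
  The vertex \<open>0\<close> is the source of the edge \<open>e j\<close> and the vertices \<open>1, \<dots>, n + 1\<close> span the simplex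
  of cocones, with \<open>x\<close> at the vertex \<open>1\<close>.
\<close>

definition coprod :: "'c sset => 'j set => 'c => ('j => 'c) => bool" where
  "coprod C J x e \<longleftrightarrow> (\<forall>n>0. \<forall>g f. cmap C (bcx n) g \<and> g [1] = x \<and>
     (\<forall>j\<in>J. cmap C (hcx n) (f j) \<and> f j [0,1] = e j \<and> (\<forall>l\<in>chains (bcx n). f j l = g l)) \<longrightarrow>
     (\<exists>s t. s \<in> splx C n \<and> (\<forall>l\<in>chains (bcx n). opr C n (map (\<lambda>i. i - 1) l) s = g l) \<and>
       (\<forall>j\<in>J. t j \<in> splx C (Suc n) \<and> (\<forall>l\<in>chains (hcx n). opr C (Suc n) l (t j) = f j l) \<and>
          opr C (Suc n) [1..<Suc (Suc n)] (t j) = s)))"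

lemma coprodD:
  assumes "coprod C J x e" "0 < n" "cmap C (bcx n) g" "g [1] = x"
    "\<And>j. j \<in> J ==> cmap C (hcx n) (f j)" "\<And>j. j \<in> J ==> f j [0,1] = e j"
    "\<And>j l. j \<in> J ==> l \<in> chains (bcx n) ==> f j l = g l"
  obtains s t where "s \<in> splx C n" "\<forall>l\<in>chains (bcx n). opr C n (map (\<lambda>i. i - 1) l) s = g l"
    "\<forall>j\<in>J. t j \<in> splx C (Suc n)" "\<forall>j\<in>J. \<forall>l\<in>chains (hcx n). opr C (Suc n) l (t j) = f j l"
    "\<forall>j\<in>J. opr C (Suc n) [1..<Suc (Suc n)] (t j) = s"
proof -
  have "\<exists>s t. s \<in> splx C n \<and> (\<forall>l\<in>chains (bcx n). opr C n (map (\<lambda>i. i - 1) l) s = g l) \<and>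
       (\<forall>j\<in>J. t j \<in> splx C (Suc n) \<and> (\<forall>l\<in>chains (hcx n). opr C (Suc n) l (t j) = f j l) \<and>
          opr C (Suc n) [1..<Suc (Suc n)] (t j) = s)"
    using assms(1)[unfolded coprod_def, rule_format, of n g f] assms(2-) by simp
  then show ?thesis using that by blast
qed

lemma subcomplex_hcx: "subcomplex (hcx n)"
  unfolding subcomplex_def hcx_def by (auto intro: finite_subset)

lemma subcomplex_bcx: "subcomplex (bcx n)"
  unfolding subcomplex_def bcx_def by (auto intro: finite_subset)

lemma hcx_bcx:
  assumes "\<tau> \<in> hcx n" "0 \<notin> \<tau>" shows "\<tau> \<in> bcx n"
proof -
  have "x \<in> {1..Suc n}" if "x \<in> \<tau>" for x
    using assms that by (cases x) (auto simp: hcx_def)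
  then show ?thesis using assms by (auto simp: hcx_def bcx_def)
qed

lemma hcx_Delta: "l \<in> chains (hcx n) ==> l \<in> splx (Delta (Suc n)) (length l - 1)"
  by (auto simp: chains_def hcx_def Delta_iff)

text \<open>Every chain in a simplex arises by an operator from the increasing enumeration of its
  vertices.\<close>

lemma cmap_eq_on_full:
  assumes \<tau>: "finite \<tau>" "\<tau> \<noteq> {}" and f: "cmap C (full \<tau>) f" "cmap C (full \<tau>) f'"
    and eq: "f (sorted_list_of_set \<tau>) = f' (sorted_list_of_set \<tau>)"
    and l: "l \<in> chains (full \<tau>)"
  shows "f l = f' l"
proof -
  let ?L = "sorted_list_of_set \<tau>"
  have L: "?L \<in> chains (full \<tau>)" using \<tau> by (auto simp: chains_def full_def)
  have "map (nth ?L) (map (pos \<tau>) l) = l" using nth_pos_list[OF \<tau>(1)] l by (auto simp: chains_def full_def)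
  then show ?thesis
    using cmapD(2)[OF f(1) L, of "map (pos \<tau>) l"] cmapD(2)[OF f(2) L, of "map (pos \<tau>) l"]
      pos_Delta[OF \<tau>(1) l] eq by (simp del: map_map)
qed

lemma attach_nth:
  assumes "finite \<sigma>" "\<sigma> \<noteq> {}" "\<alpha> \<in> splx (Delta (card \<sigma> - 1)) m"
    "l = map (nth (sorted_list_of_set \<sigma>)) \<alpha>"
  shows "attach C \<sigma> t f l = opr C (card \<sigma> - 1) \<alpha> t"
proof -
  have "set l \<subseteq> \<sigma>" using nth_Delta_chains[OF assms(1,3,2)] assms(4) by (auto simp: chains_def full_def)
  then show ?thesis using pos_nth_list[OF assms(1-3)] assms(4) by (simp add: attach_def del: map_map)
qed

lemma pos_ivl: "k \<le> v ==> v \<le> m ==> pos {k..m} v = v - k"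
proof -
  assume "k \<le> v" "v \<le> m"
  then have "{w \<in> {k..m}. w < v} = {k..<v}" by auto
  then show ?thesis by (simp add: pos_def)
qed

text \<open>The universal property is read along the increasing enumeration of
  \<open>insert a \<sigma>\<close>, whose first two entries are \<open>a\<close> and
  \<open>b\<close>. The cell \<sigma> goes into the common part and gets one value for all indices;
  each index gets its own cone over it.\<close>

lemma coprod_cell:
  assumes C: "is_sset C" and cp: "coprod C J x e"
    and K0: "subcomplex K0" and K: "subcomplex K" and sub: "K0 \<subseteq> K"
    and g: "cmap C K0 g" and f: "\<And>j. j \<in> J ==> cmap C K (f j)"
    and fg: "\<And>j l. j \<in> J ==> l \<in> chains K0 ==> f j l = g l"
    and \<sigma>: "finite \<sigma>" "b \<in> \<sigma>" "w \<in> \<sigma>" "b < w" and min: "\<And>v. v \<in> \<sigma> ==> b \<le> v" and a: "a < b"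
    and nin: "\<sigma> \<notin> K"
    and faces0: "\<And>\<tau>. \<tau> \<subset> \<sigma> ==> \<tau> \<noteq> {} ==> \<tau> \<in> K0"
    and faces: "\<And>\<tau>. \<tau> \<subset> insert a \<sigma> ==> \<tau> \<noteq> {} ==> \<tau> \<noteq> \<sigma> ==> \<tau> \<in> K"
    and gx: "g [b] = x" and fe: "\<And>j. j \<in> J ==> f j [a,b] = e j"
  shows "\<exists>g' f'. cmap C (insert \<sigma> K0) g' \<and> (\<forall>l\<in>chains K0. g' l = g l) \<and> subcomplex (insert \<sigma> K0) \<and>
    subcomplex (insert \<sigma> (insert (insert a \<sigma>) K)) \<and>
    (\<forall>j\<in>J. cmap C (insert \<sigma> (insert (insert a \<sigma>) K)) (f' j) \<and> (\<forall>l\<in>chains K. f' j l = f j l) \<and>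
      (\<forall>l\<in>chains (insert \<sigma> K0). f' j l = g' l))"
proof -
  let ?S = "insert a \<sigma>" and ?n = "card \<sigma> - 1"
  let ?L = "sorted_list_of_set ?S"
  define \<psi> where "\<psi> = nth ?L"
  have ne: "\<sigma> \<noteq> {}" using \<sigma> by auto
  have an: "a \<notin> \<sigma>" using min a by force
  have "card {b,w} \<le> card \<sigma>" by (rule card_mono) (use \<sigma> in auto)
  then have n: "0 < ?n" "card \<sigma> = Suc ?n" "card ?S = Suc (Suc ?n)" using \<sigma> an by auto
  have amin: "\<And>v. v \<in> \<sigma> ==> a < v" using min a by force
  have posS: "pos ?S v = Suc (pos \<sigma> v)" if "v \<in> \<sigma>" for v
  proof -
    have "{w \<in> ?S. w < v} = insert a {w \<in> \<sigma>. w < v}" using amin[OF that] by auto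
    then show ?thesis using \<sigma>(1) an by (simp add: pos_def)
  qed
  have pa: "pos ?S a = 0" unfolding pos_def using amin \<sigma>(1) by (auto dest: less_asym)
  have pb: "pos ?S b = 1" using posS[OF \<sigma>(2)] min \<sigma>(1) by (auto simp: pos_def leD)
  have \<psi>p: "\<psi> (pos ?S v) = v" if "v \<in> ?S" for v
    using nth_pos[of ?S v] that \<sigma>(1) by (simp add: \<psi>_def)
  have p\<psi>: "pos ?S (\<psi> i) = i" if "i \<le> Suc ?n" for i
    using pos_nth[of ?S i] that \<sigma>(1) n by (simp add: \<psi>_def)
  have \<psi>S: "\<psi> i \<in> ?S" if "i \<le> Suc ?n" for i
    using that n \<sigma>(1) unfolding \<psi>_def
    by (metis finite_insert le_imp_less_Suc length_sorted_list_of_set nth_mem set_sorted_list_of_set)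
  have \<psi>a: "\<psi> 0 = a" "\<psi> 1 = b" using \<psi>p[of a] \<psi>p[of b] pa pb \<sigma> by auto
  have \<psi>\<sigma>: "\<psi> i \<in> \<sigma>" if "1 \<le> i" "i \<le> Suc ?n" for i
    using \<psi>S[OF that(2)] p\<psi>[OF that(2)] pa that by auto
  have mono: "mono_on {..Suc ?n} \<psi>"
  proof (rule mono_onI)
    fix r s assume "r \<in> {..Suc ?n}" "s \<in> {..Suc ?n}" "r \<le> s"
    moreover have "length ?L = Suc (Suc ?n)" using n(3) by (simp only: length_sorted_list_of_set)
    ultimately show "\<psi> r \<le> \<psi> s"
      unfolding \<psi>_def by (intro sorted_nth_mono) auto
  qed
  \<comment> \<open>The enumeration is injective, so an image contains \<sigma> only if the preimage
    contains every positive vertex; images of horn faces therefore never contain \<sigma>.\<close>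
  have cover: "{1..Suc ?n} \<subseteq> \<tau>" if "\<sigma> \<subseteq> \<psi> ` \<tau>" "\<tau> \<subseteq> {..Suc ?n}" for \<tau>
  proof
    fix i assume i: "i \<in> {1..Suc ?n}"
    then have "\<psi> i \<in> \<psi> ` \<tau>" using \<psi>\<sigma>[of i] that by auto
    then obtain k where k: "k \<in> \<tau>" "\<psi> i = \<psi> k" by auto
    have "k \<le> Suc ?n" "i \<le> Suc ?n" using k i that by auto
    then have "i = k" using p\<psi>[of i] p\<psi>[of k] k(2) by metis
    then show "i \<in> \<tau>" using k by simp
  qed
  have b1: "\<psi> ` \<tau> \<in> K0" if "\<tau> \<in> bcx ?n" for \<tau>
  proof (rule faces0)
    have t: "\<tau> \<subset> {1..Suc ?n}" "\<tau> \<noteq> {}" using that by (auto simp: bcx_def)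
    then have "\<not> \<sigma> \<subseteq> \<psi> ` \<tau>" using cover[of \<tau>] by fastforce
    moreover have "\<psi> ` \<tau> \<subseteq> \<sigma>" using t \<psi>\<sigma> by auto
    ultimately show "\<psi> ` \<tau> \<subset> \<sigma>" by auto
    show "\<psi> ` \<tau> \<noteq> {}" using t by auto
  qed
  have h1: "\<psi> ` \<tau> \<in> K" if "\<tau> \<in> hcx ?n" for \<tau>
  proof (rule faces)
    have t: "\<tau> \<subseteq> {..Suc ?n}" "\<tau> \<noteq> {}" "\<not> {1..Suc ?n} \<subseteq> \<tau>" using that by (auto simp: hcx_def)
    then have nc: "\<not> \<sigma> \<subseteq> \<psi> ` \<tau>" using cover[of \<tau>] by blast
    then show "\<psi> ` \<tau> \<noteq> \<sigma>" by auto
    have "\<psi> ` \<tau> \<subseteq> ?S" using t \<psi>S by blast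
    then show "\<psi> ` \<tau> \<subset> ?S" using nc by blast
    show "\<psi> ` \<tau> \<noteq> {}" using t by auto
  qed
  have ub: "\<Union> (bcx ?n) \<subseteq> {..Suc ?n}" "\<Union> (hcx ?n) \<subseteq> {..Suc ?n}"
    by (auto simp: bcx_def hcx_def)
  have G: "cmap C (bcx ?n) (\<lambda>l. g (map \<psi> l))"
    by (rule cmap_relabel[OF g mono_on_subset[OF mono ub(1)] b1])
  have F: "cmap C (hcx ?n) (\<lambda>l. f j (map \<psi> l))" if "j \<in> J" for j
    by (rule cmap_relabel[OF f[OF that] mono_on_subset[OF mono ub(2)] h1])
  have cK0: "map \<psi> l \<in> chains K0" if "l \<in> chains (bcx ?n)" for l
    using b1[of "set l"] that mono ub(1) by (auto simp: chains_def sorted_iff_nth_mono intro!: mono_onD[OF mono_on_subset[OF mono ub(1)]])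
  have ge: "g (map \<psi> [1]) = x" and fe': "\<And>j. j \<in> J ==> f j (map \<psi> [0,1]) = e j"
    using \<psi>a gx fe by auto
  obtain s t where s: "s \<in> splx C ?n"
    and sg': "\<forall>l\<in>chains (bcx ?n). opr C ?n (map (\<lambda>i. i - 1) l) s = g (map \<psi> l)"
    and t': "\<forall>j\<in>J. t j \<in> splx C (Suc ?n)"
    and tf': "\<forall>j\<in>J. \<forall>l\<in>chains (hcx ?n). opr C (Suc ?n) l (t j) = f j (map \<psi> l)"
    and ts': "\<forall>j\<in>J. opr C (Suc ?n) [1..<Suc (Suc ?n)] (t j) = s"
    by (rule coprodD[OF cp n(1) G ge F fe' fg[OF _ cK0]])
  note sg = bspec[OF sg'] and t = bspec[OF t'] and tf = bspec[OF bspec[OF tf']] and ts = bspec[OF ts']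
  have \<psi>pl: "map \<psi> (map (pos ?S) l) = l" if "set l \<subseteq> ?S" for l
    using that \<psi>p by (auto intro!: map_idI)
  have pS: "map (pos ?S) l \<in> chains (full {..Suc ?n})" if "l \<in> chains (full ?S)" for l
    using pos_Delta[OF _ that] \<sigma>(1) n that by (auto simp: chains_def full_def Delta_iff)
  have pimg: "set (map (pos ?S) l) \<in> hcx ?n" if "l \<in> chains (full ?S)" "\<not> \<sigma> \<subseteq> set l" for l
  proof -
    have "\<not> {1..Suc ?n} \<subseteq> set (map (pos ?S) l)"
    proof
      assume h: "{1..Suc ?n} \<subseteq> set (map (pos ?S) l)"
      have "\<sigma> \<subseteq> set l"
      proof
        fix v assume v: "v \<in> \<sigma>"
        have "pos ?S v \<in> {1..Suc ?n}" using posS[OF v] pos_less[OF \<sigma>(1) v] n by auto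
        then obtain u where u: "u \<in> set l" "pos ?S v = pos ?S u" using h by auto
        have "u \<in> ?S" "v \<in> ?S" using u(1) v that(1) by (auto simp: chains_def full_def)
        then have "v = u" using \<psi>p u(2) by metis
        then show "v \<in> set l" using u by simp
      qed
      then show False using that by simp
    qed
    then show ?thesis using pS[OF that(1)] unfolding chains_def full_def hcx_def by auto
  qed
  have eqf: "opr C (card ?S - 1) (map (pos ?S) l) (t j) = f j l"
    if j: "j \<in> J" and l: "l \<in> chains K" "set l \<subseteq> ?S" for j l
  proof -
    have lf: "l \<in> chains (full ?S)" using l by (auto simp: chains_def full_def)
    have "\<not> \<sigma> \<subseteq> set l" using nin subcomplexD(1)[OF K, of "set l" \<sigma>] l ne by (auto simp: chains_def)
    then have "map (pos ?S) l \<in> chains (hcx ?n)" using pimg[OF lf] pS[OF lf] by (auto simp: chains_def)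
    then show ?thesis using tf[OF j] \<psi>pl[OF l(2)] n(3) by (simp del: map_map)
  qed
  have pos1: "map (\<lambda>i. i - 1) (map (pos ?S) l) = map (pos \<sigma>) l" if "set l \<subseteq> \<sigma>" for l
    using that posS by auto
  have eqg: "opr C (card \<sigma> - 1) (map (pos \<sigma>) l) s = g l"
    if l: "l \<in> chains K0" "set l \<subseteq> \<sigma>" for l
  proof -
    have lf: "l \<in> chains (full ?S)" using l by (auto simp: chains_def full_def)
    have "\<not> \<sigma> \<subseteq> set l" using nin subcomplexD(1)[OF K, of "set l" \<sigma>] l sub ne by (auto simp: chains_def)
    then have h: "set (map (pos ?S) l) \<in> hcx ?n" using pimg[OF lf] by blast
    have "0 \<notin> set (map (pos ?S) l)" using posS l(2) by auto
    then have "set (map (pos ?S) l) \<in> bcx ?n" using hcx_bcx[OF h] by blast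
    then have "map (pos ?S) l \<in> chains (bcx ?n)" using pS[OF lf] by (auto simp: chains_def)
    then show ?thesis using sg \<psi>pl[of l] pos1[OF l(2)] l(2) by (metis subset_insertI2)
  qed
  let ?g = "attach C \<sigma> s g" and ?f = "\<lambda>j. attach C ?S (t j) (f j)"
  have U0: "K0 \<union> full \<sigma> = insert \<sigma> K0" using faces0 ne unfolding full_def by blast
  have U: "K \<union> full ?S = insert \<sigma> (insert ?S K)" using faces ne unfolding full_def by blast
  have fS: "finite ?S" using \<sigma>(1) by simp
  have tS: "t j \<in> splx C (card ?S - 1)" if "j \<in> J" for j using t[OF that] n(3) by simp
  have A: "cmap C (insert \<sigma> K0) ?g" "\<And>l. l \<in> chains K0 ==> ?g l = g l"
    using cmap_attach[OF C K0 g \<sigma>(1) s eqg] U0 by auto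
  have B: "cmap C (insert \<sigma> (insert ?S K)) (?f j)" "\<And>l. l \<in> chains K ==> ?f j l = f j l" if j: "j \<in> J" for j
    using cmap_attach[OF C K f[OF j] fS tS[OF j] eqf[OF j]] U by auto
  have D: "?f j l = ?g l" if j: "j \<in> J" and l: "l \<in> chains (insert \<sigma> K0)" for j l
  proof (cases "set l \<in> K0")
    case True
    then have "l \<in> chains K0" using l by (auto simp: chains_def)
    moreover then have "l \<in> chains K" using sub by (auto simp: chains_def)
    ultimately show ?thesis using A(2) B(2)[OF j] fg[OF j] by simp
  next
    case False
    then have sl: "set l = \<sigma>" using l by (auto simp: chains_def)
    have lf: "l \<in> chains (full \<sigma>)" using sl l ne by (auto simp: chains_def full_def)
    \<comment> \<open>The face of \<open>t j\<close> opposite 0 is the common \<open>s\<close>; this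
      makes the new values on \<sigma> independent of \<open>j\<close>.\<close>
    have d1: "[1..<Suc (Suc ?n)] \<in> splx (Delta (Suc ?n)) ?n" by (auto simp: Delta_iff)
    have d2: "map (pos \<sigma>) l \<in> splx (Delta ?n) (length l - 1)" by (rule pos_Delta[OF \<sigma>(1) lf])
    have m: "map (nth [1..<Suc (Suc ?n)]) (map (pos \<sigma>) l) = map (pos ?S) l"
      using sl posS pos_less[OF \<sigma>(1)] n by (auto)
    then have "opr C (Suc ?n) (map (pos ?S) l) (t j) = opr C ?n (map (pos \<sigma>) l) s"
      using is_ssetD(3)[OF C t[OF j] d1 d2] by (simp only: m ts[OF j])
    then show ?thesis using sl n(3) by (auto simp: attach_def)
  qed
  have "subcomplex (insert \<sigma> K0)" "subcomplex (insert \<sigma> (insert ?S K))"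
    using subcomplex_Un[OF K0 subcomplex_full[OF \<sigma>(1)]] subcomplex_Un[OF K subcomplex_full[OF fS]] U U0 by auto
  then show ?thesis using A B D by (intro exI[of _ ?g] exI[of _ ?f]) simp
qed

lemma chains_mono: "K \<subseteq> L ==> chains K \<subseteq> chains L"
  by (auto simp: chains_def)

lemma cmap_full_sub:
  assumes "cmap C K f" "subcomplex K" "\<tau> \<in> K" shows "cmap C (full \<tau>) f"
  by (rule cmap_mono[OF assms(1)]) (use subcomplexD(1)[OF assms(2,3)] in \<open>auto simp: full_def\<close>)

text \<open>The overlap of the new simplex with \<open>K\<close> is the single face \<tau>, so
  agreement reduces to one equation on the enumeration of \<tau>; the operator \<alpha> names that
  face inside \<sigma>.\<close>

lemma cmap_attach':
  assumes C: "is_sset C" and K: "subcomplex K" and f: "cmap C K f"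
    and \<sigma>: "finite \<sigma>" and t: "t \<in> splx C (card \<sigma> - 1)"
    and \<tau>: "\<tau> \<in> K" "\<tau> \<subseteq> \<sigma>" "\<And>\<rho>. \<rho> \<in> K ==> \<rho> \<subseteq> \<sigma> ==> \<rho> \<subseteq> \<tau>"
    and \<alpha>: "map (nth (sorted_list_of_set \<sigma>)) \<alpha> = sorted_list_of_set \<tau>" "\<alpha> \<in> splx (Delta (card \<sigma> - 1)) (card \<tau> - 1)"
    and eq: "opr C (card \<sigma> - 1) \<alpha> t = f (sorted_list_of_set \<tau>)"
  shows "cmap C (K \<union> full \<sigma>) (attach C \<sigma> t f)"
    and "\<And>l. l \<in> chains K ==> attach C \<sigma> t f l = f l"
proof -
  have ne: "\<tau> \<noteq> {}" "finite \<tau>" using subcomplexD[OF K \<tau>(1)] by auto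
  have ne': "\<sigma> \<noteq> {}" using ne \<tau> by auto
  have "opr C (card \<sigma> - 1) (map (pos \<sigma>) l) t = f l" if l: "l \<in> chains K" "set l \<subseteq> \<sigma>" for l
  proof (rule cmap_eq_on_full[OF ne(2,1) _ cmap_full_sub[OF f K \<tau>(1)]])
    show "cmap C (full \<tau>) (\<lambda>l. opr C (card \<sigma> - 1) (map (pos \<sigma>) l) t)"
      by (rule cmap_mono[OF cmap_simplex[OF C \<sigma> t]]) (use \<tau> in \<open>auto simp: full_def\<close>)
    show "opr C (card \<sigma> - 1) (map (pos \<sigma>) (sorted_list_of_set \<tau>)) t = f (sorted_list_of_set \<tau>)"
      using pos_nth_list[OF \<sigma> ne' \<alpha>(2)] eq \<alpha>(1) by (simp del: map_map)
    show "l \<in> chains (full \<tau>)" using l \<tau>(3)[of "set l"] by (auto simp: chains_def full_def)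
  qed
  then show "cmap C (K \<union> full \<sigma>) (attach C \<sigma> t f)"
    and "\<And>l. l \<in> chains K ==> attach C \<sigma> t f l = f l"
    using cmap_attach[OF C K f \<sigma> t] by blast+
qed

section \<open>Shifting vertices to make room for new ones\<close>

definition faces_of :: "nat => nat => nat set set" where
  "faces_of k n = {\<tau>. \<tau> \<subset> {k..k + n} \<and> \<tau> \<noteq> {}}"

lemma subcomplex_faces_of: "subcomplex (faces_of k n)"
  unfolding subcomplex_def faces_of_def by (auto intro: finite_subset)

text \<open>\<open>up k\<close> opens a gap of \<open>k\<close> free vertices between 0 and the
  others; \<open>dn k\<close> collapses the vertices \<open>0..k\<close> onto 0 and closes the gap
  again.\<close>

definition up :: "nat => nat => nat" where "up k i = (if i = 0 then 0 else i + k)"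
definition dn :: "nat => nat => nat" where "dn k i = (if i \<le> k then 0 else i - k)"

lemma dn_up [simp]: "dn k (up k i) = i" by (auto simp: up_def dn_def)
lemma map_dn_up [simp]: "map (dn k) (map (up k) l) = l" by (simp add: comp_def)
lemma mono_dn: "mono_on S (dn k)" by (auto simp: mono_on_def dn_def)
lemma mono_up: "mono_on S (up k)" by (auto simp: mono_on_def up_def)

text \<open>The image of \<open>hcx n\<close> under \<open>up k\<close>: the cone with its base
  moved up by \<open>k\<close>.\<close>

definition upperc :: "nat => nat => nat set set" where
  "upperc k n = {\<tau>. \<tau> \<subseteq> insert 0 {Suc k..Suc k + n} \<and> \<tau> \<noteq> {} \<and> \<not> {Suc k..Suc k + n} \<subseteq> \<tau>}"

lemma subcomplex_upperc: "subcomplex (upperc k n)"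
  unfolding subcomplex_def upperc_def by (auto intro: finite_subset)

text \<open>The collapse is injective above \<open>k\<close>, so a missing vertex of the base stays
  missing.\<close>

lemma dn_faces: "\<tau> \<in> faces_of (Suc k) n ==> dn k ` \<tau> \<in> bcx n"
proof -
  assume t: "\<tau> \<in> faces_of (Suc k) n"
  then obtain v where v: "Suc k \<le> v" "v \<le> Suc k + n" "v \<notin> \<tau>" by (auto simp: faces_of_def)
  have "dn k v \<notin> dn k ` \<tau>"
  proof
    assume "dn k v \<in> dn k ` \<tau>"
    then obtain w where w: "w \<in> \<tau>" "dn k v = dn k w" by auto
    then have "Suc k \<le> w" using t by (auto simp: faces_of_def)
    then have "v = w" using v w by (auto simp: dn_def split: if_splits)
    then show False using v w by simp
  qed
  moreover have "dn k v \<in> {1..Suc n}" using v by (auto simp: dn_def)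
  moreover have "dn k x \<in> {1..Suc n}" if "x \<in> \<tau>" for x
  proof -
    have "x \<in> {Suc k..Suc k + n}" using t that by (auto simp: faces_of_def)
    then show ?thesis by (auto simp: dn_def)
  qed
  ultimately show ?thesis using t by (auto simp: bcx_def faces_of_def)
qed

lemma dn_hcx:
  assumes t: "\<tau> \<subseteq> {..Suc k + n}" "\<tau> \<noteq> {}" "\<not> {Suc k..Suc k + n} \<subseteq> \<tau>"
  shows "dn k ` \<tau> \<in> hcx n"
proof -
  obtain v where v: "Suc k \<le> v" "v \<le> Suc k + n" "v \<notin> \<tau>" using t by auto
  have "dn k v \<notin> dn k ` \<tau>"
  proof
    assume "dn k v \<in> dn k ` \<tau>"
    then obtain w where w: "w \<in> \<tau>" "dn k v = dn k w" by auto
    then have "v = w" using v w by (auto simp: dn_def split: if_splits)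
    then show False using v w by simp
  qed
  moreover have "dn k v \<in> {1..Suc n}" using v by (auto simp: dn_def)
  moreover have "dn k ` \<tau> \<subseteq> {..Suc n}" using t by (auto simp: dn_def)
  ultimately show ?thesis using t by (auto simp: hcx_def)
qed

lemma up_hcx: "\<tau> \<in> hcx n ==> up k ` \<tau> \<in> upperc k n"
proof -
  assume t: "\<tau> \<in> hcx n"
  then obtain v where v: "1 \<le> v" "v \<le> Suc n" "v \<notin> \<tau>" by (auto simp: hcx_def)
  have "up k v \<notin> up k ` \<tau>"
  proof
    assume "up k v \<in> up k ` \<tau>"
    then obtain w where w: "w \<in> \<tau>" "up k v = up k w" by auto
    then have "v = w" by (metis dn_up)
    then show False using v w by simp
  qed
  moreover have "up k v \<in> {Suc k..Suc k + n}" using v by (auto simp: up_def)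
  moreover have "up k ` \<tau> \<subseteq> insert 0 {Suc k..Suc k + n}" using t by (auto simp: hcx_def up_def)
  ultimately show ?thesis using t by (auto simp: upperc_def hcx_def)
qed

text \<open>The state of a simultaneous construction: the common part \<open>K0\<close> carries one
  map, and each index extends it to \<open>K\<close> in its own way.\<close>

definition fam :: "'c sset => 'j set => nat set set => nat set set => (nat list => 'c) => ('j => nat list => 'c) => bool" where
  "fam C J K0 K g f \<longleftrightarrow> subcomplex K0 \<and> subcomplex K \<and> K0 \<subseteq> K \<and> cmap C K0 g \<and>
     (\<forall>j\<in>J. cmap C K (f j) \<and> (\<forall>l\<in>chains K0. f j l = g l))"

lemma famD:
  assumes "fam C J K0 K g f"
  shows "subcomplex K0" "subcomplex K" "K0 \<subseteq> K" "cmap C K0 g"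
    "\<And>j. j \<in> J ==> cmap C K (f j)" "\<And>j l. j \<in> J ==> l \<in> chains K0 ==> f j l = g l"
  using assms by (simp_all add: fam_def)

text \<open>Turns the attachment of a cell into a step from one simultaneous construction to the
  next, in the form used by an induction over cells.\<close>

lemma coprod_fam:
  assumes C: "is_sset C" and cp: "coprod C J x e" and fam: "fam C J K0 K g f"
    and \<sigma>: "finite \<sigma>" "b \<in> \<sigma>" "w \<in> \<sigma>" "b < w" and min: "\<And>v. v \<in> \<sigma> ==> b \<le> v" and a: "a < b"
    and nin: "\<sigma> \<notin> K"
    and faces0: "\<And>\<tau>. \<tau> \<subset> \<sigma> ==> \<tau> \<noteq> {} ==> \<tau> \<in> K0"
    and faces: "\<And>\<tau>. \<tau> \<subset> insert a \<sigma> ==> \<tau> \<noteq> {} ==> \<tau> \<noteq> \<sigma> ==> \<tau> \<in> K"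
    and gx: "g [b] = x" and fe: "\<And>j. j \<in> J ==> f j [a,b] = e j"
  obtains g' f' where "fam C J (insert \<sigma> K0) (insert \<sigma> (insert (insert a \<sigma>) K)) g' f'"
    "\<And>l. l \<in> chains K0 ==> g' l = g l" "\<And>j l. j \<in> J ==> l \<in> chains K ==> f' j l = f j l"
proof -
  have "\<exists>g' f'. cmap C (insert \<sigma> K0) g' \<and> (\<forall>l\<in>chains K0. g' l = g l) \<and> subcomplex (insert \<sigma> K0) \<and>
    subcomplex (insert \<sigma> (insert (insert a \<sigma>) K)) \<and>
    (\<forall>j\<in>J. cmap C (insert \<sigma> (insert (insert a \<sigma>) K)) (f' j) \<and> (\<forall>l\<in>chains K. f' j l = f j l) \<and>
      (\<forall>l\<in>chains (insert \<sigma> K0). f' j l = g' l))"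
    by (rule coprod_cell[OF C cp famD[OF fam] \<sigma> min a nin faces0 faces gx fe])
  moreover have "insert \<sigma> K0 \<subseteq> insert \<sigma> (insert (insert a \<sigma>) K)" using famD(3)[OF fam] by blast
  ultimately show ?thesis using that unfolding fam_def by metis
qed

lemma d0_Delta: "[1..<Suc (Suc n)] \<in> splx (Delta (Suc n)) n"
  by (auto simp: Delta_iff)

lemma chains_map:
  assumes "l \<in> chains L" "mono_on (\<Union>L) \<psi>" "\<And>\<tau>. \<tau> \<in> L ==> \<psi> ` \<tau> \<in> K"
  shows "map \<psi> l \<in> chains K"
  using assms unfolding chains_def by (auto simp: sorted_iff_nth_mono intro!: mono_onD[OF assms(2)])

text \<open>
  The vertex \<open>0\<close> is the source of \<open>e j\<close>, the vertex \<open>1\<close> is \<open>x'\<close> and \<open>{2..n + 2}\<close> is the simplex to be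
  filled. The missing faces containing \<open>1\<close> are filled by the universal property of \<open>x'\<close>, the simplex
  itself by that of \<open>x\<close>, and the last remaining cell is an inner horn.
\<close>

lemma coprod_comp:
  assumes Q: "quasi_category C" and c1: "coprod C J x' e" and c2: "coprod C L x d" and l0: "l0 \<in> L"
    and tri: "\<And>j. j \<in> J ==> t j \<in> splx C 2" "\<And>j. j \<in> J ==> opr C 2 [0,1] (t j) = e j"
      "\<And>j. j \<in> J ==> opr C 2 [1,2] (t j) = d l0" "\<And>j. j \<in> J ==> opr C 2 [0,2] (t j) = e' (Inl j)"
    and d: "d l0 \<in> splx C 1" "opr C 1 [0] (d l0) = x'" "opr C 1 [1] (d l0) = x"
    and e': "\<And>l. l \<in> L ==> l \<noteq> l0 ==> e' (Inr l) = d l"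
  shows "coprod C (J <+> (L - {l0})) x e'"
  unfolding coprod_def
proof (intro allI impI, elim conjE, goal_cases)
  case (1 n g f)
  have C: "is_sset C" using Q by (simp add: quasi_category_def)
  note n = \<open>0 < n\<close>
  have g: "cmap C (bcx n) g" "g [1] = x" using 1 by auto
  have f: "cmap C (hcx n) (f i)" "f i [0,1] = e' i" "\<And>l. l \<in> chains (bcx n) ==> f i l = g l"
    if "i \<in> J <+> (L - {l0})" for i using 1 that by auto
  have iL: "Inl j \<in> J <+> (L - {l0})" if "j \<in> J" for j using that by auto
  have iR: "Inr l \<in> J <+> (L - {l0})" if "l \<in> L" "l \<noteq> l0" for l using that by auto
  let ?F = "{2..2 + n}"
  let ?A = "faces_of 2 n" and ?B = "upperc 1 n"
  \<comment> \<open>Pulling back along \<open>dn 1\<close> moves the base up by one and frees the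
    vertex 1 for \<open>x'\<close>.\<close>
  let ?g0 = "\<lambda>l. g (map (dn 1) l)" and ?f0 = "\<lambda>j l. f (Inl j) (map (dn 1) l)"
  have fac: "\<tau> \<in> faces_of (Suc 1) n" if "\<tau> \<in> ?A" for \<tau> using that by (simp add: numeral_2_eq_2)
  have upp: "\<tau> \<subseteq> {..Suc 1 + n}" "\<tau> \<noteq> {}" "\<not> {Suc 1..Suc 1 + n} \<subseteq> \<tau>" if "\<tau> \<in> ?B" for \<tau>
    using that by (auto simp: upperc_def)
  have g0: "cmap C ?A ?g0" by (rule cmap_relabel[OF g(1) mono_dn dn_faces[OF fac]])
  have f0: "cmap C ?B (?f0 j)" if "j \<in> J" for j
    by (rule cmap_relabel[OF f(1) mono_dn dn_hcx[OF upp]]) (use that in auto)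
  have AB: "?A \<subseteq> ?B" by (auto simp: faces_of_def upperc_def numeral_2_eq_2)
  have f0g0: "?f0 j l = ?g0 l" if "j \<in> J" "l \<in> chains ?A" for j l
    using f(3)[OF iL[OF that(1)] chains_map[OF that(2) mono_dn dn_faces[OF fac]]] by simp
  have F3: "3 \<in> ?F" "2 \<in> ?F" using n by auto
  have pos2: "{2} \<in> ?A" "{0,2} \<in> ?B"
  proof -
    have n3: "3 \<notin> {2::nat}" "3 \<notin> {0,2::nat}" by auto
    have "{2} \<subset> ?F" "\<not> ?F \<subseteq> {0,2}" "{0,2} \<subseteq> insert 0 ?F" using F3 n3 by blast+
    then show "{2} \<in> ?A" "{0,2} \<in> ?B" unfolding faces_of_def upperc_def by (simp_all add: numeral_2_eq_2)
  qed
  \<comment> \<open>The edge from \<open>x'\<close> to \<open>x\<close> goes into the common part,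
    the triangle over it into each member of the family.\<close>
  let ?g1 = "attach C {1,2} (d l0) ?g0" and ?f1 = "\<lambda>j. attach C {0,1,2} (t j) (?f0 j)"
  have s12: "sorted_list_of_set {1,2::nat} = [1,2]" "sorted_list_of_set {0,1,2::nat} = [0,1,2]"
    "sorted_list_of_set {0,2::nat} = [0,2]" "sorted_list_of_set {0,1::nat} = [0,1]" by simp_all
  have g1: "cmap C (?A \<union> full {1,2}) ?g1" "\<And>l. l \<in> chains ?A ==> ?g1 l = ?g0 l"
  proof -
    have a: "\<rho> \<subseteq> {2}" if "\<rho> \<in> ?A" "\<rho> \<subseteq> {1,2}" for \<rho>
    proof
      fix v assume "v \<in> \<rho>"
      then have "v \<in> {2..2+n}" "v \<in> {1,2}" using that unfolding faces_of_def by blast+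
      then show "v \<in> {2}" by auto
    qed
    have b: "opr C 1 [1] (d l0) = g [dn 1 2]" using d g(2) by (simp add: dn_def)
    note c = cmap_attach'[OF C subcomplex_faces_of g0, of "{1,2}" "d l0" "{2}" "[1]"]
    show "cmap C (?A \<union> full {1,2}) ?g1" "\<And>l. l \<in> chains ?A ==> ?g1 l = ?g0 l"
      by (rule c; use pos2(1) a b d(1) in \<open>simp add: Delta_iff\<close>)+
  qed
  have f1: "cmap C (?B \<union> full {0,1,2}) (?f1 j)" "\<And>l. l \<in> chains ?B ==> ?f1 j l = ?f0 j l" if j: "j \<in> J" for j
  proof -
    have a: "\<rho> \<subseteq> {0,2}" if "\<rho> \<in> ?B" "\<rho> \<subseteq> {0,1,2}" for \<rho>
    proof
      fix v assume "v \<in> \<rho>"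
      then have "v \<in> insert 0 {Suc 1..Suc 1+n}" "v \<in> {0,1,2}" using that unfolding upperc_def by blast+
      then show "v \<in> {0,2}" by auto
    qed
    have b: "opr C 2 [0,2] (t j) = f (Inl j) [dn 1 0, dn 1 2]"
      using f(2)[OF iL[OF j]] tri(4)[OF j] by (simp add: dn_def)
    note c = cmap_attach'[OF C subcomplex_upperc f0[OF j], of "{0,1,2}" "t j" "{0,2}" "[0,2]"]
    show "cmap C (?B \<union> full {0,1,2}) (?f1 j)" "\<And>l. l \<in> chains ?B ==> ?f1 j l = ?f0 j l"
      by (rule c; use pos2(2) a b tri(1)[OF j] in \<open>simp add: Delta_iff numeral_2_eq_2\<close>)+
  qed
  have f1g1: "?f1 j l = ?g1 l" if j: "j \<in> J" and l: "l \<in> chains (?A \<union> full {1,2})" for j l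
  proof (cases "l \<in> chains ?A")
    case True
    then show ?thesis using f1(2)[OF j] g1(2) f0g0[OF j] chains_mono[OF AB] by auto
  next
    case False
    then have l12: "l \<in> chains (full {1,2})" using l by (auto simp: chains_Un)
    show ?thesis
    proof (rule cmap_eq_on_full[OF _ _ _ _ _ l12])
      show "cmap C (full {1,2}) (?f1 j)"
        by (rule cmap_mono[OF f1(1)[OF j]]) (auto simp: full_def)
      show "cmap C (full {1,2}) ?g1" by (rule cmap_mono[OF g1(1)]) auto
      have "?f1 j [1,2] = d l0"
        using attach_nth[of "{0,1,2}" "[1,2]" 1 "[1,2]" C "t j" "?f0 j"] tri(3)[OF j] by (auto simp: Delta_iff numeral_2_eq_2)
      moreover have "?g1 [1,2] = d l0"
        using attach_top[OF C, of "{1,2}" "d l0" ?g0] d(1) by simp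
      ultimately show "?f1 j (sorted_list_of_set {1,2}) = ?g1 (sorted_list_of_set {1,2})" by simp
    qed auto
  qed
  let ?KA = "?A \<union> full {1,2}" and ?K = "?B \<union> full {0,1,2}"
  have sK0: "subcomplex ?KA" and sK: "subcomplex ?K"
    by (intro subcomplex_Un subcomplex_faces_of subcomplex_upperc subcomplex_full; simp)+
  have K0K: "?KA \<subseteq> ?K" using AB by (auto simp: full_def)
  have fam1: "fam C J ?KA ?K ?g1 ?f1" using g1(1) f1(1) f1g1 sK0 sK K0K by (simp add: fam_def)
  \<comment> \<open>The faces of the base whose cones with 1 are still to be built; those of the
    empty face and of \<open>{2}\<close> are present already.\<close>
  define \<A> where "\<A> = {\<phi>. \<phi> \<subset> ?F \<and> \<phi> \<noteq> {} \<and> \<phi> \<noteq> {2}}"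
  let ?X = "\<lambda>\<B>. ?KA \<union> insert 1 ` \<B>" and ?Y = "\<lambda>\<B>. ?K \<union> insert 1 ` \<B> \<union> (\<lambda>\<phi>. insert 0 (insert 1 \<phi>)) ` \<B>"
  have Acases: "\<psi> = {} \<or> \<psi> = {2} \<or> \<psi> \<in> \<A>" if "\<psi> \<subset> ?F" for \<psi>
    using that unfolding \<A>_def by (cases "\<psi> = {}"; cases "\<psi> = {2}"; simp)
  define P where "P \<B> \<longleftrightarrow> (\<exists>g' f'. fam C J (?X \<B>) (?Y \<B>) g' f' \<and>
      (\<forall>l\<in>chains ?KA. g' l = ?g1 l) \<and> (\<forall>j\<in>J. \<forall>l\<in>chains ?K. f' j l = ?f1 j l))" for \<B>
  have "P \<A>"
  proof (rule downset_induct[where P = P])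
    show "finite \<A>" by (rule finite_subset[of _ "Pow ?F"]) (auto simp: \<A>_def)
    show "finite \<phi>" if "\<phi> \<in> \<A>" for \<phi> using that finite_subset[of \<phi> ?F] by (auto simp: \<A>_def)
    show "P {}" unfolding P_def
      by (rule exI[of _ ?g1], rule exI[of _ ?f1]) (use fam1 in simp)
  next
    fix \<B> \<phi>
    assume \<B>: "\<B> \<subseteq> \<A>" "\<phi> \<in> \<A>" "\<phi> \<notin> \<B>" and below: "\<And>\<psi>. \<psi> \<subset> \<phi> ==> \<psi> \<in> \<A> ==> \<psi> \<in> \<B>" and "P \<B>"
    obtain g' f' where fam': "fam C J (?X \<B>) (?Y \<B>) g' f'" and g': "\<forall>l\<in>chains ?KA. g' l = ?g1 l"
      and f': "\<forall>j\<in>J. \<forall>l\<in>chains ?K. f' j l = ?f1 j l"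
      using \<open>P \<B>\<close> unfolding P_def by (elim exE conjE) (rule that)
    have \<phi>: "\<phi> \<subset> ?F" "\<phi> \<noteq> {}" "\<phi> \<noteq> {2}" using \<B>(2) by (auto simp: \<A>_def)
    then have fin: "finite \<phi>" using finite_subset[of \<phi> ?F] by auto
    obtain w where w: "w \<in> \<phi>" "1 < w" using \<phi> by fastforce
    have not01: "0 \<notin> \<psi>" "1 \<notin> \<psi>" if "\<psi> \<subseteq> ?F" for \<psi> using that by auto
    have BF: "\<psi> \<subseteq> ?F" if "\<psi> \<in> \<B>" for \<psi> using that \<B>(1) by (auto simp: \<A>_def)
    have ins: "insert 1 \<phi> \<notin> ?Y \<B>"
    proof
      assume "insert 1 \<phi> \<in> ?Y \<B>"
      moreover have "insert 1 \<phi> \<notin> ?B" by (auto simp: upperc_def)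
      moreover have "\<not> insert 1 \<phi> \<subseteq> {0,1,2}"
      proof
        assume "insert 1 \<phi> \<subseteq> {0,1,2}"
        then have "\<phi> \<subseteq> {2}" using not01[of \<phi>] \<phi> by auto
        then show False using \<phi> by auto
      qed
      moreover have "insert 1 \<phi> \<noteq> insert 1 \<psi>" if "\<psi> \<in> \<B>" for \<psi>
        using that \<B>(3) not01[of \<phi>] not01[OF BF[OF that]] \<phi> by (metis insert_ident psubset_imp_subset)
      moreover have "insert 1 \<phi> \<noteq> insert 0 (insert 1 \<psi>)" for \<psi>
        using not01[of \<phi>] \<phi> by (metis insertCI insertE psubset_imp_subset zero_neq_one)
      ultimately show False by (auto simp: full_def)
    qed
    have low: "insert 1 \<psi> \<in> ?X \<B>" "insert 0 (insert 1 \<psi>) \<in> ?Y \<B>" if s: "\<psi> \<subset> \<phi>" for \<psi>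
    proof -
      consider "\<psi> = {}" | "\<psi> = {2}" | "\<psi> \<in> \<A>" using Acases[OF psubset_trans[OF s \<phi>(1)]] by metis
      then show "insert 1 \<psi> \<in> ?X \<B>" "insert 0 (insert 1 \<psi>) \<in> ?Y \<B>"
        using below[OF s] by (cases; auto simp: full_def)+
    qed
    have faces0: "\<tau> \<in> ?X \<B>" if t: "\<tau> \<subset> insert 1 \<phi>" "\<tau> \<noteq> {}" for \<tau>
    proof (cases "1 \<in> \<tau>")
      case True
      then have "\<tau> = insert 1 (\<tau> - {1})" "\<tau> - {1} \<subset> \<phi>" using t not01[of \<phi>] \<phi> by auto
      then show ?thesis using low(1) by metis
    next
      case False
      then have "\<tau> \<subset> ?F" using t \<phi> by auto
      then show ?thesis using t by (auto simp: faces_of_def)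
    qed
    have XY: "?X \<B> \<subseteq> ?Y \<B>" using K0K by auto
    have faces: "\<tau> \<in> ?Y \<B>" if t: "\<tau> \<subset> insert 0 (insert 1 \<phi>)" "\<tau> \<noteq> {}" "\<tau> \<noteq> insert 1 \<phi>" for \<tau>
    proof (cases "0 \<in> \<tau>")
      case False
      then have "\<tau> \<subset> insert 1 \<phi>" using t by auto
      then show ?thesis using faces0 t(2) XY by blast
    next
      case 0: True
      show ?thesis
      proof (cases "1 \<in> \<tau>")
        case True
        then have "\<tau> = insert 0 (insert 1 (\<tau> - {0,1}))" "\<tau> - {0,1} \<subset> \<phi>" using 0 t not01[of \<phi>] \<phi> by auto
        then show ?thesis using low(2) by metis
      next
        case False
        then have "\<tau> \<subseteq> insert 0 \<phi>" using t by auto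
        moreover have "\<not> ?F \<subseteq> \<tau>" using calculation \<phi> by auto
        ultimately have "\<tau> \<in> ?B" using t \<phi> by (auto simp: upperc_def numeral_2_eq_2)
        then show ?thesis by simp
      qed
    qed
    have c12: "[1] \<in> chains ?KA" "[0,1] \<in> chains ?K"
      by (auto simp: chains_def full_def)
    have b1: "g' [1] = x'"
      using bspec[OF g' c12(1)] attach_nth[of "{1,2}" "[0]" 0 "[1]" C "d l0" ?g0] d(2) by (simp add: Delta_iff)
    have b2: "f' j [0,1] = e j" if "j \<in> J" for j
      using bspec[OF bspec[OF f' that] c12(2)] attach_nth[of "{0,1,2}" "[0,1]" 1 "[0,1]" C "t j" "?f0 j"] tri(2)[OF that]
      by (simp add: Delta_iff numeral_2_eq_2)
    have min: "1 \<le> v" if "v \<in> insert 1 \<phi>" for v using \<phi> that by auto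
    \<comment> \<open>With \<open>a = 0\<close> and \<open>b = 1\<close>, the property of
      \<open>x'\<close> supplies \<open>insert 1 \<phi>\<close> once for all indices and its cone
      with 0 for each of them.\<close>
    obtain g'' f'' where h: "fam C J (insert (insert 1 \<phi>) (?X \<B>)) (insert (insert 1 \<phi>) (insert (insert 0 (insert 1 \<phi>)) (?Y \<B>))) g'' f''"
      "\<And>l. l \<in> chains (?X \<B>) ==> g'' l = g' l" "\<And>j l. j \<in> J ==> l \<in> chains (?Y \<B>) ==> f'' j l = f' j l"
      by (rule coprod_fam[OF C c1 fam' _ _ _ w(2) min _ ins faces0 faces b1 b2]) (use fin w in auto)
    have eX: "insert (insert 1 \<phi>) (?X \<B>) = ?X (insert \<phi> \<B>)"
      and eY: "insert (insert 1 \<phi>) (insert (insert 0 (insert 1 \<phi>)) (?Y \<B>)) = ?Y (insert \<phi> \<B>)" by auto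
    have c: "chains ?KA \<subseteq> chains (?X \<B>)" "chains ?K \<subseteq> chains (?Y \<B>)" by (intro chains_mono; blast)+
    show "P (insert \<phi> \<B>)" unfolding P_def
    proof (intro exI[of _ g''] exI[of _ f''] conjI ballI)
      show "g'' l = ?g1 l" if "l \<in> chains ?KA" for l
        by (rule trans[OF h(2) bspec[OF g' that]]) (use c that in blast)
      show "f'' j l = ?f1 j l" if "j \<in> J" "l \<in> chains ?K" for j l
        by (rule trans[OF h(3)[OF that(1)] bspec[OF bspec[OF f' that(1)] that(2)]]) (use c that in blast)
      show "fam C J (?X (insert \<phi> \<B>)) (?Y (insert \<phi> \<B>)) g'' f''" using h(1) unfolding eX eY .
    qed
  qed
  then obtain g2 f2 where fam2: "fam C J (?X \<A>) (?Y \<A>) g2 f2" and g2': "\<forall>l\<in>chains ?KA. g2 l = ?g1 l"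
    and f2': "\<forall>j\<in>J. \<forall>l\<in>chains ?K. f2 j l = ?f1 j l"
    unfolding P_def by (elim exE conjE) (rule that)
  note g2 = famD(4)[OF fam2] famD(1,2)[OF fam2] bspec[OF g2']
  note f2 = famD(5)[OF fam2] bspec[OF bspec[OF f2']] famD(6)[OF fam2]
  have X1: "\<tau> \<in> ?X \<A>" if t: "\<tau> \<subseteq> insert 1 ?F" "\<not> ?F \<subseteq> \<tau>" "\<tau> \<noteq> {}" for \<tau>
  proof (cases "1 \<in> \<tau>")
    case False
    then show ?thesis using t by (auto simp: faces_of_def)
  next
    case True
    let ?\<psi> = "\<tau> - {1}"
    have e: "\<tau> = insert 1 ?\<psi>" using True by auto
    have "?\<psi> \<subset> ?F" using t by auto
    from Acases[OF this] consider "?\<psi> = {}" | "?\<psi> = {2}" | "?\<psi> \<in> \<A>" by metis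
    then show ?thesis
    proof cases
      case 1 then show ?thesis using e by (auto simp: full_def)
    next
      case 2 then show ?thesis using e by (auto simp: full_def)
    next
      case 3 then show ?thesis using e by blast
    qed
  qed
  have Y1: "\<tau> \<in> ?Y \<A>" if t: "\<tau> \<subseteq> insert 0 (insert 1 ?F)" "\<not> ?F \<subseteq> \<tau>" "\<tau> \<noteq> {}" for \<tau>
  proof (cases "0 \<in> \<tau>")
    case False
    then show ?thesis using X1[of \<tau>] t K0K by blast
  next
    case 0: True
    show ?thesis
    proof (cases "1 \<in> \<tau>")
      case False
      then show ?thesis using t by (auto simp: upperc_def numeral_2_eq_2)
    next
      case True
      let ?\<psi> = "\<tau> - {0,1}"
      have e: "\<tau> = insert 0 (insert 1 ?\<psi>)" using True 0 by auto
      have "?\<psi> \<subset> ?F" using t by auto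
      from Acases[OF this] consider "?\<psi> = {}" | "?\<psi> = {2}" | "?\<psi> \<in> \<A>" by metis
      then show ?thesis
      proof cases
        case 1 then show ?thesis using e by (auto simp: full_def)
      next
        case 2 then show ?thesis using e by (auto simp: full_def)
      next
        case 3 then show ?thesis using e by blast
      qed
    qed
  qed
  have noF: "\<not> ?F \<subseteq> \<tau>" if "\<tau> \<in> ?Y \<A>" for \<tau>
  proof
    assume h: "?F \<subseteq> \<tau>"
    have "\<tau> \<notin> ?B" using h by (auto simp: upperc_def numeral_2_eq_2)
    moreover have "2 + n \<in> \<tau>" using h by auto
    then have "\<tau> \<notin> full {0,1,2}" using n by (auto simp: full_def)
    moreover have "\<not> ?F \<subseteq> insert 0 (insert 1 \<psi>)" "\<not> ?F \<subseteq> insert 1 \<psi>" if "\<psi> \<in> \<A>" for \<psi>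
      using that unfolding \<A>_def by auto
    ultimately show False using that h by blast
  qed
  \<comment> \<open>The common part on the vertices \<open>1..n+2\<close> is an outer horn at 1
    whose first edge is \<open>d l0\<close>. Lowered by one it is the datum for the index
    \<open>l0\<close>; the other indices keep the given data.\<close>
  let ?fL = "\<lambda>l. if l = l0 then (\<lambda>l. g2 (map Suc l)) else f (Inr l)"
  have mS: "mono_on S Suc" for S by (auto simp: mono_on_def)
  have SucX: "Suc ` \<tau> \<in> ?X \<A>" if "\<tau> \<in> hcx n" for \<tau>
  proof (rule X1)
    have t: "\<tau> \<subseteq> {..Suc n}" "\<not> {1..Suc n} \<subseteq> \<tau>" "\<tau> \<noteq> {}" using that by (auto simp: hcx_def)
    then obtain v where v: "1 \<le> v" "v \<le> Suc n" "v \<notin> \<tau>" by auto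
    have "Suc v \<in> ?F" "Suc v \<notin> Suc ` \<tau>" using v by auto
    then show "\<not> ?F \<subseteq> Suc ` \<tau>" by blast
    show "Suc ` \<tau> \<subseteq> insert 1 ?F" using t by (auto simp: numeral_2_eq_2)
    show "Suc ` \<tau> \<noteq> {}" using t by auto
  qed
  have fL: "cmap C (hcx n) (?fL l)" if "l \<in> L" for l
  proof (cases "l = l0")
    case True
    then show ?thesis using cmap_relabel[OF g2(1) mS SucX] by simp
  next
    case False
    then show ?thesis using f(1)[OF iR[OF that False]] by simp
  qed
  have bA: "map Suc l \<in> chains ?A" "map (dn 1) (map Suc l) = l" if "l \<in> chains (bcx n)" for l
  proof -
    have "Suc ` \<tau> \<in> ?A" if "\<tau> \<in> bcx n" for \<tau>
    proof -
      have "\<tau> \<subset> {1..Suc n}" "\<tau> \<noteq> {}" using that by (auto simp: bcx_def)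
      moreover have "Suc ` {1..Suc n} = ?F" by (simp add: numeral_2_eq_2)
      ultimately have "Suc ` \<tau> \<subset> ?F" using image_strict_mono[OF inj_on_subset[OF inj_Suc subset_UNIV], of \<tau> "{1..Suc n}"] by metis
      then show ?thesis using \<open>\<tau> \<noteq> {}\<close> unfolding faces_of_def by blast
    qed
    then show "map Suc l \<in> chains ?A" using chains_map[OF that mS] by blast
    show "map (dn 1) (map Suc l) = l" using that by (auto simp: chains_def bcx_def dn_def intro!: map_idI)
  qed
  have g2A: "g2 (map Suc l) = g l" if "l \<in> chains (bcx n)" for l
    using bA[OF that] g2(4)[of "map Suc l"] g1(2)[of "map Suc l"] by (simp add: chains_Un del: map_map)
  have c12: "[1,2] \<in> chains ?KA" by (auto simp: chains_def full_def)
  have gL: "?fL j [0,1] = d j" if "j \<in> L" for j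
  proof (cases "j = l0")
    case True
    have "g2 [1,2] = d l0" using g2(4)[OF c12] attach_top[OF C, of "{1,2}" "d l0" ?g0] d(1) by simp
    then show ?thesis using True by (simp add: numeral_2_eq_2)
  next
    case False
    then show ?thesis using f(2)[OF iR[OF that False]] e'[OF that] by simp
  qed
  have hL: "?fL j l = g l" if "j \<in> L" "l \<in> chains (bcx n)" for j l
    using f(3)[OF iR[OF that(1)] that(2)] g2A[OF that(2)] by simp
  obtain s t' where s: "s \<in> splx C n" "\<forall>l\<in>chains (bcx n). opr C n (map (\<lambda>i. i - 1) l) s = g l"
    and T1: "\<forall>j\<in>L. t' j \<in> splx C (Suc n)"
    and T2: "\<forall>j\<in>L. \<forall>l\<in>chains (hcx n). opr C (Suc n) l (t' j) = ?fL j l"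
    and T3: "\<forall>j\<in>L. opr C (Suc n) [1..<Suc (Suc n)] (t' j) = s"
    by (rule coprodD[OF c2 n g fL gL hL])
  note t' = bspec[OF T1] bspec[OF bspec[OF T2]] bspec[OF T3]
  let ?S1 = "{1..2 + n}"
  have S1: "?S1 = insert 1 ?F" by auto
  have cardS1: "card ?S1 - 1 = Suc n" by simp
  \<comment> \<open>The filler for \<open>l0\<close> is a cell over the whole base, while no earlier
    cell contains the base; so the two meet only in the data that the filler was made to
    extend.\<close>
  have f3eq: "opr C (card ?S1 - 1) (map (pos ?S1) l) (t' l0) = f2 j l"
    if j: "j \<in> J" and l: "l \<in> chains (?Y \<A>)" "set l \<subseteq> ?S1" for j l
  proof -
    have nF: "\<not> ?F \<subseteq> set l" using noF[of "set l"] l by (simp add: chains_def)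
    have lX: "l \<in> chains (?X \<A>)" using X1[of "set l"] l nF S1 by (simp add: chains_def)
    have p: "map (pos ?S1) l = map (\<lambda>i. i - 1) l" using l by (auto simp: pos_ivl)
    have Sl: "map Suc (map (pos ?S1) l) = l" unfolding p using l(2) by (auto intro!: map_idI)
    have "map (pos ?S1) l \<in> chains (hcx n)"
    proof -
      have "\<not> {1..Suc n} \<subseteq> set (map (pos ?S1) l)"
      proof
        assume "{1..Suc n} \<subseteq> set (map (pos ?S1) l)"
        then have "Suc ` {1..Suc n} \<subseteq> set (map Suc (map (pos ?S1) l))" by (metis image_mono set_map)
        moreover have "Suc ` {1..Suc n} = ?F" by (simp add: numeral_2_eq_2)
        ultimately show False using nF unfolding Sl by metis
      qed
      moreover have "map (pos ?S1) l \<in> splx (Delta (Suc n)) (length l - 1)"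
        using pos_Delta[of ?S1 l] l cardS1 by (auto simp: chains_def full_def)
      ultimately show ?thesis using l by (auto simp: chains_def hcx_def Delta_iff)
    qed
    then have "opr C (Suc n) (map (pos ?S1) l) (t' l0) = g2 l" using t'(2)[OF l0] Sl by (simp del: map_map)
    then show ?thesis using f2(3)[OF j lX] cardS1 by simp
  qed
  let ?f3 = "\<lambda>j. attach C ?S1 (t' l0) (f2 j)"
  have f3: "cmap C (?Y \<A> \<union> full ?S1) (?f3 j)" "\<And>l. l \<in> chains (?Y \<A>) ==> ?f3 j l = f2 j l" if j: "j \<in> J" for j
    using cmap_attach[OF C g2(3) f2(1)[OF j], of ?S1 "t' l0"] f3eq[OF j] t'(1)[OF l0] cardS1 by auto
  have s3: "subcomplex (?Y \<A> \<union> full ?S1)" by (intro subcomplex_Un g2(3) subcomplex_full) simp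
  let ?S = "{0..2 + n}"
  have SF: "?S = insert 0 (insert 1 ?F)" by auto
  let ?Z = "insert ?S (insert (?S - {1}) (?Y \<A> \<union> full ?S1))"
  have ex4: "\<forall>j\<in>J. \<exists>f4. cmap C ?Z f4 \<and> subcomplex ?Z \<and> (\<forall>l\<in>chains (?Y \<A> \<union> full ?S1). f4 l = ?f3 j l)"
  proof
    fix j assume j: "j \<in> J"
    show "\<exists>f4. cmap C ?Z f4 \<and> subcomplex ?Z \<and> (\<forall>l\<in>chains (?Y \<A> \<union> full ?S1). f4 l = ?f3 j l)"
  \<comment> \<open>The last cell is \<open>0..n+2\<close>. Besides the cell itself only its face
    opposite 1 is missing, and 1 is an inner vertex.\<close>
  proof (rule inner_pair[OF Q s3 f3(1)[OF j], where u = 0 and w = 2])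
    have "?F \<subseteq> ?S - {1}" by auto
    then have "?S - {1} \<notin> ?Y \<A>" using noF by metis
    moreover have "0 \<in> ?S - {1}" "0 \<notin> ?S1" by auto
    then have "?S - {1} \<notin> full ?S1" unfolding full_def by blast
    ultimately show "?S - {1} \<notin> ?Y \<A> \<union> full ?S1" by blast
    show "\<tau> \<in> ?Y \<A> \<union> full ?S1" if t: "\<tau> \<subset> ?S" "\<tau> \<noteq> {}" "\<tau> \<noteq> ?S - {1}" for \<tau>
    proof (cases "?F \<subseteq> \<tau>")
      case False
      then show ?thesis using Y1[of \<tau>] t SF by auto
    next
      case True
      have "0 \<notin> \<tau>"
      proof
        assume "0 \<in> \<tau>"
        then have "?S - {1} \<subseteq> \<tau>" using True unfolding SF by blast
        moreover have "1 \<in> ?S" by simp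
        ultimately show False using t by blast
      qed
      have "\<tau> \<subseteq> ?S1"
      proof
        fix v assume v: "v \<in> \<tau>"
        then have "v \<in> ?S" "v \<noteq> 0" using t(1) \<open>0 \<notin> \<tau>\<close> by (blast, metis)
        then show "v \<in> ?S1" by auto
      qed
      then show ?thesis using t unfolding full_def by blast
    qed
  qed (use n in auto)
  qed
  from bchoice[OF ex4] obtain f4 where
    f4': "\<forall>j\<in>J. cmap C ?Z (f4 j) \<and> subcomplex ?Z \<and> (\<forall>l\<in>chains (?Y \<A> \<union> full ?S1). f4 j l = ?f3 j l)"
    by (elim exE) (rule that)
  have f4: "\<And>j. j \<in> J ==> cmap C ?Z (f4 j)"
    "\<And>j l. j \<in> J ==> l \<in> chains (?Y \<A> \<union> full ?S1) ==> f4 j l = ?f3 j l"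
    using bspec[OF f4', THEN conjunct1] bspec[OF bspec[OF f4', THEN conjunct2, THEN conjunct2]] by blast+
  \<comment> \<open>The face opposite 1 of the last cell is the filler sought for the index
    \<open>j\<close>; its enumeration skips 1 and is given by \<open>up 1\<close>.\<close>
  let ?l = "0 # [2..<Suc (Suc (Suc n))]"
  have lc: "?l \<in> chains ?Z"
    by (auto simp: chains_def SF)
  have lnth: "?l ! i = up 1 i" if "i \<le> Suc n" for i
    using that by (cases i) (auto simp: up_def)
  have len: "length ?l - 1 = Suc n" by simp
  have ml: "map (nth ?l) l = map (up 1) l" if "set l \<subseteq> {..Suc n}" for l using that lnth by auto
  let ?T = "\<lambda>j. f4 j ?l"
  have T: "?T j \<in> splx C (Suc n)" if "j \<in> J" for j using cmapD(1)[OF f4(1)[OF that] lc] len by simp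
  have Tf: "opr C (Suc n) l (?T j) = f (Inl j) l" if j: "j \<in> J" and l: "l \<in> chains (hcx n)" for j l
  proof -
    have "opr C (Suc n) l (?T j) = f4 j (map (nth ?l) l)"
      using cmapD(2)[OF f4(1)[OF j] lc, of l "length l - 1"] hcx_Delta[OF l] len by simp
    also have "map (nth ?l) l = map (up 1) l" by (rule ml) (use l in \<open>auto simp: chains_def hcx_def\<close>)
    also have "f4 j (map (up 1) l) = ?f0 j (map (up 1) l)"
      using chains_map[OF l mono_up up_hcx] f4(2)[OF j, of "map (up 1) l"] f3(2)[OF j, of "map (up 1) l"] f2(2)[OF j, of "map (up 1) l"] f1(2)[OF j, of "map (up 1) l"]
      by (simp add: chains_Un)
    also have "\<dots> = f (Inl j) l" by (simp only: map_dn_up)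
    finally show ?thesis .
  qed
  have Ts: "opr C (Suc n) [1..<Suc (Suc n)] (?T j) = s" if j: "j \<in> J" for j
  proof -
    have c: "map Suc [1..<Suc (Suc n)] \<in> chains (full ?S1)"
      by (auto simp: chains_def full_def map_Suc_upt)
    have "opr C (Suc n) [1..<Suc (Suc n)] (?T j) = f4 j (map (nth ?l) [1..<Suc (Suc n)])"
      using cmapD(2)[OF f4(1)[OF j] lc, of "[1..<Suc (Suc n)]" n] d0_Delta[of n] unfolding len by metis
    also have "map (nth ?l) [1..<Suc (Suc n)] = map Suc [1..<Suc (Suc n)]"
      by (subst ml) (auto simp: up_def)
    also have "f4 j (map Suc [1..<Suc (Suc n)]) = ?f3 j (map Suc [1..<Suc (Suc n)])"
      using f4(2)[OF j] c by (simp add: chains_Un)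
    also have "\<dots> = opr C (Suc n) (map (pos ?S1) (map Suc [1..<Suc (Suc n)])) (t' l0)"
      using c cardS1 by (auto simp: attach_def chains_def full_def)
    also have "map (pos ?S1) (map Suc [1..<Suc (Suc n)]) = [1..<Suc (Suc n)]"
      by (auto simp: pos_ivl intro!: map_idI)
    also have "opr C (Suc n) [1..<Suc (Suc n)] (t' l0) = s" by (rule t'(3)[OF l0])
    finally show ?thesis .
  qed
  let ?t = "\<lambda>i. case i of Inl j => ?T j | Inr l => t' l"
  show ?case
  proof (rule exI[of _ s], rule exI[of _ ?t], intro conjI ballI)
    fix i assume i: "i \<in> J <+> (L - {l0})"
    from i consider j where "i = Inl j" "j \<in> J" | m where "i = Inr m" "m \<in> L" "m \<noteq> l0" by auto
    note ic = this
    show "?t i \<in> splx C (Suc n)" using i T t'(1) by auto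
    show "opr C (Suc n) [1..<Suc (Suc n)] (?t i) = s" using i Ts t'(3) by (auto)
    show "opr C (Suc n) l (?t i) = f i l" if "l \<in> chains (hcx n)" for l
      using Tf[OF _ that] t'(2)[OF _ that] by (cases rule: ic) simp_all
  qed (use s in auto)
qed

section \<open>Attaching cones of cells\<close>

lemma Un_eq_disjoint: "\<beta> \<inter> F = {} ==> \<phi> \<subseteq> F ==> \<psi> \<subseteq> F ==> \<beta> \<union> \<phi> = \<beta> \<union> \<psi> ==> \<phi> = \<psi>"
  by blast

text \<open>Attached in increasing order of \<phi>, each cell \<open>\<beta> \<union> \<phi>\<close>
  has its whole boundary present by \<open>cov\<close>, and the initial vertex \<open>u\<close> is
  its least vertex.\<close>

lemma initial_cone:
  assumes C: "is_sset C" and K: "subcomplex K" and f: "cmap C K f"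
    and F: "finite F" and A: "\<And>\<phi>. \<phi> \<in> \<A> ==> \<phi> \<subseteq> F" "{} \<notin> \<A>"
    and \<beta>: "finite \<beta>" "u \<in> \<beta>" "\<beta> \<inter> F = {}" and min: "\<And>v. v \<in> \<beta> \<union> F ==> u \<le> v"
    and u: "{u} \<in> K" "initial C (f [u])"
    and new: "\<And>\<phi>. \<phi> \<in> \<A> ==> \<beta> \<union> \<phi> \<notin> K"
    and cov: "\<And>\<phi> \<tau>. \<phi> \<in> \<A> ==> \<tau> \<subset> \<beta> \<union> \<phi> ==> \<tau> \<noteq> {} ==> \<tau> \<in> K \<or> (\<exists>\<psi>\<in>\<A>. \<psi> \<subset> \<phi> \<and> \<tau> = \<beta> \<union> \<psi>)"
  shows "\<exists>f'. cmap C (K \<union> (\<union>) \<beta> ` \<A>) f' \<and> subcomplex (K \<union> (\<union>) \<beta> ` \<A>) \<and> (\<forall>l\<in>chains K. f' l = f l)"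
proof -
  define X where "X \<B> = K \<union> (\<union>) \<beta> ` \<B>" for \<B>
  define P where "P \<B> \<longleftrightarrow> (\<exists>f'. cmap C (X \<B>) f' \<and> subcomplex (X \<B>) \<and> (\<forall>l\<in>chains K. f' l = f l))" for \<B>
  have "P \<A>"
  proof (rule downset_induct[where P = P])
    show "finite \<A>" by (rule finite_subset[of _ "Pow F"]) (use A F in blast)+
    show "finite \<phi>" if "\<phi> \<in> \<A>" for \<phi> using A(1)[OF that] F by (rule finite_subset)
    show "P {}" unfolding P_def X_def using K f by auto
  next
    fix \<B> \<phi>
    assume \<B>: "\<B> \<subseteq> \<A>" "\<phi> \<in> \<A>" "\<phi> \<notin> \<B>" and below: "\<And>\<psi>. \<psi> \<subset> \<phi> ==> \<psi> \<in> \<A> ==> \<psi> \<in> \<B>" and "P \<B>"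
    then obtain f' where f': "cmap C (X \<B>) f'" "subcomplex (X \<B>)" "\<forall>l\<in>chains K. f' l = f l"
      unfolding P_def by blast
    have \<phi>F: "\<phi> \<subseteq> F" using A \<B> by blast
    obtain w where w: "w \<in> \<phi>" using A(2) \<B>(2) by (metis ex_in_conv)
    have uw: "u \<noteq> w" "u \<le> w" using min[of w] w \<phi>F \<beta> by blast+
    have nin: "\<beta> \<union> \<phi> \<notin> X \<B>"
    proof
      assume "\<beta> \<union> \<phi> \<in> X \<B>"
      then obtain \<psi> where "\<psi> \<in> \<B>" "\<beta> \<union> \<phi> = \<beta> \<union> \<psi>" using new[OF \<B>(2)] unfolding X_def by blast
      then show False using Un_eq_disjoint[OF \<beta>(3) \<phi>F, of \<psi>] A(1)[of \<psi>] \<B> by blast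
    qed
    have "[u] \<in> chains K" using u by (simp add: chains_def)
    then have ini: "initial C (f' [u])" using f'(3) u(2) by simp
    have fin: "finite (\<beta> \<union> \<phi>)" using \<beta>(1) finite_subset[OF \<phi>F F] by blast
    have "\<exists>f''. cmap C (insert (\<beta> \<union> \<phi>) (X \<B>)) f'' \<and> subcomplex (insert (\<beta> \<union> \<phi>) (X \<B>)) \<and> (\<forall>l\<in>chains (X \<B>). f'' l = f' l)"
    proof (rule initial_cell[OF C f'(2,1) fin, of u w])
      show "v \<in> \<beta> \<union> \<phi> ==> u \<le> v" for v using min \<phi>F by blast
      show "\<tau> \<in> X \<B>" if "\<tau> \<subset> \<beta> \<union> \<phi>" "\<tau> \<noteq> {}" for \<tau>
        using cov[OF \<B>(2) that] below unfolding X_def by blast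
    qed (use \<beta> w uw nin ini in simp_all)
    moreover have "insert (\<beta> \<union> \<phi>) (X \<B>) = X (insert \<phi> \<B>)" unfolding X_def by blast
    moreover have "chains K \<subseteq> chains (X \<B>)" unfolding X_def by (rule chains_mono) blast
    ultimately show "P (insert \<phi> \<B>)" unfolding P_def using f'(3) by (metis subsetD)
  qed
  then show ?thesis unfolding P_def X_def .
qed

text \<open>Here \<open>v\<close> separates \<open>u\<close> from all of \<open>F\<close>, so each
  \<open>\<beta> \<union> \<phi>\<close> is filled as an inner horn together with its face opposite
  \<open>v\<close>. The condition \<open>new\<close> says that this face was not prescribed.\<close>

lemma inner_cone:
  assumes Q: "quasi_category C" and K: "subcomplex K" and f: "cmap C K f"
    and F: "finite F" and A: "\<And>\<phi>. \<phi> \<in> \<A> ==> \<phi> \<subseteq> F" "{} \<notin> \<A>"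
    and \<beta>: "finite \<beta>" "u \<in> \<beta>" "v \<in> \<beta>" "u < v" "\<beta> \<inter> F = {}" and vF: "\<And>w. w \<in> F ==> v < w"
    and new: "\<And>\<phi>. \<phi> \<in> \<A> ==> (\<beta> - {v}) \<union> \<phi> \<notin> K"
    and cov: "\<And>\<phi> \<tau>. \<phi> \<in> \<A> ==> \<tau> \<subset> \<beta> \<union> \<phi> ==> \<tau> \<noteq> {} ==> \<tau> \<noteq> (\<beta> - {v}) \<union> \<phi> ==>
      \<tau> \<in> K \<or> (\<exists>\<psi>\<in>\<A>. \<psi> \<subset> \<phi> \<and> (\<tau> = \<beta> \<union> \<psi> \<or> \<tau> = (\<beta> - {v}) \<union> \<psi>))"
  shows "\<exists>f'. cmap C (K \<union> (\<union>) \<beta> ` \<A> \<union> (\<union>) (\<beta> - {v}) ` \<A>) f' \<and>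
    subcomplex (K \<union> (\<union>) \<beta> ` \<A> \<union> (\<union>) (\<beta> - {v}) ` \<A>) \<and> (\<forall>l\<in>chains K. f' l = f l)"
proof -
  define X where "X \<B> = K \<union> (\<union>) \<beta> ` \<B> \<union> (\<union>) (\<beta> - {v}) ` \<B>" for \<B>
  define P where "P \<B> \<longleftrightarrow> (\<exists>f'. cmap C (X \<B>) f' \<and> subcomplex (X \<B>) \<and> (\<forall>l\<in>chains K. f' l = f l))" for \<B>
  have "P \<A>"
  proof (rule downset_induct[where P = P])
    show "finite \<A>" by (rule finite_subset[of _ "Pow F"]) (use A F in blast)+
    show "finite \<phi>" if "\<phi> \<in> \<A>" for \<phi> using A(1)[OF that] F by (rule finite_subset)
    show "P {}" unfolding P_def X_def using K f by auto
  next
    fix \<B> \<phi>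
    assume \<B>: "\<B> \<subseteq> \<A>" "\<phi> \<in> \<A>" "\<phi> \<notin> \<B>" and below: "\<And>\<psi>. \<psi> \<subset> \<phi> ==> \<psi> \<in> \<A> ==> \<psi> \<in> \<B>" and "P \<B>"
    then obtain f' where f': "cmap C (X \<B>) f'" "subcomplex (X \<B>)" "\<forall>l\<in>chains K. f' l = f l"
      unfolding P_def by blast
    have \<phi>F: "\<phi> \<subseteq> F" using A \<B> by blast
    obtain w where w: "w \<in> \<phi>" using A(2) \<B>(2) by (metis ex_in_conv)
    have vw: "v < w" using vF w \<phi>F by blast
    have v\<phi>: "v \<notin> \<phi>" using vF \<phi>F by blast
    have e: "(\<beta> \<union> \<phi>) - {v} = (\<beta> - {v}) \<union> \<phi>" using v\<phi> by blast
    have nin: "(\<beta> \<union> \<phi>) - {v} \<notin> X \<B>"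
    proof
      assume "(\<beta> \<union> \<phi>) - {v} \<in> X \<B>"
      then obtain \<psi> where \<psi>: "\<psi> \<in> \<B>" "(\<beta> - {v}) \<union> \<phi> = \<beta> \<union> \<psi> \<or> (\<beta> - {v}) \<union> \<phi> = (\<beta> - {v}) \<union> \<psi>"
        using new[OF \<B>(2)] unfolding X_def e by blast
      moreover have "v \<notin> (\<beta> - {v}) \<union> \<phi>" "v \<in> \<beta> \<union> \<psi>" using v\<phi> \<beta>(3) by blast+
      ultimately have "(\<beta> - {v}) \<union> \<phi> = (\<beta> - {v}) \<union> \<psi>" by metis
      moreover have "(\<beta> - {v}) \<inter> F = {}" using \<beta>(5) by blast
      moreover have "\<psi> \<subseteq> F" using \<psi>(1) \<B>(1) A(1) by blast
      ultimately have "\<phi> = \<psi>" using Un_eq_disjoint[OF _ \<phi>F] by blast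
      then show False using \<psi>(1) \<B>(3) by blast
    qed
    have fin: "finite (\<beta> \<union> \<phi>)" using \<beta>(1) finite_subset[OF \<phi>F F] by blast
    have "\<exists>f''. cmap C (insert (\<beta> \<union> \<phi>) (insert ((\<beta> \<union> \<phi>) - {v}) (X \<B>))) f'' \<and>
      subcomplex (insert (\<beta> \<union> \<phi>) (insert ((\<beta> \<union> \<phi>) - {v}) (X \<B>))) \<and> (\<forall>l\<in>chains (X \<B>). f'' l = f' l)"
    proof (rule inner_pair[OF Q f'(2,1) fin, of v u w])
      show "\<tau> \<in> X \<B>" if "\<tau> \<subset> \<beta> \<union> \<phi>" "\<tau> \<noteq> {}" "\<tau> \<noteq> (\<beta> \<union> \<phi>) - {v}" for \<tau>
        using cov[OF \<B>(2) that(1,2)] that(3) below unfolding X_def e by blast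
    qed (use \<beta> w vw nin in simp_all)
    moreover have "insert (\<beta> \<union> \<phi>) (insert ((\<beta> \<union> \<phi>) - {v}) (X \<B>)) = X (insert \<phi> \<B>)" unfolding X_def e by blast
    moreover have "chains K \<subseteq> chains (X \<B>)" unfolding X_def by (rule chains_mono) blast
    ultimately show "P (insert \<phi> \<B>)" unfolding P_def using f'(3) by (metis subsetD)
  qed
  then show ?thesis unfolding P_def X_def .
qed

section \<open>Changing the family of legs of a coproduct\<close>

lemma coprod_reindex:
  assumes c: "coprod C J x e" and \<phi>: "\<And>k. k \<in> K ==> \<phi> k \<in> J" "\<And>k. k \<in> K ==> \<psi> (\<phi> k) = k"
    and \<psi>: "\<And>j. j \<in> J ==> \<psi> j \<in> K" "\<And>j. j \<in> J ==> e' (\<psi> j) = e j"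
  shows "coprod C K x e'"
  unfolding coprod_def
proof (intro allI impI, elim conjE, goal_cases)
  case (1 n g f)
  have f: "\<And>j. j \<in> J ==> cmap C (hcx n) (f (\<psi> j))" "\<And>j. j \<in> J ==> f (\<psi> j) [0,1] = e j"
    "\<And>j l. j \<in> J ==> l \<in> chains (bcx n) ==> f (\<psi> j) l = g l"
    using 1(4) \<psi> by simp_all
  obtain s t where s: "s \<in> splx C n" "\<forall>l\<in>chains (bcx n). opr C n (map (\<lambda>i. i - 1) l) s = g l"
    "\<forall>j\<in>J. t j \<in> splx C (Suc n)" "\<forall>j\<in>J. \<forall>l\<in>chains (hcx n). opr C (Suc n) l (t j) = f (\<psi> j) l"
    "\<forall>j\<in>J. opr C (Suc n) [1..<Suc (Suc n)] (t j) = s"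
    by (rule coprodD[OF c 1(1-3) f])
  \<comment> \<open>Data are spread along \<psi>, fillers are selected along \<phi>.\<close>
  show ?case
    by (rule exI[of _ s], rule exI[of _ "t \<circ> \<phi>"]) (use s \<phi> in simp)
qed

lemma bcx_hcx: "bcx n \<subseteq> hcx n" by (auto simp: bcx_def hcx_def)

lemma chains_bcx_iff: "l \<in> chains (bcx n) \<longleftrightarrow> l \<in> chains (hcx n) \<and> 0 \<notin> set l"
proof -
  have "0 \<notin> \<tau>" if "\<tau> \<in> bcx n" for \<tau> using that by (auto simp: bcx_def)
  then show ?thesis using hcx_bcx[of "set l" n] bcx_hcx[of n] unfolding chains_def by blast
qed

lemma low_chains:
  assumes "0 < n"
  shows "[0] \<in> chains (hcx n)" "[0,1] \<in> chains (hcx n)" "[1] \<in> chains (bcx n)"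
proof -
  have "2 \<in> {1..Suc n}" "1 \<in> {1..Suc n}" "2 \<notin> {0,1::nat}" "{0,1} \<subseteq> {..Suc n}" using assms by auto
  then have "{0,1} \<in> hcx n" "{1} \<in> bcx n" unfolding hcx_def bcx_def by blast+
  moreover have "{0} \<in> hcx n" using subcomplexD(1)[OF subcomplex_hcx calculation(1), of "{0}"] by blast
  ultimately show "[0] \<in> chains (hcx n)" "[0,1] \<in> chains (hcx n)" "[1] \<in> chains (bcx n)"
    by (simp_all add: chains_def)
qed

text \<open>The old legs already determine the base \<open>s\<close>. For a new leg what remains is
  a sphere whose vertex 0 is initial, so it has a filler over that base.\<close>

lemma coprod_extend_initial:
  assumes C: "is_sset C" and c: "coprod C J' x e" and J: "J' \<subseteq> J"
    and ini: "\<And>j. j \<in> J - J' ==> initial C (opr C 1 [0] (e j))"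
  shows "coprod C J x e"
  unfolding coprod_def
proof (intro allI impI, elim conjE, goal_cases)
  case (1 n g f)
  have f: "\<And>j. j \<in> J ==> cmap C (hcx n) (f j)" "\<And>j. j \<in> J ==> f j [0,1] = e j"
    "\<And>j l. j \<in> J ==> l \<in> chains (bcx n) ==> f j l = g l"
    using 1(4) by simp_all
  obtain s t where s: "s \<in> splx C n" "\<forall>l\<in>chains (bcx n). opr C n (map (\<lambda>i. i - 1) l) s = g l"
    "\<forall>j\<in>J'. t j \<in> splx C (Suc n)" "\<forall>j\<in>J'. \<forall>l\<in>chains (hcx n). opr C (Suc n) l (t j) = f j l"
    "\<forall>j\<in>J'. opr C (Suc n) [1..<Suc (Suc n)] (t j) = s"
    by (rule coprodD[OF c 1(1-3) f]) (use J in blast)+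
  have "\<exists>t. t \<in> splx C (Suc n) \<and> (\<forall>l\<in>chains (hcx n). opr C (Suc n) l t = f j l) \<and>
      opr C (Suc n) [1..<Suc (Suc n)] t = s" if j: "j \<in> J" for j
  proof (cases "j \<in> J'")
    case True
    then show ?thesis using s by blast
  next
    case False
    let ?S1 = "{1..Suc n}" and ?S = "{0..Suc n}"
    \<comment> \<open>Attaching \<open>s\<close> completes the horn to the boundary of the simplex
      on \<open>0..n+1\<close>.\<close>
    let ?h = "attach C ?S1 s (f j)"
    have card1: "card ?S1 - 1 = n" by simp
    have eq: "opr C (card ?S1 - 1) (map (pos ?S1) l) s = f j l" if l: "l \<in> chains (hcx n)" "set l \<subseteq> ?S1" for l
    proof -
      have lb: "l \<in> chains (bcx n)" unfolding chains_bcx_iff using l by auto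
      have p: "map (pos ?S1) l = map (\<lambda>i. i - 1) l" using l(2) by (auto simp: pos_ivl)
      show ?thesis unfolding p card1 using s(2) f(3)[OF j lb] lb by simp
    qed
    have h: "cmap C (hcx n \<union> full ?S1) ?h" "\<And>l. l \<in> chains (hcx n) ==> ?h l = f j l"
      using cmap_attach[OF C subcomplex_hcx f(1)[OF j], of ?S1 s] eq s(1) card1 by auto
    have sc: "subcomplex (hcx n \<union> full ?S1)" by (intro subcomplex_Un subcomplex_hcx subcomplex_full) simp
    note c01 = low_chains[OF 1(1)]
    have f0: "f j [0] = opr C 1 [0] (e j)"
      using cmapD(2)[OF f(1)[OF j] c01(2), of "[0]" 0] f(2)[OF j] by (simp add: Delta_iff)
    have "\<exists>f'. cmap C (insert ?S (hcx n \<union> full ?S1)) f' \<and> subcomplex (insert ?S (hcx n \<union> full ?S1)) \<and>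
       (\<forall>l\<in>chains (hcx n \<union> full ?S1). f' l = ?h l)"
    proof (rule initial_cell[OF C sc h(1), where u = 0 and w = 1])
      show "initial C (?h [0])" using h(2)[OF c01(1)] f0 ini j False by simp
      show "?S \<notin> hcx n \<union> full ?S1"
      proof -
        have "?S1 \<subseteq> ?S" "0 \<in> ?S" "0 \<notin> ?S1" by auto
        then show ?thesis unfolding hcx_def full_def by blast
      qed
      show "\<tau> \<in> hcx n \<union> full ?S1" if t: "\<tau> \<subset> ?S" "\<tau> \<noteq> {}" for \<tau>
      proof (cases "?S1 \<subseteq> \<tau>")
        case True
        have S: "?S = insert 0 ?S1" by auto
        have "\<tau> \<subseteq> ?S1" using True t(1) unfolding S by blast
        then show ?thesis using t unfolding full_def by blast
      next
        case False
        have "\<tau> \<subseteq> {..Suc n}" using t by auto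
        then show ?thesis using t False unfolding hcx_def by blast
      qed
    qed auto
    then obtain h' where h': "cmap C (insert ?S (hcx n \<union> full ?S1)) h'"
      "\<forall>l\<in>chains (hcx n \<union> full ?S1). h' l = ?h l" by blast
    let ?l = "[0..<Suc (Suc n)]"
    have lc: "?l \<in> chains (insert ?S (hcx n \<union> full ?S1))" by (auto simp: chains_def)
    have len: "length ?l - 1 = Suc n" by simp
    have nl: "map (nth ?l) l = l" if "set l \<subseteq> {..Suc n}" for l
      using that by (auto intro!: map_idI)
    show ?thesis
    proof (rule exI[of _ "h' ?l"], intro conjI ballI)
      show "h' ?l \<in> splx C (Suc n)" using cmapD(1)[OF h'(1) lc] unfolding len .
      show "opr C (Suc n) l (h' ?l) = f j l" if l: "l \<in> chains (hcx n)" for l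
      proof -
        have "opr C (Suc n) l (h' ?l) = h' (map (nth ?l) l)"
          using cmapD(2)[OF h'(1) lc, of l] hcx_Delta[OF l] unfolding len by metis
        also have "map (nth ?l) l = l" by (rule nl) (use l in \<open>auto simp: chains_def hcx_def\<close>)
        also have "h' l = f j l" using h'(2) h(2)[OF l] l by (simp add: chains_Un)
        finally show ?thesis .
      qed
      have c: "[1..<Suc (Suc n)] \<in> chains (full ?S1)" by (auto simp: chains_def full_def)
      have "opr C (Suc n) [1..<Suc (Suc n)] (h' ?l) = h' (map (nth ?l) [1..<Suc (Suc n)])"
        using cmapD(2)[OF h'(1) lc, of "[1..<Suc (Suc n)]" n] d0_Delta[of n] unfolding len by metis
      also have "map (nth ?l) [1..<Suc (Suc n)] = [1..<Suc (Suc n)]" by (rule nl) auto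
      also have "h' \<dots> = ?h [1..<Suc (Suc n)]" using h'(2) c by (simp add: chains_Un)
      also have "\<dots> = ?h (sorted_list_of_set ?S1)"
        by (simp add: atLeastLessThanSuc_atLeastAtMost flip: sorted_list_of_set_range)
      also have "\<dots> = s" by (rule attach_top[OF C]) (use s(1) in auto)
      finally show "opr C (Suc n) [1..<Suc (Suc n)] (h' ?l) = s" .
    qed
  qed
  then have "\<forall>j\<in>J. \<exists>t. t \<in> splx C (Suc n) \<and> (\<forall>l\<in>chains (hcx n). opr C (Suc n) l t = f j l) \<and>
      opr C (Suc n) [1..<Suc (Suc n)] t = s" by blast
  from bchoice[OF this] show ?case using s(1,2) by blast
qed

text \<open>A cone over a sphere with initial vertex is filled from the edges to \<open>x\<close> upwards.\<close>

lemma coprod_initial: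
  assumes C: "is_sset C" and c: "coprod C J x e" and x: "x \<in> splx C 0"
    and e: "\<And>j. j \<in> J ==> e j \<in> splx C 1" "\<And>j. j \<in> J ==> opr C 1 [1] (e j) = x"
    and ini: "\<And>j. j \<in> J ==> initial C (opr C 1 [0] (e j))"
  shows "initial C x"
  unfolding initial_def
proof (intro conjI allI impI x, elim conjE)
  fix n b assume n: "0 < n" and b: "sset_map (boundary n) C b" "b 0 [0] = x"
  let ?p = "\<lambda>i. i - 1 :: nat"
  \<comment> \<open>The sphere \<open>b\<close> with its vertices raised by one, so that 0 is free
    for the source of a leg.\<close>
  define g where "g l = b (length l - 1) (map ?p l)" for l
  have pb: "map ?p l \<in> splx (boundary n) (length l - 1)" if l: "l \<in> chains (bcx n)" for l
  proof -
    have s: "set l \<subset> {1..Suc n}" "sorted l" "l \<noteq> []" using l by (auto simp: chains_def bcx_def)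
    then obtain v where v: "v \<in> {1..Suc n}" "v \<notin> set l" by blast
    have "?p v \<notin> set (map ?p l)"
    proof
      assume "?p v \<in> set (map ?p l)"
      then obtain w where w: "w \<in> set l" "?p v = ?p w" by auto
      have "w \<in> {1..Suc n}" using w s by blast
      then have "v = w" using v w(2) by auto
      then show False using v w by blast
    qed
    moreover have "?p v \<in> {..n}" using v by auto
    ultimately have ne: "set (map ?p l) \<noteq> {..n}" by blast
    have "?p i \<le> n" if "i \<in> set l" for i
    proof -
      have "i \<in> {1..Suc n}" using that s by blast
      then show ?thesis by auto
    qed
    moreover have "sorted (map ?p l)" using s(2) by (auto simp: sorted_iff_nth_mono diff_le_mono)
    ultimately show ?thesis using ne s(3) unfolding boundary_def sub_sset_def by (auto simp: Delta_iff)
  qed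
  have g: "cmap C (bcx n) g"
  proof (rule cmapI, goal_cases)
    case (1 l)
    then show ?case using b(1) pb[OF 1] by (simp add: g_def sset_map_def)
  next
    case (2 l m \<alpha>)
    have m: "map ?p (map (nth l) \<alpha>) = map (nth (map ?p l)) \<alpha>" and lm: "length \<alpha> - 1 = m"
      using Delta_len[OF 2(2)] chainsD(1)[OF 2(1)] 2(2) by (auto simp: Delta_iff)
    have "b m (opr (boundary n) (length l - 1) \<alpha> (map ?p l)) = opr C (length l - 1) \<alpha> (b (length l - 1) (map ?p l))"
      using b(1) pb[OF 2(1)] 2(2) unfolding sset_map_def by blast
    then show ?case using m lm by (simp add: g_def boundary_def sub_sset_def pnerve_def del: map_map)
  qed
  have g1: "g [1] = x" using b(2) by (simp add: g_def)
  have "\<exists>f. cmap C (hcx n) f \<and> f [0,1] = e j \<and> (\<forall>l\<in>chains (bcx n). f l = g l)" if j: "j \<in> J" for j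
  proof -
    let ?h = "attach C {0,1} (e j) g"
    let ?F = "{1..Suc n}"
    \<comment> \<open>The cone over \<open>{1}\<close> is the given edge \<open>e j\<close>; the
      cones over the other proper faces come from initiality of its source.\<close>
    define \<A> where "\<A> = {\<phi>. \<phi> \<subset> ?F \<and> \<phi> \<noteq> {} \<and> \<phi> \<noteq> {1}}"
    have n2: "2 \<in> ?F" "1 \<in> ?F" using n by auto
    have "{1} \<subset> ?F"
    proof -
      have "2 \<notin> {1::nat}" by simp
      then show ?thesis using n2 by blast
    qed
    then have b1: "{1} \<in> bcx n" by (simp add: bcx_def)
    have a: "\<rho> \<subseteq> {1}" if "\<rho> \<in> bcx n" "\<rho> \<subseteq> {0,1}" for \<rho>
    proof
      fix v assume "v \<in> \<rho>"
      then have "v \<in> {1..Suc n}" "v \<in> {0,1}" using that unfolding bcx_def by blast+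
      then show "v \<in> {1}" by auto
    qed
    have h: "cmap C (bcx n \<union> full {0,1}) ?h" "\<And>l. l \<in> chains (bcx n) ==> ?h l = g l"
      by (rule cmap_attach'[OF C subcomplex_bcx g, of "{0,1}" "e j" "{1}" "[1]"];
          use b1 a e[OF j] g1 in \<open>simp add: Delta_iff\<close>)+
    have sc: "subcomplex (bcx n \<union> full {0,1})" by (intro subcomplex_Un subcomplex_bcx subcomplex_full) simp
    have h0: "?h [0] = opr C 1 [0] (e j)"
      using attach_nth[of "{0,1}" "[0]" 0 "[0]" C "e j" g] by (simp add: Delta_iff)
    have Acases: "\<psi> = {} \<or> \<psi> = {1} \<or> \<psi> \<in> \<A>" if "\<psi> \<subset> ?F" for \<psi>
      using that unfolding \<A>_def by (cases "\<psi> = {}"; cases "\<psi> = {1}"; simp)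
    have cone: "\<exists>f'. cmap C ((bcx n \<union> full {0,1}) \<union> (\<union>) {0} ` \<A>) f' \<and> subcomplex ((bcx n \<union> full {0,1}) \<union> (\<union>) {0} ` \<A>) \<and>
       (\<forall>l\<in>chains (bcx n \<union> full {0,1}). f' l = ?h l)"
    proof (rule initial_cone[OF C sc h(1), where F = ?F and u = 0])
      show "initial C (?h [0])" using h0 ini j by simp
      show "{0} \<in> bcx n \<union> full {0,1}" by (simp add: full_def)
      fix \<phi> assume \<phi>: "\<phi> \<in> \<A>"
      then show \<phi>F: "\<phi> \<subseteq> ?F" unfolding \<A>_def by blast
      have F0: "0 \<notin> ?F" by simp
      show "{0} \<union> \<phi> \<notin> bcx n \<union> full {0,1}"
      proof
        assume "{0} \<union> \<phi> \<in> bcx n \<union> full {0,1}"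
        moreover have "{0} \<union> \<phi> \<notin> bcx n" using F0 unfolding bcx_def by blast
        ultimately have "\<phi> \<subseteq> {0,1}" unfolding full_def by blast
        then have "\<phi> \<subseteq> {1}" using \<phi>F F0 by blast
        then show False using \<phi> unfolding \<A>_def by blast
      qed
      fix \<tau> assume t: "\<tau> \<subset> {0} \<union> \<phi>" "\<tau> \<noteq> {}"
      have \<phi>s: "\<phi> \<subset> ?F" using \<phi> unfolding \<A>_def by blast
      show "\<tau> \<in> bcx n \<union> full {0,1} \<or> (\<exists>\<psi>\<in>\<A>. \<psi> \<subset> \<phi> \<and> \<tau> = {0} \<union> \<psi>)"
      proof (cases "0 \<in> \<tau>")
        case False
        then have "\<tau> \<subset> ?F" using t \<phi>s by blast
        then show ?thesis using t unfolding bcx_def by blast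
      next
        case True
        then have e: "\<tau> = {0} \<union> (\<tau> - {0})" "\<tau> - {0} \<subset> \<phi>" using t \<phi>F F0 by blast+
        from Acases[OF psubset_trans[OF e(2) \<phi>s]] show ?thesis
        proof (elim disjE)
          assume "\<tau> - {0} = {}" then show ?thesis using e(1) unfolding full_def by blast
        next
          assume "\<tau> - {0} = {1}" then show ?thesis using e(1) unfolding full_def by blast
        next
          assume "\<tau> - {0} \<in> \<A>" then show ?thesis using e by blast
        qed
      qed
    next
      show "v \<in> {0} \<union> ?F ==> 0 \<le> v" for v by simp
    qed (auto simp: \<A>_def)
    then obtain f where f: "cmap C ((bcx n \<union> full {0,1}) \<union> (\<union>) {0} ` \<A>) f" "\<forall>l\<in>chains (bcx n \<union> full {0,1}). f l = ?h l"
      by blast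
    have sub: "hcx n \<subseteq> (bcx n \<union> full {0,1}) \<union> (\<union>) {0} ` \<A>"
    proof
      fix \<tau> assume t: "\<tau> \<in> hcx n"
      show "\<tau> \<in> (bcx n \<union> full {0,1}) \<union> (\<union>) {0} ` \<A>"
      proof (cases "0 \<in> \<tau>")
        case False
        then show ?thesis using hcx_bcx[OF t] by blast
      next
        case True
        then have e: "\<tau> = {0} \<union> (\<tau> - {0})" by blast
        have "\<tau> - {0} \<subset> ?F"
        proof -
          have "v \<in> ?F" if "v \<in> \<tau>" "v \<noteq> 0" for v using that t by (auto simp: hcx_def)
          moreover have "\<not> ?F \<subseteq> \<tau>" using t by (simp add: hcx_def)
          ultimately show ?thesis by blast
        qed
        from Acases[OF this] show ?thesis
        proof (elim disjE)
          assume "\<tau> - {0} = {}" then show ?thesis using e(1) unfolding full_def by blast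
        next
          assume "\<tau> - {0} = {1}" then show ?thesis using e(1) unfolding full_def by blast
        next
          assume "\<tau> - {0} \<in> \<A>" then show ?thesis using e by blast
        qed
      qed
    qed
    have "cmap C (hcx n) f" by (rule cmap_mono[OF f(1) sub])
    moreover have "f [0,1] = e j"
    proof -
      have "[0,1] \<in> chains (full {0,1})" by (simp add: chains_def full_def)
      then have "f [0,1] = ?h [0,1]" using f(2) by (simp add: chains_Un)
      then show ?thesis using attach_top[OF C, of "{0,1}" "e j" g] e(1)[OF j] by simp
    qed
    moreover have "\<forall>l\<in>chains (bcx n). f l = g l" using f(2) h(2) by (simp add: chains_Un)
    ultimately show ?thesis by blast
  qed
  then have "\<forall>j\<in>J. \<exists>f. cmap C (hcx n) f \<and> f [0,1] = e j \<and> (\<forall>l\<in>chains (bcx n). f l = g l)" by blast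
  from bchoice[OF this] obtain f where f: "\<forall>j\<in>J. cmap C (hcx n) (f j) \<and> f j [0,1] = e j \<and> (\<forall>l\<in>chains (bcx n). f j l = g l)"
    by (elim exE) (rule that)
  have f': "\<And>j. j \<in> J ==> cmap C (hcx n) (f j)" "\<And>j. j \<in> J ==> f j [0,1] = e j"
    "\<And>j l. j \<in> J ==> l \<in> chains (bcx n) ==> f j l = g l" using f by blast+
  \<comment> \<open>The universal property is applied for the sake of the common base alone: this
    base fills the sphere.\<close>
  obtain s where s: "s \<in> splx C n" "\<forall>l\<in>chains (bcx n). opr C n (map ?p l) s = g l"
    by (rule coprodD[OF c n g g1 f'])
  show "\<exists>s\<in>splx C n. \<forall>m. \<forall>\<alpha>\<in>splx (boundary n) m. opr C n \<alpha> s = b m \<alpha>"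
  proof (rule bexI[OF _ s(1)], intro allI ballI)
    fix m \<alpha> assume a: "\<alpha> \<in> splx (boundary n) m"
    then have a': "length \<alpha> = Suc m" "set \<alpha> \<subseteq> {..n}" "sorted \<alpha>" "set \<alpha> \<noteq> {..n}"
      by (simp_all add: boundary_def sub_sset_def Delta_iff)
    have "Suc ` set \<alpha> \<subset> {1..Suc n}"
    proof -
      have "set \<alpha> \<subset> {..n}" using a' by blast
      then have "Suc ` set \<alpha> \<subset> Suc ` {..n}" by (rule image_strict_mono[OF inj_on_subset[OF inj_Suc subset_UNIV]])
      then show ?thesis by (simp add: image_Suc_atMost)
    qed
    then have "map Suc \<alpha> \<in> chains (bcx n)" using a' by (auto simp: chains_def bcx_def sorted_iff_nth_mono)
    then have "opr C n (map ?p (map Suc \<alpha>)) s = g (map Suc \<alpha>)" using s(2) by blast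
    moreover have "map ?p (map Suc \<alpha>) = \<alpha>" by (simp add: comp_def)
    ultimately show "opr C n \<alpha> s = b m \<alpha>" using a'(1) by (simp add: g_def del: map_map)
  qed
qed

section \<open>Replacing the sources of the legs by retracts\<close>

lemma cmap_attach_faces:
  assumes C: "is_sset C" and K: "subcomplex K" and f: "cmap C K f"
    and \<sigma>: "finite \<sigma>" and t: "t \<in> splx C (card \<sigma> - 1)"
    and T: "\<And>\<tau>. \<tau> \<in> T ==> \<tau> \<in> K \<and> \<tau> \<subseteq> \<sigma>" "\<And>\<rho>. \<rho> \<in> K ==> \<rho> \<subseteq> \<sigma> ==> \<exists>\<tau>\<in>T. \<rho> \<subseteq> \<tau>"
    and eq: "\<And>\<tau>. \<tau> \<in> T ==> opr C (card \<sigma> - 1) (map (pos \<sigma>) (sorted_list_of_set \<tau>)) t = f (sorted_list_of_set \<tau>)"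
  shows "cmap C (K \<union> full \<sigma>) (attach C \<sigma> t f)"
    and "\<And>l. l \<in> chains K ==> attach C \<sigma> t f l = f l"
proof -
  have "opr C (card \<sigma> - 1) (map (pos \<sigma>) l) t = f l" if l: "l \<in> chains K" "set l \<subseteq> \<sigma>" for l
  proof -
    obtain \<tau> where \<tau>: "\<tau> \<in> T" "set l \<subseteq> \<tau>" using T(2)[of "set l"] l by (auto simp: chains_def)
    have \<tau>': "\<tau> \<in> K" "\<tau> \<subseteq> \<sigma>" using T(1)[OF \<tau>(1)] by simp_all
    have ne: "\<tau> \<noteq> {}" "finite \<tau>" using subcomplexD[OF K \<tau>'(1)] by auto
    show ?thesis
    proof (rule cmap_eq_on_full[OF ne(2,1) _ cmap_full_sub[OF f K \<tau>'(1)]])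
      show "cmap C (full \<tau>) (\<lambda>l. opr C (card \<sigma> - 1) (map (pos \<sigma>) l) t)"
        by (rule cmap_mono[OF cmap_simplex[OF C \<sigma> t]]) (use \<tau>' in \<open>auto simp: full_def\<close>)
      show "opr C (card \<sigma> - 1) (map (pos \<sigma>) (sorted_list_of_set \<tau>)) t = f (sorted_list_of_set \<tau>)"
        by (rule eq[OF \<tau>(1)])
      show "l \<in> chains (full \<tau>)" using l \<tau> by (auto simp: chains_def full_def)
    qed
  qed
  then show "cmap C (K \<union> full \<sigma>) (attach C \<sigma> t f)"
    and "\<And>l. l \<in> chains K ==> attach C \<sigma> t f l = f l"
    using cmap_attach[OF C K f \<sigma> t] by blast+
qed

text \<open>The join of the full simplex on \<open>S\<close> with the boundary of the simplex on
  \<open>F\<close>. For \<open>F\<close> equal to \<open>1..n+1\<close>, the choice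
  \<open>S = {0}\<close> gives \<open>hcx n\<close> and \<open>S = {}\<close> gives
  \<open>bcx n\<close>.\<close>

definition cocx :: "nat set => nat set => nat set set" where
  "cocx S F = {\<tau>. \<tau> \<subseteq> S \<union> F \<and> \<tau> \<noteq> {} \<and> \<not> F \<subseteq> \<tau>}"

lemma subcomplex_cocx: "finite S ==> finite F ==> subcomplex (cocx S F)"
proof -
  assume "finite S" "finite F"
  then have "finite (S \<union> F)" by simp
  then show ?thesis unfolding subcomplex_def cocx_def by (auto dest: finite_subset)
qed

lemma cocxI: "\<tau> \<subseteq> S \<union> F ==> \<tau> \<noteq> {} ==> \<not> F \<subseteq> \<tau> ==> \<tau> \<in> cocx S F"
  by (simp add: cocx_def)

text \<open>
  Here \<open>0\<close> and \<open>2\<close> both stand for the retract \<open>s'\<close> of \<open>s\<close>, which is the vertex \<open>1\<close>. On the chains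
  avoiding \<open>1\<close> the map is degenerate along the edge from \<open>0\<close> to \<open>2\<close>.
\<close>

lemma retract_prepare:
  assumes Q: "quasi_category C" and n: "0 < n" and f: "cmap C (hcx n) f" and fe: "f [0,1] = e'"
    and r: "r \<in> splx C 2" "opr C 2 [0,1] r = v" "opr C 2 [1,2] r = e'" "opr C 2 [0,2] r = e"
    and t: "t \<in> splx C 2" "opr C 2 [1,2] t = v" "opr C 2 [0,2] t = opr C 1 [0,0] e'"
  shows "\<exists>h. cmap C (cocx {0,1,2} {3..3+n}) h \<and> h [1,3] = e \<and>
    (\<forall>l\<in>chains (cocx {0,2} {3..3+n}). h l = f (map (dn 2) l))"
proof -
  have C: "is_sset C" using Q by (simp add: quasi_category_def)
  define F where "F = {3..3+n}"
  have F34: "3 \<in> F" "4 \<in> F" using n by (auto simp: F_def)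
  have F012: "0 \<notin> F" "1 \<notin> F" "2 \<notin> F" by (auto simp: F_def)
  have finF: "finite F" by (simp add: F_def)
  let ?A = "cocx {0,2} F"
  let ?h0 = "\<lambda>l. f (map (dn 2) l)"
  have dnA: "dn 2 ` \<tau> \<in> hcx n" if "\<tau> \<in> ?A" for \<tau>
  proof -
    have e: "{0,2} \<union> F \<subseteq> {..Suc 2 + n}" "F = {Suc 2..Suc 2 + n}" by (auto simp: F_def)
    have "\<tau> \<subseteq> {..Suc 2 + n}" "\<tau> \<noteq> {}" "\<not> {Suc 2..Suc 2 + n} \<subseteq> \<tau>"
      using that e(1) unfolding cocx_def e(2)[symmetric] by blast+
    then show ?thesis by (rule dn_hcx)
  qed
  have sA: "subcomplex ?A" by (rule subcomplex_cocx) (use finF in auto)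
  have h0: "cmap C ?A ?h0" by (rule cmap_relabel[OF f mono_dn dnA])
  have f0: "f [0,0] = opr C 1 [0,0] e'"
    using cmapD(2)[OF f low_chains(2)[OF n], of "[0,0]" 1] fe by (simp add: Delta_iff)
  have noF: "\<not> F \<subseteq> {0,1,2,3}"
  proof -
    have "4 \<notin> {0,1,2,3::nat}" by simp
    then show ?thesis using F34 by blast
  qed
  have i23: "{2,3} \<in> ?A" "{0,2} \<in> ?A" by (rule cocxI; use F34 noF in blast)+
  have s13: "{1..3} = {1,2,3::nat}" "{0..2} = {0,1,2::nat}" by auto
  \<comment> \<open>\<open>r\<close> goes on the vertices 1, 2, 3: it presents \<open>e\<close> as
    \<open>e'\<close> after \<open>v\<close>.\<close>
  let ?h1 = "attach C {1..3} r ?h0"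
  have h1: "cmap C (?A \<union> full {1..3}) ?h1" "\<And>l. l \<in> chains ?A ==> ?h1 l = ?h0 l"
  proof -
    have a: "\<exists>\<tau>\<in>{{2,3}}. \<rho> \<subseteq> \<tau>" if "\<rho> \<in> ?A" "\<rho> \<subseteq> {1..3}" for \<rho>
    proof -
      have "v \<in> {2,3}" if "v \<in> \<rho>" for v
      proof -
        have "v \<in> {0,2} \<union> F" "v \<in> {1,2,3}" using that \<open>\<rho> \<in> ?A\<close> \<open>\<rho> \<subseteq> {1..3}\<close> unfolding cocx_def s13 by blast+
        then show ?thesis using F012 by auto
      qed
      then show ?thesis by blast
    qed
    have b: "\<tau> \<in> ?A \<and> \<tau> \<subseteq> {1..3}" if "\<tau> \<in> {{2,3}}" for \<tau> using that i23 by auto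
    have c: "opr C (card {1..3::nat} - 1) (map (pos {1..3}) (sorted_list_of_set \<tau>)) r = ?h0 (sorted_list_of_set \<tau>)"
      if "\<tau> \<in> {{2,3}}" for \<tau> using that r(3) fe by (simp add: pos_ivl dn_def)
    have d: "r \<in> splx C (card {1..3::nat} - 1)" using r(1) by simp
    show "cmap C (?A \<union> full {1..3}) ?h1" "\<And>l. l \<in> chains ?A ==> ?h1 l = ?h0 l"
      by (rule cmap_attach_faces[OF C sA h0 _ d b a c]; simp)+
  qed
  let ?B = "?A \<union> full {1..3}"
  have sB: "subcomplex ?B" by (intro subcomplex_Un sA subcomplex_full) simp
  have h1r: "?h1 [1,2] = v" "?h1 [1,3] = e"
    using r by (simp_all add: attach_def pos_ivl)
  \<comment> \<open>\<open>t\<close> goes on 0, 1, 2: its last edge is \<open>v\<close> and its long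
    edge is degenerate, so its first edge is a section of \<open>v\<close>.\<close>
  let ?h2 = "attach C {0..2} t ?h1"
  have h2: "cmap C (?B \<union> full {0..2}) ?h2" "\<And>l. l \<in> chains ?B ==> ?h2 l = ?h1 l"
  proof -
    have a: "\<exists>\<tau>\<in>{{0,2},{1,2}}. \<rho> \<subseteq> \<tau>" if "\<rho> \<in> ?B" "\<rho> \<subseteq> {0..2}" for \<rho>
    proof (cases "\<rho> \<in> ?A")
      case True
      have "v \<in> {0,2}" if "v \<in> \<rho>" for v
      proof -
        have "v \<in> {0,2} \<union> F" "v \<in> {0,1,2}" using that True \<open>\<rho> \<subseteq> {0..2}\<close> unfolding cocx_def s13 by blast+
        then show ?thesis using F012 by auto
      qed
      then show ?thesis by blast
    next
      case False
      then have "\<rho> \<subseteq> {1..3}" using that unfolding full_def by blast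
      then show ?thesis using that unfolding s13 by auto
    qed
    have b: "\<tau> \<in> ?B \<and> \<tau> \<subseteq> {0..2}" if "\<tau> \<in> {{0,2},{1,2}}" for \<tau> using that i23 by (auto simp: full_def)
    have z: "?h1 [0,2] = f [0,0]" using h1(2)[of "[0,2]"] i23(2) by (simp add: chains_def dn_def)
    have c: "opr C (card {0..2::nat} - 1) (map (pos {0..2}) (sorted_list_of_set \<tau>)) t = ?h1 (sorted_list_of_set \<tau>)"
      if "\<tau> \<in> {{0,2},{1,2}}" for \<tau> using that t(2,3) h1r(1) f0 z by (auto simp: pos_ivl)
    have d: "t \<in> splx C (card {0..2::nat} - 1)" using t(1) by simp
    show "cmap C (?B \<union> full {0..2}) ?h2" "\<And>l. l \<in> chains ?B ==> ?h2 l = ?h1 l"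
      by (rule cmap_attach_faces[OF C sB h1(1) _ d b a c]; simp)+
  qed
  define K3 where "K3 = ?B \<union> full {0..2}"
  have s3: "subcomplex K3" unfolding K3_def by (intro subcomplex_Un sA subcomplex_full) simp_all
  have inA: "\<tau> \<in> K3" if "1 \<notin> \<tau>" "\<tau> \<subseteq> {0,1,2} \<union> F" "\<not> F \<subseteq> \<tau>" "\<tau> \<noteq> {}" for \<tau>
    using that unfolding K3_def cocx_def by blast
  have in13: "\<tau> \<in> K3" if "\<tau> \<subseteq> {1,2,3}" "\<tau> \<noteq> {}" for \<tau>
    using that unfolding K3_def full_def s13 by blast
  have in02: "\<tau> \<in> K3" if "\<tau> \<subseteq> {0,1,2}" "\<tau> \<noteq> {}" for \<tau>
    using that unfolding K3_def full_def s13 by blast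
  have K3c: "\<tau> \<subseteq> {1,2,3} \<or> \<tau> \<subseteq> {0,1,2}" if t: "\<tau> \<in> K3" "1 \<in> \<tau>" for \<tau>
  proof -
    have "1 \<notin> {0,2} \<union> F" using F012 by auto
    then have "\<tau> \<notin> ?A" using t(2) unfolding cocx_def by blast
    then show ?thesis using t(1) unfolding K3_def full_def s13 by blast
  qed
  \<comment> \<open>Two rounds of inner horns at the vertex 2 follow. The first adds the vertex 1 to
    the cones with apex 2 over proper faces of \<open>F\<close>; its case \<open>{3}\<close> is
    \<open>r\<close>. The second adds 0 as well and has no such exception.\<close>
  define \<A> where "\<A> = {\<phi>. \<phi> \<subset> F \<and> \<phi> \<noteq> {} \<and> \<phi> \<noteq> {3}}"
  define \<A>' where "\<A>' = {\<phi>. \<phi> \<subset> F \<and> \<phi> \<noteq> {}}"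
  have Ac: "\<psi> = {} \<or> \<psi> = {3} \<or> \<psi> \<in> \<A>" if "\<psi> \<subset> F" for \<psi>
    using that unfolding \<A>_def by (cases "\<psi> = {}"; cases "\<psi> = {3}"; simp)
  have d12: "{1,2} - {2} = {1::nat}" "{0,1,2} - {2} = {0,1::nat}" by auto
  have "\<exists>h. cmap C (K3 \<union> (\<union>) {1,2} ` \<A> \<union> (\<union>) ({1,2} - {2}) ` \<A>) h \<and>
      subcomplex (K3 \<union> (\<union>) {1,2} ` \<A> \<union> (\<union>) ({1,2} - {2}) ` \<A>) \<and> (\<forall>l\<in>chains K3. h l = ?h2 l)"
  proof (rule inner_cone[OF Q s3 h2(1)[folded K3_def] finF, where u = 1 and v = 2])
    fix \<phi> assume \<phi>: "\<phi> \<in> \<A>"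
    then have \<phi>': "\<phi> \<subset> F" "\<phi> \<noteq> {}" "\<phi> \<noteq> {3}" by (simp_all add: \<A>_def)
    show "\<phi> \<subseteq> F" using \<phi>' by blast
    show "{1,2} - {2} \<union> \<phi> \<notin> K3"
    proof
      assume "{1,2} - {2} \<union> \<phi> \<in> K3"
      then have "{1} \<union> \<phi> \<subseteq> {1,2,3} \<or> {1} \<union> \<phi> \<subseteq> {0,1,2}" using K3c[of "{1} \<union> \<phi>"] unfolding d12 by blast
      then have "\<phi> \<subseteq> {3}" using \<phi>'(1) F012 by blast
      then show False using \<phi>' by blast
    qed
    fix \<tau> assume \<tau>: "\<tau> \<subset> {1,2} \<union> \<phi>" "\<tau> \<noteq> {}" "\<tau> \<noteq> {1,2} - {2} \<union> \<phi>"
    have \<tau>F: "\<not> F \<subseteq> \<tau>" using \<tau>(1) \<phi>'(1) F012 by blast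
    show "\<tau> \<in> K3 \<or> (\<exists>\<psi>\<in>\<A>. \<psi> \<subset> \<phi> \<and> (\<tau> = {1,2} \<union> \<psi> \<or> \<tau> = {1,2} - {2} \<union> \<psi>))"
    proof (cases "1 \<in> \<tau>")
      case False
      have "\<tau> \<subseteq> {0,1,2} \<union> F" using \<tau>(1) \<phi>'(1) by blast
      then show ?thesis using inA[OF False] \<tau>F \<tau>(2) by blast
    next
      case True
      let ?\<psi> = "\<tau> \<inter> \<phi>"
      have e: "\<tau> = {1,2} \<union> ?\<psi> \<or> \<tau> = {1} \<union> ?\<psi>" using True \<tau>(1) by blast
      have sub: "?\<psi> \<subset> \<phi>" using e \<tau>(1,3) unfolding d12 by blast
      from Ac[OF psubset_trans[OF sub \<phi>'(1)]] show ?thesis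
      proof (elim disjE)
        assume "?\<psi> = {}" then show ?thesis using in13[of \<tau>] e \<tau>(2) by blast
      next
        assume "?\<psi> = {3}" then show ?thesis using in13[of \<tau>] e \<tau>(2) by blast
      next
        assume "?\<psi> \<in> \<A>" then show ?thesis using e sub unfolding d12 by blast
      qed
    qed
  next
    show "{1,2} \<inter> F = {}" using F012 by blast
    show "w \<in> F ==> 2 < w" for w by (auto simp: F_def)
  qed (auto simp: \<A>_def)
  then obtain h3 where h3: "cmap C (K3 \<union> (\<union>) {1,2} ` \<A> \<union> (\<union>) {1} ` \<A>) h3"
    "subcomplex (K3 \<union> (\<union>) {1,2} ` \<A> \<union> (\<union>) {1} ` \<A>)" "\<forall>l\<in>chains K3. h3 l = ?h2 l"
    unfolding d12 by (elim exE conjE) (rule that)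
  define K4 where "K4 = K3 \<union> (\<union>) {1,2} ` \<A> \<union> (\<union>) {1} ` \<A>"
  have in4: "\<tau> \<in> K4" if t: "0 \<notin> \<tau> \<or> 1 \<notin> \<tau>" "\<tau> \<subseteq> {0,1,2} \<union> F" "\<not> F \<subseteq> \<tau>" "\<tau> \<noteq> {}" for \<tau>
  proof (cases "1 \<in> \<tau>")
    case False
    then show ?thesis using inA[OF False t(2-)] unfolding K4_def by blast
  next
    case True
    let ?\<psi> = "\<tau> \<inter> F"
    have e: "\<tau> = {1,2} \<union> ?\<psi> \<or> \<tau> = {1} \<union> ?\<psi>" using True t by blast
    have "?\<psi> \<subset> F" using t(3) by blast
    from Ac[OF this] show ?thesis
    proof (elim disjE)
      assume "?\<psi> = {}" then show ?thesis using in13[of \<tau>] e t(4) unfolding K4_def by blast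
    next
      assume "?\<psi> = {3}" then show ?thesis using in13[of \<tau>] e t(4) unfolding K4_def by blast
    next
      assume "?\<psi> \<in> \<A>" then show ?thesis using e unfolding K4_def by blast
    qed
  qed
  have K4c: "\<tau> \<subseteq> {0,1,2}" if t: "\<tau> \<in> K4" "0 \<in> \<tau>" "1 \<in> \<tau>" for \<tau>
  proof -
    have "\<tau> \<notin> (\<union>) {1,2} ` \<A>" "\<tau> \<notin> (\<union>) {1} ` \<A>" using t(2) F012 unfolding \<A>_def by auto
    then have "\<tau> \<in> K3" using t(1) unfolding K4_def by blast
    from K3c[OF this t(3)] show ?thesis using t(2) by auto
  qed
  have "\<exists>h. cmap C (K4 \<union> (\<union>) {0,1,2} ` \<A>' \<union> (\<union>) ({0,1,2} - {2}) ` \<A>') h \<and>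
      subcomplex (K4 \<union> (\<union>) {0,1,2} ` \<A>' \<union> (\<union>) ({0,1,2} - {2}) ` \<A>') \<and> (\<forall>l\<in>chains K4. h l = h3 l)"
  proof (rule inner_cone[OF Q h3(2,1)[folded K4_def] finF, where u = 0 and v = 2])
    fix \<phi> assume \<phi>: "\<phi> \<in> \<A>'"
    then have \<phi>': "\<phi> \<subset> F" "\<phi> \<noteq> {}" by (simp_all add: \<A>'_def)
    show "\<phi> \<subseteq> F" using \<phi>' by blast
    show "{0,1,2} - {2} \<union> \<phi> \<notin> K4"
    proof
      assume "{0,1,2} - {2} \<union> \<phi> \<in> K4"
      then have "{0,1} \<union> \<phi> \<subseteq> {0,1,2}" using K4c[of "{0,1} \<union> \<phi>"] unfolding d12 by blast
      then show False using \<phi>' F012 by blast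
    qed
    fix \<tau> assume \<tau>: "\<tau> \<subset> {0,1,2} \<union> \<phi>" "\<tau> \<noteq> {}" "\<tau> \<noteq> {0,1,2} - {2} \<union> \<phi>"
    have \<tau>F: "\<not> F \<subseteq> \<tau>" "\<tau> \<subseteq> {0,1,2} \<union> F" using \<tau>(1) \<phi>'(1) F012 by blast+
    show "\<tau> \<in> K4 \<or> (\<exists>\<psi>\<in>\<A>'. \<psi> \<subset> \<phi> \<and> (\<tau> = {0,1,2} \<union> \<psi> \<or> \<tau> = {0,1,2} - {2} \<union> \<psi>))"
    proof (cases "0 \<notin> \<tau> \<or> 1 \<notin> \<tau>")
      case True
      then show ?thesis using in4[OF True] \<tau>F \<tau>(2) by blast
    next
      case False
      let ?\<psi> = "\<tau> \<inter> \<phi>"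
      have e: "\<tau> = {0,1,2} \<union> ?\<psi> \<or> \<tau> = {0,1} \<union> ?\<psi>" using False \<tau>(1) by blast
      have sub: "?\<psi> \<subset> \<phi>" using e \<tau>(1,3) unfolding d12 by blast
      show ?thesis
      proof (cases "?\<psi> = {}")
        case True
        then have "\<tau> \<in> K3" using in02[of \<tau>] e \<tau>(2) by blast
        then show ?thesis unfolding K4_def by blast
      next
        case False
        then have "?\<psi> \<in> \<A>'" using sub \<phi>' unfolding \<A>'_def by blast
        then show ?thesis using e sub unfolding d12 by blast
      qed
    qed
  next
    show "{0,1,2} \<inter> F = {}" using F012 by blast
    show "w \<in> F ==> 2 < w" for w by (auto simp: F_def)
  qed (auto simp: \<A>'_def)
  then obtain h4 where h4: "cmap C (K4 \<union> (\<union>) {0,1,2} ` \<A>' \<union> (\<union>) {0,1} ` \<A>') h4"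
    "\<forall>l\<in>chains K4. h4 l = h3 l"
    unfolding d12 by (elim exE conjE) (rule that)
  have "cocx {0,1,2} F \<subseteq> K4 \<union> (\<union>) {0,1,2} ` \<A>' \<union> (\<union>) {0,1} ` \<A>'"
  proof
    fix \<tau> assume "\<tau> \<in> cocx {0,1,2} F"
    then have t: "\<tau> \<subseteq> {0,1,2} \<union> F" "\<not> F \<subseteq> \<tau>" "\<tau> \<noteq> {}" by (simp_all add: cocx_def)
    show "\<tau> \<in> K4 \<union> (\<union>) {0,1,2} ` \<A>' \<union> (\<union>) {0,1} ` \<A>'"
    proof (cases "0 \<notin> \<tau> \<or> 1 \<notin> \<tau>")
      case True
      then show ?thesis using in4[OF True t] by blast
    next
      case False
      let ?\<psi> = "\<tau> \<inter> F"
      have e: "\<tau> = {0,1,2} \<union> ?\<psi> \<or> \<tau> = {0,1} \<union> ?\<psi>" using False t(1) by blast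
      show ?thesis
      proof (cases "?\<psi> = {}")
        case True
        then have "\<tau> \<in> K3" using in02[of \<tau>] e t(3) by blast
        then show ?thesis unfolding K4_def by blast
      next
        case False
        then have "?\<psi> \<in> \<A>'" using t(2) unfolding \<A>'_def by blast
        then show ?thesis using e by blast
      qed
    qed
  qed
  then have "cmap C (cocx {0,1,2} F) h4" by (rule cmap_mono[OF h4(1)])
  moreover have c3: "l \<in> chains K4" "h4 l = ?h2 l" if "l \<in> chains K3" for l
  proof -
    show "l \<in> chains K4" using that unfolding K4_def chains_Un by blast
    then show "h4 l = ?h2 l" using h4(2) h3(3) that by simp
  qed
  moreover have "h4 [1,3] = e"
  proof -
    have a: "[1,3] \<in> chains ?B" by (auto simp: chains_def full_def)
    then have "[1,3] \<in> chains K3" unfolding K3_def chains_Un by blast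
    then show ?thesis using c3(2) h2(2)[OF a] h1r(2) by metis
  qed
  moreover have "h4 l = f (map (dn 2) l)" if l: "l \<in> chains ?A" for l
  proof -
    have a: "l \<in> chains ?B" "l \<in> chains K3" using l unfolding K3_def chains_Un by blast+
    then show ?thesis using c3(2)[OF a(2)] h2(2)[OF a(1)] h1(2)[OF l] by metis
  qed
  ultimately show ?thesis unfolding F_def by blast
qed

text \<open>\<open>e\<close> is \<open>e'\<close> after \<open>v\<close>, and \<open>v\<close> has a
  section. Cocone data for \<open>e'\<close> are precomposed with \<open>v\<close>, filled by the
  universal property for \<open>e\<close>, and restored along the section. The last operation is an
  inner horn at the vertex 1, whose missing face carries the filler for \<open>e'\<close>.\<close>

lemma coprod_retract:
  assumes Q: "quasi_category C" and c: "coprod C J x e"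
    and r: "\<And>j. j \<in> J ==> \<exists>r\<in>splx C 2. opr C 2 [0,1] r = v j \<and> opr C 2 [1,2] r = e' j \<and> opr C 2 [0,2] r = e j"
    and t: "\<And>j. j \<in> J ==> \<exists>t\<in>splx C 2. opr C 2 [1,2] t = v j \<and> opr C 2 [0,2] t = opr C 1 [0,0] (e' j)"
  shows "coprod C J x e'"
  unfolding coprod_def
proof (intro allI impI, elim conjE, goal_cases)
  case (1 n g f)
  have C: "is_sset C" using Q by (simp add: quasi_category_def)
  note n = 1(1)
  have f: "\<And>j. j \<in> J ==> cmap C (hcx n) (f j)" "\<And>j. j \<in> J ==> f j [0,1] = e' j"
    "\<And>j l. j \<in> J ==> l \<in> chains (bcx n) ==> f j l = g l"
    using 1(4) by simp_all
  let ?F = "{3..3+n}"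
  let ?K = "cocx {0,1,2} ?F" and ?A = "cocx {0,2} ?F"
  have F34: "3 \<in> ?F" "4 \<in> ?F" "0 \<notin> ?F" "1 \<notin> ?F" "2 \<notin> ?F" using n by auto
  have sK: "subcomplex ?K" "subcomplex ?A" by (rule subcomplex_cocx; simp)+
  have "\<exists>h. cmap C ?K h \<and> h [1,3] = e j \<and> (\<forall>l\<in>chains ?A. h l = f j (map (dn 2) l))" if j: "j \<in> J" for j
  proof -
    obtain r' where r': "r' \<in> splx C 2" "opr C 2 [0,1] r' = v j" "opr C 2 [1,2] r' = e' j" "opr C 2 [0,2] r' = e j"
      using r[OF j] by blast
    obtain t' where t': "t' \<in> splx C 2" "opr C 2 [1,2] t' = v j" "opr C 2 [0,2] t' = opr C 1 [0,0] (e' j)"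
      using t[OF j] by blast
    show ?thesis by (rule retract_prepare[OF Q n f(1,2)[OF j] r' t'])
  qed
  then have "\<forall>j\<in>J. \<exists>h. cmap C ?K h \<and> h [1,3] = e j \<and> (\<forall>l\<in>chains ?A. h l = f j (map (dn 2) l))" by blast
  from bchoice[OF this] obtain h where
    "\<forall>j\<in>J. cmap C ?K (h j) \<and> h j [1,3] = e j \<and> (\<forall>l\<in>chains ?A. h j l = f j (map (dn 2) l))" by (elim exE) (rule that)
  then have h: "\<And>j. j \<in> J ==> cmap C ?K (h j)" "\<And>j. j \<in> J ==> h j [1,3] = e j"
    "\<And>j l. j \<in> J ==> l \<in> chains ?A ==> h j l = f j (map (dn 2) l)" by blast+
  \<comment> \<open>Embeds \<open>0..n+1\<close> onto 1 and \<open>F\<close>, because the source of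
    \<open>e j\<close> sits at the vertex 1; \<open>dn 2\<close> is a left inverse.\<close>
  define \<psi> where "\<psi> i = (if i = 0 then 1 else i + 2)" for i :: nat
  have dn\<psi>: "dn 2 (\<psi> i) = i" for i by (auto simp: dn_def \<psi>_def)
  have mono\<psi>: "mono_on S \<psi>" for S by (auto simp: mono_on_def \<psi>_def)
  have \<psi>F: "F = \<psi> ` {1..Suc n}" if "F = ?F" for F
  proof -
    have "\<psi> ` {1..Suc n} = (\<lambda>i. i + 2) ` {1..Suc n}" by (auto simp: \<psi>_def intro!: image_cong)
    also have "\<dots> = ?F" by (subst image_add_atLeastAtMost') simp
    finally show ?thesis using that by simp
  qed
  have nosub: "\<not> ?F \<subseteq> \<psi> ` \<tau>" if "\<not> {1..Suc n} \<subseteq> \<tau>" for \<tau>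
  proof
    assume "?F \<subseteq> \<psi> ` \<tau>"
    then have "dn 2 ` \<psi> ` {1..Suc n} \<subseteq> dn 2 ` \<psi> ` \<tau>" using \<psi>F[OF refl] by blast
    then show False using that by (simp add: image_comp dn\<psi>)
  qed
  have \<psi>K: "\<psi> ` \<tau> \<in> ?K" if t: "\<tau> \<in> hcx n" for \<tau>
  proof (rule cocxI)
    show "\<not> ?F \<subseteq> \<psi> ` \<tau>" by (rule nosub) (use t in \<open>simp add: hcx_def\<close>)
    have "\<psi> i \<in> insert 1 ?F" if "i \<le> Suc n" for i using that by (auto simp: \<psi>_def)
    then show "\<psi> ` \<tau> \<subseteq> {0,1,2} \<union> ?F" using t unfolding hcx_def by blast
    show "\<psi> ` \<tau> \<noteq> {}" using t by (simp add: hcx_def)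
  qed
  have \<psi>A: "\<psi> ` \<tau> \<in> ?A" if t: "\<tau> \<in> bcx n" for \<tau>
  proof (rule cocxI)
    have t': "\<tau> \<subset> {1..Suc n}" "\<tau> \<noteq> {}" using t by (simp_all add: bcx_def)
    show "\<not> ?F \<subseteq> \<psi> ` \<tau>" by (rule nosub) (use t' in blast)
    show "\<psi> ` \<tau> \<subseteq> {0,2} \<union> ?F" using t'(1) \<psi>F[OF refl] by blast
    show "\<psi> ` \<tau> \<noteq> {}" using t' by simp
  qed
  have hf: "cmap C (hcx n) (\<lambda>l. h j (map \<psi> l))" if "j \<in> J" for j
    by (rule cmap_relabel[OF h(1)[OF that] mono\<psi> \<psi>K])
  have he: "h j (map \<psi> [0,1]) = e j" if "j \<in> J" for j
    using h(2)[OF that] by (simp add: \<psi>_def numeral_3_eq_3)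
  \<comment> \<open>On the boundary of \<open>F\<close> the prepared map is the pulled back datum,
    which does not depend on \<open>j\<close>.\<close>
  have hg: "h j (map \<psi> l) = g l" if "j \<in> J" "l \<in> chains (bcx n)" for j l
  proof -
    have "h j (map \<psi> l) = f j (map (dn 2) (map \<psi> l))"
      using h(3)[OF that(1) chains_map[OF that(2) mono\<psi> \<psi>A]] .
    also have "map (dn 2) (map \<psi> l) = l" by (simp add: comp_def dn\<psi>)
    finally show ?thesis using f(3)[OF that] by simp
  qed
  obtain s t where s: "s \<in> splx C n" "\<forall>l\<in>chains (bcx n). opr C n (map (\<lambda>i. i - 1) l) s = g l"
    "\<forall>j\<in>J. t j \<in> splx C (Suc n)" "\<forall>j\<in>J. \<forall>l\<in>chains (hcx n). opr C (Suc n) l (t j) = h j (map \<psi> l)"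
    "\<forall>j\<in>J. opr C (Suc n) [1..<Suc (Suc n)] (t j) = s"
    by (rule coprodD[OF c n 1(2,3) hf he hg])
  let ?\<sigma> = "insert 1 ?F"
  have card\<sigma>: "card ?\<sigma> - 1 = Suc n" using F34(4) by simp
  have pos\<sigma>: "pos ?\<sigma> v = dn 2 v" "\<psi> (pos ?\<sigma> v) = v" if "v \<in> ?\<sigma>" for v
  proof -
    show 1: "pos ?\<sigma> v = dn 2 v"
    proof (cases "v = 1")
      case True
      then show ?thesis by (auto simp: pos_def dn_def)
    next
      case False
      then have v: "v \<in> ?F" using that by simp
      then have "{w \<in> ?\<sigma>. w < v} = insert 1 {3..<v}" by auto
      then have "pos ?\<sigma> v = card (insert 1 {3..<v})" by (simp only: pos_def)
      also have "\<dots> = Suc (v - 3)" by (subst card_insert_disjoint) auto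
      also have "Suc (v - 3) = dn 2 v" unfolding dn_def using v by (auto split: nat_diff_split)
      finally show ?thesis .
    qed
    show "\<psi> (pos ?\<sigma> v) = v" unfolding 1 using that by (auto simp: \<psi>_def dn_def)
  qed
  have ex: "\<exists>T. T \<in> splx C (Suc n) \<and> (\<forall>l\<in>chains (hcx n). opr C (Suc n) l T = f j l) \<and>
      opr C (Suc n) [1..<Suc (Suc n)] T = s" if j: "j \<in> J" for j
  proof -
    let ?h1 = "attach C ?\<sigma> (t j) (h j)"
    have eq: "opr C (card ?\<sigma> - 1) (map (pos ?\<sigma>) l) (t j) = h j l" if l: "l \<in> chains ?K" "set l \<subseteq> ?\<sigma>" for l
    proof -
      have lf: "l \<in> chains (full ?\<sigma>)" using l by (auto simp: chains_def full_def)
      have \<psi>l: "map \<psi> (map (pos ?\<sigma>) l) = l" using l(2) pos\<sigma>(2) by (auto intro!: map_idI)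
      have d: "map (pos ?\<sigma>) l \<in> splx (Delta (Suc n)) (length l - 1)"
        using pos_Delta[OF _ lf] card\<sigma> by simp
      have "\<not> {1..Suc n} \<subseteq> set (map (pos ?\<sigma>) l)"
      proof
        assume "{1..Suc n} \<subseteq> set (map (pos ?\<sigma>) l)"
        then have "?F \<subseteq> set (map \<psi> (map (pos ?\<sigma>) l))" using \<psi>F[OF refl] unfolding set_map[of \<psi>] by blast
        then show False using l(1) unfolding \<psi>l by (simp add: chains_def cocx_def)
      qed
      then have "map (pos ?\<sigma>) l \<in> chains (hcx n)" using d l by (auto simp: chains_def hcx_def Delta_iff)
      then have "opr C (Suc n) (map (pos ?\<sigma>) l) (t j) = h j (map \<psi> (map (pos ?\<sigma>) l))" using s(4) j by blast
      then show ?thesis unfolding \<psi>l card\<sigma> .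
    qed
    have tj: "t j \<in> splx C (card ?\<sigma> - 1)" unfolding card\<sigma> using s(3) j by blast
    have h1: "cmap C (?K \<union> full ?\<sigma>) ?h1" "\<And>l. l \<in> chains ?K ==> ?h1 l = h j l"
      using cmap_attach[OF C sK(1) h(1)[OF j] _ tj eq] by simp_all
    have s1: "subcomplex (?K \<union> full ?\<sigma>)" by (intro subcomplex_Un sK(1) subcomplex_full) simp
    let ?S = "insert 0 ?\<sigma>"
    have S1: "?S - {1} = insert 0 ?F" using F34 by auto
    let ?Z = "insert ?S (insert (?S - {1}) (?K \<union> full ?\<sigma>))"
    have "\<exists>h'. cmap C ?Z h' \<and> subcomplex ?Z \<and> (\<forall>l\<in>chains (?K \<union> full ?\<sigma>). h' l = ?h1 l)"
    \<comment> \<open>On the vertices 0, 1 and \<open>F\<close>, the cell and its face opposite 1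
      are all that is missing.\<close>
    proof (rule inner_pair[OF Q s1 h1(1), where u = 0 and w = 3])
      show "?S - {1} \<notin> ?K \<union> full ?\<sigma>"
      proof -
        have "0 \<notin> ?\<sigma>" by simp
        then show ?thesis unfolding S1 cocx_def full_def by blast
      qed
      show "\<tau> \<in> ?K \<union> full ?\<sigma>" if t: "\<tau> \<subset> ?S" "\<tau> \<noteq> {}" "\<tau> \<noteq> ?S - {1}" for \<tau>
      proof (cases "?F \<subseteq> \<tau>")
        case False
        then have "\<tau> \<in> ?K" using t(1,2) by (intro cocxI) blast+
        then show ?thesis by blast
      next
        case True
        then have "\<tau> \<subseteq> ?\<sigma>" using t(1,3) unfolding S1 by blast
        then show ?thesis using t(2) unfolding full_def by blast
      qed
    qed (use F34 in simp_all)
    then obtain h' where h': "cmap C ?Z h'" "\<forall>l\<in>chains (?K \<union> full ?\<sigma>). h' l = ?h1 l" by blast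
    \<comment> \<open>The enumeration of 0 and \<open>F\<close> avoids 1, so it names the face just
      filled; it is given by \<open>up 2\<close>.\<close>
    let ?l = "0 # [3..<4+n]"
    have setl: "set ?l = insert 0 ?F" by auto
    have lc: "?l \<in> chains ?Z" unfolding chains_def using setl S1 by simp
    have len: "length ?l - 1 = Suc n" by simp
    have lnth: "?l ! i = up 2 i" if "i \<le> Suc n" for i
      using that by (cases i) (auto simp: up_def)
    have ml: "map (nth ?l) l = map (up 2) l" if "set l \<subseteq> {..Suc n}" for l using that lnth by auto
    show ?thesis
    proof (rule exI[of _ "h' ?l"], intro conjI ballI)
      show "h' ?l \<in> splx C (Suc n)" using cmapD(1)[OF h'(1) lc] unfolding len .
      show "opr C (Suc n) l (h' ?l) = f j l" if l: "l \<in> chains (hcx n)" for l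
      proof -
        have "opr C (Suc n) l (h' ?l) = h' (map (nth ?l) l)"
          using cmapD(2)[OF h'(1) lc, of l] hcx_Delta[OF l] unfolding len by metis
        also have "map (nth ?l) l = map (up 2) l" by (rule ml) (use l in \<open>auto simp: chains_def hcx_def\<close>)
        also have "h' (map (up 2) l) = f j l"
        proof -
          have up: "up 2 ` \<tau> \<in> ?A" if "\<tau> \<in> hcx n" for \<tau>
          proof -
            have e: "{Suc 2..Suc 2 + n} = ?F" by simp
            have "up 2 ` \<tau> \<subseteq> insert 0 ?F \<and> up 2 ` \<tau> \<noteq> {} \<and> \<not> ?F \<subseteq> up 2 ` \<tau>"
              using up_hcx[OF that, of 2] unfolding upperc_def mem_Collect_eq e .
            moreover have "X \<subseteq> insert 0 F ==> X \<subseteq> {0,2} \<union> F" for X F :: "nat set" by blast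
            ultimately show ?thesis by (elim conjE) (rule cocxI)
          qed
          have u: "map (up 2) l \<in> chains ?A" by (rule chains_map[OF l mono_up up])
          have "?A \<subseteq> ?K" unfolding cocx_def by blast
          then have uK: "map (up 2) l \<in> chains ?K" using u chains_mono by blast
          have "h' (map (up 2) l) = h j (map (up 2) l)" using h'(2) h1(2)[OF uK] uK unfolding chains_Un by simp
          also have "\<dots> = f j (map (dn 2) (map (up 2) l))" by (rule h(3)[OF j u])
          finally show ?thesis by (simp only: map_dn_up)
        qed
        finally show ?thesis .
      qed
      have d: "map (up 2) [1..<Suc (Suc n)] = [3..<4+n]"
        by (rule nth_equalityI) (auto simp: up_def)
      have c: "[3..<4+n] \<in> chains (full ?\<sigma>)" by (auto simp: chains_def full_def)
      have "opr C (Suc n) [1..<Suc (Suc n)] (h' ?l) = h' (map (nth ?l) [1..<Suc (Suc n)])"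
        using cmapD(2)[OF h'(1) lc, of "[1..<Suc (Suc n)]" n] d0_Delta[of n] unfolding len by metis
      also have "map (nth ?l) [1..<Suc (Suc n)] = [3..<4+n]" by (rule trans[OF ml d]) auto
      also have "h' \<dots> = ?h1 [3..<4+n]" using h'(2) c unfolding chains_Un by blast
      also have "\<dots> = opr C (Suc n) (map (pos ?\<sigma>) [3..<4+n]) (t j)"
        unfolding attach_def card\<sigma> using c by (simp add: chains_def full_def)
      also have "map (pos ?\<sigma>) [3..<4+n] = [1..<Suc (Suc n)]"
      proof -
        have "map (pos ?\<sigma>) [3..<4+n] = map (dn 2) [3..<4+n]" using pos\<sigma>(1) by auto
        also have "\<dots> = map (dn 2) (map (up 2) [1..<Suc (Suc n)])" unfolding d ..
        finally show ?thesis by (simp only: map_dn_up)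
      qed
      also have "opr C (Suc n) [1..<Suc (Suc n)] (t j) = s" using s(5) j by blast
      finally show "opr C (Suc n) [1..<Suc (Suc n)] (h' ?l) = s" .
    qed
  qed
  then have "\<forall>j\<in>J. \<exists>T. T \<in> splx C (Suc n) \<and> (\<forall>l\<in>chains (hcx n). opr C (Suc n) l T = f j l) \<and>
      opr C (Suc n) [1..<Suc (Suc n)] T = s" by blast
  from bchoice[OF this] show ?case using s(1,2) by blast
qed

section \<open>Simplicial maps out of joins\<close>

text \<open>Cuts out the join of \<open>K\<close> with the boundary of the simplex. The simplices of
  \<open>K\<close> alone always belong to it.\<close>

definition join_part :: "nat => ('k, nat list) join => bool" where
  "join_part n z = (case z of JLeft x => True | JRight y => set y \<noteq> {..n} | JMix i x y => set y \<noteq> {..n})"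

lemma splx_sjoin:
  "JLeft x \<in> splx (sjoin K L) n \<longleftrightarrow> x \<in> splx K n"
  "JRight y \<in> splx (sjoin K L) n \<longleftrightarrow> y \<in> splx L n"
  "JMix i x y \<in> splx (sjoin K L) n \<longleftrightarrow> i < n \<and> x \<in> splx K i \<and> y \<in> splx L (n - Suc i)"
  by (auto simp: sjoin_def)

lemma opr_sjoin: "opr (sjoin K L) = join_opr K L"
  by (simp add: sjoin_def)

lemma sorted_filter_split:
  assumes "sorted (\<alpha> :: nat list)"
  shows "\<alpha> = filter (\<lambda>t. t \<le> i) \<alpha> @ filter (\<lambda>t. i < t) \<alpha>"
  using assms
proof (induction \<alpha>)
  case (Cons a \<alpha>)
  then show ?case
  proof (cases "a \<le> i")
    case False
    then have "\<forall>t\<in>set \<alpha>. i < t" using Cons.prems by auto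
    then have "filter (\<lambda>t. t \<le> i) \<alpha> = []" "filter (\<lambda>t. i < t) \<alpha> = \<alpha>"
      by (auto simp: filter_empty_conv intro!: filter_True)
    then show ?thesis using False by simp
  qed auto
qed simp

text \<open>Monotonicity puts the values up to \<open>i\<close> before the others, so an operator on
  a mixed simplex splits into one for each factor. An empty part means that the resulting face lies
  in the other factor.\<close>

lemma split_Delta:
  assumes \<alpha>: "\<alpha> \<in> splx (Delta n) m" and i: "i < n"
  defines "\<beta> \<equiv> filter (\<lambda>t. t \<le> i) \<alpha>" and "\<gamma> \<equiv> map (\<lambda>t. t - Suc i) (filter (\<lambda>t. i < t) \<alpha>)"
  shows "\<beta> \<noteq> [] ==> \<beta> \<in> splx (Delta i) (length \<beta> - 1)"
    "\<gamma> \<noteq> [] ==> \<gamma> \<in> splx (Delta (n - Suc i)) (length \<gamma> - 1)"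
    "length \<beta> + length \<gamma> = Suc m" "\<alpha> = \<beta> @ map (\<lambda>t. t + Suc i) \<gamma>"
proof -
  have a: "length \<alpha> = Suc m" "set \<alpha> \<subseteq> {..n}" "sorted \<alpha>" using \<alpha> by (auto simp: Delta_iff)
  show "\<beta> \<noteq> [] ==> \<beta> \<in> splx (Delta i) (length \<beta> - 1)"
    using a by (auto simp: Delta_iff \<beta>_def sorted_filter[of id, simplified])
  have "sorted (filter (\<lambda>t. i < t) \<alpha>)" using a(3) sorted_filter[of id \<alpha>] by simp
  then have "sorted \<gamma>" unfolding \<gamma>_def by (auto simp: sorted_iff_nth_mono diff_le_mono)
  then show "\<gamma> \<noteq> [] ==> \<gamma> \<in> splx (Delta (n - Suc i)) (length \<gamma> - 1)"
    using a i by (auto simp: Delta_iff \<gamma>_def)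
  have "map (\<lambda>t. t + Suc i) \<gamma> = filter (\<lambda>t. i < t) \<alpha>"
    unfolding \<gamma>_def by (auto intro!: map_idI)
  then show e: "\<alpha> = \<beta> @ map (\<lambda>t. t + Suc i) \<gamma>" using sorted_filter_split[OF a(3), of i] by (simp add: \<beta>_def)
  show "length \<beta> + length \<gamma> = Suc m" using arg_cong[OF e, of length] a(1) by simp
qed

lemma join_opr_JMix:
  assumes "\<beta> = filter (\<lambda>t. t \<le> i) \<alpha>" "\<gamma> = map (\<lambda>t. t - Suc i) (filter (\<lambda>t. i < t) \<alpha>)"
  shows "join_opr K L n \<alpha> (JMix i x y) =
    (if \<gamma> = [] then JLeft (opr K i \<beta> x) else if \<beta> = [] then JRight (opr L (n - Suc i) \<gamma> y)
     else JMix (length \<beta> - 1) (opr K i \<beta> x) (opr L (n - Suc i) \<gamma> y))"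
  unfolding assms by (simp add: Let_def)

declare join_opr.simps(3) [simp del]

lemma join_opr_in:
  assumes K: "is_sset K" and L: "is_sset L" and z: "z \<in> splx (sjoin K L) n" and \<alpha>: "\<alpha> \<in> splx (Delta n) m"
  shows "join_opr K L n \<alpha> z \<in> splx (sjoin K L) m"
proof (cases z)
  case (JMix i x y)
  then have i: "i < n" "x \<in> splx K i" "y \<in> splx L (n - Suc i)" using z by (simp_all add: splx_sjoin)
  define \<beta> where "\<beta> = filter (\<lambda>t. t \<le> i) \<alpha>"
  define \<gamma> where "\<gamma> = map (\<lambda>t. t - Suc i) (filter (\<lambda>t. i < t) \<alpha>)"
  note s = split_Delta[OF \<alpha> i(1), folded \<beta>_def \<gamma>_def]
  note e = join_opr_JMix[OF \<beta>_def \<gamma>_def]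
  consider "\<gamma> = []" | "\<beta> = []" "\<gamma> \<noteq> []" | "\<beta> \<noteq> []" "\<gamma> \<noteq> []" by blast
  then show ?thesis
  proof cases
    case 1
    then have b: "length \<beta> = Suc m" using s(3) by simp
    then have "\<beta> \<in> splx (Delta i) m" using s(1) by fastforce
    then show ?thesis using 1 JMix is_ssetD(2)[OF K i(2)] by (simp add: splx_sjoin e)
  next
    case 2
    then have "length \<gamma> = Suc m" using s(3) by simp
    then have "\<gamma> \<in> splx (Delta (n - Suc i)) m" using s(2) 2 by fastforce
    then show ?thesis using 2 JMix is_ssetD(2)[OF L i(3)] by (simp add: splx_sjoin e)
  next
    case 3
    have "length \<beta> \<noteq> 0" "length \<gamma> \<noteq> 0" using 3 by simp_all
    then have "length \<beta> - 1 < m" "m - Suc (length \<beta> - 1) = length \<gamma> - 1" using s(3) by linarith+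
    moreover have "opr K i \<beta> x \<in> splx K (length \<beta> - 1)" using is_ssetD(2)[OF K i(2) s(1)] 3 by blast
    moreover have "opr L (n - Suc i) \<gamma> y \<in> splx L (length \<gamma> - 1)" using is_ssetD(2)[OF L i(3) s(2)] 3 by blast
    ultimately show ?thesis using 3 JMix by (simp add: splx_sjoin e)
  qed
qed (use assms in \<open>auto simp: splx_sjoin dest: is_ssetD\<close>)

declare atMost_0 [simp del]

section \<open>Nerves of posets and the functoriality of joins\<close>

lemma splx_pnerve: "l \<in> splx (pnerve P po) n \<longleftrightarrow> length l = Suc n \<and> set l \<subseteq> P \<and> sorted_wrt po l"
  by (simp add: pnerve_def)

lemma opr_pnerve: "opr (pnerve P po) n \<alpha> l = map (nth l) \<alpha>"
  by (simp add: pnerve_def)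

text \<open>Chains are related pairwise and not just consecutively, so faces are again chains;
  reflexivity accounts for the repetitions in degeneracies.\<close>

lemma is_sset_pnerve:
  assumes "reflp_on P po"
  shows "is_sset (pnerve P po)"
  unfolding is_sset_def
proof (intro allI ballI conjI)
  fix n l assume l: "l \<in> splx (pnerve P po) n"
  then have l': "length l = Suc n" "set l \<subseteq> P" "sorted_wrt po l" by (simp_all add: splx_pnerve)
  show "opr (pnerve P po) n [0..<Suc n] l = l" using l'(1) map_nth[of l] by (simp add: opr_pnerve)
  fix m \<alpha> assume a: "\<alpha> \<in> splx (Delta n) m"
  have i: "\<forall>i\<in>set \<alpha>. i < length l" using a l'(1) by (auto simp: Delta_iff)
  have "po (l ! (\<alpha> ! r)) (l ! (\<alpha> ! s))" if rs: "r < s" "s < length \<alpha>" for r s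
  proof (cases "\<alpha> ! r = \<alpha> ! s")
    case True
    have "l ! (\<alpha> ! s) \<in> P" using i rs l'(2) by (metis nth_mem subsetD)
    then show ?thesis using assms True by (auto simp: reflp_on_def)
  next
    case False
    have "\<alpha> ! r \<le> \<alpha> ! s" using a rs by (simp add: Delta_iff sorted_iff_nth_mono)
    then have "\<alpha> ! r < \<alpha> ! s" using False by simp
    then show ?thesis using l'(3) i rs by (auto simp: sorted_wrt_iff_nth_less)
  qed
  then have "sorted_wrt po (map (nth l) \<alpha>)" by (auto simp: sorted_wrt_iff_nth_less)
  then show "opr (pnerve P po) n \<alpha> l \<in> splx (pnerve P po) m"
    using a l'(2) set_map_nth_subset[OF i] by (simp add: splx_pnerve opr_pnerve Delta_iff)
  fix k \<beta> assume "\<beta> \<in> splx (Delta m) k"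
  then show "opr (pnerve P po) m \<beta> (opr (pnerve P po) n \<alpha> l) = opr (pnerve P po) n (map (nth \<alpha>) \<beta>) l"
    using a by (auto simp: opr_pnerve Delta_iff)
qed

lemma is_sset_Delta: "is_sset (Delta n)"
  by (rule is_sset_pnerve) (simp add: reflp_on_def)

lemma is_sset_discrete: "is_sset (discrete J)"
  by (simp add: is_sset_def discrete_def)

abbreviation jmap :: "nat list => ('k, nat list) join => ('k, nat list) join" where
  "jmap \<alpha> \<equiv> map_join id (map (nth \<alpha>))"

lemma Delta_comp:
  assumes "\<alpha> \<in> splx (Delta n) m" "y \<in> splx (Delta m) k"
  shows "map (nth \<alpha>) y \<in> splx (Delta n) k" "set (map (nth \<alpha>) y) \<subseteq> set \<alpha>"
proof -
  have i: "\<forall>i\<in>set y. i < length \<alpha>" using assms by (auto simp: Delta_iff)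
  show "set (map (nth \<alpha>) y) \<subseteq> set \<alpha>" by (rule set_map_nth_subset[OF i])
  show "map (nth \<alpha>) y \<in> splx (Delta n) k"
    using is_ssetD(2)[OF is_sset_Delta assms] by (simp add: opr_pnerve)
qed

lemma jmap_in:
  assumes "\<alpha> \<in> splx (Delta n) m" "z \<in> splx (sjoin K (Delta m)) k"
  shows "jmap \<alpha> z \<in> splx (sjoin K (Delta n)) k"
  using assms Delta_comp[OF assms(1)] by (cases z) (auto simp: splx_sjoin)

lemma jmap_part:
  assumes "\<alpha> \<in> splx (Delta n) m" "set \<alpha> \<noteq> {..n}" "z \<in> splx (sjoin K (Delta m)) k"
  shows "join_part n (jmap \<alpha> z)"
proof -
  have "set \<alpha> \<subset> {..n}" using assms by (auto simp: Delta_iff)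
  then have "set (map (nth \<alpha>) y) \<noteq> {..n}" if "y \<in> splx (Delta m) k" for y k
    using Delta_comp(2)[OF assms(1) that] by blast
  then show ?thesis using assms(3) by (cases z) (auto simp: splx_sjoin join_part_def)
qed

lemma jmap_comp:
  assumes "\<alpha> \<in> splx (Delta n) m" "\<gamma> \<in> splx (Delta m) k" "z \<in> splx (sjoin K (Delta k)) i"
  shows "jmap \<alpha> (jmap \<gamma> z) = jmap (map (nth \<alpha>) \<gamma>) z"
proof -
  have "map (nth \<alpha>) (map (nth \<gamma>) y) = map (nth (map (nth \<alpha>) \<gamma>)) y" if "y \<in> splx (Delta k) r" for y r
    using assms(2) that by (auto simp: Delta_iff)
  then show ?thesis using assms(3) by (cases z) (auto simp: splx_sjoin simp del: map_map)
qed

text \<open>Operators of the join act on positions and \<open>jmap\<close> acts on the vertices of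
  the second factor, so the two commute.\<close>

lemma jmap_opr:
  assumes \<alpha>: "\<alpha> \<in> splx (Delta n) m" and z: "z \<in> splx (sjoin K (Delta m)) k" and \<gamma>: "\<gamma> \<in> splx (Delta k) r"
  shows "join_opr K (Delta n) k \<gamma> (jmap \<alpha> z) = jmap \<alpha> (join_opr K (Delta m) k \<gamma> z)"
proof (cases z)
  case (JMix i x y)
  then have i: "i < k" "y \<in> splx (Delta m) (k - Suc i)" using z by (simp_all add: splx_sjoin)
  define \<beta>' where "\<beta>' = filter (\<lambda>t. t \<le> i) \<gamma>"
  define \<gamma>' where "\<gamma>' = map (\<lambda>t. t - Suc i) (filter (\<lambda>t. i < t) \<gamma>)"
  have "\<forall>t\<in>set \<gamma>'. t < length y"
    using i \<gamma> by (auto simp: \<gamma>'_def Delta_iff)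
  then have "map (nth (map (nth \<alpha>) y)) \<gamma>' = map (nth \<alpha>) (map (nth y) \<gamma>')" by auto
  then show ?thesis using JMix by (simp add: opr_pnerve join_opr_JMix[OF \<beta>'_def \<gamma>'_def] del: map_map)
next
  case (JRight y)
  then have "\<forall>t\<in>set \<gamma>. t < length y" using z \<gamma> by (auto simp: Delta_iff splx_sjoin)
  then show ?thesis using JRight by (simp add: opr_pnerve)
qed simp

section \<open>Initiality in a slice as an extension property\<close>

lemma restrict_sset_idem: "restrict_sset K (restrict_sset K f) = restrict_sset K f"
  by (auto simp: restrict_sset_def fun_eq_iff restrict_def)

lemma restrict_sset_apply: "z \<in> splx K m ==> restrict_sset K f m z = f m z"
  by (simp add: restrict_sset_def)

lemma restrict_sset_cong: "(\<And>m z. z \<in> splx K m ==> f m z = g m z) ==> restrict_sset K f = restrict_sset K g"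
  by (auto simp: restrict_sset_def fun_eq_iff restrict_def)

lemma sset_mapD:
  assumes "sset_map K C f" "x \<in> splx K n"
  shows "f n x \<in> splx C n" "\<alpha> \<in> splx (Delta n) m ==> f m (opr K n \<alpha> x) = opr C n \<alpha> (f n x)"
  using assms by (auto simp: sset_map_def)

lemma is_sset_sjoin_opr:
  assumes "is_sset K" "z \<in> splx (sjoin K (Delta n)) m" "\<alpha> \<in> splx (Delta m) k"
  shows "opr (sjoin K (Delta n)) m \<alpha> z \<in> splx (sjoin K (Delta n)) k"
  using join_opr_in[OF assms(1) is_sset_Delta assms(2,3)] by (simp add: opr_sjoin)

text \<open>Simplices of the slice are normalized outside the join, which is harmless because
  operators do not leave the join.\<close>

lemma sset_map_restrict:
  assumes K: "is_sset K"
  shows "sset_map (sjoin K (Delta n)) C (restrict_sset (sjoin K (Delta n)) f) \<longleftrightarrow> sset_map (sjoin K (Delta n)) C f"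
proof -
  have "opr (sjoin K (Delta n)) m \<alpha> z \<in> splx (sjoin K (Delta n)) k" if "z \<in> splx (sjoin K (Delta n)) m" "\<alpha> \<in> splx (Delta m) k" for m k z \<alpha>
    by (rule is_sset_sjoin_opr[OF K that])
  then show ?thesis by (simp add: sset_map_def restrict_sset_apply)
qed

lemma colimit_cocone_sset_map:
  assumes K: "is_sset K" and c: "colimit_cocone K C c"
  shows "sset_map (sjoin K (Delta 0)) C c"
  using c unfolding colimit_cocone_def initial_def under_slice_def
  by (simp add: sset_map_restrict[OF K])

lemma zeros_id: "y \<in> splx (Delta 0) m ==> map (nth [0]) y = y"
  by (auto simp: Delta_iff intro!: map_idI)

lemma jmap_zero: "z \<in> splx (sjoin K (Delta 0)) m ==> jmap [0] z = z"
  using zeros_id by (cases z) (auto simp: splx_sjoin)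

text \<open>A sphere in the slice amounts to a map on the join of \<open>K\<close> with the boundary
  of a simplex: its face \<alpha> is the restriction of \<open>h\<close> along \<alpha>. A filler of
  the sphere is then the extension.\<close>

lemma colimit_cocone_extend:
  assumes K: "is_sset K" and cc: "colimit_cocone K C c" and n: "0 < n"
    and h: "sset_map (sub_sset (sjoin K (Delta n)) (\<lambda>_. join_part n)) C h"
    and hc: "\<And>m z. z \<in> splx (sjoin K (Delta 0)) m ==> h m z = c m z"
  obtains F where "sset_map (sjoin K (Delta n)) C F"
    "\<And>m z. z \<in> splx (sjoin K (Delta n)) m ==> join_part n z ==> F m z = h m z"
proof -
  let ?S = "under_slice K C (\<lambda>m x. c m (JLeft x))"
  let ?J = "\<lambda>m. sjoin K (Delta m)"
  define b where "b m \<alpha> = restrict_sset (?J m) (\<lambda>k z. h k (jmap \<alpha> z))" for m \<alpha>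
  have bd: "\<alpha> \<in> splx (Delta n) m \<and> set \<alpha> \<noteq> {..n}" if "\<alpha> \<in> splx (boundary n) m" for \<alpha> m
    using that by (simp add: boundary_def sub_sset_def)
  have h1: "h k z \<in> splx C k" "\<gamma> \<in> splx (Delta k) r ==> h r (join_opr K (Delta n) k \<gamma> z) = opr C k \<gamma> (h k z)"
    if "z \<in> splx (?J n) k" "join_part n z" for z k \<gamma> r
    using h that unfolding sset_map_def sub_sset_def by (simp_all add: opr_sjoin)
  have bS: "b m \<alpha> \<in> splx ?S m" if a: "\<alpha> \<in> splx (boundary n) m" for m \<alpha>
  proof -
    have a1: "\<alpha> \<in> splx (Delta n) m" "set \<alpha> \<noteq> {..n}" using bd[OF a] by auto
    have "sset_map (?J m) C (\<lambda>k z. h k (jmap \<alpha> z))" unfolding sset_map_def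
    proof (intro allI ballI conjI)
      fix k z assume z: "z \<in> splx (?J m) k"
      note z' = jmap_in[OF a1(1) z] jmap_part[OF a1 z]
      show "h k (jmap \<alpha> z) \<in> splx C k" by (rule h1(1)[OF z'])
      fix r \<gamma> assume g: "\<gamma> \<in> splx (Delta k) r"
      show "h r (jmap \<alpha> (opr (?J m) k \<gamma> z)) = opr C k \<gamma> (h k (jmap \<alpha> z))"
        using h1(2)[OF z' g] jmap_opr[OF a1(1) z g] by (simp add: opr_sjoin)
    qed
    moreover have "b m \<alpha> k (JLeft x) = c k (JLeft x)" if "x \<in> splx K k" for k x
    proof -
      have "b m \<alpha> k (JLeft x) = h k (JLeft x)" using that by (simp add: b_def restrict_sset_apply splx_sjoin)
      also have "\<dots> = c k (JLeft x)" by (rule hc) (use that in \<open>simp add: splx_sjoin\<close>)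
      finally show ?thesis .
    qed
    ultimately show ?thesis unfolding under_slice_def
      by (simp add: b_def restrict_sset_idem sset_map_restrict[OF K])
  qed
  have bm: "sset_map (boundary n) ?S b" unfolding sset_map_def
  proof (intro allI ballI conjI bS)
    fix m \<alpha> k \<gamma> assume a: "\<alpha> \<in> splx (boundary n) m" and g: "\<gamma> \<in> splx (Delta m) k"
    have a1: "\<alpha> \<in> splx (Delta n) m" using bd[OF a] by auto
    have lg: "length \<gamma> = Suc k" using g by (simp add: Delta_iff)
    have "restrict_sset (?J k) (\<lambda>i z. h i (jmap (map (nth \<alpha>) \<gamma>) z)) = restrict_sset (?J k) (\<lambda>i z. b m \<alpha> i (jmap \<gamma> z))"
      by (rule restrict_sset_cong)
        (simp only: b_def restrict_sset_apply[OF jmap_in[OF g]] jmap_comp[OF a1 g])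
    then show "b k (opr (boundary n) m \<gamma> \<alpha>) = opr ?S m \<gamma> (b m \<alpha>)"
      by (simp add: boundary_def sub_sset_def opr_pnerve under_slice_def lg b_def)
  qed
  \<comment> \<open>At the vertex 0 the sphere is the given cocone, that is, it starts at the
    initial object of the slice.\<close>
  have b0: "b 0 [0] = restrict_sset (?J 0) c"
    unfolding b_def by (rule restrict_sset_cong) (simp add: jmap_zero hc)
  obtain F where F: "F \<in> splx ?S n" "\<And>m \<alpha>. \<alpha> \<in> splx (boundary n) m ==> opr ?S n \<alpha> F = b m \<alpha>"
    using cc n bm b0 unfolding colimit_cocone_def initial_def by blast
  have F1: "sset_map (?J n) C F" "\<And>k x. x \<in> splx K k ==> F k (JLeft x) = c k (JLeft x)"
    using F(1) by (simp_all add: under_slice_def)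
  have Fb: "F k (jmap \<alpha> z) = h k (jmap \<alpha> z)" if a: "\<alpha> \<in> splx (boundary n) m" and z: "z \<in> splx (?J m) k" for \<alpha> m z k
  proof -
    have "length \<alpha> - 1 = m" using bd[OF a] by (simp add: Delta_iff)
    then have "restrict_sset (?J m) (\<lambda>i z. F i (jmap \<alpha> z)) k z = b m \<alpha> k z"
      using F(2)[OF a] by (simp add: under_slice_def)
    then show ?thesis using z by (simp add: b_def restrict_sset_apply)
  qed
  have "F k z = h k z" if z: "z \<in> splx (?J n) k" "join_part n z" for k z
  proof (cases z)
    case (JLeft x)
    then have x: "x \<in> splx K k" using z by (simp add: splx_sjoin)
    then have "h k (JLeft x) = c k (JLeft x)" by (intro hc) (simp add: splx_sjoin)
    then show ?thesis using F1(2)[OF x] JLeft by simp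
  next
    case (JRight y)
    then have y: "y \<in> splx (Delta n) k" "set y \<noteq> {..n}" using z by (simp_all add: splx_sjoin join_part_def)
    then have a: "y \<in> splx (boundary n) k" by (simp add: boundary_def sub_sset_def)
    have ly: "length y = Suc k" using y by (simp add: Delta_iff)
    \<comment> \<open>A simplex of the join is the image of a tautological one along its own second
      component, so equality of restrictions gives equality at the simplex itself.\<close>
    have "[0..<Suc k] \<in> splx (Delta k) k" by (auto simp: Delta_iff)
    then have "JRight [0..<Suc k] \<in> splx (?J k) k" by (simp add: splx_sjoin)
    from Fb[OF a this] show ?thesis using JRight ly map_nth[of y] by simp
  next
    case (JMix i x y)
    then have y: "y \<in> splx (Delta n) (k - Suc i)" "set y \<noteq> {..n}" "i < k" "x \<in> splx K i"
      using z by (simp_all add: splx_sjoin join_part_def)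
    then have a: "y \<in> splx (boundary n) (k - Suc i)" by (simp add: boundary_def sub_sset_def)
    have ly: "length y = Suc (k - Suc i)" using y by (simp add: Delta_iff)
    have "[0..<Suc (k - Suc i)] \<in> splx (Delta (k - Suc i)) (k - Suc i)" by (auto simp: Delta_iff)
    then have "JMix i x [0..<Suc (k - Suc i)] \<in> splx (?J (k - Suc i)) k" using y by (simp add: splx_sjoin)
    from Fb[OF a this] show ?thesis using JMix ly map_nth[of y] by simp
  qed
  then show ?thesis using that F1(1) by blast
qed

lemma colimit_coconeI:
  assumes K: "is_sset K" and c: "sset_map (sjoin K (Delta 0)) C c"
    and ext: "\<And>n h. 0 < n ==> sset_map (sub_sset (sjoin K (Delta n)) (\<lambda>_. join_part n)) C h ==>
      (\<And>m z. z \<in> splx (sjoin K (Delta 0)) m ==> h m z = c m z) ==>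
      \<exists>F. sset_map (sjoin K (Delta n)) C F \<and> (\<forall>m. \<forall>z\<in>splx (sjoin K (Delta n)) m. join_part n z \<longrightarrow> F m z = h m z)"
  shows "colimit_cocone K C c"
  unfolding colimit_cocone_def initial_def
proof (intro conjI allI impI, goal_cases)
  case 1
  show ?case unfolding under_slice_def
    by (simp add: restrict_sset_idem sset_map_restrict[OF K] c restrict_sset_apply splx_sjoin)
next
  case (2 n b)
  let ?S = "under_slice K C (\<lambda>m x. c m (JLeft x))"
  let ?J = "\<lambda>m. sjoin K (Delta m)"
  have n: "0 < n" and b: "sset_map (boundary n) ?S b" and b0: "b 0 [0] = restrict_sset (?J 0) c" using 2 by auto
  \<comment> \<open>The faces of the sphere are assembled to one map: a simplex of the join is
    evaluated on the face that its second component names, at the tautological simplex.\<close>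
  define h where "h m z = (case z of JLeft x => c m (JLeft x) | JRight y => b m y m (JRight [0..<Suc m])
     | JMix i x y => b (m - Suc i) y m (JMix i x [0..<Suc (m - Suc i)]))" for m z
  have bdI: "\<alpha> \<in> splx (boundary n) m" if "\<alpha> \<in> splx (Delta n) m" "set \<alpha> \<noteq> {..n}" for \<alpha> m
    using that by (simp add: boundary_def sub_sset_def)
  have bD: "\<alpha> \<in> splx (Delta n) m" "set \<alpha> \<noteq> {..n}" if "\<alpha> \<in> splx (boundary n) m" for \<alpha> m
    using that by (simp_all add: boundary_def sub_sset_def)
  have bS: "sset_map (?J m) C (b m \<alpha>)" "restrict_sset (?J m) (b m \<alpha>) = b m \<alpha>"
    "\<And>k x. x \<in> splx K k ==> b m \<alpha> k (JLeft x) = c k (JLeft x)" if a: "\<alpha> \<in> splx (boundary n) m" for m \<alpha>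
    using sset_mapD(1)[OF b a] by (simp_all add: under_slice_def)
  have bc: "b k (map (nth \<alpha>) \<gamma>) i z = b m \<alpha> i (jmap \<gamma> z)"
    if a: "\<alpha> \<in> splx (boundary n) m" and g: "\<gamma> \<in> splx (Delta m) k" and z: "z \<in> splx (?J k) i" for m k i \<alpha> \<gamma> z
  proof -
    have lg: "length \<gamma> = Suc k" using g by (simp add: Delta_iff)
    have "b k (map (nth \<alpha>) \<gamma>) = opr ?S m \<gamma> (b m \<alpha>)"
      using sset_mapD(2)[OF b a g] by (simp add: boundary_def sub_sset_def opr_pnerve)
    then have "b k (map (nth \<alpha>) \<gamma>) i z = restrict_sset (?J k) (\<lambda>i z. b m \<alpha> i (jmap \<gamma> z)) i z"
      by (simp add: under_slice_def lg)
    then show ?thesis using z by (simp add: restrict_sset_apply)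
  qed
  have hb: "h k (jmap \<alpha> z) = b m \<alpha> k z" if a: "\<alpha> \<in> splx (boundary n) m" and z: "z \<in> splx (?J m) k" for \<alpha> m z k
  proof (cases z)
    case (JLeft x)
    then show ?thesis using bS(3)[OF a] z by (simp add: h_def splx_sjoin)
  next
    case (JRight y)
    then have y: "y \<in> splx (Delta m) k" using z by (simp add: splx_sjoin)
    have ly: "length y = Suc k" using y by (simp add: Delta_iff)
    have "JRight [0..<Suc k] \<in> splx (?J k) k" by (auto simp: splx_sjoin Delta_iff)
    from bc[OF a y this] show ?thesis using JRight ly map_nth[of y] by (simp add: h_def)
  next
    case (JMix i x y)
    then have y: "y \<in> splx (Delta m) (k - Suc i)" "i < k" "x \<in> splx K i" using z by (simp_all add: splx_sjoin)
    have ly: "length y = Suc (k - Suc i)" using y by (simp add: Delta_iff)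
    have "JMix i x [0..<Suc (k - Suc i)] \<in> splx (?J (k - Suc i)) k" using y by (auto simp: splx_sjoin Delta_iff)
    from bc[OF a y(1) this] show ?thesis using JMix ly map_nth[of y] by (simp add: h_def)
  qed
  have decomp: "\<exists>m \<alpha> z'. \<alpha> \<in> splx (boundary n) m \<and> z' \<in> splx (?J m) k \<and> z = jmap \<alpha> z'"
    if z: "z \<in> splx (?J n) k" "join_part n z" "\<not> (\<exists>x. z = JLeft x)" for k z
  proof (cases z)
    case (JLeft x) then show ?thesis using z by blast
  next
    case (JRight y)
    then have y: "y \<in> splx (boundary n) k" using z by (intro bdI) (simp_all add: splx_sjoin join_part_def)
    have ly: "length y = Suc k" using bD(1)[OF y] by (simp add: Delta_iff)
    have "JRight [0..<Suc k] \<in> splx (?J k) k" by (auto simp: splx_sjoin Delta_iff)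
    moreover have "z = jmap y (JRight [0..<Suc k])" using JRight ly map_nth[of y] by simp
    ultimately show ?thesis using y by blast
  next
    case (JMix i x y)
    then have y: "y \<in> splx (boundary n) (k - Suc i)" "i < k" "x \<in> splx K i"
      using z by (auto intro!: bdI simp: splx_sjoin join_part_def)
    have ly: "length y = Suc (k - Suc i)" using bD(1)[OF y(1)] by (simp add: Delta_iff)
    have "JMix i x [0..<Suc (k - Suc i)] \<in> splx (?J (k - Suc i)) k" using y by (auto simp: splx_sjoin Delta_iff)
    moreover have "z = jmap y (JMix i x [0..<Suc (k - Suc i)])" using JMix ly map_nth[of y] by simp
    ultimately show ?thesis using y(1) by blast
  qed
  have hm: "sset_map (sub_sset (?J n) (\<lambda>_. join_part n)) C h"
    unfolding sset_map_def
  proof (intro allI ballI)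
    fix k z assume "z \<in> splx (sub_sset (?J n) (\<lambda>_. join_part n)) k"
    then have z: "z \<in> splx (?J n) k" "join_part n z" by (simp_all add: sub_sset_def)
    have o: "opr (sub_sset (?J n) (\<lambda>_. join_part n)) k \<gamma> z = join_opr K (Delta n) k \<gamma> z" for \<gamma>
      by (simp add: sub_sset_def opr_sjoin)
    show "h k z \<in> splx C k \<and> (\<forall>r. \<forall>\<gamma>\<in>splx (Delta k) r. h r (opr (sub_sset (?J n) (\<lambda>_. join_part n)) k \<gamma> z) = opr C k \<gamma> (h k z))"
    proof (cases "\<exists>x. z = JLeft x")
      case True
      then obtain x where x: "z = JLeft x" by blast
      then have z0: "z \<in> splx (?J 0) k" using z by (simp add: splx_sjoin)
      show ?thesis using sset_mapD[OF c z0] x unfolding o by (auto simp: h_def opr_sjoin)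
    next
      case False
      then obtain m \<alpha> z' where d: "\<alpha> \<in> splx (boundary n) m" "z' \<in> splx (?J m) k" "z = jmap \<alpha> z'"
        using decomp[OF z] by blast
      have e: "h k z = b m \<alpha> k z'" using hb[OF d(1,2)] d(3) by simp
      show ?thesis
      proof (intro conjI allI ballI)
        show "h k z \<in> splx C k" unfolding e by (rule sset_mapD(1)[OF bS(1)[OF d(1)] d(2)])
        fix r \<gamma> assume g: "\<gamma> \<in> splx (Delta k) r"
        have "h r (join_opr K (Delta n) k \<gamma> z) = h r (jmap \<alpha> (join_opr K (Delta m) k \<gamma> z'))"
          unfolding d(3) by (simp only: jmap_opr[OF bD(1)[OF d(1)] d(2) g])
        also have "\<dots> = b m \<alpha> r (join_opr K (Delta m) k \<gamma> z')"
          by (rule hb[OF d(1) join_opr_in[OF K is_sset_Delta d(2) g]])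
        also have "\<dots> = opr C k \<gamma> (b m \<alpha> k z')"
          using sset_mapD(2)[OF bS(1)[OF d(1)] d(2) g] by (simp add: opr_sjoin)
        finally show "h r (opr (sub_sset (?J n) (\<lambda>_. join_part n)) k \<gamma> z) = opr C k \<gamma> (h k z)"
          unfolding o e .
      qed
    qed
  qed
  have z0: "[0] \<in> splx (boundary n) 0"
  proof (rule bdI)
    show "[0] \<in> splx (Delta n) 0" by (simp add: Delta_iff)
    show "set [0] \<noteq> {..n}"
    proof
      assume "set [0] = {..n}"
      then have "n \<in> set [0]" by (metis atMost_iff order_refl)
      then show False using n by simp
    qed
  qed
  have hc: "h m z = c m z" if "z \<in> splx (?J 0) m" for m z
    using hb[OF z0 that] jmap_zero[OF that] b0 that by (simp add: restrict_sset_apply)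
  obtain F where F: "sset_map (?J n) C F" "\<forall>m. \<forall>z\<in>splx (?J n) m. join_part n z \<longrightarrow> F m z = h m z"
    using ext[OF n hm hc] by blast
  let ?s = "restrict_sset (?J n) F"
  show "\<exists>s\<in>splx ?S n. \<forall>m. \<forall>\<alpha>\<in>splx (boundary n) m. opr ?S n \<alpha> s = b m \<alpha>"
  proof (rule bexI[of _ ?s], intro allI ballI)
    have "?s k (JLeft x) = c k (JLeft x)" if "x \<in> splx K k" for k x
    proof -
      have "JLeft x \<in> splx (?J n) k" using that by (simp add: splx_sjoin)
      then show ?thesis using F(2) by (simp add: restrict_sset_apply h_def join_part_def)
    qed
    then show "?s \<in> splx ?S n" using F(1) by (simp add: under_slice_def restrict_sset_idem sset_map_restrict[OF K])
    fix m \<alpha> assume a: "\<alpha> \<in> splx (boundary n) m"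
    have la: "length \<alpha> = Suc m" using bD(1)[OF a] by (simp add: Delta_iff)
    have "?s k (jmap \<alpha> z) = b m \<alpha> k z" if z: "z \<in> splx (?J m) k" for k z
    proof -
      note z' = jmap_in[OF bD(1)[OF a] z] jmap_part[OF bD[OF a] z]
      have "?s k (jmap \<alpha> z) = F k (jmap \<alpha> z)" by (rule restrict_sset_apply[OF z'(1)])
      also have "\<dots> = h k (jmap \<alpha> z)" using F(2) z' by blast
      also have "\<dots> = b m \<alpha> k z" by (rule hb[OF a z])
      finally show ?thesis .
    qed
    then have "restrict_sset (?J m) (\<lambda>k z. ?s k (jmap \<alpha> z)) = restrict_sset (?J m) (b m \<alpha>)"
      by (rule restrict_sset_cong)
    then show "opr ?S n \<alpha> ?s = b m \<alpha>" using bS(2)[OF a] by (simp add: under_slice_def la)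
  qed
qed

section \<open>Coproducts as colimits\<close>

lemma map_nth_map:
  assumes "\<forall>i\<in>set \<alpha>. i < length l" shows "map (nth (map \<psi> l)) \<alpha> = map \<psi> (map (nth l) \<alpha>)"
  using assms by auto

lemma map_nth_append_split:
  assumes "sorted \<alpha>" "\<forall>t\<in>set \<alpha>. t < length xs + length ys"
  shows "map (nth (xs @ ys)) \<alpha> = map (nth xs) (filter (\<lambda>t. t < length xs) \<alpha>) @
    map (nth ys) (map (\<lambda>t. t - length xs) (filter (\<lambda>t. length xs \<le> t) \<alpha>))"
  using assms
proof (induction \<alpha>)
  case (Cons a \<alpha>)
  show ?case
  proof (cases "a < length xs")
    case False
    then have b: "\<forall>t\<in>set \<alpha>. length xs \<le> t" using Cons.prems by auto
    then have "filter (\<lambda>t. t < length xs) \<alpha> = []" "filter (\<lambda>t. length xs \<le> t) \<alpha> = \<alpha>"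
      by (auto simp: filter_empty_conv intro!: filter_True)
    then show ?thesis using False b by (auto simp: nth_append)
  qed (use Cons in \<open>auto simp: nth_append\<close>)
qed simp

lemma map_nth_replicate: "\<forall>t\<in>set \<beta>. t < a ==> map (nth (replicate a c)) \<beta> = replicate (length \<beta>) c"
  by (induction \<beta>) auto

text \<open>Chains on a cone: \<open>a\<close> copies of the apex 0 followed by \<open>y\<close>
  raised by one. Over a single index, a simplex of the join is such a chain.\<close>

abbreviation zs :: "nat => nat list => nat list" where
  "zs a y \<equiv> replicate a 0 @ map Suc y"

text \<open>Matches the action of operators on cone chains with \<open>join_opr\<close> on mixed
  simplices: positions up to \<open>i\<close> hit the apex, the later ones hit
  \<open>y\<close>.\<close>

lemma zs_nth:
  assumes \<alpha>: "\<alpha> \<in> splx (Delta n) m" and i: "i < n" and y: "length y = n - i"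
    and \<beta>: "\<beta> = filter (\<lambda>t. t \<le> i) \<alpha>" and \<gamma>: "\<gamma> = map (\<lambda>t. t - Suc i) (filter (\<lambda>t. i < t) \<alpha>)"
  shows "map (nth (zs (Suc i) y)) \<alpha> = zs (length \<beta>) (map (nth y) \<gamma>)"
proof -
  let ?xs = "replicate (Suc i) (0::nat)" and ?ys = "map Suc y"
  have a: "sorted \<alpha>" "\<forall>t\<in>set \<alpha>. t < length ?xs + length ?ys" using \<alpha> i y by (auto simp: Delta_iff)
  have f: "filter (\<lambda>t. t < length ?xs) \<alpha> = \<beta>" "map (\<lambda>t. t - length ?xs) (filter (\<lambda>t. length ?xs \<le> t) \<alpha>) = \<gamma>"
    unfolding \<beta> \<gamma> by (simp_all add: less_Suc_eq_le Suc_le_eq)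
  have g: "\<forall>t\<in>set \<gamma>. t < length y" using \<alpha> i y unfolding \<gamma> by (auto simp: Delta_iff)
  have b: "\<forall>t\<in>set \<beta>. t < Suc i" unfolding \<beta> by auto
  have "map (nth (?xs @ ?ys)) \<alpha> = map (nth ?xs) \<beta> @ map (nth ?ys) \<gamma>"
    unfolding map_nth_append_split[OF a] f ..
  also have "map (nth ?xs) \<beta> = replicate (length \<beta>) 0" by (rule map_nth_replicate[OF b])
  also have "map (nth ?ys) \<gamma> = map Suc (map (nth y) \<gamma>)" by (rule map_nth_map[OF g])
  finally show ?thesis .
qed

lemma zs_chain:
  assumes "y \<noteq> [] ==> y \<in> splx (Delta n) (length y - 1)" "set y \<noteq> {..n}" "a \<noteq> 0 \<or> y \<noteq> []"
  shows "zs a y \<in> chains (hcx n)"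
proof -
  have y: "set y \<subseteq> {..n}" "sorted y" using assms(1) by (cases "y = []"; simp add: Delta_iff)+
  then obtain v where v: "v \<le> n" "v \<notin> set y" using assms(2) by blast
  have "Suc v \<notin> set (zs a y)" using v by auto
  moreover have "Suc v \<in> {1..Suc n}" using v by simp
  ultimately have "\<not> {1..Suc n} \<subseteq> set (zs a y)" by blast
  moreover have "set (zs a y) \<subseteq> {..Suc n}" using y by auto
  moreover have "zs a y \<noteq> []" using assms(3) by auto
  moreover have "sorted (zs a y)" using y(2) by (auto simp: sorted_append sorted_iff_nth_mono[of "map Suc y"] sorted_nth_mono)
  ultimately show ?thesis by (simp add: chains_def hcx_def)
qed

text \<open>Splitting a chain after its zeros; with \<open>zs_chain\<close> this describes all
  chains of \<open>hcx n\<close> by their number of zeros and the rest.\<close>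

lemma chain_zs:
  assumes "l \<in> chains (hcx n)"
  obtains a y where "l = zs a y" "y \<noteq> [] \<longrightarrow> y \<in> splx (Delta n) (length y - 1)" "set y \<noteq> {..n}" "a \<noteq> 0 \<or> y \<noteq> []"
proof -
  have l: "l \<noteq> []" "sorted l" "set l \<subseteq> {..Suc n}" "\<not> {1..Suc n} \<subseteq> set l" using assms by (auto simp: chains_def hcx_def)
  let ?a = "length (filter (\<lambda>t. t \<le> 0) l)" and ?y = "map (\<lambda>t. t - Suc 0) (filter (\<lambda>t. 0 < t) l)"
  have "filter (\<lambda>t. t \<le> 0) l = replicate ?a 0" by (induction l) auto
  moreover have "map Suc ?y = filter (\<lambda>t. 0 < t) l"
    unfolding map_map by (rule map_idI) simp
  ultimately have e: "l = zs ?a ?y" using sorted_filter_split[OF l(2), of 0] by simp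
  have s: "sorted ?y" using l(2) sorted_filter[of id l] by (auto simp: sorted_iff_nth_mono diff_le_mono)
  have "?y \<noteq> [] \<longrightarrow> ?y \<in> splx (Delta n) (length ?y - 1)" using s l(3) by (auto simp: Delta_iff)
  moreover have "set ?y \<noteq> {..n}"
  proof
    assume h: "set ?y = {..n}"
    have "{1..Suc n} \<subseteq> set (map Suc ?y)" unfolding set_map[of Suc] h by (simp add: image_Suc_atMost)
    then show False using l(4) e by (metis Un_iff set_append subset_iff)
  qed
  moreover have "?a \<noteq> 0 \<or> ?y \<noteq> []" using e l(1) by fastforce
  ultimately show ?thesis using that[OF e] by blast
qed

lemma bcx_chain:
  assumes "y \<in> splx (Delta n) m" "set y \<noteq> {..n}"
  shows "map Suc y \<in> chains (bcx n)"
proof -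
  have "length y = Suc m" using assms by (simp add: Delta_iff)
  then have "zs 0 y \<in> chains (hcx n)" using assms by (intro zs_chain) auto
  then show ?thesis by (simp add: chains_bcx_iff image_iff)
qed

lemma chain_bcx:
  assumes "l \<in> chains (bcx n)"
  obtains y where "l = map Suc y" "y \<in> splx (Delta n) (length l - 1)" "set y \<noteq> {..n}"
proof -
  have "l \<in> chains (hcx n)" "0 \<notin> set l" using assms by (simp_all add: chains_bcx_iff)
  obtain a y where ay: "l = zs a y" "y \<noteq> [] \<longrightarrow> y \<in> splx (Delta n) (length y - 1)" "set y \<noteq> {..n}" "a \<noteq> 0 \<or> y \<noteq> []"
    using chain_zs[OF \<open>l \<in> chains (hcx n)\<close>] by metis
  have "a = 0" using \<open>0 \<notin> set l\<close> ay(1) by auto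
  then show ?thesis using ay that by auto
qed

text \<open>
  Besides discrete simplicial sets this covers the nerve of a one-element poset, whose \<open>m\<close>-simplices are
  constant chains of length \<open>m + 1\<close>.
\<close>

lemma colimit_cocone_coprod:
  fixes K :: "'k sset"
  assumes K: "is_sset K" and rep: "\<And>m. splx K m = rep m ` J"
    and deg: "\<And>n m \<alpha> j. \<alpha> \<in> splx (Delta n) m ==> opr K n \<alpha> (rep n j) = rep m j"
    and lab: "\<And>m j. j \<in> J ==> lab (rep m j) = j"
    and cc: "colimit_cocone K C c"
  shows "coprod C J (c 0 (JRight [0])) (\<lambda>j. c 1 (JMix 0 (rep 0 j) [0]))"
  unfolding coprod_def
proof (intro allI impI, elim conjE, goal_cases)
  case (1 n g f)
  note n = 1(1) and g = 1(2) and g1 = 1(3)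
  have f: "\<And>j. j \<in> J ==> cmap C (hcx n) (f j)" "\<And>j. j \<in> J ==> f j [0,1] = c 1 (JMix 0 (rep 0 j) [0])"
    "\<And>j l. j \<in> J ==> l \<in> chains (bcx n) ==> f j l = g l"
    using 1(4) by simp_all
  have cm: "sset_map (sjoin K (Delta 0)) C c" by (rule colimit_cocone_sset_map[OF K cc])
  \<comment> \<open>The family and its common base glue to a map on the join, since each simplex of
    \<open>K\<close> lies over one index, which \<open>lab\<close> recovers.\<close>
  define h where "h m z = (case z of JLeft x => f (lab x) (zs (Suc m) []) | JRight y => g (map Suc y)
    | JMix i x y => f (lab x) (zs (Suc i) y))" for m and z :: "('k, nat list) join"
  have n0: "set ([] :: nat list) \<noteq> {..n}" by auto
  have hm: "sset_map (sub_sset (sjoin K (Delta n)) (\<lambda>_. join_part n)) C h"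
    unfolding sset_map_def
  proof (intro allI ballI)
    fix k z assume "z \<in> splx (sub_sset (sjoin K (Delta n)) (\<lambda>_. join_part n)) k"
    then have z: "z \<in> splx (sjoin K (Delta n)) k" "join_part n z" by (simp_all add: sub_sset_def)
    have o: "opr (sub_sset (sjoin K (Delta n)) (\<lambda>_. join_part n)) k \<gamma> z = join_opr K (Delta n) k \<gamma> z" for \<gamma>
      by (simp add: sub_sset_def opr_sjoin)
    show "h k z \<in> splx C k \<and> (\<forall>r. \<forall>\<alpha>\<in>splx (Delta k) r. h r (opr (sub_sset (sjoin K (Delta n)) (\<lambda>_. join_part n)) k \<alpha> z) = opr C k \<alpha> (h k z))"
      unfolding o
    proof (cases z)
      case (JLeft x)
      then obtain j where j: "j \<in> J" "x = rep k j" using z(1) rep by (auto simp: splx_sjoin)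
      have c: "zs (Suc k) [] \<in> chains (hcx n)" using n0 by (intro zs_chain) auto
      have len: "length (zs (Suc k) []) - 1 = k" by simp
      show "h k z \<in> splx C k \<and> (\<forall>r. \<forall>\<alpha>\<in>splx (Delta k) r. h r (join_opr K (Delta n) k \<alpha> z) = opr C k \<alpha> (h k z))"
      proof (intro conjI allI ballI)
        show "h k z \<in> splx C k" using cmapD(1)[OF f(1)[OF j(1)] c] JLeft j lab by (simp add: h_def)
        fix r \<alpha> assume a: "\<alpha> \<in> splx (Delta k) r"
        have lt: "\<forall>t\<in>set \<alpha>. t < Suc k" and la: "length \<alpha> = Suc r"
          using a by (auto simp: Delta_iff less_Suc_eq_le)
        have "map (nth (zs (Suc k) [])) \<alpha> = zs (Suc r) []"
          using map_nth_replicate[OF lt, of 0] la by (simp del: replicate_Suc)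
        then show "h r (join_opr K (Delta n) k \<alpha> z) = opr C k \<alpha> (h k z)"
          using cmapD(2)[OF f(1)[OF j(1)] c, of \<alpha> r] a JLeft j lab deg[OF a] unfolding len by (simp add: h_def)
      qed
    next
      case (JRight y)
      then have y: "y \<in> splx (Delta n) k" "set y \<noteq> {..n}" using z by (simp_all add: splx_sjoin join_part_def)
      have c: "map Suc y \<in> chains (bcx n)" by (rule bcx_chain[OF y])
      have len: "length (map Suc y) - 1 = k" using y by (simp add: Delta_iff)
      show "h k z \<in> splx C k \<and> (\<forall>r. \<forall>\<alpha>\<in>splx (Delta k) r. h r (join_opr K (Delta n) k \<alpha> z) = opr C k \<alpha> (h k z))"
      proof (intro conjI allI ballI)
        show "h k z \<in> splx C k" using cmapD(1)[OF g c] JRight len by (simp add: h_def)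
        fix r \<alpha> assume a: "\<alpha> \<in> splx (Delta k) r"
        have "\<forall>t\<in>set \<alpha>. t < length y" using a y by (auto simp: Delta_iff)
        then have "map (nth (map Suc y)) \<alpha> = map Suc (map (nth y) \<alpha>)" by (rule map_nth_map)
        then show "h r (join_opr K (Delta n) k \<alpha> z) = opr C k \<alpha> (h k z)"
          using cmapD(2)[OF g c, of \<alpha> r] a JRight unfolding len by (simp add: h_def opr_pnerve del: map_map)
      qed
    next
      case (JMix i x y)
      then have i: "i < k" "x \<in> splx K i" "y \<in> splx (Delta n) (k - Suc i)" "set y \<noteq> {..n}"
        using z by (simp_all add: splx_sjoin join_part_def)
      then obtain j where j: "j \<in> J" "x = rep i j" using rep by auto
      have ly: "length y = k - i" "length y = Suc (k - Suc i)" using i by (simp_all add: Delta_iff)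
      have c: "zs (Suc i) y \<in> chains (hcx n)" using i ly by (intro zs_chain) auto
      have len: "length (zs (Suc i) y) - 1 = k" using ly i by simp
      show "h k z \<in> splx C k \<and> (\<forall>r. \<forall>\<alpha>\<in>splx (Delta k) r. h r (join_opr K (Delta n) k \<alpha> z) = opr C k \<alpha> (h k z))"
      proof (intro conjI allI ballI)
        show "h k z \<in> splx C k" using cmapD(1)[OF f(1)[OF j(1)] c] len JMix j lab by (simp add: h_def)
        fix r \<alpha> assume a: "\<alpha> \<in> splx (Delta k) r"
        define \<beta> where "\<beta> = filter (\<lambda>t. t \<le> i) \<alpha>"
        define \<gamma> where "\<gamma> = map (\<lambda>t. t - Suc i) (filter (\<lambda>t. i < t) \<alpha>)"
        note s = split_Delta[OF a i(1), folded \<beta>_def \<gamma>_def]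
        have e: "opr C k \<alpha> (h k z) = f j (zs (length \<beta>) (map (nth y) \<gamma>))"
          using cmapD(2)[OF f(1)[OF j(1)] c, of \<alpha> r] a zs_nth[OF a i(1) ly(1) \<beta>_def \<gamma>_def] JMix j lab
          unfolding len by (simp add: h_def)
        have hz: "h r (join_opr K (Delta n) k \<alpha> z) =
          h r (if \<gamma> = [] then JLeft (opr K i \<beta> x) else if \<beta> = [] then JRight (map (nth y) \<gamma>)
               else JMix (length \<beta> - 1) (opr K i \<beta> x) (map (nth y) \<gamma>))"
          unfolding JMix join_opr_JMix[OF \<beta>_def \<gamma>_def] by (simp add: opr_pnerve)
        have labx: "lab (opr K i \<beta> x) = j" if "\<beta> \<noteq> []" using deg[OF s(1)[OF that]] j lab by simp
        show "h r (join_opr K (Delta n) k \<alpha> z) = opr C k \<alpha> (h k z)"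
        proof (cases "\<gamma> = []")
          case True
          then have "length \<beta> = Suc r" using s(3) by simp
          then have "\<beta> \<noteq> []" by auto
          then show ?thesis unfolding hz e using True labx \<open>length \<beta> = Suc r\<close> by (simp add: h_def)
        next
          case g0: False
          show ?thesis
          proof (cases "\<beta> = []")
            case True
            have "\<forall>t\<in>set \<gamma>. t < length y" using s(2)[OF g0] ly by (auto simp: Delta_iff)
            then have "set (map (nth y) \<gamma>) \<subseteq> set y" by (rule set_map_nth_subset)
            moreover have "set y \<subset> {..n}" using i by (auto simp: Delta_iff)
            ultimately have "set (map (nth y) \<gamma>) \<noteq> {..n}" by blast
            then have "map Suc (map (nth y) \<gamma>) \<in> chains (bcx n)"
              by (rule bcx_chain[OF Delta_comp(1)[OF i(3) s(2)[OF g0]]])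
            then show ?thesis unfolding hz e using True g0 f(3)[OF j(1)] by (simp add: h_def)
          next
            case False
            then show ?thesis unfolding hz e using g0 labx by (simp add: h_def)
          qed
        qed
      qed
    qed
  qed
  have hc: "h m z = c m z" if z: "z \<in> splx (sjoin K (Delta 0)) m" for m z
  proof -
    have zero: "y = replicate (Suc k) 0" if "y \<in> splx (Delta 0) k" for y k
      using that by (intro replicate_eqI) (auto simp: Delta_iff)
    have e1: "[0,1] \<in> chains (hcx n)" "[1] \<in> chains (bcx n)" by (rule low_chains[OF n])+
    \<comment> \<open>Over the index \<open>j\<close>, a simplex of the join with a point comes from
      the edge between \<open>j\<close> and the cone point, where both sides agree by the condition
      on \<open>[0,1]\<close>. An empty \<gamma> is the case of a simplex of \<open>K\<close>
      alone.\<close>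
    have left: "h m (if \<gamma> = [] then JLeft (rep m j) else JMix (length \<beta> - 1) (rep (length \<beta> - 1) j) \<gamma>) =
        c m (if \<gamma> = [] then JLeft (rep m j) else JMix (length \<beta> - 1) (rep (length \<beta> - 1) j) \<gamma>)"
      if j: "j \<in> J" and pq: "\<beta> = replicate p 0" "\<gamma> = replicate q 0" "p \<noteq> 0" "p + q = Suc m"
      for j p q and \<beta> \<gamma> :: "nat list"
    proof -
      have b: "\<beta> = replicate (length \<beta>) 0" "\<beta> \<noteq> []" and l: "length \<beta> + length \<gamma> = Suc m"
        and b0: "\<forall>t\<in>set \<beta>. t = 0" "sorted \<beta>" and c0: "\<forall>t\<in>set \<gamma>. t = 0" "sorted (map Suc \<gamma>)" using pq by auto
      define \<alpha> where "\<alpha> = \<beta> @ map Suc \<gamma>"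
      have a: "\<alpha> \<in> splx (Delta 1) m"
        unfolding \<alpha>_def using l b0 c0 by (auto simp: Delta_iff sorted_append)
      have fl: "filter (\<lambda>t. t \<le> 0) \<alpha> = \<beta>" "map (\<lambda>t. t - Suc 0) (filter (\<lambda>t. 0 < t) \<alpha>) = \<gamma>"
      proof -
        show "filter (\<lambda>t. t \<le> 0) \<alpha> = \<beta>" "map (\<lambda>t. t - Suc 0) (filter (\<lambda>t. 0 < t) \<alpha>) = \<gamma>"
          unfolding \<alpha>_def using b0(1) by (auto simp: filter_map comp_def filter_empty_conv intro!: filter_True)
      qed
      have v: "JMix 0 (rep 0 j) [0] \<in> splx (sjoin K (Delta 0)) 1"
        using rep j by (auto simp: splx_sjoin Delta_iff)
      have d: "opr K 0 \<beta> (rep 0 j) = rep (length \<beta> - 1) j"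
      proof (rule deg)
        show "\<beta> \<in> splx (Delta 0) (length \<beta> - 1)" using b(2) b0 by (auto simp: Delta_iff)
      qed
      have mg: "map (nth [0]) \<gamma> = \<gamma>" using c0(1) by (auto intro!: map_idI)
      have "join_opr K (Delta 0) 1 \<alpha> (JMix 0 (rep 0 j) [0]) =
         (if \<gamma> = [] then JLeft (rep (length \<beta> - 1) j) else JMix (length \<beta> - 1) (rep (length \<beta> - 1) j) \<gamma>)"
        using join_opr_JMix[OF fl[symmetric], of K "Delta 0" 1 "rep 0 j" "[0]"] b(2) d mg by (simp add: opr_pnerve)
      also have "\<dots> = (if \<gamma> = [] then JLeft (rep m j) else JMix (length \<beta> - 1) (rep (length \<beta> - 1) j) \<gamma>)"
        using l by (cases "\<gamma> = []") auto
      finally have ee: "c m (if \<gamma> = [] then JLeft (rep m j) else JMix (length \<beta> - 1) (rep (length \<beta> - 1) j) \<gamma>)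
          = opr C 1 \<alpha> (c 1 (JMix 0 (rep 0 j) [0]))"
        using sset_mapD(2)[OF cm v a] by (simp add: opr_sjoin)
      have "map (nth [0,1]) \<alpha> = \<alpha>"
        using a by (auto simp: Delta_iff nth_Cons' intro!: map_idI)
      then have "f j \<alpha> = opr C 1 \<alpha> (c 1 (JMix 0 (rep 0 j) [0]))"
        using cmapD(2)[OF f(1)[OF j] e1(1), of \<alpha> m] a f(2)[OF j] by simp
      moreover have "\<alpha> = zs (length \<beta>) \<gamma>" unfolding \<alpha>_def by (subst b(1)) simp
      moreover have "lab (rep k j) = j" for k by (rule lab[OF j])
      ultimately show ?thesis unfolding ee using l b(2) by (cases "\<gamma> = []") (simp_all add: h_def)
    qed
    show ?thesis
    proof (cases z)
      case (JLeft x)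
      then obtain j where j: "j \<in> J" "x = rep m j" using z rep by (auto simp: splx_sjoin)
      show ?thesis using left[OF j(1), of "replicate (Suc m) 0" "Suc m" "[]" 0] JLeft j(2) by simp
    next
      case (JRight y)
      then have y: "y \<in> splx (Delta 0) m" using z by (simp add: splx_sjoin)
      have v: "JRight [0] \<in> splx (sjoin K (Delta 0)) 0" by (simp add: splx_sjoin Delta_iff)
      have "c m (JRight y) = opr C 0 y (c 0 (JRight [0]))"
        using sset_mapD(2)[OF cm v y] zeros_id[OF y] by (simp add: opr_sjoin opr_pnerve)
      moreover have m1: "map (nth [1]) y = map Suc y" using y by (auto simp: Delta_iff)
      ultimately show ?thesis using cmapD(2)[OF g e1(2), of y m, unfolded m1] y g1 JRight by (simp add: h_def)
    next
      case (JMix i x y)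
      then have i: "i < m" "x \<in> splx K i" "y \<in> splx (Delta 0) (m - Suc i)" using z by (simp_all add: splx_sjoin)
      then obtain j where j: "j \<in> J" "x = rep i j" using rep by auto
      have ly: "length y = Suc (m - Suc i)" using i by (simp add: Delta_iff)
      have "y = replicate (length y) 0" using zero[OF i(3)] ly by simp
      then show ?thesis using left[OF j(1), of "replicate (Suc i) 0" "Suc i" y "length y"] JMix j(2) ly i(1) by auto
    qed
  qed
  obtain F where F: "sset_map (sjoin K (Delta n)) C F"
    "\<And>m z. z \<in> splx (sjoin K (Delta n)) m ==> join_part n z ==> F m z = h m z"
    by (rule colimit_cocone_extend[OF K cc n hm hc]) blast+
  \<comment> \<open>The fillers are the values of the extension on tautological simplices: the base
    simplex, and its join with the vertex over \<open>j\<close>.\<close>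
  let ?s = "F n (JRight [0..<Suc n])" and ?t = "\<lambda>j. F (Suc n) (JMix 0 (rep 0 j) [0..<Suc n])"
  have u: "[0..<Suc n] \<in> splx (Delta n) n" by (auto simp: Delta_iff)
  have vs: "JRight [0..<Suc n] \<in> splx (sjoin K (Delta n)) n" using u by (simp add: splx_sjoin)
  have vt: "JMix 0 (rep 0 j) [0..<Suc n] \<in> splx (sjoin K (Delta n)) (Suc n)" if "j \<in> J" for j
    using u that rep by (auto simp: splx_sjoin)
  have un: "map (nth [0..<Suc n]) y = y" if "set y \<subseteq> {..n}" for y
    using that by (auto intro!: map_idI)
  show ?case
  proof (intro exI[of _ ?s] exI[of _ ?t] conjI ballI)
    show "?s \<in> splx C n" by (rule sset_mapD(1)[OF F(1) vs])
    show "opr C n (map (\<lambda>i. i - 1) l) ?s = g l" if l: "l \<in> chains (bcx n)" for l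
    proof -
      obtain y where y: "l = map Suc y" "y \<in> splx (Delta n) (length l - 1)" "set y \<noteq> {..n}" by (rule chain_bcx[OF l])
      have "opr C n y ?s = F (length l - 1) (JRight y)"
        using sset_mapD(2)[OF F(1) vs y(2)] un[of y] y(2) by (simp add: opr_sjoin opr_pnerve Delta_iff)
      also have "\<dots> = h (length l - 1) (JRight y)" by (rule F(2)) (use y in \<open>simp_all add: splx_sjoin join_part_def\<close>)
      finally show ?thesis using y(1) by (simp add: h_def comp_def)
    qed
    fix j assume j: "j \<in> J"
    show "?t j \<in> splx C (Suc n)" by (rule sset_mapD(1)[OF F(1) vt[OF j]])
    have dt: "opr C (Suc n) \<alpha> (?t j) = F m (if \<gamma> = [] then JLeft (rep (length \<beta> - 1) j) else if \<beta> = [] then JRight \<gamma>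
         else JMix (length \<beta> - 1) (rep (length \<beta> - 1) j) \<gamma>)"
      if a: "\<alpha> \<in> splx (Delta (Suc n)) m" and b: "\<beta> = filter (\<lambda>t. t \<le> 0) \<alpha>" "\<gamma> = map (\<lambda>t. t - Suc 0) (filter (\<lambda>t. 0 < t) \<alpha>)"
      for \<alpha> \<beta> \<gamma> m
    proof -
      note s = split_Delta[OF a, of 0, folded b]
      have d: "opr K 0 \<beta> (rep 0 j) = rep (length \<beta> - 1) j" if "\<beta> \<noteq> []" by (rule deg) (use s(1) that in simp)
      have "set \<gamma> \<subseteq> {..n}" using s(2) by (cases "\<gamma> = []") (auto simp: Delta_iff)
      then have m: "map (nth [0..<Suc n]) \<gamma> = \<gamma>" by (rule un)
      have "\<gamma> = [] ==> \<beta> \<noteq> []" using s(3) by auto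
      then show ?thesis using sset_mapD(2)[OF F(1) vt[OF j] a] d m
        by (auto simp: opr_sjoin join_opr_JMix[OF b] opr_pnerve)
    qed
    show "opr C (Suc n) l (?t j) = f j l" if l: "l \<in> chains (hcx n)" for l
    proof -
      obtain a y where ay: "l = zs a y" "y \<noteq> [] \<longrightarrow> y \<in> splx (Delta n) (length y - 1)" "set y \<noteq> {..n}" "a \<noteq> 0 \<or> y \<noteq> []"
        by (rule chain_zs[OF l])
      have fl: "replicate a 0 = filter (\<lambda>t. t \<le> 0) l" "y = map (\<lambda>t. t - Suc 0) (filter (\<lambda>t. 0 < t) l)"
        unfolding ay(1) by (simp_all add: filter_map comp_def)
      let ?m = "length l - 1"
      have lm: "?m = a + length y - 1" using ay(1) by simp
      let ?z = "if y = [] then JLeft (rep (length (replicate a (0::nat)) - 1) j) else if replicate a (0::nat) = [] then JRight y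
         else JMix (length (replicate a (0::nat)) - 1) (rep (length (replicate a (0::nat)) - 1) j) y"
      have 1: "opr C (Suc n) l (?t j) = F ?m ?z" by (rule dt[OF hcx_Delta[OF l] fl])
      have z: "?z \<in> splx (sjoin K (Delta n)) ?m" "join_part n ?z"
      proof -
        show "join_part n ?z" using ay(3) by (simp add: join_part_def)
        have "rep k j \<in> splx K k" for k using rep j by simp
        moreover have "a \<noteq> 0 ==> y \<noteq> [] ==> a - 1 < ?m \<and> ?m - Suc (a - 1) = length y - 1" unfolding lm by (cases y) auto
        moreover have "y \<noteq> [] ==> a = 0 ==> y \<in> splx (Delta n) ?m" using ay(2) lm by simp
        moreover have "y = [] ==> ?m = a - 1" using lm by simp
        ultimately show "?z \<in> splx (sjoin K (Delta n)) ?m" using ay(2) by (simp add: splx_sjoin)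
      qed
      have "h ?m ?z = f j l"
      proof -
        have "a = 0 ==> g (map Suc y) = f j l"
        proof -
          assume a0: "a = 0"
          then have "y \<noteq> []" using ay(4) by simp
          then have "map Suc y \<in> chains (bcx n)" using bcx_chain[of y n "length y - 1"] ay(2,3) by simp
          then show "g (map Suc y) = f j l" using f(3)[OF j] ay(1) a0 by simp
        qed
        moreover have "lab (rep k j) = j" for k by (rule lab[OF j])
        moreover have "y = [] ==> Suc ?m = a" using lm ay(4) by simp
        ultimately show ?thesis using ay(1,4) by (cases "a = 0"; cases "y = []") (simp_all add: h_def)
      qed
      then show ?thesis using 1 F(2)[OF z] by simp
    qed
    have fl: "[] = filter (\<lambda>t. t \<le> 0) [1..<Suc (Suc n)]" "[0..<Suc n] = map (\<lambda>t. t - Suc 0) (filter (\<lambda>t. 0 < t) [1..<Suc (Suc n)])"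
    proof -
      show "[] = filter (\<lambda>t. t \<le> 0) [1..<Suc (Suc n)]" by (auto simp: filter_empty_conv)
      have "filter (\<lambda>t. 0 < t) [1..<Suc (Suc n)] = [1..<Suc (Suc n)]" by (rule filter_True) auto
      then show "[0..<Suc n] = map (\<lambda>t. t - Suc 0) (filter (\<lambda>t. 0 < t) [1..<Suc (Suc n)])"
        by (simp add: map_decr_upt)
    qed
    show "opr C (Suc n) [1..<Suc (Suc n)] (?t j) = ?s"
      using dt[OF d0_Delta fl] by simp
  qed
qed

text \<open>A discrete \<open>J\<close> has only constant simplices, so a map out of the join is a
  map on the simplex together with one cone for each index. Such data are what \<open>coprod\<close>
  extends.\<close>

lemma coprod_colimit_cocone:
  fixes J :: "'k set"
  assumes C: "is_sset C" and c: "sset_map (sjoin (discrete J) (Delta 0)) C c"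
    and cp: "coprod C J (c 0 (JRight [0])) (\<lambda>j. c 1 (JMix 0 j [0]))"
  shows "colimit_cocone (discrete J) C c"
proof (rule colimit_coconeI[OF is_sset_discrete c])
  let ?K = "discrete J"
  fix n h
  assume n: "0 < n" and h: "sset_map (sub_sset (sjoin ?K (Delta n)) (\<lambda>_. join_part n)) C h"
    and hc: "\<And>m z. z \<in> splx (sjoin ?K (Delta 0)) m ==> h m z = c m z"
  have K: "splx ?K m = J" "opr ?K m \<alpha> x = x" for m \<alpha> x by (simp_all add: discrete_def)
  have h1: "h k z \<in> splx C k" "\<gamma> \<in> splx (Delta k) r ==> h r (join_opr ?K (Delta n) k \<gamma> z) = opr C k \<gamma> (h k z)"
    if "z \<in> splx (sjoin ?K (Delta n)) k" "join_part n z" for z k \<gamma> r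
    using h that unfolding sset_map_def sub_sset_def by (simp_all add: opr_sjoin)
  \<comment> \<open>Translates a chain with \<open>a\<close> zeros and rest \<open>y\<close> into
    the join; for \<open>a = 0\<close> the index is forgotten. The entry \<open>a - 1\<close> is the
    dimension of the part over the index.\<close>
  define D where "D j a y = (if y = [] then JLeft j else if a = 0 then JRight y else JMix (a - 1) j y)" for j :: 'k and a :: nat and y :: "nat list"
  let ?a = "\<lambda>l. length (filter (\<lambda>t. t \<le> 0) l)" and ?y = "\<lambda>l. map (\<lambda>t. t - Suc 0) (filter (\<lambda>t. 0 < t) l)"
  define f where "f j l = h (length l - 1) (D j (?a l) (?y l))" for j :: 'k and l :: "nat list"
  define g where "g l = h (length l - 1) (JRight (map (\<lambda>i. i - 1) l))" for l :: "nat list"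
  have fz: "f j (zs a y) = h (a + length y - 1) (D j a y)" for j a y
    by (simp add: f_def filter_map comp_def)
  have Din: "D j a y \<in> splx (sjoin ?K (Delta n)) (a + length y - 1)" "join_part n (D j a y)"
    if j: "j \<in> J" and y: "y \<noteq> [] \<longrightarrow> y \<in> splx (Delta n) (length y - 1)" "set y \<noteq> {..n}" "a \<noteq> 0 \<or> y \<noteq> []" for j a y
  proof -
    show "join_part n (D j a y)" using y(2) by (simp add: D_def join_part_def)
    have "a \<noteq> 0 ==> y \<noteq> [] ==> a - 1 < a + length y - 1 \<and> a + length y - 1 - Suc (a - 1) = length y - 1" by (cases y) auto
    then show "D j a y \<in> splx (sjoin ?K (Delta n)) (a + length y - 1)" using y j by (simp add: D_def splx_sjoin K)
  qed
  have f: "cmap C (hcx n) (f j)" if j: "j \<in> J" for j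
  proof (rule cmapI)
    fix l assume "l \<in> chains (hcx n)"
    then obtain a y where ay: "l = zs a y" "y \<noteq> [] \<longrightarrow> y \<in> splx (Delta n) (length y - 1)" "set y \<noteq> {..n}" "a \<noteq> 0 \<or> y \<noteq> []"
      by (rule chain_zs)
    note D = Din[OF j ay(2-4)]
    have ll: "length l - 1 = a + length y - 1" using ay(1) by simp
    show "f j l \<in> splx C (length l - 1)" unfolding ll unfolding ay(1) fz by (rule h1(1)[OF D])
    fix m \<alpha> assume al: "\<alpha> \<in> splx (Delta (length l - 1)) m"
    have "f j (map (nth l) \<alpha>) = h m (join_opr ?K (Delta n) (a + length y - 1) \<alpha> (D j a y))"
    proof (cases "a = 0")
      case True
      then have y: "y \<noteq> []" using ay(4) by simp
      then have "\<forall>t\<in>set \<alpha>. t < length y" using al True ay(1) Delta_len[of \<alpha> y m] by simp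
      then have "map (nth l) \<alpha> = zs 0 (map (nth y) \<alpha>)" using map_nth_map[of \<alpha> y Suc] ay(1) True by simp
      moreover have "\<alpha> \<noteq> []" "length \<alpha> - 1 = m" using al by (auto simp: Delta_iff)
      ultimately show ?thesis using True y fz[of j 0 "map (nth y) \<alpha>"] by (simp add: D_def opr_pnerve del: map_map)
    next
      case a0: False
      show ?thesis
      proof (cases "y = []")
        case True
        have "\<forall>t\<in>set \<alpha>. t < a" using al True ay(1) a0 by (auto simp: Delta_iff)
        then have "map (nth l) \<alpha> = zs (length \<alpha>) []" using map_nth_replicate[of \<alpha> a 0] ay(1) True by simp
        moreover have "length \<alpha> - 1 = m" using al by (auto simp: Delta_iff)
        ultimately show ?thesis using True fz[of j "length \<alpha>" "[]"] by (simp add: D_def K)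
      next
        case y: False
        let ?k = "a + length y - 1" and ?i = "a - 1"
        have i: "?i < ?k" "length y = ?k - ?i" "Suc ?i = a" using a0 y by (cases y; simp)+
        define \<beta> where "\<beta> = filter (\<lambda>t. t \<le> ?i) \<alpha>"
        define \<gamma> where "\<gamma> = map (\<lambda>t. t - Suc ?i) (filter (\<lambda>t. ?i < t) \<alpha>)"
        have al': "\<alpha> \<in> splx (Delta ?k) m" using al ll by simp
        have "map (nth l) \<alpha> = zs (length \<beta>) (map (nth y) \<gamma>)"
          using zs_nth[OF al' i(1,2) \<beta>_def \<gamma>_def] ay(1) i(3) by simp
        moreover have "length \<beta> + length (map (nth y) \<gamma>) - 1 = m"
          using split_Delta(3)[OF al' i(1), folded \<beta>_def \<gamma>_def] by simp
        ultimately have "f j (map (nth l) \<alpha>) = h m (D j (length \<beta>) (map (nth y) \<gamma>))" by (simp only: fz)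
        also have "D j (length \<beta>) (map (nth y) \<gamma>) = join_opr ?K (Delta n) ?k \<alpha> (JMix ?i j y)"
          unfolding join_opr_JMix[OF \<beta>_def \<gamma>_def] by (simp add: D_def opr_pnerve K)
        also have "JMix ?i j y = D j a y" using a0 y by (simp add: D_def)
        finally show ?thesis .
      qed
    qed
    also have "\<dots> = opr C (a + length y - 1) \<alpha> (h (a + length y - 1) (D j a y))"
      by (rule h1(2)[OF D]) (use al ll in simp)
    finally show "f j (map (nth l) \<alpha>) = opr C (length l - 1) \<alpha> (f j l)" unfolding ll unfolding ay(1) fz .
  qed
  have gS: "g (map Suc y) = h (length y - 1) (JRight y)" for y by (simp add: g_def comp_def)
  have g: "cmap C (bcx n) g"
  proof (rule cmapI)
    fix l assume "l \<in> chains (bcx n)"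
    then obtain y where y: "l = map Suc y" "y \<in> splx (Delta n) (length l - 1)" "set y \<noteq> {..n}" by (rule chain_bcx)
    have z: "JRight y \<in> splx (sjoin ?K (Delta n)) (length l - 1)" "join_part n (JRight y)"
      using y by (simp_all add: splx_sjoin join_part_def)
    have ll: "length y - 1 = length l - 1" using y(1) by simp
    show "g l \<in> splx C (length l - 1)" using h1(1)[OF z] gS[of y] y(1) by simp
    fix m \<alpha> assume al: "\<alpha> \<in> splx (Delta (length l - 1)) m"
    have "y \<noteq> []" using y(2) by (auto simp: Delta_iff)
    then have "\<forall>t\<in>set \<alpha>. t < length y" using Delta_len[of \<alpha> y m] al ll by simp
    then have "map (nth l) \<alpha> = map Suc (map (nth y) \<alpha>)" using map_nth_map[of \<alpha> y Suc] y(1) by simp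
    then have "g (map (nth l) \<alpha>) = h (length \<alpha> - 1) (JRight (map (nth y) \<alpha>))" using gS[of "map (nth y) \<alpha>"] by (simp del: map_map)
    also have "length \<alpha> - 1 = m" using al by (simp add: Delta_iff)
    also have "h m (JRight (map (nth y) \<alpha>)) = opr C (length l - 1) \<alpha> (h (length l - 1) (JRight y))"
      using h1(2)[OF z al] by (simp add: opr_pnerve)
    finally show "g (map (nth l) \<alpha>) = opr C (length l - 1) \<alpha> (g l)" using gS[of y] y(1) by simp
  qed
  have v0: "JRight [0] \<in> splx (sjoin ?K (Delta 0)) 0" by (simp add: splx_sjoin Delta_iff)
  have g1: "g [1] = c 0 (JRight [0])" using hc[OF v0] by (simp add: g_def)
  have f01: "f j [0,1] = c 1 (JMix 0 j [0])" if j: "j \<in> J" for j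
  proof -
    have "JMix 0 j [0] \<in> splx (sjoin ?K (Delta 0)) 1" using j by (simp add: splx_sjoin Delta_iff K)
    from hc[OF this] show ?thesis by (simp add: f_def D_def)
  qed
  have fg: "f j l = g l" if j: "j \<in> J" and l: "l \<in> chains (bcx n)" for j l
  proof -
    obtain y where y: "l = map Suc y" "y \<in> splx (Delta n) (length l - 1)" "set y \<noteq> {..n}" by (rule chain_bcx[OF l])
    have "y \<noteq> []" using y(2) by (auto simp: Delta_iff)
    then show ?thesis using fz[of j 0 y] gS[of y] y(1) by (simp add: D_def)
  qed
  obtain s t where s: "s \<in> splx C n" and sg: "\<forall>l\<in>chains (bcx n). opr C n (map (\<lambda>i. i - 1) l) s = g l"
    and t: "\<forall>j\<in>J. t j \<in> splx C (Suc n)" and tf: "\<forall>j\<in>J. \<forall>l\<in>chains (hcx n). opr C (Suc n) l (t j) = f j l"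
    and ts: "\<forall>j\<in>J. opr C (Suc n) [1..<Suc (Suc n)] (t j) = s"
    by (rule coprodD[OF cp n g g1 f f01 fg])
  \<comment> \<open>A face of \<open>t j\<close> avoiding the apex is a face of the common
    \<open>s\<close>. This settles the operators that remove all vertices over the index.\<close>
  have tt: "opr C (Suc n) (map Suc y) (t j) = opr C n y s" if j: "j \<in> J" and y: "y \<in> splx (Delta n) m" for j y m
  proof -
    have m: "map (nth [1..<Suc (Suc n)]) y = map Suc y" using y by (auto simp: Delta_iff)
    show ?thesis using is_ssetD(3)[OF C bspec[OF t j] d0_Delta y] unfolding m bspec[OF ts j] by (rule sym)
  qed
  define F where "F m z = (case z of JLeft j => c m (JLeft j) | JRight y => opr C n y s
     | JMix i j y => opr C (Suc n) (zs (Suc i) y) (t j))" for m z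
  have zsD: "zs (Suc i) y \<in> splx (Delta (Suc n)) k" if "i < k" "y \<in> splx (Delta n) (k - Suc i)" for i y k
    using that by (auto simp: Delta_iff sorted_append sorted_iff_nth_mono[of "map Suc y"] sorted_nth_mono)
  have cl: "c m (JLeft j) = f j (zs (Suc m) [])" if j: "j \<in> J" for m j
  proof -
    have "JLeft j \<in> splx (sjoin ?K (Delta 0)) m" using j by (simp add: splx_sjoin K)
    then show ?thesis using hc fz[of j "Suc m" "[]"] by (simp add: D_def)
  qed
  have Fm: "sset_map (sjoin ?K (Delta n)) C F"
    unfolding sset_map_def
  proof (intro allI ballI)
    fix k z assume z: "z \<in> splx (sjoin ?K (Delta n)) k"
    show "F k z \<in> splx C k \<and> (\<forall>r. \<forall>\<alpha>\<in>splx (Delta k) r. F r (opr (sjoin ?K (Delta n)) k \<alpha> z) = opr C k \<alpha> (F k z))"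
    proof (cases z)
      case (JLeft j)
      then have "z \<in> splx (sjoin ?K (Delta 0)) k" using z by (simp add: splx_sjoin)
      from sset_mapD[OF c this] show ?thesis using JLeft by (auto simp: F_def opr_sjoin)
    next
      case (JRight y)
      then have y: "y \<in> splx (Delta n) k" using z by (simp add: splx_sjoin)
      then show ?thesis using is_ssetD(2,3)[OF C s y] JRight by (auto simp: F_def opr_sjoin opr_pnerve)
    next
      case (JMix i j y)
      then have i: "i < k" "j \<in> J" "y \<in> splx (Delta n) (k - Suc i)" using z by (simp_all add: splx_sjoin K)
      have ly: "length y = k - i" using i by (simp add: Delta_iff)
      note T = bspec[OF t i(2)] and zk = zsD[OF i(1,3)]
      show ?thesis
      proof (intro conjI allI ballI)
        show "F k z \<in> splx C k" using is_ssetD(2)[OF C T zk] JMix by (simp add: F_def)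
        fix r \<alpha> assume a: "\<alpha> \<in> splx (Delta k) r"
        define \<beta> where "\<beta> = filter (\<lambda>t. t \<le> i) \<alpha>"
        define \<gamma> where "\<gamma> = map (\<lambda>t. t - Suc i) (filter (\<lambda>t. i < t) \<alpha>)"
        note sp = split_Delta[OF a i(1), folded \<beta>_def \<gamma>_def]
        have e: "opr C k \<alpha> (F k z) = opr C (Suc n) (zs (length \<beta>) (map (nth y) \<gamma>)) (t j)"
          using is_ssetD(3)[OF C T zk a] zs_nth[OF a i(1) ly \<beta>_def \<gamma>_def] JMix by (simp add: F_def)
        have hz: "F r (opr (sjoin ?K (Delta n)) k \<alpha> z) =
          F r (if \<gamma> = [] then JLeft j else if \<beta> = [] then JRight (map (nth y) \<gamma>) else JMix (length \<beta> - 1) j (map (nth y) \<gamma>))"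
          unfolding JMix opr_sjoin join_opr_JMix[OF \<beta>_def \<gamma>_def] by (simp add: opr_pnerve K)
        show "F r (opr (sjoin ?K (Delta n)) k \<alpha> z) = opr C k \<alpha> (F k z)"
        proof (cases "\<gamma> = []")
          case True
          then have b: "length \<beta> = Suc r" using sp(3) by simp
          have "zs (Suc r) [] \<in> chains (hcx n)" by (rule zs_chain) auto
          then have "opr C (Suc n) (zs (Suc r) []) (t j) = c r (JLeft j)" using tf i(2) cl[OF i(2)] by simp
          then show ?thesis unfolding hz e using True b by (simp add: F_def)
        next
          case g0: False
          show ?thesis
          proof (cases "\<beta> = []")
            case True
            then show ?thesis unfolding hz e using g0 tt[OF i(2) Delta_comp(1)[OF i(3) sp(2)[OF g0]]] by (simp add: F_def)
          next
            case False
            then show ?thesis unfolding hz e using g0 by (simp add: F_def)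
          qed
        qed
      qed
    qed
  qed
  have "F m z = h m z" if z: "z \<in> splx (sjoin ?K (Delta n)) m" "join_part n z" for m z
  proof (cases z)
    case (JLeft j)
    then have "z \<in> splx (sjoin ?K (Delta 0)) m" using z by (simp add: splx_sjoin)
    then show ?thesis using hc JLeft by (simp add: F_def)
  next
    case (JRight y)
    then have y: "y \<in> splx (Delta n) m" "set y \<noteq> {..n}" using z by (simp_all add: splx_sjoin join_part_def)
    have "opr C n (map (\<lambda>i. i - 1) (map Suc y)) s = g (map Suc y)" using sg bcx_chain[OF y] by blast
    moreover have "length y - 1 = m" using y by (simp add: Delta_iff)
    ultimately show ?thesis using gS[of y] JRight by (simp add: F_def comp_def)
  next
    case (JMix i j y)
    then have i: "i < m" "j \<in> J" "y \<in> splx (Delta n) (m - Suc i)" "set y \<noteq> {..n}" using z by (simp_all add: splx_sjoin K join_part_def)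
    have ly: "length y = Suc (m - Suc i)" using i by (simp add: Delta_iff)
    have "zs (Suc i) y \<in> chains (hcx n)" using i ly by (intro zs_chain) auto
    then have "opr C (Suc n) (zs (Suc i) y) (t j) = f j (zs (Suc i) y)" using tf i(2) by blast
    also have "\<dots> = h m (D j (Suc i) y)" unfolding fz using ly i(1) by simp
    also have "D j (Suc i) y = z" using JMix ly by (auto simp: D_def)
    finally show ?thesis using JMix by (simp add: F_def)
  qed
  then show "\<exists>F. sset_map (sjoin ?K (Delta n)) C F \<and> (\<forall>m. \<forall>z\<in>splx (sjoin ?K (Delta n)) m. join_part n z \<longrightarrow> F m z = h m z)"
    using Fm by blast
qed

section \<open>Push-out squares with initial corner\<close>

text \<open>The vertex \<open>0\<close> is the initial corner, \<open>1\<close> one of the two intermediate corners.\<close>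

lemma initial_corner_prepare:
  fixes f :: "bool => nat list => 'c"
  assumes C: "is_sset C" and n: "0 < n" and g: "cmap C (bcx n) g" and f: "\<And>t. cmap C (hcx n) (f t)"
    and fg: "\<And>t l. l \<in> chains (bcx n) ==> f t l = g l"
    and r: "\<And>t. r t \<in> splx C 2" "\<And>t. opr C 2 [1,2] (r t) = f t [0,1]" "\<And>t. opr C 2 [0,2] (r t) = d"
    and ini: "\<And>t. initial C (opr C 2 [0] (r t))"
  shows "\<exists>h. \<forall>t. cmap C (cocx {0,1} {2..2+n}) (h t) \<and> (\<forall>l\<in>chains (full {0..2}). h t l = opr C 2 l (r t)) \<and>
    (\<forall>l\<in>chains (hcx n). h t (map Suc l) = f t l) \<and> (\<forall>l\<in>chains (cocx {0} {2..2+n}). h t l = h True l)"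
proof -
  define F where "F = {2..2+n}"
  have F23: "2 \<in> F" "3 \<in> F" using n by (auto simp: F_def)
  have F01: "0 \<notin> F" "1 \<notin> F" by (auto simp: F_def)
  have finF: "finite F" by (simp add: F_def)
  have F1: "F = {Suc 1..Suc 1 + n}" by (auto simp: F_def)
  let ?p = "\<lambda>i. i - 1 :: nat"
  have sc: "subcomplex (cocx S F)" if "finite S" for S by (rule subcomplex_cocx[OF that finF])
  have noF: "\<not> F \<subseteq> {0,1,2}"
  proof -
    have "3 \<notin> {0,1,2::nat}" by simp
    then show ?thesis using F23 by blast
  qed
  have s02: "{0..2} = {0,1,2::nat}" by auto
  have dnp: "map (dn 1) l = map ?p l" for l by (auto simp: dn_def)
  have r1: "opr C 1 [1] d = g [1]" "d \<in> splx C 1"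
  proof -
    have e: "opr C 1 [1] (opr C 2 [a,2] (r True)) = opr C 2 [2] (r True)" if "a \<le> 2" for a
      using is_ssetD(3)[OF C r(1)[of True], of "[a,2]" 1 "[1]" 0] that by (simp add: Delta_iff)
    have "g [1] = f True [1]" using fg[OF low_chains(3)[OF n]] by simp
    also have "\<dots> = opr C 1 [1] (f True [0,1])"
      using cmapD(2)[OF f low_chains(2)[OF n], of "[1]" 0 True] by (simp add: Delta_iff)
    finally show "opr C 1 [1] d = g [1]" using r(2,3)[of True] e[of 0] e[of 1] by simp
    show "d \<in> splx C 1" using is_ssetD(2)[OF C r(1)[of True], of "[0,2]" 1] r(3)[of True] by (simp add: Delta_iff)
  qed
  let ?A = "cocx {} F"
  let ?g0 = "\<lambda>l. g (map (dn 1) l)"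
  have dnA: "dn 1 ` \<tau> \<in> bcx n" if "\<tau> \<in> ?A" for \<tau>
  proof (rule dn_faces)
    show "\<tau> \<in> faces_of (Suc 1) n" using that unfolding faces_of_def cocx_def F1 by blast
  qed
  have g0: "cmap C ?A ?g0" by (rule cmap_relabel[OF g mono_dn dnA])
  have in2: "{2} \<in> ?A" "{1,2} \<in> cocx {1} F" by (rule cocxI; use F23 noF in blast)+
  \<comment> \<open>The diagonal and all cones from the initial corner are built before the two
    intermediate corners are treated separately, so that both results coincide there.\<close>
  let ?g1 = "attach C {0,2} d ?g0"
  have g1: "cmap C (?A \<union> full {0,2}) ?g1" "\<And>l. l \<in> chains ?A ==> ?g1 l = ?g0 l"
  proof -
    have a: "\<exists>\<tau>\<in>{{2}}. \<rho> \<subseteq> \<tau>" if "\<rho> \<in> ?A" "\<rho> \<subseteq> {0,2}" for \<rho>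
      using that F01 unfolding cocx_def by blast
    have b: "\<tau> \<in> ?A \<and> \<tau> \<subseteq> {0,2}" if "\<tau> \<in> {{2}}" for \<tau> using that in2 by auto
    have "{w \<in> {0,2::nat}. w < 2} = {0}" by auto
    then have "pos {0,2} 2 = 1" by (simp add: pos_def)
    then have c: "opr C (card {0,2::nat} - 1) (map (pos {0,2}) (sorted_list_of_set \<tau>)) d = ?g0 (sorted_list_of_set \<tau>)"
      if "\<tau> \<in> {{2}}" for \<tau> using that r1(1) by (simp add: dn_def)
    have dd: "d \<in> splx C (card {0,2::nat} - 1)" using r1(2) by simp
    show "cmap C (?A \<union> full {0,2}) ?g1" "\<And>l. l \<in> chains ?A ==> ?g1 l = ?g0 l"
      by (rule cmap_attach_faces[OF C sc g0 _ dd b a c]; simp)+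
  qed
  define K1 where "K1 = ?A \<union> full {0,2}"
  define \<A> where "\<A> = {\<phi>. \<phi> \<subset> F \<and> \<phi> \<noteq> {} \<and> \<phi> \<noteq> {2}}"
  have Ac: "\<psi> = {} \<or> \<psi> = {2} \<or> \<psi> \<in> \<A>" if "\<psi> \<subset> F" for \<psi>
    using that unfolding \<A>_def by (cases "\<psi> = {}"; cases "\<psi> = {2}"; simp)
  have s1: "subcomplex K1" unfolding K1_def by (intro subcomplex_Un sc subcomplex_full) simp_all
  have K1A: "\<tau> \<in> K1" if "\<tau> \<subset> F" "\<tau> \<noteq> {}" for \<tau> using that unfolding K1_def cocx_def by blast
  have K1f: "\<tau> \<in> K1" if "\<tau> \<subseteq> {0,2}" "\<tau> \<noteq> {}" for \<tau> using that unfolding K1_def full_def by blast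
  have K1c: "\<tau> \<subseteq> {0,2}" if "\<tau> \<in> K1" "0 \<in> \<tau>" for \<tau>
  proof -
    have "\<tau> \<notin> ?A" using that(2) F01 unfolding cocx_def by blast
    then show ?thesis using that(1) unfolding K1_def full_def by blast
  qed
  have g10: "?g1 [0] = opr C 2 [0] (r True)"
  proof -
    have "?g1 [0] = opr C 1 [0] d" using attach_nth[of "{0,2}" "[0]" 0 "[0]" C d ?g0] by (simp add: Delta_iff)
    then show ?thesis using is_ssetD(3)[OF C r(1)[of True], of "[0,2]" 1 "[0]" 0] r(3)[of True] by (simp add: Delta_iff)
  qed
  have "\<exists>f'. cmap C (K1 \<union> (\<union>) {0} ` \<A>) f' \<and> subcomplex (K1 \<union> (\<union>) {0} ` \<A>) \<and> (\<forall>l\<in>chains K1. f' l = ?g1 l)"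
  proof (rule initial_cone[OF C s1 g1(1)[folded K1_def] finF, where u = 0])
    show "initial C (?g1 [0])" unfolding g10 by (rule ini)
    show "{0} \<in> K1" by (rule K1f) auto
    show "{0} \<inter> F = {}" using F01 by blast
    fix \<phi> assume \<phi>: "\<phi> \<in> \<A>"
    then have \<phi>': "\<phi> \<subset> F" "\<phi> \<noteq> {}" "\<phi> \<noteq> {2}" by (simp_all add: \<A>_def)
    then show "\<phi> \<subseteq> F" by blast
    show "{0} \<union> \<phi> \<notin> K1"
    proof
      assume "{0} \<union> \<phi> \<in> K1"
      then have "\<phi> \<subseteq> {0,2}" using K1c[of "{0} \<union> \<phi>"] by blast
      then have "\<phi> \<subseteq> {2}" using \<phi>'(1) F01 by blast
      then show False using \<phi>' by blast
    qed
    fix \<tau> assume t: "\<tau> \<subset> {0} \<union> \<phi>" "\<tau> \<noteq> {}"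
    show "\<tau> \<in> K1 \<or> (\<exists>\<psi>\<in>\<A>. \<psi> \<subset> \<phi> \<and> \<tau> = {0} \<union> \<psi>)"
    proof (cases "0 \<in> \<tau>")
      case False
      then have "\<tau> \<subset> F" using t(1) \<phi>'(1) by blast
      then show ?thesis using K1A t(2) by blast
    next
      case True
      then have e: "\<tau> = {0} \<union> (\<tau> - {0})" "\<tau> - {0} \<subset> \<phi>" using t(1) \<phi>'(1) F01 by blast+
      from Ac[OF psubset_trans[OF e(2) \<phi>'(1)]] show ?thesis
      proof (elim disjE)
        assume "\<tau> - {0} = {}" then show ?thesis using K1f[of \<tau>] e(1) t(2) by blast
      next
        assume "\<tau> - {0} = {2}" then show ?thesis using K1f[of \<tau>] e(1) t(2) by blast
      next
        assume "\<tau> - {0} \<in> \<A>" then show ?thesis using e by blast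
      qed
    qed
  qed (auto simp: \<A>_def)
  then obtain g2 where g2': "cmap C (K1 \<union> (\<union>) {0} ` \<A>) g2" "\<forall>l\<in>chains K1. g2 l = ?g1 l"
    by (elim exE conjE) (rule that)
  have "cocx {0} F \<subseteq> K1 \<union> (\<union>) {0} ` \<A>"
  proof
    fix \<tau> assume "\<tau> \<in> cocx {0} F"
    then have t: "\<tau> \<subseteq> {0} \<union> F" "\<tau> \<noteq> {}" "\<not> F \<subseteq> \<tau>" by (simp_all add: cocx_def)
    show "\<tau> \<in> K1 \<union> (\<union>) {0} ` \<A>"
    proof (cases "0 \<in> \<tau>")
      case False
      then have "\<tau> \<subset> F" using t by blast
      then show ?thesis using K1A t(2) by blast
    next
      case True
      then have e: "\<tau> = {0} \<union> (\<tau> - {0})" "\<tau> - {0} \<subset> F" using t F01 by blast+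
      from Ac[OF e(2)] show ?thesis
      proof (elim disjE)
        assume "\<tau> - {0} = {}" then show ?thesis using K1f[of \<tau>] e(1) t(2) by blast
      next
        assume "\<tau> - {0} = {2}" then show ?thesis using K1f[of \<tau>] e(1) t(2) by blast
      next
        assume "\<tau> - {0} \<in> \<A>" then show ?thesis using e by blast
      qed
    qed
  qed
  then have g2: "cmap C (cocx {0} F) g2" by (rule cmap_mono[OF g2'(1)])
  let ?B = "cocx {1} F"
  let ?f0 = "\<lambda>t l. f t (map ?p l)"
  have monop: "mono_on S ?p" for S by (auto simp: mono_on_def)
  have pB: "?p ` \<tau> \<in> hcx n" if "\<tau> \<in> ?B" for \<tau>
  proof -
    have t: "\<tau> \<subseteq> {1} \<union> F" "\<tau> \<noteq> {}" "\<not> F \<subseteq> \<tau>" using that by (simp_all add: cocx_def)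
    obtain v where v: "v \<in> F" "v \<notin> \<tau>" using t(3) by blast
    have ge: "1 \<le> w" "w \<le> 2 + n" if "w \<in> \<tau>" for w using t(1) that by (auto simp: F_def)
    have "?p v \<notin> ?p ` \<tau>"
    proof
      assume "?p v \<in> ?p ` \<tau>"
      then obtain w where w: "w \<in> \<tau>" "?p v = ?p w" by blast
      have "1 \<le> v" using v(1) by (simp add: F_def)
      then have "v = w" using w(2) ge(1)[OF w(1)] by simp
      then show False using v w by simp
    qed
    moreover have "?p v \<in> {1..Suc n}" using v(1) by (auto simp: F_def)
    moreover have "?p ` \<tau> \<subseteq> {..Suc n}" using ge(2) by fastforce
    ultimately show ?thesis using t(2) unfolding hcx_def by blast
  qed
  have f0: "cmap C ?B (?f0 t)" for t by (rule cmap_relabel[OF f monop pB])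
  \<comment> \<open>The triangle \<open>r t\<close> links the initial corner to the datum for the
    corner \<open>t\<close>, which now occupies the vertices 1 and \<open>F\<close>.\<close>
  let ?f1 = "\<lambda>t. attach C {0..2} (r t) (?f0 t)"
  have f1: "cmap C (?B \<union> full {0..2}) (?f1 t)" "\<And>l. l \<in> chains ?B ==> ?f1 t l = ?f0 t l" for t
  proof -
    have a: "\<exists>\<tau>\<in>{{1,2}}. \<rho> \<subseteq> \<tau>" if "\<rho> \<in> ?B" "\<rho> \<subseteq> {0..2}" for \<rho>
    proof -
      have "0 \<notin> {1} \<union> F" using F01 by auto
      then have "0 \<notin> \<rho>" using that(1) unfolding cocx_def by blast
      then show ?thesis using that(2) unfolding s02 by blast
    qed
    have b: "\<tau> \<in> ?B \<and> \<tau> \<subseteq> {0..2}" if "\<tau> \<in> {{1,2}}" for \<tau> using that in2 by auto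
    have c: "opr C (card {0..2::nat} - 1) (map (pos {0..2}) (sorted_list_of_set \<tau>)) (r t) = ?f0 t (sorted_list_of_set \<tau>)"
      if "\<tau> \<in> {{1,2}}" for \<tau> using that r(2)[of t] by (simp add: pos_ivl)
    have dd: "r t \<in> splx C (card {0..2::nat} - 1)" using r(1) by simp
    show "cmap C (?B \<union> full {0..2}) (?f1 t)" "\<And>l. l \<in> chains ?B ==> ?f1 t l = ?f0 t l"
      by (rule cmap_attach_faces[OF C sc f0 _ dd b a c]; simp)+
  qed
  have f1r: "?f1 t l = opr C 2 l (r t)" if "l \<in> chains (full {0..2})" for l t
  proof -
    have s: "set l \<subseteq> {0..2}" using that by (simp add: chains_def full_def)
    then have "map (pos {0..2}) l = l" by (auto simp: pos_ivl intro!: map_idI)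
    then show ?thesis using s by (simp add: attach_def)
  qed
  define K2 where "K2 = ?B \<union> full {0..2}"
  have s2: "subcomplex K2" unfolding K2_def by (intro subcomplex_Un sc subcomplex_full) simp_all
  have chA: "l \<in> chains K1 \<and> g2 l = g (map ?p l)" if "l \<in> chains ?A" for l
  proof -
    have "l \<in> chains K1" using that unfolding K1_def chains_Un by blast
    then show ?thesis using bspec[OF g2'(2), of l] g1(2)[OF that] unfolding dnp by simp
  qed
  have agree: "?f1 t l = g2 l" if l: "l \<in> chains K2" "l \<in> chains (cocx {0} F)" for l t
  proof (cases "l \<in> chains ?B")
    case True
    have "set l \<subseteq> {1} \<union> F" "set l \<subseteq> {0} \<union> F" "\<not> F \<subseteq> set l" "set l \<noteq> {}"
      using True l(2) unfolding chains_def cocx_def by blast+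
    moreover have "({1} \<union> F) \<inter> ({0} \<union> F) \<subseteq> {} \<union> F" by auto
    ultimately have "set l \<in> ?A" by (intro cocxI) blast+
    then have lA: "l \<in> chains ?A" using l by (simp add: chains_def)
    have "map ?p l \<in> chains (bcx n)"
      using chains_map[OF lA mono_dn dnA] unfolding dnp .
    then show ?thesis using f1(2)[OF True] chA[OF lA] fg by simp
  next
    case False
    then have "set l \<subseteq> {0..2}" using l(1) unfolding K2_def chains_def full_def by blast
    moreover have "1 \<notin> {0} \<union> F" using F01 by auto
    then have "1 \<notin> set l" using l(2) unfolding chains_def cocx_def by blast
    ultimately have "set l \<subseteq> {0,2}" unfolding s02 by blast
    then have lf: "l \<in> chains (full {0,2})" using l by (simp add: chains_def full_def)
    show ?thesis
    proof (rule cmap_eq_on_full[OF _ _ _ _ _ lf])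
      show "cmap C (full {0,2}) (?f1 t)"
        by (rule cmap_mono[OF f1(1)]) (auto simp: full_def)
      show "cmap C (full {0,2}) g2"
        by (rule cmap_mono[OF g2'(1)]) (auto simp: K1_def)
      have c: "[0,2] \<in> chains (full {0..2})" "[0,2] \<in> chains K1"
        by (simp_all add: chains_def full_def K1_def)
      have "?g1 [0,2] = d" using attach_top[OF C, of "{0,2}" d ?g0] r1(2) by simp
      then show "?f1 t (sorted_list_of_set {0,2}) = g2 (sorted_list_of_set {0,2})"
        using f1r[OF c(1), of t] r(3)[of t] bspec[OF g2'(2) c(2)] by simp
    qed auto
  qed
  define K3 where "K3 = K2 \<union> cocx {0} F"
  define h2 where "h2 t l = (if set l \<in> K2 then ?f1 t l else g2 l)" for t l
  have s3: "subcomplex K3" unfolding K3_def by (intro subcomplex_Un s2 sc) simp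
  have h2: "cmap C K3 (h2 t)" for t
    unfolding K3_def h2_def by (rule cmap_glue[OF s2 sc f1(1)[folded K2_def] g2 agree]) simp_all
  have h2f: "h2 t l = ?f1 t l" if "l \<in> chains K2" for t l using that by (simp add: h2_def chains_def)
  have h2g: "h2 t l = g2 l" if "l \<in> chains (cocx {0} F)" for t l
  proof (cases "set l \<in> K2")
    case True
    then have "l \<in> chains K2" using that by (simp add: chains_def)
    then show ?thesis using agree[OF _ that] h2f by simp
  qed (simp add: h2_def)
  have K3f: "\<tau> \<in> K3" if "\<tau> \<subseteq> {0,1,2}" "\<tau> \<noteq> {}" for \<tau>
    using that unfolding K3_def K2_def full_def s02 by blast
  have K3c: "\<tau> \<in> K3" if "0 \<notin> \<tau> \<or> 1 \<notin> \<tau>" "\<tau> \<subseteq> {0,1} \<union> F" "\<not> F \<subseteq> \<tau>" "\<tau> \<noteq> {}" for \<tau>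
    using that unfolding K3_def K2_def cocx_def by blast
  have K3d: "\<tau> \<subseteq> {0,1,2}" if t: "\<tau> \<in> K3" "0 \<in> \<tau>" "1 \<in> \<tau>" for \<tau>
  proof -
    have "0 \<notin> {1} \<union> F" "1 \<notin> {0} \<union> F" using F01 by auto
    then have "\<tau> \<notin> ?B" "\<tau> \<notin> cocx {0} F" using t(2,3) unfolding cocx_def by blast+
    then show ?thesis using t(1) unfolding K3_def K2_def full_def s02 by blast
  qed
  have ex3: "\<exists>f'. cmap C (K3 \<union> (\<union>) {0,1} ` \<A>) f' \<and> subcomplex (K3 \<union> (\<union>) {0,1} ` \<A>) \<and> (\<forall>l\<in>chains K3. f' l = h2 t l)" for t
  proof (rule initial_cone[OF C s3 h2 finF, where u = 0])
    have c: "[0] \<in> chains (full {0..2})" by (simp add: chains_def full_def)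
    then have "[0] \<in> chains K2" unfolding K2_def chains_Un by blast
    then have "h2 t [0] = opr C 2 [0] (r t)" using h2f f1r[OF c] by simp
    then show "initial C (h2 t [0])" using ini by simp
    show "{0} \<in> K3" by (rule K3f) auto
    show "{0,1} \<inter> F = {}" using F01 by blast
    fix \<phi> assume \<phi>: "\<phi> \<in> \<A>"
    then have \<phi>': "\<phi> \<subset> F" "\<phi> \<noteq> {}" "\<phi> \<noteq> {2}" by (simp_all add: \<A>_def)
    then show "\<phi> \<subseteq> F" by blast
    show "{0,1} \<union> \<phi> \<notin> K3"
    proof
      assume "{0,1} \<union> \<phi> \<in> K3"
      then have "\<phi> \<subseteq> {0,1,2}" using K3d[of "{0,1} \<union> \<phi>"] by blast
      then have "\<phi> \<subseteq> {2}" using \<phi>'(1) F01 by blast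
      then show False using \<phi>' by blast
    qed
    fix \<tau> assume t: "\<tau> \<subset> {0,1} \<union> \<phi>" "\<tau> \<noteq> {}"
    have tF: "\<tau> \<subseteq> {0,1} \<union> F" "\<not> F \<subseteq> \<tau>" using t(1) \<phi>'(1) F01 by blast+
    show "\<tau> \<in> K3 \<or> (\<exists>\<psi>\<in>\<A>. \<psi> \<subset> \<phi> \<and> \<tau> = {0,1} \<union> \<psi>)"
    proof (cases "0 \<notin> \<tau> \<or> 1 \<notin> \<tau>")
      case True
      then show ?thesis using K3c[OF True tF t(2)] by blast
    next
      case False
      let ?\<psi> = "\<tau> \<inter> \<phi>"
      have e: "\<tau> = {0,1} \<union> ?\<psi>" using False t(1) by blast
      have sub: "?\<psi> \<subset> \<phi>" using e t(1) by blast
      from Ac[OF psubset_trans[OF sub \<phi>'(1)]] show ?thesis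
      proof (elim disjE)
        assume "?\<psi> = {}" then show ?thesis using K3f[of \<tau>] e t(2) by blast
      next
        assume "?\<psi> = {2}" then show ?thesis using K3f[of \<tau>] e t(2) by blast
      next
        assume "?\<psi> \<in> \<A>" then show ?thesis using e sub by blast
      qed
    qed
  qed (auto simp: \<A>_def)
  then have "\<forall>t. \<exists>f'. cmap C (K3 \<union> (\<union>) {0,1} ` \<A>) f' \<and> subcomplex (K3 \<union> (\<union>) {0,1} ` \<A>) \<and> (\<forall>l\<in>chains K3. f' l = h2 t l)" by blast
  from choice[OF this] obtain h where "\<forall>t. cmap C (K3 \<union> (\<union>) {0,1} ` \<A>) (h t) \<and> subcomplex (K3 \<union> (\<union>) {0,1} ` \<A>) \<and> (\<forall>l\<in>chains K3. h t l = h2 t l)"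
    by (elim exE) (rule that)
  then have h: "\<And>t. cmap C (K3 \<union> (\<union>) {0,1} ` \<A>) (h t)" "\<And>t l. l \<in> chains K3 ==> h t l = h2 t l" by blast+
  have sub3: "cocx {0,1} F \<subseteq> K3 \<union> (\<union>) {0,1} ` \<A>"
  proof
    fix \<tau> assume "\<tau> \<in> cocx {0,1} F"
    then have t: "\<tau> \<subseteq> {0,1} \<union> F" "\<tau> \<noteq> {}" "\<not> F \<subseteq> \<tau>" by (simp_all add: cocx_def)
    show "\<tau> \<in> K3 \<union> (\<union>) {0,1} ` \<A>"
    proof (cases "0 \<notin> \<tau> \<or> 1 \<notin> \<tau>")
      case True
      then show ?thesis using K3c[OF True t(1,3,2)] by blast
    next
      case False
      let ?\<psi> = "\<tau> \<inter> F"
      have e: "\<tau> = {0,1} \<union> ?\<psi>" using False t(1) by blast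
      have "?\<psi> \<subset> F" using t(3) by blast
      from Ac[OF this] show ?thesis
      proof (elim disjE)
        assume "?\<psi> = {}" then show ?thesis using K3f[of \<tau>] e t(2) by blast
      next
        assume "?\<psi> = {2}" then show ?thesis using K3f[of \<tau>] e t(2) by blast
      next
        assume "?\<psi> \<in> \<A>" then show ?thesis using e by blast
      qed
    qed
  qed
  have K23: "chains K2 \<subseteq> chains K3" "chains (cocx {0} F) \<subseteq> chains K3" unfolding K3_def chains_Un by blast+
  have SucB: "map Suc l \<in> chains ?B" "map ?p (map Suc l) = l" if "l \<in> chains (hcx n)" for l
  proof -
    have mS: "mono_on S Suc" for S by (auto simp: mono_on_def)
    have "Suc ` \<tau> \<in> ?B" if t: "\<tau> \<in> hcx n" for \<tau>
    proof (rule cocxI)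
      have FS: "F = Suc ` {1..Suc n}" by (simp add: F_def numeral_2_eq_2)
      show "\<not> F \<subseteq> Suc ` \<tau>" using t unfolding FS hcx_def by blast
      have "Suc ` {..Suc n} \<subseteq> {1} \<union> F" by (auto simp: F_def)
      then show "Suc ` \<tau> \<subseteq> {1} \<union> F" using t unfolding hcx_def by blast
      show "Suc ` \<tau> \<noteq> {}" using t by (simp add: hcx_def)
    qed
    then show "map Suc l \<in> chains ?B" by (rule chains_map[OF that mS])
    show "map ?p (map Suc l) = l" by (simp add: comp_def)
  qed
  show ?thesis
  proof (rule exI[of _ h], intro allI conjI ballI)
    fix t
    show "cmap C (cocx {0,1} {2..2+n}) (h t)" using cmap_mono[OF h(1) sub3] by (simp add: F_def)
    show "h t l = opr C 2 l (r t)" if l: "l \<in> chains (full {0..2})" for l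
    proof -
      have "l \<in> chains K2" using l unfolding K2_def chains_Un by blast
      then show ?thesis using h(2) h2f f1r[OF l] K23 by (metis subsetD)
    qed
    show "h t (map Suc l) = f t l" if l: "l \<in> chains (hcx n)" for l
    proof -
      have c: "map Suc l \<in> chains K2" using SucB(1)[OF l] unfolding K2_def chains_Un by blast
      have "h t (map Suc l) = ?f1 t (map Suc l)" using h(2)[OF subsetD[OF K23(1) c]] h2f[OF c] by simp
      also have "\<dots> = f t (map ?p (map Suc l))" by (rule f1(2)[OF SucB(1)[OF l]])
      finally show ?thesis using SucB(2)[OF l] by simp
    qed
    show "h t l = h True l" if "l \<in> chains (cocx {0} {2..2+n})" for l
    proof -
      have l: "l \<in> chains (cocx {0} F)" using that by (simp add: F_def)
      show ?thesis using h(2)[OF subsetD[OF K23(2) l]] h2g[OF l] by simp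
    qed
  qed
qed

text \<open>The index poset of a push-out; as a diagram shape it has (0,0) as common source of two
  arrows.\<close>

definition cospan :: "(nat \<times> nat) set" where "cospan = {(0,0),(0,1),(1,0)}"

text \<open>Two horns with a common base only lack data over the initial corner. Initiality supplies
  these, equally for both intermediate corners, and the push-out property extends the result; the
  extension contains a common base and a cone over it for each corner.\<close>

lemma pushout_coprod:
  assumes C: "is_sset C" and po: "pushout_square C q" and ini: "initial C (q 0 [(0,0)])"
  shows "coprod C UNIV (q 0 [(1,1)]) (\<lambda>t. if t then q 1 [(1,0),(1,1)] else q 1 [(0,1),(1,1)])"
  unfolding coprod_def
proof (intro allI impI, elim conjE, goal_cases)
  case (1 n g f)
  note n = 1(1) and g = 1(2) and g1 = 1(3)
  define p where "p t = (if t then (1,0) else (0,1) :: nat \<times> nat)" for t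
  have f: "\<And>t. cmap C (hcx n) (f t)" "\<And>t. f t [0,1] = q 1 [p t,(1,1)]"
    "\<And>t l. l \<in> chains (bcx n) ==> f t l = g l"
    using 1(4) by (simp_all add: p_def)
  let ?S = "pnerve ({..1} \<times> {..1}) square_le" and ?K = "pnerve cospan square_le"
  define c where "c = chain_cocone id (1,1) q"
  have sq: "sset_map ?S C q" and cc: "colimit_cocone ?K C c"
    using po by (simp_all add: pushout_square_def square_def cospan_def c_def)
  have sK: "is_sset ?K" by (rule is_sset_pnerve) (simp add: reflp_on_def prod_le_def)
  \<comment> \<open>The two triangles into which the diagonal cuts the square.\<close>
  define r where "r t = q 2 [(0,0), p t, (1,1)]" for t
  have v: "[(0,0), p t, (1,1)] \<in> splx ?S 2" for t by (simp add: splx_pnerve p_def prod_le_def)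
  have qr: "q m (map (nth [(0,0), p t, (1,1)]) \<alpha>) = opr C 2 \<alpha> (r t)" if "\<alpha> \<in> splx (Delta 2) m" for \<alpha> m t
    using sset_mapD(2)[OF sq v that] by (simp add: r_def opr_pnerve)
  have r: "\<And>t. r t \<in> splx C 2" "\<And>t. opr C 2 [1,2] (r t) = f t [0,1]" "\<And>t. opr C 2 [0,2] (r t) = q 1 [(0,0),(1,1)]"
    "\<And>t. initial C (opr C 2 [0] (r t))"
    using sset_mapD(1)[OF sq v, folded r_def] qr[of "[1,2]" 1] qr[of "[0,2]" 1] qr[of "[0]" 0] f(2) ini
    by (simp_all add: Delta_iff)
  let ?F = "{2..2+n}"
  have exh: "\<exists>h. \<forall>t. cmap C (cocx {0,1} ?F) (h t) \<and> (\<forall>l\<in>chains (full {0..2}). h t l = opr C 2 l (r t)) \<and>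
    (\<forall>l\<in>chains (hcx n). h t (map Suc l) = f t l) \<and> (\<forall>l\<in>chains (cocx {0} ?F). h t l = h True l)"
    by (rule initial_corner_prepare[where f = f and r = r and g = g and d = "q 1 [(0,0),(1,1)]"])
      (assumption | rule C n g f(1) f(3) r)+
  then obtain h where h': "\<forall>t. cmap C (cocx {0,1} ?F) (h t) \<and> (\<forall>l\<in>chains (full {0..2}). h t l = opr C 2 l (r t)) \<and>
    (\<forall>l\<in>chains (hcx n). h t (map Suc l) = f t l) \<and> (\<forall>l\<in>chains (cocx {0} ?F). h t l = h True l)"
    by (elim exE) (rule that)
  have h: "\<And>t. cmap C (cocx {0,1} ?F) (h t)" "\<And>t l. l \<in> chains (full {0..2}) ==> h t l = opr C 2 l (r t)"
    "\<And>t l. l \<in> chains (hcx n) ==> h t (map Suc l) = f t l" "\<And>t t' l. l \<in> chains (cocx {0} ?F) ==> h t l = h t' l"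
  proof -
    fix t t' l assume l: "l \<in> chains (cocx {0} ?F)"
    have "h t l = h True l" "h t' l = h True l" using h' l by blast+
    then show "h t l = h t' l" by simp
  qed (use h' in blast)+
  \<comment> \<open>A simplex of the join is encoded by a chain with 0 for the initial corner, 1 for
    either intermediate corner and entries from 2 on for the base; \<open>tt\<close> remembers which
    intermediate corner is meant.\<close>
  define co where "co x = (if x = (0,0) then 0 else 1 :: nat)" for x :: "nat \<times> nat"
  define enc where "enc z = (case z of JLeft l => map co l | JRight y => map (\<lambda>i. i + 2) y
    | JMix i l y => map co l @ map (\<lambda>i. i + 2) y)" for z :: "((nat \<times> nat) list, nat list) join"
  define tt where "tt z = (case z of JLeft l => (1,0) \<in> set l | JRight y => True
    | JMix i l y => (1,0) \<in> set l)" for z :: "((nat \<times> nat) list, nat list) join"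
  define ok where "ok t z = (case z of JLeft l => set l \<subseteq> {(0,0), p t} | JRight y => True
    | JMix i l y => set l \<subseteq> {(0,0), p t})" for t and z :: "((nat \<times> nat) list, nat list) join"
  define H where "H m z = h (tt z) (enc z)" for m :: nat and z
  have srt: "square_le (l ! a) (l ! b)" if "l \<in> splx ?K m" "a < b" "b < length l" for l m a b
    using that by (simp add: splx_pnerve sorted_wrt_iff_nth_less)
  \<comment> \<open>The two intermediate corners are incomparable, so a chain meets at most one of
    them.\<close>
  have one: "set l \<subseteq> {(0,0), p ((1,0) \<in> set l)}" if l: "l \<in> splx ?K m" for l m
  proof (cases "(1,0) \<in> set l")
    case True
    have "\<not> ((0,1) \<in> set l)"
    proof
      assume "(0,1) \<in> set l"
      then obtain a b where ab: "a < length l" "b < length l" "l ! a = (1,0)" "l ! b = (0,1)"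
        using True by (metis in_set_conv_nth)
      have "a < b \<or> b < a" using ab by (cases a b rule: linorder_cases) auto
      then show False using srt[OF l, of a b] srt[OF l, of b a] ab by (auto simp: prod_le_def)
    qed
    then show ?thesis using True l by (auto simp: splx_pnerve cospan_def p_def)
  next
    case False
    then show ?thesis using l by (auto simp: splx_pnerve cospan_def p_def)
  qed
  have sorted_co: "sorted (map co l)" if l: "l \<in> splx ?K m" for l m
    unfolding sorted_iff_nth_mono_less
  proof (intro allI impI)
    fix a b assume ab: "a < b" "b < length (map co l)"
    then have "square_le (l ! a) (l ! b)" using srt[OF l] by simp
    then show "map co l ! a \<le> map co l ! b" using ab by (cases "l ! a"; cases "l ! b") (auto simp: co_def prod_le_def)
  qed
  have enc_ch: "enc z \<in> chains (cocx {0,1} ?F) \<and> length (enc z) = Suc m"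
    if z: "z \<in> splx (sjoin ?K (Delta n)) m" "join_part n z" for z m
  proof -
    have F2: "?F = (\<lambda>i. i + 2) ` {..n}"
    proof -
      have "(\<lambda>i. i + 2) ` {0..n} = ?F" by (subst image_add_atLeastAtMost') simp
      then show ?thesis by (simp add: atMost_atLeast0)
    qed
    have y: "set (map (\<lambda>i. i + 2) y) \<subseteq> ?F \<and> \<not> ?F \<subseteq> set (map (\<lambda>i. i + 2) y)" if "set y \<noteq> {..n}" "set y \<subseteq> {..n}" for y
    proof -
      have "inj (\<lambda>i::nat. i + 2)" by (simp add: inj_def)
      then show ?thesis using that unfolding F2 set_map by (auto simp: inj_image_subset_iff)
    qed
    have c01: "set (map co l) \<subseteq> {0,1}" for l by (auto simp: co_def)
    have disj: "?F \<inter> {0,1} = {}" by auto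
    have neF: "?F \<noteq> {}" by simp
    show ?thesis
    proof (cases z)
      case (JLeft l)
      then have l: "l \<in> splx ?K m" using z by (simp add: splx_sjoin)
      have "set (map co l) \<in> cocx {0,1} ?F"
        by (rule cocxI) (use c01[of l] disj neF l in \<open>blast, force simp: splx_pnerve, blast\<close>)
      then show ?thesis using JLeft l sorted_co[OF l] by (auto simp: enc_def chains_def splx_pnerve)
    next
      case (JRight y)
      then have yy: "y \<in> splx (Delta n) m" "set y \<noteq> {..n}" using z by (simp_all add: splx_sjoin join_part_def)
      then have ys: "set y \<subseteq> {..n}" "sorted y" "length y = Suc m" by (simp_all add: Delta_iff)
      have "set (map (\<lambda>i. i + 2) y) \<in> cocx {0,1} ?F"
        by (rule cocxI) (use y[OF yy(2) ys(1)] ys(3) in \<open>blast, force, blast\<close>)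
      then show ?thesis using JRight ys by (auto simp: enc_def chains_def sorted_iff_nth_mono)
    next
      case (JMix i l y)
      then have i: "i < m" "l \<in> splx ?K i" "y \<in> splx (Delta n) (m - Suc i)" "set y \<noteq> {..n}"
        using z by (simp_all add: splx_sjoin join_part_def)
      then have ys: "set y \<subseteq> {..n}" "sorted y" "length y = Suc (m - Suc i)" "length l = Suc i" by (simp_all add: Delta_iff splx_pnerve)
      have s: "set (map co l @ map (\<lambda>i. i + 2) y) = set (map co l) \<union> set (map (\<lambda>i. i + 2) y)" by simp
      have "set (map co l @ map (\<lambda>i. i + 2) y) \<in> cocx {0,1} ?F" unfolding s
        by (rule cocxI) (use y[OF i(4) ys(1)] c01[of l] disj ys(3) in \<open>blast, force, blast\<close>)
      moreover have "sorted (map co l @ map (\<lambda>i. i + 2) y)"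
        using sorted_co[OF i(2)] ys(2) unfolding sorted_append by (auto simp: co_def sorted_iff_nth_mono)
      ultimately show ?thesis using JMix ys i(1) by (auto simp: enc_def chains_def)
    qed
  qed
  \<comment> \<open>A simplex meeting neither intermediate corner may be evaluated by either map,
    since the two agree away from the vertex 1.\<close>
  have H_ok: "H m z = h t (enc z)" if z: "z \<in> splx (sjoin ?K (Delta n)) m" "join_part n z" "ok t z" for m z t
  proof (cases "tt z = t")
    case False
    have e: "enc z \<in> chains (cocx {0,1} ?F)" using enc_ch[OF z(1,2)] by blast
    have "1 \<notin> set (enc z)"
    proof -
      have "set l \<subseteq> {(0,0)}" if "l \<in> splx ?K k" "set l \<subseteq> {(0,0), p t}" "((1,0) \<in> set l) \<noteq> t" for l k
        using one[OF that(1)] that(2,3) by (cases t) (auto simp: p_def)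
      then have "co ` set l \<subseteq> {0}" if "l \<in> splx ?K k" "set l \<subseteq> {(0,0), p t}" "((1,0) \<in> set l) \<noteq> t" for l k
        using that by (fastforce simp: co_def)
      then show ?thesis using z False by (cases z) (fastforce simp: splx_sjoin ok_def tt_def enc_def)+
    qed
    then have "enc z \<in> chains (cocx {0} ?F)" using e unfolding chains_def cocx_def by blast
    then show ?thesis unfolding H_def by (rule h(4))
  qed (simp add: H_def)
  have ok_tt: "ok (tt z) z" if "z \<in> splx (sjoin ?K (Delta n)) m" for z m
    using that one by (cases z) (auto simp: splx_sjoin ok_def tt_def)
  have op: "enc (join_opr ?K (Delta n) m \<alpha> z) = map (nth (enc z)) \<alpha> \<and> (ok t z \<longrightarrow> ok t (join_opr ?K (Delta n) m \<alpha> z)) \<and>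
     (join_part n z \<longrightarrow> join_part n (join_opr ?K (Delta n) m \<alpha> z))"
    if z: "z \<in> splx (sjoin ?K (Delta n)) m" and a: "\<alpha> \<in> splx (Delta m) k" for z m \<alpha> k t
  proof -
    have sub: "set (map (nth y) \<gamma>) \<noteq> {..n}" if "set y \<noteq> {..n}" "y \<in> splx (Delta n) i" "\<gamma> \<in> splx (Delta i) j" for y \<gamma> i j
      using Delta_comp(2)[OF that(2,3)] that(1,2) by (auto simp: Delta_iff)
    show ?thesis
    proof (cases z)
      case (JLeft l)
      then have l: "length l = Suc m" using z by (simp add: splx_sjoin splx_pnerve)
      then have i: "\<forall>i\<in>set \<alpha>. i < length l" using a by (auto simp: Delta_iff)
      have "set (map (nth l) \<alpha>) \<subseteq> set l" by (rule set_map_nth_subset[OF i])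
      then show ?thesis using JLeft map_nth_map[OF i, of co] by (auto simp: enc_def ok_def join_part_def opr_pnerve simp del: map_map)
    next
      case (JRight y)
      then have y: "y \<in> splx (Delta n) m" "length y = Suc m" using z by (simp_all add: splx_sjoin Delta_iff)
      then have i: "\<forall>i\<in>set \<alpha>. i < length y" using a by (auto simp: Delta_iff)
      then show ?thesis using JRight map_nth_map[OF i, of "\<lambda>i. i + 2"] sub[OF _ y(1) a]
        by (simp add: enc_def ok_def join_part_def opr_pnerve del: map_map)
    next
      case (JMix i l y)
      then have i: "i < m" "l \<in> splx ?K i" "y \<in> splx (Delta n) (m - Suc i)" using z by (simp_all add: splx_sjoin)
      have len: "length l = Suc i" "length y = Suc (m - Suc i)" using i by (simp_all add: splx_pnerve Delta_iff)
      define \<beta> where "\<beta> = filter (\<lambda>t. t \<le> i) \<alpha>"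
      define \<gamma> where "\<gamma> = map (\<lambda>t. t - Suc i) (filter (\<lambda>t. i < t) \<alpha>)"
      note s = split_Delta[OF a i(1), folded \<beta>_def \<gamma>_def]
      have b: "\<forall>t\<in>set \<beta>. t < length l" by (auto simp: \<beta>_def len)
      have c: "\<forall>t\<in>set \<gamma>. t < length y" using s(2) len(2) by (cases "\<gamma> = []") (auto simp: Delta_iff)
      have sl: "set (map (nth l) \<beta>) \<subseteq> set l" by (rule set_map_nth_subset[OF b])
      let ?xs = "map co l" and ?ys = "map (\<lambda>i. i + 2) y"
      have srt: "sorted \<alpha>" "\<forall>t\<in>set \<alpha>. t < length ?xs + length ?ys" using a len i(1) by (auto simp: Delta_iff)
      have fl: "filter (\<lambda>t. t < length ?xs) \<alpha> = \<beta>" "map (\<lambda>t. t - length ?xs) (filter (\<lambda>t. length ?xs \<le> t) \<alpha>) = \<gamma>"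
        unfolding \<beta>_def \<gamma>_def by (simp_all add: len less_Suc_eq_le Suc_le_eq)
      have "map (nth (?xs @ ?ys)) \<alpha> = map co (map (nth l) \<beta>) @ map (\<lambda>i. i + 2) (map (nth y) \<gamma>)"
        unfolding map_nth_append_split[OF srt] fl map_nth_map[OF b] map_nth_map[OF c] ..
      moreover have "\<gamma> = [] ==> \<beta> \<noteq> []" using s(3) by auto
      ultimately show ?thesis using JMix sl sub[OF _ i(3) s(2)]
        unfolding JMix join_opr_JMix[OF \<beta>_def \<gamma>_def] opr_pnerve
        by (auto simp: enc_def ok_def join_part_def simp del: map_map set_map)
    qed
  qed
  have Hm: "sset_map (sub_sset (sjoin ?K (Delta n)) (\<lambda>_. join_part n)) C H"
    unfolding sset_map_def
  proof (intro allI ballI conjI)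
    fix k z assume "z \<in> splx (sub_sset (sjoin ?K (Delta n)) (\<lambda>_. join_part n)) k"
    then have z: "z \<in> splx (sjoin ?K (Delta n)) k" "join_part n z" by (simp_all add: sub_sset_def)
    note e = enc_ch[OF z]
    show "H k z \<in> splx C k" using cmapD(1)[OF h(1) conjunct1[OF e], of "tt z"] e by (simp add: H_def)
    fix j \<alpha> assume a: "\<alpha> \<in> splx (Delta k) j"
    note o = op[OF z(1) a, of "tt z"]
    have z': "join_opr ?K (Delta n) k \<alpha> z \<in> splx (sjoin ?K (Delta n)) j" by (rule join_opr_in[OF sK is_sset_Delta z(1) a])
    have "H j (join_opr ?K (Delta n) k \<alpha> z) = h (tt z) (enc (join_opr ?K (Delta n) k \<alpha> z))"
      by (rule H_ok[OF z']) (use o z(2) ok_tt[OF z(1)] in blast)+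
    also have "enc (join_opr ?K (Delta n) k \<alpha> z) = map (nth (enc z)) \<alpha>" using o by blast
    also have "h (tt z) \<dots> = opr C k \<alpha> (h (tt z) (enc z))"
      using cmapD(2)[OF h(1) conjunct1[OF e], of \<alpha> j "tt z"] e a by simp
    finally show "H j (opr (sub_sset (sjoin ?K (Delta n)) (\<lambda>_. join_part n)) k \<alpha> z) = opr C k \<alpha> (H k z)"
      by (simp add: sub_sset_def opr_sjoin H_def)
  qed
  \<comment> \<open>Over a single cone point all simplices of the join come from the two triangles,
    where the values of \<open>h\<close> were prescribed.\<close>
  have Hc: "H m z = c m z" if z: "z \<in> splx (sjoin ?K (Delta 0)) m" for m z
  proof -
    have nz: "z \<in> splx (sjoin ?K (Delta n)) m" "join_part n z"
    proof -
      have d: "y \<in> splx (Delta n) k \<and> set y \<noteq> {..n}" if "y \<in> splx (Delta 0) k" for y k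
      proof -
        have "set y \<subseteq> {0}" using that by (auto simp: Delta_iff)
        moreover have "n \<in> {..n}" "n \<notin> {0}" using n by auto
        ultimately show ?thesis using that by (auto simp: Delta_iff)
      qed
      then show "z \<in> splx (sjoin ?K (Delta n)) m" using z by (cases z) (auto simp: splx_sjoin)
      show "join_part n z" using z d by (cases z) (auto simp: splx_sjoin join_part_def)
    qed
    note e = enc_ch[OF nz]
    let ?t = "tt z"
    have co_nth: "map (nth [(0,0), p t, (1,1)]) (map co l) = l" if "set l \<subseteq> {(0,0), p t}" for l t
      using that by (auto simp: co_def p_def intro!: map_idI)
    have ze: "map (nth [(0,0), p t, (1,1)]) (map (\<lambda>i. i + 2) y) = map (\<lambda>_. (1,1)) y" if "y \<in> splx (Delta 0) k" for y k t
      using that by (auto simp: Delta_iff)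
    have s2: "set (enc z) \<subseteq> {0..2}"
      using z by (cases z) (auto simp: enc_def splx_sjoin co_def Delta_iff)
    then have cf: "enc z \<in> chains (full {0..2})" using e by (auto simp: chains_def full_def)
    have D: "enc z \<in> splx (Delta 2) m" using s2 e by (auto simp: Delta_iff chains_def)
    have "H m z = opr C 2 (enc z) (r ?t)" unfolding H_def by (rule h(2)[OF cf])
    also have "\<dots> = q m (map (nth [(0,0), p ?t, (1,1)]) (enc z))" using qr[OF D] by simp
    also have "\<dots> = c m z"
    proof (cases z)
      case (JLeft l)
      then have "set l \<subseteq> {(0,0), p ?t}" using ok_tt[OF nz(1)] by (simp add: ok_def)
      then have "map (nth [(0,0), p ?t, (1,1)]) (enc z) = l" using JLeft co_nth by (simp only: enc_def join.case)
      then show ?thesis using JLeft by (simp add: c_def)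
    next
      case (JRight y)
      then have "y \<in> splx (Delta 0) m" using z by (simp add: splx_sjoin)
      then have "map (nth [(0,0), p ?t, (1,1)]) (enc z) = map (\<lambda>_. (1,1)) y"
        using JRight ze by (simp only: enc_def join.case)
      then show ?thesis using JRight by (simp add: c_def)
    next
      case (JMix i l y)
      then have "y \<in> splx (Delta 0) (m - Suc i)" "set l \<subseteq> {(0,0), p ?t}"
        using z ok_tt[OF nz(1)] by (simp_all add: splx_sjoin ok_def)
      then have "map (nth [(0,0), p ?t, (1,1)]) (enc z) = l @ map (\<lambda>_. (1,1)) y"
        using JMix ze co_nth by (simp only: enc_def join.case map_append)
      then show ?thesis using JMix by (simp add: c_def)
    qed
    finally show ?thesis .
  qed
  obtain G where G: "sset_map (sjoin ?K (Delta n)) C G"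
    "\<And>m z. z \<in> splx (sjoin ?K (Delta n)) m ==> join_part n z ==> G m z = H m z"
    by (rule colimit_cocone_extend[OF sK cc n Hm Hc]) blast+
  let ?u = "[0..<Suc n]"
  let ?s = "G n (JRight ?u)" and ?t = "\<lambda>t. G (Suc n) (JMix 0 [p t] ?u)"
  have u: "?u \<in> splx (Delta n) n" by (auto simp: Delta_iff)
  have vs: "JRight ?u \<in> splx (sjoin ?K (Delta n)) n" using u by (simp add: splx_sjoin)
  have vt: "JMix 0 [p t] ?u \<in> splx (sjoin ?K (Delta n)) (Suc n)" for t
    using u by (auto simp: splx_sjoin splx_pnerve p_def cospan_def)
  have un: "map (nth ?u) y = y" if "set y \<subseteq> {..n}" for y
    using that by (auto intro!: map_idI)
  have enct: "enc (JMix 0 [p t] ?u) = map Suc [0..<Suc (Suc n)]" for t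
  proof -
    have "map Suc [0..<Suc (Suc n)] = 1 # map Suc [1..<Suc (Suc n)]" by (subst upt_conv_Cons) auto
    also have "map Suc [1..<Suc (Suc n)] = map (\<lambda>i. i + 2) ?u" by (rule nth_equalityI) auto
    finally show ?thesis by (simp add: enc_def co_def p_def)
  qed
  \<comment> \<open>The encoding shows whether the second component is onto, so horn chains stay in
    the part where the extension is known.\<close>
  have HP: "join_part n z" if ez: "enc z = map Suc l" and l: "l \<in> chains (hcx n)" for z l
  proof -
    have F3: "set y \<noteq> {..n}" if s: "set (map (\<lambda>i. i + 2) y) \<subseteq> set (map Suc l)" for y
    proof
      assume y: "set y = {..n}"
      have "v \<in> set l" if v: "v \<in> {1..Suc n}" for v
      proof -
        have "v - 1 \<in> set y" using v y by auto
        then have "v - 1 + 2 \<in> set (map (\<lambda>i. i + 2) y)" by (simp add: image_iff)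
        moreover have "v - 1 + 2 = Suc v" using v by simp
        ultimately have "Suc v \<in> set (map Suc l)" using s by (metis subsetD)
        then show ?thesis by auto
      qed
      then show False using l by (auto simp: chains_def hcx_def)
    qed
    have "set (enc z) = set (map Suc l)" using ez by simp
    then show ?thesis using F3 by (cases z) (simp_all add: join_part_def enc_def del: set_map, metis Un_upper2)
  qed
  show ?case
  proof (intro exI[of _ ?s] exI[of _ ?t] conjI ballI)
    show "?s \<in> splx C n" by (rule sset_mapD(1)[OF G(1) vs])
    have low: "l \<in> chains (hcx n)" if "l \<in> chains (bcx n)" for l using that by (simp add: chains_bcx_iff)
    show "opr C n (map (\<lambda>i. i - 1) l) ?s = g l" if l: "l \<in> chains (bcx n)" for l
    proof -
      obtain y where y: "l = map Suc y" "y \<in> splx (Delta n) (length l - 1)" "set y \<noteq> {..n}" by (rule chain_bcx[OF l])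
      have z: "JRight y \<in> splx (sjoin ?K (Delta n)) (length l - 1)" "join_part n (JRight y)" using y by (simp_all add: splx_sjoin join_part_def)
      have "opr C n y ?s = G (length l - 1) (JRight y)"
        using sset_mapD(2)[OF G(1) vs y(2)] un[of y] y(2) by (simp add: opr_sjoin opr_pnerve Delta_iff)
      also have "\<dots> = H (length l - 1) (JRight y)" by (rule G(2)[OF z])
      also have "\<dots> = h True (map Suc l)" using y(1) by (simp add: H_def tt_def enc_def comp_def)
      also have "\<dots> = g l" using h(3)[OF low[OF l]] f(3)[OF l] by simp
      finally show ?thesis using y(1) by (simp add: comp_def)
    qed
    fix t :: bool
    show "?t t \<in> splx C (Suc n)" by (rule sset_mapD(1)[OF G(1) vt])
    show "opr C (Suc n) l (?t t) = f t l" if l: "l \<in> chains (hcx n)" for l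
    proof -
      let ?m = "length l - 1"
      let ?z = "join_opr ?K (Delta n) (Suc n) l (JMix 0 [p t] ?u)"
      note D = hcx_Delta[OF l]
      have z: "?z \<in> splx (sjoin ?K (Delta n)) ?m" by (rule join_opr_in[OF sK is_sset_Delta vt D])
      have sl: "set l \<subseteq> {..Suc n}" using D by (simp add: Delta_iff)
      have "map (nth (map Suc [0..<Suc (Suc n)])) l = map Suc l" using sl by auto
      then have ez: "enc ?z = map Suc l" using op[OF vt D] enct by simp
      have okz: "ok t ?z" using op[OF vt D, of t] by (simp add: ok_def)
      note jp = HP[OF ez l]
      have Gz: "G ?m ?z = H ?m ?z" by (rule G(2)[OF z jp])
      have "opr C (Suc n) l (?t t) = G ?m ?z" using sset_mapD(2)[OF G(1) vt D] by (simp add: opr_sjoin)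
      also have "\<dots> = h t (enc ?z)" unfolding Gz by (rule H_ok[OF z jp okz])
      also have "\<dots> = f t l" unfolding ez by (rule h(3)[OF l])
      finally show ?thesis .
    qed
    have fl: "[] = filter (\<lambda>t. t \<le> 0) [1..<Suc (Suc n)]" "[0..<Suc n] = map (\<lambda>t. t - Suc 0) (filter (\<lambda>t. 0 < t) [1..<Suc (Suc n)])"
    proof -
      show "[] = filter (\<lambda>t. t \<le> 0) [1..<Suc (Suc n)]" by (auto simp: filter_empty_conv)
      have "filter (\<lambda>t. 0 < t) [1..<Suc (Suc n)] = [1..<Suc (Suc n)]" by (rule filter_True) auto
      then show "[0..<Suc n] = map (\<lambda>t. t - Suc 0) (filter (\<lambda>t. 0 < t) [1..<Suc (Suc n)])"
        by (simp add: map_decr_upt)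
    qed
    have uu: "map (nth ?u) ?u = ?u" by (rule un) auto
    show "opr C (Suc n) [1..<Suc (Suc n)] (?t t) = ?s"
      using sset_mapD(2)[OF G(1) vt d0_Delta, of t] join_opr_JMix[OF fl, of ?K "Delta n" "Suc n" "[p t]" ?u] uu
      by (simp add: opr_sjoin opr_pnerve)
  qed
qed

section \<open>Finite G-sets\<close>

lemma group_of_gset: "is_gset G X ==> group G"
  by (simp add: is_gset_def group_action_def group_hom_def)

lemma gsetD:
  assumes "is_gset G X"
  shows "g \<in> carrier G ==> x \<in> car X ==> act X g x \<in> car X"
    and "x \<in> car X ==> act X \<one>\<^bsub>G\<^esub> x = x"
    and "g \<in> carrier G ==> h \<in> carrier G ==> x \<in> car X ==> act X (g \<otimes>\<^bsub>G\<^esub> h) x = act X g (act X h x)"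
    and "g \<in> carrier G ==> act X g \<in> extensional (car X)"
    and "act X \<in> extensional (carrier G)"
proof -
  interpret group_action G "car X" "act X" using assms by (simp add: is_gset_def)
  show "g \<in> carrier G ==> x \<in> car X ==> act X g x \<in> car X" by (rule element_image) auto
  show "x \<in> car X ==> act X \<one>\<^bsub>G\<^esub> x = x" using id_eq_one by (metis restrict_apply')
  show "g \<in> carrier G ==> h \<in> carrier G ==> x \<in> car X ==> act X (g \<otimes>\<^bsub>G\<^esub> h) x = act X g (act X h x)"
    by (rule composition_rule)
  show "g \<in> carrier G ==> act X g \<in> extensional (car X)"
    using bij_prop0 group_hom.hom_closed[OF group_hom] by (fastforce simp: BijGroup_def Bij_def)
  show "act X \<in> extensional (carrier G)" using assms by (simp add: is_gset_def)
qed

text \<open>Group inverses make each translation bijective, which turns the pointwise axioms into a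
  homomorphism to the group of bijections.\<close>

lemma is_gsetI:
  assumes G: "group G"
    and cl: "\<And>g x. g \<in> carrier G ==> x \<in> car X ==> act X g x \<in> car X"
    and one: "\<And>x. x \<in> car X ==> act X \<one>\<^bsub>G\<^esub> x = x"
    and mult: "\<And>g h x. g \<in> carrier G ==> h \<in> carrier G ==> x \<in> car X ==> act X (g \<otimes>\<^bsub>G\<^esub> h) x = act X g (act X h x)"
    and ext: "\<And>g. g \<in> carrier G ==> act X g \<in> extensional (car X)" "act X \<in> extensional (carrier G)"
  shows "is_gset G X"
proof -
  interpret group G by (rule G)
  have bij: "bij_betw (act X g) (car X) (car X)" if g: "g \<in> carrier G" for g
  proof (rule bij_betwI[where g = "act X (inv\<^bsub>G\<^esub> g)"])
    show "act X g \<in> car X \<rightarrow> car X" "act X (inv\<^bsub>G\<^esub> g) \<in> car X \<rightarrow> car X" using cl g by auto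
    show "act X (inv\<^bsub>G\<^esub> g) (act X g x) = x" if "x \<in> car X" for x
      using mult[of "inv\<^bsub>G\<^esub> g" g x] one[OF that] g that by simp
    show "act X g (act X (inv\<^bsub>G\<^esub> g) x) = x" if "x \<in> car X" for x
      using mult[of g "inv\<^bsub>G\<^esub> g" x] one[OF that] g that by simp
  qed
  have B: "act X g \<in> carrier (BijGroup (car X))" if "g \<in> carrier G" for g
    using bij[OF that] ext(1)[OF that] by (simp add: BijGroup_def Bij_def)
  have "act X (g \<otimes>\<^bsub>G\<^esub> h) = act X g \<otimes>\<^bsub>BijGroup (car X)\<^esub> act X h" if gh: "g \<in> carrier G" "h \<in> carrier G" for g h
  proof (rule extensionalityI[where A = "car X"])
    show "act X (g \<otimes>\<^bsub>G\<^esub> h) \<in> extensional (car X)" using ext(1) gh by simp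
    show "act X g \<otimes>\<^bsub>BijGroup (car X)\<^esub> act X h \<in> extensional (car X)"
      using B[OF gh(1)] B[OF gh(2)] by (simp add: BijGroup_def)
    show "act X (g \<otimes>\<^bsub>G\<^esub> h) x = (act X g \<otimes>\<^bsub>BijGroup (car X)\<^esub> act X h) x" if "x \<in> car X" for x
      using B[OF gh(1)] B[OF gh(2)] mult[OF gh that] that by (simp add: BijGroup_def compose_def)
  qed
  then have "act X \<in> hom G (BijGroup (car X))" using B by (auto simp: hom_def)
  then have "group_action G (car X) (act X)"
    unfolding group_action_def group_hom_def group_hom_axioms_def using G group_BijGroup by blast
  then show ?thesis using ext(2) by (simp add: is_gset_def)
qed

lemma equivariantD:
  assumes "f \<in> equivariant_maps G X Y"
  shows "x \<in> car X ==> f x \<in> car Y" "g \<in> carrier G ==> x \<in> car X ==> f (act X g x) = act Y g (f x)"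
    "f \<in> extensional (car X)"
  using assms by (auto simp: equivariant_maps_def PiE_def)

lemma equivariantI:
  assumes "\<And>x. x \<in> car X ==> f x \<in> car Y" "\<And>g x. g \<in> carrier G ==> x \<in> car X ==> f (act X g x) = act Y g (f x)"
    "f \<in> extensional (car X)"
  shows "f \<in> equivariant_maps G X Y"
  using assms by (auto simp: equivariant_maps_def PiE_def)

lemma equivariant_id: "is_gset G X ==> restrict id (car X) \<in> equivariant_maps G X X"
  by (rule equivariantI) (auto simp: gsetD)

lemma equivariant_comp:
  assumes "is_gset G X" "f \<in> equivariant_maps G X Y" "g \<in> equivariant_maps G Y Z"
  shows "compose (car X) g f \<in> equivariant_maps G X Z"
  using assms(2,3) gsetD(1)[OF assms(1)]
  by (intro equivariantI) (auto simp: compose_def equivariantD)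

text \<open>The restrictions make the action extensional, as \<open>is_gset\<close> demands, so that
  equal sub-G-sets are equal terms.\<close>

definition gsub :: "('g, 'r) monoid_scheme => ('g, 'x, 'z) gset_scheme => 'x set => ('g, 'x) gset" where
  "gsub G X A = \<lparr>car = A, act = (\<lambda>g\<in>carrier G. restrict (act X g) A)\<rparr>"

lemma is_gset_gsub:
  assumes X: "is_gset G X" and A: "A \<subseteq> car X" "\<And>g x. g \<in> carrier G ==> x \<in> A ==> act X g x \<in> A"
  shows "is_gset G (gsub G X A)"
proof -
  interpret group G by (rule group_of_gset[OF X])
  show ?thesis
    by (rule is_gsetI[OF is_group]) (use gsetD[OF X] A in \<open>auto simp: gsub_def\<close>)
qed

lemma gset_eqI:
  assumes "is_gset G X" "is_gset G Y" "car X = car Y" "\<And>g x. g \<in> carrier G ==> x \<in> car X ==> act X g x = act Y g x"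
  shows "X = (Y :: ('g, 'x) gset)"
proof -
  have "act X = act Y"
  proof (rule extensionalityI[OF gsetD(5)[OF assms(1)] gsetD(5)[OF assms(2)]])
    fix g assume g: "g \<in> carrier G"
    show "act X g = act Y g"
      by (rule extensionalityI[OF gsetD(4)[OF assms(1) g]])
         (use gsetD(4)[OF assms(2) g] assms(3,4) g in auto)
  qed
  then show ?thesis using assms(3) by simp
qed

section \<open>Copies of finite G-sets in the universe\<close>

lemma gset_transport:
  fixes X :: "('g, 'a, 'z) gset_scheme" and i :: "'a => 'u"
  assumes X: "is_gset G X" and i: "inj_on i (car X)"
  obtains Y :: "('g, 'u) gset" where "is_gset G Y" "car Y = i ` car X"
    "\<forall>g\<in>carrier G. \<forall>x\<in>car X. act Y g (i x) = i (act X g x)"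
proof -
  interpret group G by (rule group_of_gset[OF X])
  define Y where "Y = \<lparr>car = i ` car X, act = (\<lambda>g\<in>carrier G. \<lambda>u\<in>i ` car X. i (act X g (inv_into (car X) i u)))\<rparr>"
  have a: "act Y g (i x) = i (act X g x)" if "g \<in> carrier G" "x \<in> car X" for g x
    using that i by (simp add: Y_def)
  have c: "car Y = i ` car X" by (simp add: Y_def)
  have "is_gset G Y"
  proof (rule is_gsetI[OF is_group])
    show "act Y \<in> extensional (carrier G)" "\<And>g. g \<in> carrier G ==> act Y g \<in> extensional (car Y)" by (simp_all add: Y_def)
  qed (use gsetD[OF X] a in \<open>auto simp: c\<close>)
  then show ?thesis using that a c by blast
qed

lemma finite_inj_exists:
  assumes "finite A" "infinite (UNIV :: 'u set)"
  obtains i :: "'a => 'u" where "inj_on i A"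
proof -
  obtain B :: "'u set" where "finite B" "card B = card A"
    using infinite_arbitrarily_large[OF assms(2)] by metis
  then obtain i where "bij_betw i A B" using assms(1) finite_same_card_bij by metis
  then show ?thesis using that bij_betw_imp_inj_on by blast
qed

text \<open>Sets of pairs and disjoint unions live over other types; the infinite type
  \<open>'u\<close> contains a copy of any finite set, and the action is carried along.\<close>

lemma gset_realize:
  fixes X :: "('g, 'a, 'z) gset_scheme"
  assumes X: "is_gset G X" "finite (car X)" and U: "infinite (UNIV :: 'u set)"
  obtains Y :: "('g, 'u) gset" and i :: "'a => 'u" where "is_gset G Y" "car Y = i ` car X" "inj_on i (car X)"
    "\<forall>g\<in>carrier G. \<forall>x\<in>car X. act Y g (i x) = i (act X g x)"
proof -
  obtain i :: "'a => 'u" where i: "inj_on i (car X)" by (rule finite_inj_exists[OF X(2) U])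
  obtain Y :: "('g, 'u) gset" where "is_gset G Y" "car Y = i ` car X"
    "\<forall>g\<in>carrier G. \<forall>x\<in>car X. act Y g (i x) = i (act X g x)" by (rule gset_transport[OF X(1) i])
  then show ?thesis using that i by blast
qed

definition gpair :: "('g, 'r) monoid_scheme => ('g, 'x, 'z) gset_scheme => ('g, 'y, 'w) gset_scheme => ('x \<times> 'y) set => ('g, 'x \<times> 'y) gset" where
  "gpair G X Y P = \<lparr>car = P, act = (\<lambda>g\<in>carrier G. restrict (map_prod (act X g) (act Y g)) P)\<rparr>"

lemma is_gset_gpair:
  assumes X: "is_gset G X" and Y: "is_gset G Y" and P: "P \<subseteq> car X \<times> car Y"
    and cl: "\<And>g x y. g \<in> carrier G ==> (x, y) \<in> P ==> (act X g x, act Y g y) \<in> P"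
  shows "is_gset G (gpair G X Y P)"
proof -
  interpret group G by (rule group_of_gset[OF X])
  show ?thesis
  proof (rule is_gsetI[OF is_group])
    fix p assume p: "p \<in> car (gpair G X Y P)"
    then obtain x y where xy: "p = (x, y)" "(x, y) \<in> P" "x \<in> car X" "y \<in> car Y" using P by (cases p) (auto simp: gpair_def)
    show "act (gpair G X Y P) \<one>\<^bsub>G\<^esub> p = p" using xy gsetD(2)[OF X] gsetD(2)[OF Y] by (simp add: gpair_def)
    fix g assume g: "g \<in> carrier G"
    show "act (gpair G X Y P) g p \<in> car (gpair G X Y P)" using cl[OF g xy(2)] xy g by (simp add: gpair_def)
    fix h assume h: "h \<in> carrier G"
    show "act (gpair G X Y P) (g \<otimes>\<^bsub>G\<^esub> h) p = act (gpair G X Y P) g (act (gpair G X Y P) h p)"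
      using cl[OF h xy(2)] xy g h gsetD(3)[OF X g h] gsetD(3)[OF Y g h] by (simp add: gpair_def)
  qed (auto simp: gpair_def)
qed

text \<open>Provides test objects for universal properties: a copy of the invariant set
  \<open>P\<close> of pairs with its two projections.\<close>

lemma gpair_realize:
  fixes U V :: "('g, 'u) gset"
  assumes U: "is_gset G U" and V: "is_gset G V" and P: "P \<subseteq> car U \<times> car V" "finite P"
    and cl: "\<And>g x y. g \<in> carrier G ==> (x, y) \<in> P ==> (act U g x, act V g y) \<in> P"
    and inf: "infinite (UNIV :: 'u set)"
  obtains T :: "('g, 'u) gset" and a b where "is_gset G T" "finite (car T)" "a \<in> equivariant_maps G T U" "b \<in> equivariant_maps G T V"
    "\<forall>t\<in>car T. (a t, b t) \<in> P" "\<forall>p\<in>P. \<exists>t\<in>car T. a t = fst p \<and> b t = snd p"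
proof -
  have PG: "is_gset G (gpair G U V P)" by (rule is_gset_gpair[OF U V P(1) cl])
  have cP: "car (gpair G U V P) = P" by (simp add: gpair_def)
  have Pf: "finite (car (gpair G U V P))" using P(2) by (simp add: cP)
  obtain T :: "('g, 'u) gset" and i where T: "is_gset G T" "car T = i ` car (gpair G U V P)" "inj_on i (car (gpair G U V P))"
    "\<forall>h\<in>carrier G. \<forall>p\<in>car (gpair G U V P). act T h (i p) = i (act (gpair G U V P) h p)"
    by (rule gset_realize[OF PG Pf inf])
  define j where "j = inv_into P i"
  have j: "j t \<in> P" "i (j t) = t" if "t \<in> car T" for t
    using that T(2) by (auto simp: j_def cP inv_into_into f_inv_into_f)
  have ji: "j (i p) = p" if "p \<in> P" for p using that T(3) by (simp add: j_def cP)
  have jact: "j (act T h t) = (act U h (fst (j t)), act V h (snd (j t)))" if ht: "h \<in> carrier G" "t \<in> car T" for h t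
  proof -
    obtain x y where p: "j t = (x, y)" "(x, y) \<in> P" using j(1)[OF ht(2)] by (cases "j t") auto
    have "act T h t = i (act U h x, act V h y)"
      using bspec[OF bspec[OF T(4) ht(1)], of "(x, y)"] p j(2)[OF ht(2)] ht(1) by (simp add: cP) (simp add: gpair_def)
    then show ?thesis using ji[OF cl[OF ht(1) p(2)]] p by simp
  qed
  have jP: "fst (j t) \<in> car U" "snd (j t) \<in> car V" if "t \<in> car T" for t
    using j(1)[OF that] P(1) by auto
  show ?thesis
  proof (rule that[OF T(1), of "restrict (fst \<circ> j) (car T)" "restrict (snd \<circ> j) (car T)"])
    show "finite (car T)" using Pf T(2) by simp
    show "restrict (fst \<circ> j) (car T) \<in> equivariant_maps G T U" "restrict (snd \<circ> j) (car T) \<in> equivariant_maps G T V"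
      by (rule equivariantI; use jP jact gsetD(1)[OF T(1)] in auto)+
    show "\<forall>t\<in>car T. (restrict (fst \<circ> j) (car T) t, restrict (snd \<circ> j) (car T) t) \<in> P" using j(1) by simp
    show "\<forall>p\<in>P. \<exists>t\<in>car T. restrict (fst \<circ> j) (car T) t = fst p \<and> restrict (snd \<circ> j) (car T) t = snd p"
      using ji T(2) by (auto simp: cP)
  qed
qed

section \<open>Pull-backs of finite G-sets, pointwise\<close>

definition fibre_product :: "('w => 'x) => ('w => 'y) => ('x => 'z) => ('y => 'z) => 'w set => 'x set => 'y set => bool" where
  "fibre_product f w u g W U V \<longleftrightarrow> (\<forall>p\<in>W. u (f p) = g (w p)) \<and> (\<forall>x\<in>U. \<forall>y\<in>V. u x = g y \<longrightarrow> (\<exists>!p. p \<in> W \<and> f p = x \<and> w p = y))"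

lemma GFin_simps [simp]:
  "Ob (GFin G) = {S. is_gset G S \<and> finite (car S)}" "Hom (GFin G) = equivariant_maps G"
  "Idn (GFin G) S = restrict id (car S)" "Cmp (GFin G) S = compose (car S)"
  by (simp_all add: GFin_def)

lemma compose_eq_iff: "compose A g f = compose A g' f' \<longleftrightarrow> (\<forall>x\<in>A. g (f x) = g' (f' x))"
  by (auto simp: compose_def fun_eq_iff restrict_def)

lemma compose_eq_ext_iff: "h \<in> extensional A ==> compose A g f = h \<longleftrightarrow> (\<forall>x\<in>A. g (f x) = h x)"
  by (auto simp: compose_def fun_eq_iff restrict_def extensional_def)

lemma cartesianI:
  assumes "W \<in> Ob C" "U \<in> Ob C" "V \<in> Ob C" "Z \<in> Ob C" "f \<in> Hom C W U" "w \<in> Hom C W V" "u \<in> Hom C U Z" "g \<in> Hom C V Z"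
    "Cmp C W u f = Cmp C W g w"
    "\<And>T a b. T \<in> Ob C ==> a \<in> Hom C T U ==> b \<in> Hom C T V ==> Cmp C T u a = Cmp C T g b ==>
      \<exists>!h. h \<in> Hom C T W \<and> Cmp C T f h = a \<and> Cmp C T w h = b"
  shows "cartesian C W U V Z f w u g"
  unfolding cartesian_def by (intro conjI ballI impI assms(5-)) (use assms(1-4) in blast)+

lemma cartesianD:
  assumes "cartesian C W U V Z f w u g"
  shows "W \<in> Ob C" "U \<in> Ob C" "V \<in> Ob C" "Z \<in> Ob C" "f \<in> Hom C W U" "w \<in> Hom C W V" "u \<in> Hom C U Z" "g \<in> Hom C V Z"
    "Cmp C W u f = Cmp C W g w"
    "\<And>T a b. T \<in> Ob C ==> a \<in> Hom C T U ==> b \<in> Hom C T V ==> Cmp C T u a = Cmp C T g b ==>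
      \<exists>!h. h \<in> Hom C T W \<and> Cmp C T f h = a \<and> Cmp C T w h = b"
  using assms unfolding cartesian_def by blast+

lemma cartesian_transpose:
  assumes c: "cartesian C W U V Z f w u g" shows "cartesian C W V U Z w f g u"
proof (rule cartesianI)
  fix T a b assume "T \<in> Ob C" "a \<in> Hom C T V" "b \<in> Hom C T U" "Cmp C T g a = Cmp C T u b"
  then have "\<exists>!h. h \<in> Hom C T W \<and> Cmp C T f h = b \<and> Cmp C T w h = a" by (intro cartesianD(10)[OF c]) simp_all
  then show "\<exists>!h. h \<in> Hom C T W \<and> Cmp C T w h = a \<and> Cmp C T f h = b" by (simp only: conj_commute)
qed (use cartesianD[OF c] in simp_all)

text \<open>Two finite G-sets of pairs test the universal property. The pointwise fibre product
  shows that compatible pairs come from points of \<open>W\<close>; the pairs of points of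
  \<open>W\<close> with equal projections show that these points are unique.\<close>

lemma cartesian_GFin_fibre_product:
  fixes W :: "('g, 'u) gset"
  assumes U: "infinite (UNIV :: 'u set)" and c: "cartesian (GFin G) W U V Z f w u g"
  shows "fibre_product f w u g (car W) (car U) (car V)"
proof -
  have ob: "is_gset G W" "is_gset G U" "is_gset G V" "finite (car W)" "finite (car U)" "finite (car V)"
    and f: "f \<in> equivariant_maps G W U" and w: "w \<in> equivariant_maps G W V"
    and u: "u \<in> equivariant_maps G U Z" and g: "g \<in> equivariant_maps G V Z"
    and comm: "\<forall>p\<in>car W. u (f p) = g (w p)"
    using cartesianD(1-9)[OF c] by (simp_all add: compose_eq_iff)
  have univ: "\<exists>!h. h \<in> equivariant_maps G T W \<and> compose (car T) f h = a \<and> compose (car T) w h = b"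
    if "is_gset G T" "finite (car T)" "a \<in> equivariant_maps G T U" "b \<in> equivariant_maps G T V"
      "\<forall>x\<in>car T. u (a x) = g (b x)" for T :: "('g, 'u) gset" and a b
    using cartesianD(10)[OF c, of T a b] that by (simp add: compose_eq_iff)
  have ex: "\<exists>p. p \<in> car W \<and> f p = x \<and> w p = y" if xy: "x \<in> car U" "y \<in> car V" "u x = g y" for x y
  proof -
    define P where "P = {(x, y). x \<in> car U \<and> y \<in> car V \<and> u x = g y}"
    have P: "P \<subseteq> car U \<times> car V" by (auto simp: P_def)
    have fin: "finite P" by (rule finite_subset[OF P]) (use ob in simp)
    have cl: "(act U h x, act V h y) \<in> P" if "h \<in> carrier G" "(x, y) \<in> P" for h x y
      using that equivariantD[OF u] equivariantD[OF g] gsetD(1)[OF ob(2)] gsetD(1)[OF ob(3)] by (auto simp: P_def)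
    obtain T :: "('g, 'u) gset" and a b where T: "is_gset G T" "finite (car T)" "a \<in> equivariant_maps G T U" "b \<in> equivariant_maps G T V"
      "\<forall>t\<in>car T. (a t, b t) \<in> P" "\<forall>p\<in>P. \<exists>t\<in>car T. a t = fst p \<and> b t = snd p"
      by (rule gpair_realize[OF ob(2,3) P fin cl U])
    have "\<forall>t\<in>car T. u (a t) = g (b t)" using T(5) by (simp add: P_def)
    then obtain h where h: "h \<in> equivariant_maps G T W" "compose (car T) f h = a" "compose (car T) w h = b"
      using univ[OF T(1-4)] by blast
    have "(x, y) \<in> P" using xy by (simp add: P_def)
    then obtain t where t: "t \<in> car T" "a t = x" "b t = y" using T(6) by force
    have "f (h t) = a t" "w (h t) = b t" using h(2,3) t(1) by (metis compose_eq)+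
    then show ?thesis using t equivariantD(1)[OF h(1) t(1)] by auto
  qed
  have un: "p = q" if pq: "p \<in> car W" "q \<in> car W" "f p = f q" "w p = w q" for p q
  proof -
    define P where "P = {(x, y). x \<in> car W \<and> y \<in> car W \<and> f x = f y \<and> w x = w y}"
    have P: "P \<subseteq> car W \<times> car W" by (auto simp: P_def)
    have fin: "finite P" by (rule finite_subset[OF P]) (use ob in simp)
    have cl: "(act W h x, act W h y) \<in> P" if "h \<in> carrier G" "(x, y) \<in> P" for h x y
      using that equivariantD[OF f] equivariantD[OF w] gsetD(1)[OF ob(1)] by (auto simp: P_def)
    obtain T :: "('g, 'u) gset" and a b where T: "is_gset G T" "finite (car T)" and a: "a \<in> equivariant_maps G T W"
      and b: "b \<in> equivariant_maps G T W" and ab: "\<forall>t\<in>car T. (a t, b t) \<in> P" "\<forall>p\<in>P. \<exists>t\<in>car T. a t = fst p \<and> b t = snd p"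
      by (rule gpair_realize[OF ob(1,1) P fin cl U])
    have e: "compose (car T) f a = compose (car T) f b" "compose (car T) w a = compose (car T) w b"
      using ab(1) by (simp_all add: compose_eq_iff P_def)
    have "\<forall>x\<in>car T. u (compose (car T) f a x) = g (compose (car T) w a x)"
      using comm equivariantD(1)[OF a] by (simp add: compose_def)
    then have ex: "\<exists>!h. h \<in> equivariant_maps G T W \<and> compose (car T) f h = compose (car T) f a \<and> compose (car T) w h = compose (car T) w a"
      by (intro univ[OF T equivariant_comp[OF T(1) a f] equivariant_comp[OF T(1) a w]])
    have "a = b"
      using the1_equality[OF ex, of a] the1_equality[OF ex, of b] a b e by simp
    moreover have "(p, q) \<in> P" using pq by (simp add: P_def)
    then obtain t where "a t = p" "b t = q" using ab(2) by force
    ultimately show ?thesis by simp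
  qed
  show ?thesis unfolding fibre_product_def
  proof (intro conjI comm ballI impI)
    fix x y assume "x \<in> car U" "y \<in> car V" "u x = g y"
    from ex[OF this] show "\<exists>!p. p \<in> car W \<and> f p = x \<and> w p = y" using un by metis
  qed
qed

text \<open>The lift is forced pointwise, and it is equivariant because the translated point has the
  required projections.\<close>

lemma fibre_product_lift:
  assumes fp: "fibre_product f w u g (car W) (car U) (car V)"
    and W: "is_gset G W" and f: "f \<in> equivariant_maps G W U" and w: "w \<in> equivariant_maps G W V"
    and T: "is_gset G T" and a: "a \<in> equivariant_maps G T U" and b: "b \<in> equivariant_maps G T V"
    and ab: "\<forall>t\<in>car T. u (a t) = g (b t)"
  shows "\<exists>!h. h \<in> equivariant_maps G T W \<and> compose (car T) f h = a \<and> compose (car T) w h = b"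
proof -
  have ex: "\<exists>!p. p \<in> car W \<and> f p = a t \<and> w p = b t" if "t \<in> car T" for t
    using fp ab that equivariantD(1)[OF a that] equivariantD(1)[OF b that] unfolding fibre_product_def by blast
  define h where "h = (\<lambda>t\<in>car T. THE p. p \<in> car W \<and> f p = a t \<and> w p = b t)"
  have h: "h t \<in> car W \<and> f (h t) = a t \<and> w (h t) = b t" if "t \<in> car T" for t
    using theI'[OF ex[OF that]] that by (simp add: h_def)
  have heq: "p = h t" if "t \<in> car T" "p \<in> car W" "f p = a t" "w p = b t" for p t
    using ex[OF that(1)] h[OF that(1)] that by blast
  have "h \<in> equivariant_maps G T W"
  proof (rule equivariantI)
    show "h \<in> extensional (car T)" by (simp add: h_def)
    fix k t assume kt: "k \<in> carrier G" "t \<in> car T"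
    show "h (act T k t) = act W k (h t)"
      by (rule heq[symmetric])
         (use kt h[OF kt(2)] gsetD(1)[OF T] gsetD(1)[OF W] equivariantD(2)[OF f] equivariantD(2)[OF w]
            equivariantD(2)[OF a] equivariantD(2)[OF b] in simp_all)
  qed (use h in blast)
  moreover have "compose (car T) f h = a" "compose (car T) w h = b"
    using h equivariantD(3)[OF a] equivariantD(3)[OF b] by (simp_all add: compose_eq_ext_iff)
  moreover have "h' = h" if h': "h' \<in> equivariant_maps G T W" "compose (car T) f h' = a" "compose (car T) w h' = b" for h'
  proof (rule extensionalityI[OF equivariantD(3)[OF h'(1)]])
    show "h \<in> extensional (car T)" by (simp add: h_def)
    show "h' t = h t" if "t \<in> car T" for t
      by (rule heq[OF that equivariantD(1)[OF h'(1) that]]) (use h'(2,3) that compose_eq in metis)+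
  qed
  ultimately show ?thesis by blast
qed

lemma cartesian_GFinI:
  assumes ob: "is_gset G W" "is_gset G U" "is_gset G V" "is_gset G Z" "finite (car W)" "finite (car U)" "finite (car V)" "finite (car Z)"
    and f: "f \<in> equivariant_maps G W U" and w: "w \<in> equivariant_maps G W V"
    and u: "u \<in> equivariant_maps G U Z" and g: "g \<in> equivariant_maps G V Z"
    and fp: "fibre_product f w u g (car W) (car U) (car V)"
  shows "cartesian (GFin G) W U V Z f w u g"
proof (rule cartesianI)
  fix T a b assume "T \<in> Ob (GFin G)" "a \<in> Hom (GFin G) T U" "b \<in> Hom (GFin G) T V" "Cmp (GFin G) T u a = Cmp (GFin G) T g b"
  then have T: "is_gset G T" "a \<in> equivariant_maps G T U" "b \<in> equivariant_maps G T V" "\<forall>t\<in>car T. u (a t) = g (b t)"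
    by (simp_all add: compose_eq_iff)
  show "\<exists>!h. h \<in> Hom (GFin G) T W \<and> Cmp (GFin G) T f h = a \<and> Cmp (GFin G) T w h = b"
    unfolding GFin_simps by (rule fibre_product_lift[OF fp ob(1) f w T])
qed (use assms in \<open>simp_all add: compose_eq_iff fibre_product_def\<close>)

section \<open>Discrete bornological coarse spaces\<close>

lemma min_min_simps [simp]:
  "car (min_min S) = car S" "act (min_min S) = act S" "ent (min_min S) = Pow (Id_on (car S))" "bdd (min_min S) = Fpow (car S)"
  by (simp_all add: min_min_def)

lemma coarse_min: "coarse_structure X (Pow (Id_on X))"
  unfolding coarse_structure_def by auto

lemma bornology_Fpow: "bornology X (Fpow X)"
  unfolding bornology_def Fpow_def by (auto intro: finite_subset)

lemma is_gspace_min_min: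
  assumes S: "is_gset G S"
  shows "is_gspace G (min_min S)"
proof -
  interpret group_action G "car S" "act S" using S by (simp add: is_gset_def)
  \<comment> \<open>The whole diagonal is an invariant entourage containing all others.\<close>
  have inv: "Id_on (car S) \<in> inv_ent G (min_min S)"
  proof -
    have "map_prod (act S g) (act S g) ` Id_on (car S) = Id_on (car S)" if g: "g \<in> carrier G" for g
    proof -
      have "act S g ` car S = car S" by (rule surj_prop[OF g])
      then show ?thesis by (auto simp: Id_on_def image_iff) (metis image_eqI imageE)+
    qed
    then show ?thesis by (simp add: inv_ent_def)
  qed
  have "is_gset G (min_min S)" using S by (simp add: is_gset_def)
  moreover have "map_prod (act S g) (act S g) ` U \<subseteq> Id_on (car S)" if "g \<in> carrier G" "U \<subseteq> Id_on (car S)" for g U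
    using that gsetD(1)[OF S] by fastforce
  moreover have "thicken U B \<in> Fpow (car S)" if "U \<subseteq> Id_on (car S)" "B \<in> Fpow (car S)" for U B
  proof -
    have "thicken U B \<subseteq> B" using that(1) by (auto simp: thicken_def)
    then show ?thesis using that(2) by (auto simp: Fpow_def intro: finite_subset)
  qed
  moreover have "act S g ` B \<in> Fpow (car S)" if "g \<in> carrier G" "B \<in> Fpow (car S)" for g B
    using that gsetD(1)[OF S] by (auto simp: Fpow_def)
  ultimately show ?thesis unfolding is_gspace_def
    using coarse_min bornology_Fpow inv by (auto simp del: image_subset_iff)
qed

lemma gspace_wide_simps [simp]:
  "Ob (GBornCoarse_wide G) = {X. is_gspace G X}"
  "Hom (GBornCoarse_wide G) X Y = {f \<in> equivariant_maps G X Y. controlled X Y f}"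
  "Idn (GBornCoarse_wide G) X = restrict id (car X)" "Cmp (GBornCoarse_wide G) X = compose (car X)"
  by (simp_all add: GBornCoarse_wide_def)

lemma min_min_equivariant: "equivariant_maps G (min_min S) (min_min T) = equivariant_maps G S T"
  by (simp add: equivariant_maps_def)

lemma min_min_map:
  assumes u: "u \<in> equivariant_maps G S T" and fin: "finite (car S)"
  shows "controlled (min_min S) (min_min T) u" "proper (min_min S) (min_min T) u" "bornological (min_min S) (min_min T) u"
proof -
  show "controlled (min_min S) (min_min T) u" unfolding controlled_def using equivariantD(1)[OF u] by fastforce
  show "proper (min_min S) (min_min T) u" unfolding proper_def using fin by (auto simp: Fpow_def)
  show "bornological (min_min S) (min_min T) u" unfolding bornological_def using equivariantD(1)[OF u] by (auto simp: Fpow_def)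
qed

lemma components_min_min: "components (min_min S) = (\<lambda>x. {x}) ` car S"
proof -
  have c: "comp_rel (min_min S) = Id_on (car S)" by (auto simp: comp_rel_def)
  have "Id_on (car S) `` {x} = {x}" if "x \<in> car S" for x using that by auto
  then show ?thesis unfolding components_def c quotient_def by auto
qed

lemma comp_hull_min_min: "A \<subseteq> car S ==> comp_hull (min_min S) A = A"
  unfolding comp_hull_def components_min_min by auto

text \<open>Every coarse structure contains the subsets of the diagonal, and these already form
  one.\<close>

lemma gen_coarse_min:
  assumes "\<And>U. U \<in> \<S> ==> U \<subseteq> Id_on X" shows "gen_coarse X \<S> = Pow (Id_on X)"
proof
  show "gen_coarse X \<S> \<subseteq> Pow (Id_on X)" unfolding gen_coarse_def using coarse_min assms by (intro Inter_lower) auto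
  show "Pow (Id_on X) \<subseteq> gen_coarse X \<S>" unfolding gen_coarse_def coarse_structure_def by blast
qed

lemma coarse_iso_point:
  assumes "x \<in> car S" "u x \<in> car T"
  shows "coarse_iso_on (min_min S) (min_min T) u {x} {u x}"
proof -
  have i: "inv_into {x} u (u x) = x" by (metis inv_into_into imageI insertI1 singletonD)
  have "map_prod (inv_into {x} u) (inv_into {x} u) ` V \<subseteq> Id_on (car S)" if "V \<subseteq> {u x} \<times> {u x}" for V
    using that i assms(1) by auto
  moreover have "map_prod u u ` V \<subseteq> Id_on (car T)" if "V \<subseteq> {x} \<times> {x}" for V
    using that assms(2) by auto
  ultimately show ?thesis by (auto simp: coarse_iso_on_def simp del: image_subset_iff)
qed

text \<open>The coarse components are the points, so every condition is checked on single points; a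
  bounded set is finite and splits into finitely many of them.\<close>

lemma bounded_covering_min_min:
  assumes u: "u \<in> equivariant_maps G S T" and fin: "finite (car S)"
  shows "bounded_covering G (min_min S) (min_min T) u"
proof -
  have m: "u x \<in> car T" if "x \<in> car S" for x by (rule equivariantD(1)[OF u that])
  have "ent (min_min S) = gen_coarse (car (min_min S))
     {F \<inter> (\<Union>W0\<in>components (min_min S). W0 \<times> W0) | F. F \<in> max_coarse (car (min_min S)) (min_min T) u}"
    unfolding min_min_simps by (rule gen_coarse_min[symmetric]) (auto simp: components_min_min)
  moreover have "\<forall>W0\<in>components (min_min S). u ` W0 \<in> components (min_min T) \<and>
      coarse_iso_on (min_min S) (min_min T) u W0 (u ` W0)"
    unfolding components_min_min using m coarse_iso_point[of _ S u T] by auto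
  ultimately have bc: "bounded_coarse_covering (min_min S) (min_min T) u"
    unfolding bounded_coarse_covering_def by blast
  have "\<exists>\<P>. finite \<P> \<and> \<Union>\<P> = B \<and>
        (\<forall>A\<in>\<P>. \<forall>A'\<in>\<P>. A \<noteq> A' \<longrightarrow> comp_hull (min_min S) A \<inter> comp_hull (min_min S) A' = {}) \<and>
        (\<forall>A\<in>\<P>. coarse_iso_on (min_min S) (min_min T) u (comp_hull (min_min S) A) (comp_hull (min_min T) (u ` A)))"
    if B: "B \<in> Fpow (car S)" for B
  proof (rule exI[of _ "(\<lambda>x. {x}) ` B"], intro conjI ballI impI)
    show "finite ((\<lambda>x. {x}) ` B)" "\<Union>((\<lambda>x. {x}) ` B) = B" using B by (auto simp: Fpow_def)
    have h: "comp_hull (min_min S) {x} = {x}" "comp_hull (min_min T) {u x} = {u x}" if "x \<in> B" for x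
      using comp_hull_min_min[of "{x}" S] comp_hull_min_min[of "{u x}" T] m that B by (auto simp: Fpow_def)
    show "comp_hull (min_min S) A \<inter> comp_hull (min_min S) A' = {}"
      if "A \<in> (\<lambda>x. {x}) ` B" "A' \<in> (\<lambda>x. {x}) ` B" "A \<noteq> A'" for A A' using that h by auto
    show "coarse_iso_on (min_min S) (min_min T) u (comp_hull (min_min S) A) (comp_hull (min_min T) (u ` A))"
      if A: "A \<in> (\<lambda>x. {x}) ` B" for A
    proof -
      obtain x where x: "x \<in> B" "A = {x}" using A by blast
      have "x \<in> car S" using x B by (auto simp: Fpow_def)
      then show ?thesis using coarse_iso_point[of x S u T] m h[OF x(1)] x(2) by simp
    qed
  qed
  then show ?thesis unfolding bounded_covering_def
    using bc min_min_map[OF u fin] u by (simp add: min_min_equivariant)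
qed

text \<open>The test space \<open>T\<close> is arbitrary, so the lift must be shown to be
  controlled: two points related by an entourage have equal images in the discrete spaces on
  \<open>U\<close> and \<open>V\<close>, hence equal lifts.\<close>

lemma cartesian_min_min:
  assumes ob: "is_gset G W" "is_gset G U" "is_gset G V" "is_gset G Z" "finite (car W)" "finite (car U)" "finite (car V)"
    and f: "f \<in> equivariant_maps G W U" and w: "w \<in> equivariant_maps G W V"
    and u: "u \<in> equivariant_maps G U Z" and g: "g \<in> equivariant_maps G V Z"
    and fp: "fibre_product f w u g (car W) (car U) (car V)"
  shows "cartesian (GBornCoarse_wide G) (min_min W) (min_min U) (min_min V) (min_min Z) f w u g"
proof (rule cartesianI)
  fix T a b assume "T \<in> Ob (GBornCoarse_wide G)" "a \<in> Hom (GBornCoarse_wide G) T (min_min U)"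
    "b \<in> Hom (GBornCoarse_wide G) T (min_min V)" "Cmp (GBornCoarse_wide G) T u a = Cmp (GBornCoarse_wide G) T g b"
  then have T: "is_gspace G T" and a: "a \<in> equivariant_maps G T (min_min U)" "controlled T (min_min U) a"
      and b: "b \<in> equivariant_maps G T (min_min V)" "controlled T (min_min V) b" and ab: "\<forall>t\<in>car T. u (a t) = g (b t)"
    by (simp_all add: compose_eq_iff)
  show "\<exists>!h. h \<in> Hom (GBornCoarse_wide G) T (min_min W) \<and> Cmp (GBornCoarse_wide G) T f h = a \<and> Cmp (GBornCoarse_wide G) T w h = b"
    unfolding gspace_wide_simps mem_Collect_eq
  proof -
    have T': "is_gset G T" using T by (simp add: is_gspace_def)
    have W': "is_gset G (min_min W)" using ob(1) by (simp add: is_gset_def)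
    have fp': "fibre_product f w u g (car (min_min W)) (car (min_min U)) (car (min_min V))" using fp by simp
    have f': "f \<in> equivariant_maps G (min_min W) (min_min U)" and w': "w \<in> equivariant_maps G (min_min W) (min_min V)"
      using f w by (simp_all add: min_min_equivariant)
    have ex1: "\<exists>!h. h \<in> equivariant_maps G T (min_min W) \<and> compose (car T) f h = a \<and> compose (car T) w h = b"
      by (rule fibre_product_lift[OF fp' W' f' w' T' a(1) b(1) ab])
    then obtain h where h: "h \<in> equivariant_maps G T (min_min W)" "compose (car T) f h = a" "compose (car T) w h = b" by blast
    have "controlled T (min_min W) h" unfolding controlled_def
    proof
      fix F assume F: "F \<in> ent T"
      have FT: "F \<subseteq> car T \<times> car T" using T F by (auto simp: is_gspace_def coarse_structure_def)
      have "(h x, h y) \<in> Id_on (car W)" if "(x, y) \<in> F" for x y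
      proof -
        have xy: "x \<in> car T" "y \<in> car T" using that FT by auto
        have "(a x, a y) \<in> Id_on (car U)" "(b x, b y) \<in> Id_on (car V)"
          using a(2) b(2) F that unfolding controlled_def by force+
        then have "a x = a y" "b x = b y" by auto
        then have e: "f (h x) = f (h y)" "w (h x) = w (h y)" using h(2,3) xy compose_eq by metis+
        have W: "h x \<in> car W" "h y \<in> car W" using equivariantD(1)[OF h(1)] xy by simp_all
        have "u (f (h x)) = g (w (h x))" "f (h x) \<in> car U" "w (h x) \<in> car V"
          using fp W equivariantD(1)[OF f] equivariantD(1)[OF w] unfolding fibre_product_def by blast+
        then have "\<exists>!p. p \<in> car W \<and> f p = f (h x) \<and> w p = w (h x)" using fp unfolding fibre_product_def by blast
        then have "h x = h y" using e W by metis
        then show ?thesis using W by auto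
      qed
      then show "map_prod h h ` F \<in> ent (min_min W)" by auto
    qed
    then show "\<exists>!h. (h \<in> equivariant_maps G T (min_min W) \<and> controlled T (min_min W) h) \<and> compose (car T) f h = a \<and> compose (car T) w h = b"
      using h ex1 by blast
  qed
qed (use ob is_gspace_min_min min_min_map(1)[OF f] min_min_map(1)[OF w] min_min_map(1)[OF u] min_min_map(1)[OF g] f w u g fp in
    \<open>simp_all add: compose_eq_iff min_min_equivariant fibre_product_def\<close>)

lemma admissible_min_min:
  fixes W :: "('g, 'u) gset"
  assumes "infinite (UNIV :: 'u set)" and c: "cartesian (GFin G) W U V Z f w u g"
  shows "admissible G (min_min W) (min_min U) (min_min V) (min_min Z) f w u g"
proof -
  have ob: "is_gset G W" "is_gset G U" "is_gset G V" "is_gset G Z" "finite (car W)" "finite (car U)" "finite (car V)"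
    and m: "f \<in> equivariant_maps G W U" "w \<in> equivariant_maps G W V" "u \<in> equivariant_maps G U Z" "g \<in> equivariant_maps G V Z"
    using cartesianD(1-8)[OF c] by simp_all
  show ?thesis unfolding admissible_def
    using cartesian_min_min[OF ob m cartesian_GFin_fibre_product[OF assms]] min_min_map[OF m(1) ob(5)]
      min_min_map[OF m(4) ob(7)] bounded_covering_min_min[OF m(3) ob(6)] by blast
qed

section \<open>Simplicial sets of twisted diagrams\<close>

lemma mk_diag_cong:
  assumes "\<And>p. p \<in> P ==> F0 p = F0' p" "\<And>p q. p \<in> P ==> q \<in> P ==> po p q ==> F1 p q = F1' p q"
  shows "mk_diag P po F0 F1 = mk_diag P po F0' F1'"
  using assms by (simp add: mk_diag_def fun_eq_iff)

lemma fst_mk_diag [simp]: "p \<in> P ==> fst (mk_diag P po F0 F1) p = F0 p"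
  by (simp add: mk_diag_def)

lemma snd_mk_diag [simp]: "p \<in> P ==> q \<in> P ==> po p q ==> snd (mk_diag P po F0 F1) p q = F1 p q"
  by (simp add: mk_diag_def)

lemma reindex_cong:
  assumes "\<And>p. p \<in> P ==> \<phi> p = \<psi> p" shows "reindex P po \<phi> F = reindex P po \<psi> F"
  unfolding reindex_def by (rule mk_diag_cong) (simp_all add: assms)

lemma reindex_reindex:
  assumes "\<And>p. p \<in> P ==> \<phi> p \<in> Q" "\<And>p q. p \<in> P ==> q \<in> P ==> po p q ==> po' (\<phi> p) (\<phi> q)"
  shows "reindex P po \<phi> (reindex Q po' \<psi> F) = reindex P po (\<lambda>p. \<psi> (\<phi> p)) F"
  unfolding reindex_def by (rule mk_diag_cong) (simp_all add: assms)

lemma is_functorI: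
  assumes "\<And>p. p \<in> P ==> F0 p \<in> Ob C" "\<And>p. p \<in> P ==> F1 p p = Idn C (F0 p)"
    "\<And>p q. p \<in> P ==> q \<in> P ==> po p q ==> F1 p q \<in> Hom C (F0 p) (F0 q)"
    "\<And>p q r. p \<in> P ==> q \<in> P ==> r \<in> P ==> po p q ==> po q r ==> F1 p r = Cmp C (F0 p) (F1 q r) (F1 p q)"
    and po: "reflp_on P po" "transp_on P po"
  shows "is_functor P po C (mk_diag P po F0 F1)"
proof -
  have r: "po p p" if "p \<in> P" for p using po(1) that by (simp add: reflp_on_def)
  have t: "po p r" if "p \<in> P" "q \<in> P" "r \<in> P" "po p q" "po q r" for p q r using po(2) that unfolding transp_on_def by blast
  have "mk_diag P po (fst (mk_diag P po F0 F1)) (snd (mk_diag P po F0 F1)) = mk_diag P po F0 F1"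
    by (rule mk_diag_cong) simp_all
  moreover have "snd (mk_diag P po F0 F1) p r = Cmp C (fst (mk_diag P po F0 F1) p) (snd (mk_diag P po F0 F1) q r) (snd (mk_diag P po F0 F1) p q)"
    if "p \<in> P" "q \<in> P" "r \<in> P" "po p q" "po q r" for p q r
    using assms(4)[OF that] t[OF that] that by simp
  ultimately show ?thesis unfolding is_functor_def using assms(1-3) r by simp
qed

lemma is_functorD:
  assumes "is_functor P po C F"
  shows "mk_diag P po (fst F) (snd F) = F" "p \<in> P ==> fst F p \<in> Ob C" "p \<in> P ==> snd F p p = Idn C (fst F p)"
    "p \<in> P ==> q \<in> P ==> po p q ==> snd F p q \<in> Hom C (fst F p) (fst F q)"
    "p \<in> P ==> q \<in> P ==> r \<in> P ==> po p q ==> po q r ==> snd F p r = Cmp C (fst F p) (snd F q r) (snd F p q)"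
  using assms unfolding is_functor_def by blast+

lemma functor_reindex:
  assumes F: "is_functor Q po' C F" and po: "reflp_on P po" "transp_on P po"
    and m: "\<And>p. p \<in> P ==> \<phi> p \<in> Q" "\<And>p q. p \<in> P ==> q \<in> P ==> po p q ==> po' (\<phi> p) (\<phi> q)"
  shows "is_functor P po C (reindex P po \<phi> F)"
  unfolding reindex_def by (rule is_functorI) (use is_functorD(2-5)[OF F] m po in auto)

lemma tw_order: "reflp_on (Tw n) tw_le" "transp_on (Tw n) tw_le"
  by (auto simp: reflp_on_def transp_on_def tw_le_def Tw_def)

lemma Delta_nth:
  assumes "\<alpha> \<in> splx (Delta n) m"
  shows "i \<le> m ==> \<alpha> ! i \<le> n" "i \<le> j ==> j \<le> m ==> \<alpha> ! i \<le> \<alpha> ! j"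
proof -
  have a: "length \<alpha> = Suc m" "set \<alpha> \<subseteq> {..n}" "sorted \<alpha>" using assms by (simp_all add: Delta_iff)
  show "\<alpha> ! i \<le> n" if "i \<le> m" for i
  proof -
    have "\<alpha> ! i \<in> set \<alpha>" by (rule nth_mem) (use that a(1) in simp)
    then show ?thesis using a(2) by blast
  qed
  show "\<alpha> ! i \<le> \<alpha> ! j" if "i \<le> j" "j \<le> m" for i j using sorted_nth_mono[OF a(3) that(1)] that(2) a(1) by simp
qed

lemma tw_nth:
  assumes "\<alpha> \<in> splx (Delta n) m"
  shows "p \<in> Tw m ==> map_prod (nth \<alpha>) (nth \<alpha>) p \<in> Tw n"
    "p \<in> Tw m ==> q \<in> Tw m ==> tw_le p q ==> tw_le (map_prod (nth \<alpha>) (nth \<alpha>) p) (map_prod (nth \<alpha>) (nth \<alpha>) q)"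
proof -
  note n = Delta_nth(1)[OF assms] and m = Delta_nth(2)[OF assms]
  show "p \<in> Tw m ==> map_prod (nth \<alpha>) (nth \<alpha>) p \<in> Tw n" by (auto simp: Tw_def m n)
  show "p \<in> Tw m ==> q \<in> Tw m ==> tw_le p q ==> tw_le (map_prod (nth \<alpha>) (nth \<alpha>) p) (map_prod (nth \<alpha>) (nth \<alpha>) q)"
    by (auto simp: Tw_def tw_le_def intro!: m)
qed

text \<open>Operators act on both indices of \<open>Tw\<close> monotonically, so the diagrams
  restrict; stability of the extra condition \<open>Q\<close> is what has to be supplied.\<close>

lemma is_sset_tw_sset:
  assumes Q: "\<And>n m \<alpha> F. is_functor (Tw n) tw_le C F ==> Q n F ==> \<alpha> \<in> splx (Delta n) m ==>
    Q m (reindex (Tw m) tw_le (map_prod (nth \<alpha>) (nth \<alpha>)) F)"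
  shows "is_sset (tw_sset C Q)"
proof -
  have 1: "reindex (Tw n) tw_le (map_prod (nth [0..<Suc n]) (nth [0..<Suc n])) F = F" if F: "is_functor (Tw n) tw_le C F" for n F
  proof -
    have i: "map_prod (nth [0..<Suc n]) (nth [0..<Suc n]) p = p" if "p \<in> Tw n" for p
      using that by (cases p) (simp add: Tw_def)
    have "reindex (Tw n) tw_le (map_prod (nth [0..<Suc n]) (nth [0..<Suc n])) F = mk_diag (Tw n) tw_le (fst F) (snd F)"
      unfolding reindex_def by (rule mk_diag_cong) (simp_all only: i)
    then show ?thesis using is_functorD(1)[OF F] by simp
  qed
  have 2: "is_functor (Tw m) tw_le C (reindex (Tw m) tw_le (map_prod (nth \<alpha>) (nth \<alpha>)) F)"
    if "is_functor (Tw n) tw_le C F" "\<alpha> \<in> splx (Delta n) m" for n m \<alpha> F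
    by (rule functor_reindex[OF that(1) tw_order tw_nth[OF that(2)]])
  have 3: "reindex (Tw k) tw_le (map_prod (nth \<beta>) (nth \<beta>)) (reindex (Tw m) tw_le (map_prod (nth \<alpha>) (nth \<alpha>)) F) =
      reindex (Tw k) tw_le (map_prod (nth (map (nth \<alpha>) \<beta>)) (nth (map (nth \<alpha>) \<beta>))) F"
    if b: "\<beta> \<in> splx (Delta m) k" for m k \<alpha> \<beta> and F :: "(nat \<times> nat, 'a, 'b) diag"
  proof -
    have "reindex (Tw k) tw_le (map_prod (nth \<beta>) (nth \<beta>)) (reindex (Tw m) tw_le (map_prod (nth \<alpha>) (nth \<alpha>)) F) =
      reindex (Tw k) tw_le (\<lambda>p. map_prod (nth \<alpha>) (nth \<alpha>) (map_prod (nth \<beta>) (nth \<beta>) p)) F"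
      by (rule reindex_reindex[where P = "Tw k" and Q = "Tw m" and po = tw_le and po' = tw_le and \<phi> = "map_prod (nth \<beta>) (nth \<beta>)", OF tw_nth[OF b]])
    also have "\<dots> = reindex (Tw k) tw_le (map_prod (nth (map (nth \<alpha>) \<beta>)) (nth (map (nth \<alpha>) \<beta>))) F"
      by (rule reindex_cong) (use b in \<open>auto simp: Tw_def pnerve_def\<close>)
    finally show ?thesis .
  qed
  have len: "length \<alpha> = Suc m" if "\<alpha> \<in> splx (Delta n) m" for \<alpha> n m using that by (simp add: pnerve_def)
  show ?thesis unfolding is_sset_def
  proof (intro allI ballI conjI)
    fix n F assume "F \<in> splx (tw_sset C Q) n"
    then have F: "is_functor (Tw n) tw_le C F" "Q n F" by (simp_all add: tw_sset_def)
    show "opr (tw_sset C Q) n [0..<Suc n] F = F" using 1[OF F(1)] by (simp add: tw_sset_def)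
    fix m \<alpha> assume a: "\<alpha> \<in> splx (Delta n) m"
    show "opr (tw_sset C Q) n \<alpha> F \<in> splx (tw_sset C Q) m" using 2[OF F(1) a] Q[OF F a] len[OF a] by (simp add: tw_sset_def)
    fix k \<beta> assume b: "\<beta> \<in> splx (Delta m) k"
    show "opr (tw_sset C Q) m \<beta> (opr (tw_sset C Q) n \<alpha> F) = opr (tw_sset C Q) n (map (nth \<alpha>) \<beta>) F"
      using 3[OF b, of \<alpha> F] len[OF a] len[OF b] by (simp add: tw_sset_def)
  qed
qed

section \<open>The Burnside category, its duality, and the passage to spaces with transfers\<close>

definition pullback_diag :: "('g, 'r) monoid_scheme => nat => ('g, 'u) span_simplex => bool" where
  "pullback_diag G n F \<longleftrightarrow> (\<forall>i i' j' j. i \<le> i' \<and> i' \<le> j' \<and> j' \<le> j \<and> j \<le> n \<longrightarrow>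
       cartesian (GFin G) (fst F (i, j)) (fst F (i', j)) (fst F (i, j')) (fst F (i', j'))
         (snd F (i, j) (i', j)) (snd F (i, j) (i, j')) (snd F (i', j) (i', j')) (snd F (i, j') (i', j')))"

lemma A_eff_eq: "A_eff G = tw_sset (GFin G) (pullback_diag G)"
  unfolding A_eff_def pullback_diag_def by (simp add: case_prod_beta')

lemma splx_A_eff: "splx (A_eff G) n = {F. is_functor (Tw n) tw_le (GFin G) F \<and> pullback_diag G n F}"
  by (simp add: A_eff_eq tw_sset_def)

lemma opr_A_eff: "opr (A_eff G) n \<alpha> = reindex (Tw (length \<alpha> - 1)) tw_le (map_prod (nth \<alpha>) (nth \<alpha>))"
  by (simp add: A_eff_eq tw_sset_def)

lemma is_sset_A_eff:
  fixes G :: "('g, 'r) monoid_scheme"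
  shows "is_sset (A_eff G :: ('g, 'u) span_simplex sset)"
  unfolding A_eff_eq
proof (rule is_sset_tw_sset)
  fix n m \<alpha> and F :: "('g, 'u) span_simplex"
  assume F: "pullback_diag G n F" and a: "\<alpha> \<in> splx (Delta n) m"
  note n = Delta_nth(1)[OF a] and m = Delta_nth(2)[OF a]
  let ?R = "reindex (Tw m) tw_le (map_prod (nth \<alpha>) (nth \<alpha>)) F"
  show "pullback_diag G m ?R"
    unfolding pullback_diag_def
  proof (intro allI impI, elim conjE)
    fix i i' j' j assume ij: "i \<le> i'" "i' \<le> j'" "j' \<le> j" "j \<le> m"
    have tw: "(i, j) \<in> Tw m" "(i', j) \<in> Tw m" "(i, j') \<in> Tw m" "(i', j') \<in> Tw m"
      "tw_le (i, j) (i', j)" "tw_le (i, j) (i, j')" "tw_le (i', j) (i', j')" "tw_le (i, j') (i', j')"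
      using ij by (simp_all add: Tw_def tw_le_def)
    have "\<alpha> ! i \<le> \<alpha> ! i'" "\<alpha> ! i' \<le> \<alpha> ! j'" "\<alpha> ! j' \<le> \<alpha> ! j" "\<alpha> ! j \<le> n" using ij m n by simp_all
    then show "cartesian (GFin G) (fst ?R (i, j)) (fst ?R (i', j)) (fst ?R (i, j')) (fst ?R (i', j'))
      (snd ?R (i, j) (i', j)) (snd ?R (i, j) (i, j')) (snd ?R (i', j) (i', j')) (snd ?R (i, j') (i', j'))"
      using F[unfolded pullback_diag_def] tw by (simp add: reindex_def)
  qed
qed

text \<open>Conjugation of a monotone map by the order reversals, which is the action in the
  opposite simplicial set.\<close>

definition rv :: "nat => nat list => nat list" where "rv n \<alpha> = rev (map (\<lambda>i. n - i) \<alpha>)"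

lemma rv_nth: "i < length \<alpha> ==> rv n \<alpha> ! i = n - \<alpha> ! (length \<alpha> - Suc i)"
  by (simp add: rv_def rev_nth)

lemma length_rv [simp]: "length (rv n \<alpha>) = length \<alpha>"
  by (simp add: rv_def)

lemma rv_Delta:
  assumes "\<alpha> \<in> splx (Delta n) m" shows "rv n \<alpha> \<in> splx (Delta n) m"
proof -
  have a: "length \<alpha> = Suc m" "sorted \<alpha>" using assms by (simp_all add: pnerve_def)
  have "sorted (rv n \<alpha>)" unfolding sorted_iff_nth_mono
  proof (intro allI impI)
    fix i j assume ij: "i \<le> j" "j < length (rv n \<alpha>)"
    have "\<alpha> ! (length \<alpha> - Suc j) \<le> \<alpha> ! (length \<alpha> - Suc i)" by (rule sorted_nth_mono[OF a(2)]) (use ij in auto)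
    then show "rv n \<alpha> ! i \<le> rv n \<alpha> ! j" using ij by (simp add: rv_nth)
  qed
  then show ?thesis using a by (auto simp: pnerve_def rv_def)
qed

lemma opr_op_sset: "opr (op_sset X) n \<alpha> = opr X n (rv n \<alpha>)"
  by (simp add: op_sset_def rv_def)

lemma splx_op_sset [simp]: "splx (op_sset X) = splx X"
  by (simp add: op_sset_def)

lemma is_sset_op_sset:
  assumes X: "is_sset X" shows "is_sset (op_sset X)"
  unfolding is_sset_def splx_op_sset opr_op_sset
proof (intro allI ballI conjI)
  fix n x assume x: "x \<in> splx X n"
  have "rv n [0..<Suc n] = [0..<Suc n]"
    by (rule nth_equalityI) (simp_all add: rv_nth)
  then show "opr X n (rv n [0..<Suc n]) x = x" using X x by (simp add: is_sset_def)
  fix m \<alpha> assume a: "\<alpha> \<in> splx (Delta n) m"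
  show "opr X n (rv n \<alpha>) x \<in> splx X m" using X x rv_Delta[OF a] by (simp add: is_sset_def)
  fix k \<beta> assume b: "\<beta> \<in> splx (Delta m) k"
  have "map (nth (rv n \<alpha>)) (rv m \<beta>) = rv n (map (nth \<alpha>) \<beta>)"
  proof (rule nth_equalityI)
    fix i assume "i < length (map (nth (rv n \<alpha>)) (rv m \<beta>))"
    then have i: "i < length \<beta>" by simp
    have "\<beta> ! (length \<beta> - Suc i) \<le> m" using Delta_nth(1)[OF b, of "length \<beta> - Suc i"] b i by (simp add: Delta_iff)
    then show "map (nth (rv n \<alpha>)) (rv m \<beta>) ! i = rv n (map (nth \<alpha>) \<beta>) ! i"
      using a i by (simp add: rv_nth pnerve_def)
  qed simp
  then show "opr X m (rv m \<beta>) (opr X n (rv n \<alpha>) x) = opr X n (rv n (map (nth \<alpha>) \<beta>)) x"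
    using X x rv_Delta[OF a] rv_Delta[OF b] by (simp add: is_sset_def)
qed

lemma tw_dual:
  shows "p \<in> Tw n ==> (\<lambda>(i, j). (n - j, n - i)) p \<in> Tw n"
    "p \<in> Tw n ==> q \<in> Tw n ==> tw_le p q ==> tw_le ((\<lambda>(i, j). (n - j, n - i)) p) ((\<lambda>(i, j). (n - j, n - i)) q)"
  by (auto simp: Tw_def tw_le_def)

text \<open>Reversing both indices exchanges the two directions of each square, so its pull-back
  property is that of a transposed square.\<close>

lemma duality_A_eff:
  assumes F: "F \<in> splx (A_eff G) n" shows "duality n F \<in> splx (A_eff G) n"
proof -
  have F: "is_functor (Tw n) tw_le (GFin G) F" "pullback_diag G n F" using F by (simp_all add: splx_A_eff)
  have "is_functor (Tw n) tw_le (GFin G) (duality n F)"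
    unfolding duality_def by (rule functor_reindex[OF F(1) tw_order tw_dual])
  moreover have "pullback_diag G n (duality n F)" unfolding pullback_diag_def
  proof (intro allI impI, elim conjE)
    fix i i' j' j assume ij: "i \<le> i'" "i' \<le> j'" "j' \<le> j" "j \<le> n"
    have tw: "(i, j) \<in> Tw n" "(i', j) \<in> Tw n" "(i, j') \<in> Tw n" "(i', j') \<in> Tw n"
      "tw_le (i, j) (i', j)" "tw_le (i, j) (i, j')" "tw_le (i', j) (i', j')" "tw_le (i, j') (i', j')"
      using ij by (simp_all add: Tw_def tw_le_def)
    have "n - j \<le> n - j'" "n - j' \<le> n - i'" "n - i' \<le> n - i" "n - i \<le> n" using ij by simp_all
    from F(2)[unfolded pullback_diag_def, rule_format, OF conjI[OF this(1) conjI[OF this(2) conjI[OF this(3,4)]]], THEN cartesian_transpose]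
    show "cartesian (GFin G) (fst (duality n F) (i, j)) (fst (duality n F) (i', j)) (fst (duality n F) (i, j')) (fst (duality n F) (i', j'))
         (snd (duality n F) (i, j) (i', j)) (snd (duality n F) (i, j) (i, j')) (snd (duality n F) (i', j) (i', j')) (snd (duality n F) (i, j') (i', j'))"
      using tw by (simp add: duality_def reindex_def)
  qed
  ultimately show ?thesis by (simp add: splx_A_eff)
qed

text \<open>The reversal built into the opposite operators is cancelled by the one in
  \<open>duality\<close>.\<close>

lemma duality_opr:
  assumes a: "\<alpha> \<in> splx (Delta n) m"
  shows "duality m (opr (op_sset (A_eff G)) n \<alpha> F) = opr (A_eff G) n \<alpha> (duality n F)"
proof -
  have l: "length \<alpha> = Suc m" using a by (simp add: pnerve_def)
  have "duality m (opr (op_sset (A_eff G)) n \<alpha> F) =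
      reindex (Tw m) tw_le (\<lambda>p. map_prod (nth (rv n \<alpha>)) (nth (rv n \<alpha>)) ((\<lambda>(i, j). (m - j, m - i)) p)) F"
    unfolding duality_def opr_op_sset opr_A_eff using l by (simp add: reindex_reindex[where P = "Tw m" and Q = "Tw m" and po = tw_le and po' = tw_le and \<phi> = "\<lambda>(i, j). (m - j, m - i)", OF tw_dual])
  also have "\<dots> = reindex (Tw m) tw_le (\<lambda>p. (\<lambda>(i, j). (n - j, n - i)) (map_prod (nth \<alpha>) (nth \<alpha>) p)) F"
    by (rule reindex_cong) (use l in \<open>auto simp: Tw_def rv_nth\<close>)
  also have "\<dots> = opr (A_eff G) n \<alpha> (duality n F)"
    unfolding duality_def opr_A_eff using l by (simp add: reindex_reindex[where P = "Tw m" and Q = "Tw n" and po = tw_le and po' = tw_le and \<phi> = "map_prod (nth \<alpha>) (nth \<alpha>)", OF tw_nth[OF a]])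
  finally show ?thesis .
qed

text \<open>The squares tested for admissibility are those between neighbouring indices, a special
  case of the pull-back condition; equivariant maps of finite discrete spaces are bounded coverings,
  proper and bornological.\<close>

lemma M_functor_tr:
  fixes G :: "('g, 'r) monoid_scheme" and F :: "('g, 'u) span_simplex"
  assumes U: "infinite (UNIV :: 'u set)" and F: "F \<in> splx (A_eff G) n"
  shows "M_functor n F \<in> splx (GBornCoarse_tr G) n"
proof -
  have F: "is_functor (Tw n) tw_le (GFin G) F" "pullback_diag G n F" using F by (simp_all add: splx_A_eff)
  have ob: "is_gset G (fst F p)" "finite (car (fst F p))" if "p \<in> Tw n" for p
    using is_functorD(2)[OF F(1) that] by simp_all
  have mor: "snd F p q \<in> equivariant_maps G (fst F p) (fst F q)" if "p \<in> Tw n" "q \<in> Tw n" "tw_le p q" for p q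
    using is_functorD(4)[OF F(1) that] by simp
  have ftr: "is_functor (Tw n) tw_le (GBornCoarse_wide G) (M_functor n F)"
    unfolding M_functor_def
  proof (rule is_functorI[OF _ _ _ _ tw_order])
    fix p assume p: "p \<in> Tw n"
    show "min_min (fst F p) \<in> Ob (GBornCoarse_wide G)" using is_gspace_min_min[OF ob(1)[OF p]] by simp
    show "snd F p p = Idn (GBornCoarse_wide G) (min_min (fst F p))" using is_functorD(3)[OF F(1) p] by simp
    fix q assume q: "q \<in> Tw n" "tw_le p q"
    show "snd F p q \<in> Hom (GBornCoarse_wide G) (min_min (fst F p)) (min_min (fst F q))"
      using mor[OF p q] min_min_map(1)[OF mor[OF p q] ob(2)[OF p]] by (simp add: min_min_equivariant)
  next
    fix p q r assume "p \<in> Tw n" "q \<in> Tw n" "r \<in> Tw n" "tw_le p q" "tw_le q r"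
    from is_functorD(5)[OF F(1) this] show "snd F p r = Cmp (GBornCoarse_wide G) (min_min (fst F p)) (snd F q r) (snd F p q)" by simp
  qed
  have M: "fst (M_functor n F) p = min_min (fst F p)" "p \<in> Tw n ==> q \<in> Tw n ==> tw_le p q ==> snd (M_functor n F) p q = snd F p q"
    if "p \<in> Tw n" for p q using that by (simp_all add: M_functor_def)
  have 1: "bounded_covering G (fst (M_functor n F) (i, j)) (fst (M_functor n F) (i, j - 1)) (snd (M_functor n F) (i, j) (i, j - 1)) \<and>
      proper (fst (M_functor n F) (i, j)) (fst (M_functor n F) (i + 1, j)) (snd (M_functor n F) (i, j) (i + 1, j)) \<and>
      bornological (fst (M_functor n F) (i, j)) (fst (M_functor n F) (i + 1, j)) (snd (M_functor n F) (i, j) (i + 1, j))"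
    if ij: "i < j" "j \<le> n" for i j
  proof -
    have tw: "(i, j) \<in> Tw n" "(i, j - 1) \<in> Tw n" "(i + 1, j) \<in> Tw n" "tw_le (i, j) (i, j - 1)" "tw_le (i, j) (i + 1, j)"
      using ij by (auto simp: Tw_def tw_le_def)
    show ?thesis
      using bounded_covering_min_min[OF mor[OF tw(1,2,4)] ob(2)[OF tw(1)]] min_min_map(2,3)[OF mor[OF tw(1,3,5)] ob(2)[OF tw(1)]] tw
      by (simp only: M)
  qed
  have 2: "admissible G (fst (M_functor n F) (i - 1, j + 1)) (fst (M_functor n F) (i, j + 1)) (fst (M_functor n F) (i - 1, j)) (fst (M_functor n F) (i, j))
          (snd (M_functor n F) (i - 1, j + 1) (i, j + 1)) (snd (M_functor n F) (i - 1, j + 1) (i - 1, j))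
          (snd (M_functor n F) (i, j + 1) (i, j)) (snd (M_functor n F) (i - 1, j) (i, j))"
    if ij: "1 \<le> i" "i \<le> j" "j + 1 \<le> n" for i j
  proof -
    have tw: "(i - 1, j + 1) \<in> Tw n" "(i, j + 1) \<in> Tw n" "(i - 1, j) \<in> Tw n" "(i, j) \<in> Tw n"
      "tw_le (i - 1, j + 1) (i, j + 1)" "tw_le (i - 1, j + 1) (i - 1, j)" "tw_le (i, j + 1) (i, j)" "tw_le (i - 1, j) (i, j)"
      using ij by (auto simp: Tw_def tw_le_def)
    have "cartesian (GFin G) (fst F (i - 1, j + 1)) (fst F (i, j + 1)) (fst F (i - 1, j)) (fst F (i, j))
         (snd F (i - 1, j + 1) (i, j + 1)) (snd F (i - 1, j + 1) (i - 1, j)) (snd F (i, j + 1) (i, j)) (snd F (i - 1, j) (i, j))"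
      using F(2) ij unfolding pullback_diag_def by simp
    from admissible_min_min[OF U this] show ?thesis using tw by (simp only: M)
  qed
  show ?thesis unfolding GBornCoarse_tr_def tw_sset_def using ftr 1 2 by (simp add: case_prod_beta')
qed

lemma M_functor_opr:
  assumes a: "\<alpha> \<in> splx (Delta n) m"
  shows "M_functor m (opr (A_eff G) n \<alpha> F) = opr (GBornCoarse_tr G) n \<alpha> (M_functor n F)"
proof -
  have l: "length \<alpha> - 1 = m" using a by (simp add: pnerve_def)
  have o: "opr (GBornCoarse_tr G) n \<alpha> = reindex (Tw (length \<alpha> - 1)) tw_le (map_prod (nth \<alpha>) (nth \<alpha>))"
    by (simp add: GBornCoarse_tr_def tw_sset_def)
  show ?thesis unfolding o opr_A_eff l M_functor_def reindex_def
    by (rule mk_diag_cong) (simp_all add: tw_nth[OF a])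
qed

lemma sset_map_EM:
  fixes G :: "('g, 'r) monoid_scheme" and E :: "nat => ('g, 'u) tr_simplex => 'c"
  assumes U: "infinite (UNIV :: 'u set)" and E: "sset_map (GBornCoarse_tr G) C E"
  shows "sset_map (op_sset (A_eff G)) C (EM E)"
  unfolding sset_map_def splx_op_sset
proof (intro allI ballI conjI)
  fix n and x :: "('g, 'u) span_simplex" assume x: "x \<in> splx (A_eff G) n"
  have M: "M_functor n (duality n x) \<in> splx (GBornCoarse_tr G) n" by (rule M_functor_tr[OF U duality_A_eff[OF x]])
  show "EM E n x \<in> splx C n" using sset_mapD(1)[OF E M] by (simp add: EM_def)
  fix m \<alpha> assume a: "\<alpha> \<in> splx (Delta n) m"
  show "EM E m (opr (op_sset (A_eff G)) n \<alpha> x) = opr C n \<alpha> (EM E n x)"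
    using sset_mapD(2)[OF E M a] by (simp add: EM_def duality_opr[OF a] M_functor_opr[OF a])
qed

section \<open>Edges out of a coproduct\<close>

lemma pos_insert: "finite s ==> a \<notin> s ==> pos (insert a s) v = (if a < v then Suc (pos s v) else pos s v)"
proof -
  assume s: "finite s" "a \<notin> s"
  have "{w \<in> insert a s. w < v} = (if a < v then insert a {w \<in> s. w < v} else {w \<in> s. w < v})" by auto
  then show ?thesis using s by (simp add: pos_def)
qed

lemma pos_empty: "pos {} v = 0" by (simp add: pos_def)

text \<open>Two Yoneda maps agree on a common face once they agree on its enumeration, so a union of
  standard simplices is glued from one equation per pair.\<close>

lemma cmap_family:
  fixes I :: "nat set"
  assumes C: "is_sset C" and fin: "\<forall>i\<in>I. finite (\<sigma> i) \<and> t i \<in> splx C (card (\<sigma> i) - 1)"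
    and agree: "\<forall>i\<in>I. \<forall>j\<in>I. i < j \<longrightarrow> \<sigma> i \<inter> \<sigma> j \<noteq> {} \<longrightarrow>
      opr C (card (\<sigma> i) - 1) (map (pos (\<sigma> i)) (sorted_list_of_set (\<sigma> i \<inter> \<sigma> j))) (t i) =
      opr C (card (\<sigma> j) - 1) (map (pos (\<sigma> j)) (sorted_list_of_set (\<sigma> i \<inter> \<sigma> j))) (t j)"
  obtains f where "cmap C (\<Union>i\<in>I. full (\<sigma> i)) f"
    "\<forall>i\<in>I. \<forall>l\<in>chains (full (\<sigma> i)). f l = opr C (card (\<sigma> i) - 1) (map (pos (\<sigma> i)) l) (t i)"
proof -
  define F where "F = (\<lambda>i l. opr C (card (\<sigma> i) - 1) (map (pos (\<sigma> i)) l) (t i))"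
  have cm: "cmap C (full (\<sigma> i)) (F i)" if "i \<in> I" for i
    unfolding F_def by (rule cmap_simplex[OF C]) (use fin that in auto)
  have lt: "F i l = F j l" if "i \<in> I" "j \<in> I" "i < j" "l \<in> chains (full (\<sigma> i))" "l \<in> chains (full (\<sigma> j))" for i j l
  proof -
    have "set l \<subseteq> \<sigma> i \<inter> \<sigma> j" "set l \<noteq> {}" using that(4,5) by (simp_all add: chains_def full_def)
    then have ne: "\<sigma> i \<inter> \<sigma> j \<noteq> {}" by (metis subset_empty)
    have l: "l \<in> chains (full (\<sigma> i \<inter> \<sigma> j))" using that(4,5) by (auto simp: chains_def full_def)
    have sub: "full (\<sigma> i \<inter> \<sigma> j) \<subseteq> full (\<sigma> i)" "full (\<sigma> i \<inter> \<sigma> j) \<subseteq> full (\<sigma> j)" by (auto simp: full_def)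
    have eq: "F i (sorted_list_of_set (\<sigma> i \<inter> \<sigma> j)) = F j (sorted_list_of_set (\<sigma> i \<inter> \<sigma> j))"
      unfolding F_def using agree that(1-3) ne by blast
    show ?thesis
      by (rule cmap_eq_on_full[OF _ ne cmap_mono[OF cm[OF that(1)] sub(1)] cmap_mono[OF cm[OF that(2)] sub(2)] eq l])
         (use fin that(1) in auto)
  qed
  have eq: "F i l = F j l" if "i \<in> I" "j \<in> I" "l \<in> chains (full (\<sigma> i))" "l \<in> chains (full (\<sigma> j))" for i j l
  proof -
    consider "i < j" | "j < i" | "i = j" by linarith
    then show ?thesis
    proof cases
      case 1 then show ?thesis by (rule lt[OF that(1,2) _ that(3,4)])
    next
      case 2 then show ?thesis by (rule lt[OF that(2,1) _ that(4,3), symmetric])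
    qed simp
  qed
  \<comment> \<open>Any of the simplices containing the chain may be chosen, since all choices
    agree.\<close>
  define f where "f = (\<lambda>l. F (SOME i. i \<in> I \<and> l \<in> chains (full (\<sigma> i))) l)"
  have f: "f l = F i l" if "i \<in> I" "l \<in> chains (full (\<sigma> i))" for i l
  proof -
    have "\<exists>i. i \<in> I \<and> l \<in> chains (full (\<sigma> i))" using that by blast
    from someI_ex[OF this] have "(SOME i. i \<in> I \<and> l \<in> chains (full (\<sigma> i))) \<in> I" "l \<in> chains (full (\<sigma> (SOME i. i \<in> I \<and> l \<in> chains (full (\<sigma> i)))))"
      by simp_all
    then show ?thesis unfolding f_def using eq that by blast
  qed
  have ch: "\<exists>i\<in>I. l \<in> chains (full (\<sigma> i))" if "l \<in> chains (\<Union>i\<in>I. full (\<sigma> i))" for l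
    using that by (auto simp: chains_def)
  have "cmap C (\<Union>i\<in>I. full (\<sigma> i)) f"
  proof (rule cmapI)
    fix l assume "l \<in> chains (\<Union>i\<in>I. full (\<sigma> i))"
    then obtain i where i: "i \<in> I" "l \<in> chains (full (\<sigma> i))" using ch by blast
    show "f l \<in> splx C (length l - 1)" unfolding f[OF i] by (rule cmapD(1)[OF cm[OF i(1)] i(2)])
    fix m \<alpha> assume a: "\<alpha> \<in> splx (Delta (length l - 1)) m"
    have sc: "subcomplex (full (\<sigma> i))" using fin i(1) by (intro subcomplex_full) blast
    show "f (map (nth l) \<alpha>) = opr C (length l - 1) \<alpha> (f l)"
      unfolding f[OF i] f[OF i(1) chains_restrict[OF sc i(2) a]] by (rule cmapD(2)[OF cm[OF i(1)] i(2) a])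
  qed
  then show ?thesis using that f unfolding F_def by blast
qed

text \<open>The universal property for \<open>n = 1\<close>: the sphere consists of the vertices
  \<open>x\<close> and \<open>x'\<close>, and each cone of the edges \<open>e j\<close> and
  \<open>e' j\<close> with a common source. The base of the filler is the induced edge.\<close>

lemma coprod_lift:
  assumes C: "is_sset C" and cp: "coprod C J x e" and x: "x \<in> splx C 0" "x' \<in> splx C 0"
    and e: "\<forall>j\<in>J. e j \<in> splx C 1 \<and> opr C 1 [1] (e j) = x"
    and e': "\<forall>j\<in>J. e' j \<in> splx C 1 \<and> opr C 1 [1] (e' j) = x' \<and> opr C 1 [0] (e' j) = opr C 1 [0] (e j)"
  obtains w where "w \<in> splx C 1" "\<forall>j\<in>J. \<exists>t\<in>splx C 2. opr C 2 [0,1] t = e j \<and> opr C 2 [1,2] t = w \<and> opr C 2 [0,2] t = e' j"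
proof -
  have opr0: "opr C 0 [0] y = y" if "y \<in> splx C 0" for y using is_ssetD(1)[OF C that] by (simp add: upt_Suc)
  have opr1: "opr C 1 [0,1] y = y" if "y \<in> splx C 1" for y using is_ssetD(1)[OF C that] by (simp add: upt_Suc)
  obtain g where g: "cmap C (\<Union>i\<in>{1,2}. full {i}) g"
      "\<forall>i\<in>{1::nat,2}. \<forall>l\<in>chains (full {i}). g l = opr C (card {i} - 1) (map (pos {i}) l) (if i = 1 then x else x')"
    by (rule cmap_family[of C "{1,2}" "\<lambda>i. {i}" "\<lambda>i. if i = 1 then x else x'"]) (use C x in auto)
  have bU: "bcx 1 \<subseteq> (\<Union>i\<in>{1,2}. full {i})"
  proof
    fix \<tau> assume "\<tau> \<in> bcx 1"
    then have "\<tau> \<subset> {1,2}" "\<tau> \<noteq> {}" by (auto simp: bcx_def)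
    then show "\<tau> \<in> (\<Union>i\<in>{1,2}. full {i})" by (auto simp: full_def)
  qed
  have hU: "hcx 1 \<subseteq> (\<Union>i\<in>{1,2}. full {0,i})"
  proof
    fix \<tau> assume t: "\<tau> \<in> hcx 1"
    have "{1..2} = {1,2::nat}" by auto
    then have t1: "1 \<notin> \<tau> \<or> 2 \<notin> \<tau>" "\<tau> \<noteq> {}" using t by (auto simp: hcx_def numeral_2_eq_2)
    have "i = 0 \<or> i = 1 \<or> i = 2" if "i \<in> \<tau>" for i using t that by (auto simp: hcx_def)
    then show "\<tau> \<in> (\<Union>i\<in>{1,2}. full {0,i})" using t1 by (auto simp: full_def)
  qed
  have "\<exists>f. cmap C (\<Union>i\<in>{1,2}. full {0,i}) f \<and>
      (\<forall>i\<in>{1::nat,2}. \<forall>l\<in>chains (full {0,i}). f l = opr C (card {0,i} - 1) (map (pos {0,i}) l) (if i = 1 then e j else e' j))"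
    if j: "j \<in> J" for j
  proof (rule cmap_family[of C "{1,2}" "\<lambda>i. {0,i}" "\<lambda>i. if i = 1 then e j else e' j"], goal_cases)
    case 3
    have "{0,1} \<inter> {0,2} = {0::nat}" by auto
    then show ?case using e e' j by (simp add: pos_insert pos_empty)
  qed (use C e e' j in \<open>auto simp: numeral_2_eq_2\<close>)
  then obtain f where f: "\<forall>j\<in>J. cmap C (\<Union>i\<in>{1,2}. full {0,i}) (f j) \<and>
      (\<forall>i\<in>{1::nat,2}. \<forall>l\<in>chains (full {0,i}). f j l = opr C (card {0,i} - 1) (map (pos {0,i}) l) (if i = 1 then e j else e' j))"
    using bchoice[of J "\<lambda>j f. cmap C (\<Union>i\<in>{1,2}. full {0,i}) f \<and>
      (\<forall>i\<in>{1::nat,2}. \<forall>l\<in>chains (full {0,i}). f l = opr C (card {0,i} - 1) (map (pos {0,i}) l) (if i = 1 then e j else e' j))"] by blast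
  have fv: "f j l = opr C 1 (map (pos {0,i}) l) (if i = 1 then e j else e' j)"
    if "j \<in> J" "i \<in> {1,2}" "l \<in> chains (full {0,i})" for j i l
  proof -
    have "card {0,i} - 1 = 1" using that(2) by auto
    then show ?thesis using f that by metis
  qed
  have gv: "g [i] = (if i = 1 then x else x')" if i: "i \<in> {1,2}" for i
  proof -
    have "[i] \<in> chains (full {i})" by (simp add: chains_def full_def)
    then have "g [i] = opr C (card {i} - 1) (map (pos {i}) [i]) (if i = 1 then x else x')" using g(2) i by blast
    then show ?thesis using opr0 x by (simp add: pos_insert pos_empty)
  qed
  have e01: "[0,i] \<in> chains (full {0,i})" "[i] \<in> chains (full {0,i})" for i :: nat by (simp_all add: chains_def full_def)
  have fe: "f j [0,i] = (if i = 1 then e j else e' j)" "f j [i] = (if i = 1 then x else x')" if "j \<in> J" "i \<in> {1,2}" for j i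
  proof -
    have "0 < i" using that by auto
    then show "f j [0,i] = (if i = 1 then e j else e' j)" "f j [i] = (if i = 1 then x else x')"
      using fv[OF that e01(1)] fv[OF that e01(2)] e e' that(1) opr1 by (simp_all add: pos_insert pos_empty)
  qed
  have cf: "cmap C (hcx 1) (f j)" if "j \<in> J" for j using f that cmap_mono[OF _ hU] by blast
  have fg: "f j l = g l" if j: "j \<in> J" and l: "l \<in> chains (bcx 1)" for j l
  proof -
    have "set l \<in> (\<Union>i\<in>{1,2}. full {i})" using l bU by (auto simp: chains_def)
    then obtain i :: nat where i: "i \<in> {1,2}" "l \<in> chains (full {i})" using l by (auto simp: chains_def)
    have "full {i} \<subseteq> (\<Union>i\<in>{1,2}. full {0,i})" "full {i} \<subseteq> (\<Union>i\<in>{1,2}. full {i})" using i(1) by (auto simp: full_def)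
    then have "cmap C (full {i}) (f j)" "cmap C (full {i}) g" using f j g(1) cmap_mono by blast+
    then show ?thesis by (rule cmap_eq_on_full[rotated 2]) (use i fe(2)[OF j i(1)] gv[OF i(1)] in auto)
  qed
  obtain s t where st: "s \<in> splx C 1" "\<forall>l\<in>chains (bcx 1). opr C 1 (map (\<lambda>i. i - 1) l) s = g l"
    "\<forall>j\<in>J. t j \<in> splx C (Suc 1)" "\<forall>j\<in>J. \<forall>l\<in>chains (hcx 1). opr C (Suc 1) l (t j) = f j l"
    "\<forall>j\<in>J. opr C (Suc 1) [1..<Suc (Suc 1)] (t j) = s"
    by (rule coprodD[OF cp, of 1 g f]) (use g(1) cmap_mono[OF _ bU] gv[of 1] cf fe(1)[of _ 1] fg in auto)
  have "{1..Suc 1} = {1, 2::nat}" by auto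
  then have c2: "[0,1] \<in> chains (hcx 1)" "[0,2] \<in> chains (hcx 1)" by (simp_all add: chains_def hcx_def)
  show ?thesis
  proof (rule that[OF st(1)], intro ballI)
    fix j assume j: "j \<in> J"
    show "\<exists>t\<in>splx C 2. opr C 2 [0,1] t = e j \<and> opr C 2 [1,2] t = s \<and> opr C 2 [0,2] t = e' j"
      using bspec[OF st(3) j] bspec[OF bspec[OF st(4) j] c2(1)] bspec[OF bspec[OF st(4) j] c2(2)] bspec[OF st(5) j] fe(1)[OF j, of 1] fe(1)[OF j, of 2]
      by (intro bexI[of _ "t j"]) (simp_all add: numeral_2_eq_2 upt_Suc)
  qed
qed

text \<open>The universal property for \<open>n = 2\<close>: the edges of the sphere are the
  identity of \<open>x\<close>, \<open>w1\<close> and \<open>w2\<close>. The cone over it for an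
  index consists of a triangle for \<open>w1\<close>, one for \<open>w2\<close> and a degenerate one
  on \<open>e j\<close>.\<close>

lemma coprod_unique:
  assumes C: "is_sset C" and cp: "coprod C J x e" and x: "x \<in> splx C 0"
    and e: "\<forall>j\<in>J. e j \<in> splx C 1"
    and w: "w1 \<in> splx C 1" "w2 \<in> splx C 1" "opr C 1 [0] w1 = x" "opr C 1 [0] w2 = x" "opr C 1 [1] w1 = opr C 1 [1] w2"
    and t1: "\<forall>j\<in>J. \<exists>t\<in>splx C 2. opr C 2 [0,1] t = e j \<and> opr C 2 [1,2] t = w1 \<and> opr C 2 [0,2] t = e' j"
    and t2: "\<forall>j\<in>J. \<exists>t\<in>splx C 2. opr C 2 [0,1] t = e j \<and> opr C 2 [1,2] t = w2 \<and> opr C 2 [0,2] t = e' j"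
  obtains s where "s \<in> splx C 2" "opr C 2 [0,1] s = opr C 0 [0,0] x" "opr C 2 [1,2] s = w2" "opr C 2 [0,2] s = w1"
proof -
  note N = numeral_2_eq_2 numeral_3_eq_3
  define d where "d = opr C 0 [0,0] x"
  have d: "d \<in> splx C 1" "opr C 1 [0] d = x" "opr C 1 [1] d = x" "opr C 1 [0,1] d = d"
  proof -
    have a: "[0,0] \<in> splx (Delta 0) 1" by (simp add: Delta_iff)
    show d1: "d \<in> splx C 1" unfolding d_def by (rule is_ssetD(2)[OF C x a])
    show "opr C 1 [0] d = x" "opr C 1 [1] d = x"
      unfolding d_def using is_ssetD(3)[OF C x a, of "[0]" 0] is_ssetD(3)[OF C x a, of "[1]" 0] is_ssetD(1)[OF C x]
      by (simp_all add: Delta_iff upt_Suc)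
    show "opr C 1 [0,1] d = d" using is_ssetD(1)[OF C d1] by (simp add: upt_Suc)
  qed
  have w01: "opr C 1 [0,1] w1 = w1" "opr C 1 [0,1] w2 = w2" using is_ssetD(1)[OF C w(1)] is_ssetD(1)[OF C w(2)] by (simp_all add: upt_Suc)
  \<comment> \<open>\<open>ed i\<close> is the edge of the triangle 1, 2, 3 opposite to
    \<open>i\<close>, and \<open>\<sigma> i\<close> is its cone with 0.\<close>
  define ed where "ed = (\<lambda>i::nat. if i = 1 then {2,3} else if i = 2 then {1,3} else {1,2::nat})"
  define \<sigma> where "\<sigma> = (\<lambda>i. insert 0 (ed i))"
  define v where "v = (\<lambda>i::nat. if i = 1 then w2 else if i = 2 then w1 else d)"
  obtain g where g: "cmap C (\<Union>i\<in>{1,2,3}. full (ed i)) g"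
    "\<forall>i\<in>{1,2,3}. \<forall>l\<in>chains (full (ed i)). g l = opr C (card (ed i) - 1) (map (pos (ed i)) l) (v i)"
    by (rule cmap_family[OF C, of "{1,2,3}" ed v]) (use w d in \<open>simp_all add: ed_def v_def N pos_insert pos_empty\<close>)
  have lst: "sorted_list_of_set (ed 1) = [2,3]" "sorted_list_of_set (ed 2) = [1,3]" "sorted_list_of_set (ed 3) = [1,2]"
    by (simp_all add: ed_def)
  have ch: "sorted_list_of_set (ed i) \<in> chains (full (ed i))" if "i \<in> {1,2,3}" for i
    using that by (auto simp: ed_def chains_def full_def)
  have gv: "g (sorted_list_of_set (ed i)) = v i" if i: "i \<in> {1,2,3}" for i
  proof -
    have "g (sorted_list_of_set (ed i)) = opr C (card (ed i) - 1) (map (pos (ed i)) (sorted_list_of_set (ed i))) (v i)"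
      using g(2) i ch[OF i] by blast
    then show ?thesis using i w01 d by (auto simp: ed_def v_def N pos_insert pos_empty)
  qed
  have "\<exists>f. cmap C (\<Union>i\<in>{1,2,3}. full (\<sigma> i)) f \<and> f [0,1] = e j \<and> (\<forall>i\<in>{1,2,3}. f (sorted_list_of_set (ed i)) = v i)"
    if j: "j \<in> J" for j
  proof -
    obtain a b where a: "a \<in> splx C 2" "opr C 2 [0,1] a = e j" "opr C 2 [1,2] a = w1" "opr C 2 [0,2] a = e' j"
      and b: "b \<in> splx C 2" "opr C 2 [0,1] b = e j" "opr C 2 [1,2] b = w2" "opr C 2 [0,2] b = e' j" using t1 t2 j by metis
    \<comment> \<open>The degenerate triangle on \<open>e j\<close> whose last edge is the identity
      of \<open>x\<close>.\<close>
    define c where "c = opr C 1 [0,1,1] (e j)"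
    have ej: "e j \<in> splx C 1" using e j by blast
    have ej1: "opr C 1 [1] (e j) = x"
    proof -
      have "opr C 1 [1] (e j) = opr C 2 [1] a" unfolding a(2)[symmetric]
        using is_ssetD(3)[OF C a(1), of "[0,1]" 1 "[1]" 0] by (simp add: Delta_iff)
      also have "\<dots> = opr C 1 [0] w1" unfolding a(3)[symmetric]
        using is_ssetD(3)[OF C a(1), of "[1,2]" 1 "[0]" 0] by (simp add: Delta_iff)
      finally show ?thesis using w(3) by simp
    qed
    have a011: "[0,1,1] \<in> splx (Delta 1) 2" by (simp add: Delta_iff)
    have c: "c \<in> splx C 2" "opr C 2 [0,1] c = e j" "opr C 2 [0,2] c = e j" "opr C 2 [1,2] c = d"
      unfolding c_def d_def ej1[symmetric]
      using is_ssetD(2)[OF C ej a011] is_ssetD(3)[OF C ej a011, of "[0,1]" 1] is_ssetD(3)[OF C ej a011, of "[0,2]" 1]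
        is_ssetD(3)[OF C ej a011, of "[1,2]" 1] is_ssetD(3)[OF C ej, of "[1]" 0 "[0,0]" 1] is_ssetD(1)[OF C ej]
      by (simp_all add: Delta_iff upt_Suc)
    define t where "t = (\<lambda>i::nat. if i = 1 then b else if i = 2 then a else c)"
    obtain f where f: "cmap C (\<Union>i\<in>{1,2,3}. full (\<sigma> i)) f"
      "\<forall>i\<in>{1,2,3}. \<forall>l\<in>chains (full (\<sigma> i)). f l = opr C (card (\<sigma> i) - 1) (map (pos (\<sigma> i)) l) (t i)"
      by (rule cmap_family[OF C, of "{1,2,3}" \<sigma> t]) (use a b c in \<open>simp_all add: \<sigma>_def ed_def t_def N pos_insert pos_empty\<close>)
    have "[0,1] \<in> chains (full (\<sigma> 3))" by (simp add: chains_def full_def \<sigma>_def ed_def)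
    then have "f [0,1] = opr C (card (\<sigma> 3) - 1) (map (pos (\<sigma> 3)) [0,1]) (t 3)" using f(2) by blast
    then have "f [0,1] = e j" using c(2) by (simp add: \<sigma>_def ed_def t_def N pos_insert pos_empty)
    moreover have "f (sorted_list_of_set (ed i)) = v i" if i: "i \<in> {1,2,3}" for i
    proof -
      have "sorted_list_of_set (ed i) \<in> chains (full (\<sigma> i))" using ch[OF i] by (auto simp: chains_def full_def \<sigma>_def)
      then have "f (sorted_list_of_set (ed i)) = opr C (card (\<sigma> i) - 1) (map (pos (\<sigma> i)) (sorted_list_of_set (ed i))) (t i)"
        using f(2) i by blast
      then show ?thesis using i a(3) b(3) c(4) by (auto simp: \<sigma>_def ed_def v_def t_def N pos_insert pos_empty)
    qed
    ultimately show ?thesis using f(1) by blast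
  qed
  then obtain f where f: "\<forall>j\<in>J. cmap C (\<Union>i\<in>{1,2,3}. full (\<sigma> i)) (f j) \<and> f j [0,1] = e j \<and> (\<forall>i\<in>{1,2,3}. f j (sorted_list_of_set (ed i)) = v i)"
    using bchoice[of J "\<lambda>j f. cmap C (\<Union>i\<in>{1,2,3}. full (\<sigma> i)) f \<and> f [0,1] = e j \<and> (\<forall>i\<in>{1,2,3}. f (sorted_list_of_set (ed i)) = v i)"] by blast
  have I: "{1..Suc 2} = {1,2,3::nat}" by auto
  have bU: "bcx 2 \<subseteq> (\<Union>i\<in>{1,2,3}. full (ed i))"
  proof
    fix \<tau> assume "\<tau> \<in> bcx 2"
    then have t: "\<tau> \<subseteq> {1,2,3}" "\<tau> \<noteq> {}" "\<tau> \<noteq> {1,2,3}" unfolding bcx_def I by auto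
    then have "1 \<notin> \<tau> \<or> 2 \<notin> \<tau> \<or> 3 \<notin> \<tau>" by blast
    then have "\<tau> \<subseteq> ed 1 \<or> \<tau> \<subseteq> ed 2 \<or> \<tau> \<subseteq> ed 3" using t(1) by (auto simp: ed_def)
    then show "\<tau> \<in> (\<Union>i\<in>{1,2,3}. full (ed i))" using t(2) by (auto simp: full_def)
  qed
  have hU: "hcx 2 \<subseteq> (\<Union>i\<in>{1,2,3}. full (\<sigma> i))"
  proof
    fix \<tau> assume t: "\<tau> \<in> hcx 2"
    have "{..Suc 2} = {0,1,2,3::nat}" by auto
    then have t: "\<tau> \<subseteq> {0,1,2,3}" "\<tau> \<noteq> {}" "\<not> {1,2,3} \<subseteq> \<tau>" using t unfolding hcx_def I by simp_all
    have "1 \<notin> \<tau> \<or> 2 \<notin> \<tau> \<or> 3 \<notin> \<tau>" using t(3) by simp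
    then have "\<tau> \<subseteq> \<sigma> 1 \<or> \<tau> \<subseteq> \<sigma> 2 \<or> \<tau> \<subseteq> \<sigma> 3" using t(1) by (auto simp: \<sigma>_def ed_def)
    then show "\<tau> \<in> (\<Union>i\<in>{1,2,3}. full (\<sigma> i))" using t(2) by (auto simp: full_def)
  qed
  have cf: "cmap C (hcx 2) (f j)" if "j \<in> J" for j using f that cmap_mono[OF _ hU] by blast
  have fg: "f j l = g l" if j: "j \<in> J" and l: "l \<in> chains (bcx 2)" for j l
  proof -
    have "set l \<in> (\<Union>i\<in>{1,2,3}. full (ed i))" using l bU by (auto simp: chains_def)
    then obtain i where i: "i \<in> {1,2,3}" "set l \<in> full (ed i)" by blast
    have il: "l \<in> chains (full (ed i))" using i(2) l by (simp add: chains_def)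
    have "full (ed i) \<subseteq> (\<Union>i\<in>{1,2,3}. full (\<sigma> i))" "full (ed i) \<subseteq> (\<Union>i\<in>{1,2,3}. full (ed i))"
      using i(1) by (auto simp: full_def \<sigma>_def)
    then have c: "cmap C (full (ed i)) (f j)" "cmap C (full (ed i)) g" using f j g(1) cmap_mono by blast+
    have ne: "finite (ed i)" "ed i \<noteq> {}" by (simp_all add: ed_def)
    have "f j (sorted_list_of_set (ed i)) = g (sorted_list_of_set (ed i))" unfolding gv[OF i(1)] using f j i(1) by blast
    from cmap_eq_on_full[OF ne c this il] show ?thesis .
  qed
  have g1: "g [1] = x"
  proof -
    have "[1] \<in> chains (full (ed 3))" by (simp add: chains_def full_def ed_def)
    then have "g [1] = opr C (card (ed 3) - 1) (map (pos (ed 3)) [1]) (v 3)" using g(2) by blast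
    then show ?thesis using d(2) by (simp add: ed_def v_def pos_insert pos_empty)
  qed
  obtain s t where st: "s \<in> splx C 2" "\<forall>l\<in>chains (bcx 2). opr C 2 (map (\<lambda>i. i - 1) l) s = g l"
    "\<forall>j\<in>J. t j \<in> splx C (Suc 2)" "\<forall>j\<in>J. \<forall>l\<in>chains (hcx 2). opr C (Suc 2) l (t j) = f j l"
    "\<forall>j\<in>J. opr C (Suc 2) [1..<Suc (Suc 2)] (t j) = s"
    by (rule coprodD[OF cp, of 2 g f]) (use cmap_mono[OF g(1) bU] g1 cf f fg in auto)
  have b: "[2,3] \<in> chains (bcx 2)" "[1,3] \<in> chains (bcx 2)" "[1,2] \<in> chains (bcx 2)"
  proof -
    have "{2,3} \<noteq> {1,2,3::nat}" by (rule notI, drule arg_cong[where f = "\<lambda>A. 1 \<in> A"], simp)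
    moreover have "{1,3} \<noteq> {1,2,3::nat}" by (rule notI, drule arg_cong[where f = "\<lambda>A. 2 \<in> A"], simp)
    moreover have "{1,2} \<noteq> {1,2,3::nat}" by (rule notI, drule arg_cong[where f = "\<lambda>A. 3 \<in> A"], simp)
    ultimately show "[2,3] \<in> chains (bcx 2)" "[1,3] \<in> chains (bcx 2)" "[1,2] \<in> chains (bcx 2)"
      unfolding bcx_def I by (simp_all add: chains_def psubset_eq)
  qed
  show ?thesis
    by (rule that[OF st(1)])
       (use bspec[OF st(2) b(1)] bspec[OF st(2) b(2)] bspec[OF st(2) b(3)] gv[of 1] gv[of 2] gv[of 3] lst in \<open>simp_all add: v_def d_def\<close>)
qed

section \<open>Spans of finite G-sets\<close>

definition obj :: "('g, 'u) gset => ('g, 'u) span_simplex" where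
  "obj X = mk_diag (Tw 0) tw_le (\<lambda>_. X) (\<lambda>_ _. restrict id (car X))"

text \<open>As an edge of \<open>A_eff\<close> this leads from \<open>X\<close> to \<open>S\<close>,
  hence from \<open>S\<close> to \<open>X\<close> in the opposite. Of the two proper arrows out of
  (0,1), the one whose target has second index 0 is the left leg.\<close>

definition span :: "('g, 'u) gset => ('g, 'u) gset => ('g, 'u) gset => ('u => 'u) => ('u => 'u) => ('g, 'u) span_simplex" where
  "span X A S l r = (let F0 = (\<lambda>(i, j). if j = 0 then X else if i = 0 then A else S) in
     mk_diag (Tw 1) tw_le F0 (\<lambda>p q. if p = q then restrict id (car (F0 p)) else if snd q = 0 then l else r))"

lemma Tw_0: "Tw 0 = {(0,0)}" by (auto simp: Tw_def)

lemma Tw_1: "Tw 1 = {(0,0),(0,1),(1,1)}" by (auto simp: Tw_def le_Suc_eq)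

lemma Tw_2: "Tw 2 = {(0,0),(0,1),(1,1),(0,2),(1,2),(2,2)}" by (auto simp: Tw_def le_Suc_eq numeral_2_eq_2)

lemma span_simps:
  "fst (span X A S l r) (0,0) = X" "fst (span X A S l r) (0,1) = A" "fst (span X A S l r) (1,1) = S"
  "snd (span X A S l r) (0,1) (0,0) = l" "snd (span X A S l r) (0,1) (1,1) = r"
  by (simp_all add: span_def Let_def Tw_def tw_le_def)

lemma span_inject:
  assumes "span X A S l r = span X' A' S' l' r'"
  shows "X = X'" "A = A'" "S = S'" "l = l'" "r = r'"
  using assms span_simps by metis+

text \<open>\<open>Tw 1\<close> has no composites of proper arrows and its identities are forced, so
  three objects and two arrows determine the simplex.\<close>

lemma span_eqI:
  assumes "fst F (0,0) = X" "fst F (0,1) = A" "fst F (1,1) = S" "snd F (0,1) (0,0) = l" "snd F (0,1) (1,1) = r"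
    and F: "is_functor (Tw 1) tw_le (GFin G) F"
  shows "F = span X A S l r"
proof -
  have c: "p = (0,0) \<or> p = (0,1) \<or> p = (1,1)" if "p \<in> Tw 1" for p using that Tw_1 by blast
  have "mk_diag (Tw 1) tw_le (fst F) (snd F) = span X A S l r"
    unfolding span_def Let_def
  proof (rule mk_diag_cong)
    show "fst F p = (case p of (i, j) => if j = 0 then X else if i = 0 then A else S)" if "p \<in> Tw 1" for p
      using c[OF that] assms(1-3) by auto
    fix p q assume pq: "p \<in> Tw 1" "q \<in> Tw 1" "tw_le p q"
    show "snd F p q = (if p = q then restrict id (car (case p of (i, j) => if j = 0 then X else if i = 0 then A else S))
        else if snd q = 0 then l else r)"
    proof (cases "p = q")
      case True
      then show ?thesis using is_functorD(3)[OF F pq(1)] c[OF pq(1)] assms(1-3) by auto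
    next
      case False
      then show ?thesis using c[OF pq(1)] c[OF pq(2)] pq(3) assms(4,5) by (auto simp: tw_le_def)
    qed
  qed
  then show ?thesis using is_functorD(1)[OF F] by simp
qed

lemma face_span:
  assumes t: "t \<in> splx (A_eff G) n" and ab: "a \<le> b" "b \<le> n"
  shows "opr (A_eff G) n [a,b] t = span (fst t (a,a)) (fst t (a,b)) (fst t (b,b)) (snd t (a,b) (a,a)) (snd t (a,b) (b,b))"
proof (rule span_eqI)
  have "[a,b] \<in> splx (Delta n) 1" using ab by (simp add: Delta_iff)
  then have "opr (A_eff G) n [a,b] t \<in> splx (A_eff G) 1" by (rule is_ssetD(2)[OF is_sset_A_eff t])
  then show "is_functor (Tw 1) tw_le (GFin G) (opr (A_eff G) n [a,b] t)" by (simp add: splx_A_eff)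
qed (simp_all add: opr_A_eff reindex_def Tw_def tw_le_def)

lemma face_obj: "opr (A_eff G) n [a] t = obj (fst t (a,a))" if "t \<in> splx (A_eff G) n" "a \<le> n"
proof -
  have F: "is_functor (Tw n) tw_le (GFin G) t" using that(1) by (simp add: splx_A_eff)
  have l: "length [a] - 1 = 0" by simp
  show ?thesis unfolding opr_A_eff reindex_def obj_def l
    by (rule mk_diag_cong) (use is_functorD(3)[OF F, of "(a,a)"] that(2) in \<open>auto simp: Tw_def\<close>)
qed

text \<open>Composites with an identity are disposed of here once, which leaves the composites of
  two proper arrows to be checked pointwise.\<close>

lemma GFin_functorI:
  assumes po: "reflp_on P po" "transp_on P po"
    and ob: "\<And>p. p \<in> P ==> is_gset G (F0 p) \<and> finite (car (F0 p))" and id: "\<And>p. p \<in> P ==> F1 p p = restrict id (car (F0 p))"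
    and hom: "\<And>p q. p \<in> P ==> q \<in> P ==> po p q ==> p \<noteq> q ==> F1 p q \<in> equivariant_maps G (F0 p) (F0 q)"
    and comp: "\<And>p q r x. p \<in> P ==> q \<in> P ==> r \<in> P ==> po p q ==> po q r ==> p \<noteq> q ==> q \<noteq> r ==> x \<in> car (F0 p) ==>
      F1 p r x = F1 q r (F1 p q x)"
  shows "is_functor P po (GFin G) (mk_diag P po F0 F1)"
proof (rule is_functorI[OF _ _ _ _ po])
  show h: "F1 p q \<in> Hom (GFin G) (F0 p) (F0 q)" if pq: "p \<in> P" "q \<in> P" "po p q" for p q
    using hom[OF pq] id[OF pq(1)] ob[OF pq(1)] equivariant_id[of G "F0 p"] by (cases "p = q") simp_all
  fix p q r assume pqr: "p \<in> P" "q \<in> P" "r \<in> P" "po p q" "po q r"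
  have pr: "po p r" using po(2) pqr unfolding transp_on_def by blast
  have E: "F1 p r \<in> equivariant_maps G (F0 p) (F0 r)" "F1 p q \<in> equivariant_maps G (F0 p) (F0 q)"
    using h[OF pqr(1,3) pr] h[OF pqr(1,2,4)] by simp_all
  have "\<forall>x\<in>car (F0 p). F1 q r (F1 p q x) = F1 p r x"
  proof
    fix x assume x: "x \<in> car (F0 p)"
    consider "p = q" | "q = r" | "p \<noteq> q" "q \<noteq> r" by blast
    then show "F1 q r (F1 p q x) = F1 p r x"
    proof cases
      case 1 then show ?thesis using id[OF pqr(1)] x by simp
    next
      case 2 then show ?thesis using id[OF pqr(2)] equivariantD(1)[OF E(2) x] by simp
    next
      case 3 then show ?thesis using comp[OF pqr 3 x] by simp
    qed
  qed
  then show "F1 p r = Cmp (GFin G) (F0 p) (F1 q r) (F1 p q)"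
    using compose_eq_ext_iff[OF equivariantD(3)[OF E(1)], of "F1 q r" "F1 p q"] by simp
qed (use ob id in auto)

lemma fibre_product_sym:
  assumes "fibre_product f w u g W U V" shows "fibre_product w f g u W V U"
  unfolding fibre_product_def
proof (intro conjI ballI impI)
  show "g (w p) = u (f p)" if "p \<in> W" for p using assms that unfolding fibre_product_def by simp
  fix x y assume "x \<in> V" "y \<in> U" "g x = u y"
  then have "\<exists>!p. p \<in> W \<and> f p = y \<and> w p = x" using assms unfolding fibre_product_def by simp
  then show "\<exists>!p. p \<in> W \<and> w p = x \<and> f p = y" by (simp only: conj_commute)
qed

text \<open>If \<open>i = i'\<close> or \<open>j' = j\<close>, the square has a pair of opposite
  sides that are identities and is a pull-back automatically; only strict squares carry a
  condition.\<close>

lemma pullback_diagI: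
  assumes F: "is_functor (Tw n) tw_le (GFin G) F"
    and sq: "\<And>i i' j' j. i < i' ==> i' \<le> j' ==> j' < j ==> j \<le> n ==>
      fibre_product (snd F (i, j) (i', j)) (snd F (i, j) (i, j')) (snd F (i', j) (i', j')) (snd F (i, j') (i', j'))
        (car (fst F (i, j))) (car (fst F (i', j))) (car (fst F (i, j')))"
  shows "pullback_diag G n F"
  unfolding pullback_diag_def
proof (intro allI impI, elim conjE)
  fix i i' j' j assume ij: "i \<le> i'" "i' \<le> j'" "j' \<le> j" "j \<le> n"
  have tw: "(i, j) \<in> Tw n" "(i', j) \<in> Tw n" "(i, j') \<in> Tw n" "(i', j') \<in> Tw n"
    and le: "tw_le (i, j) (i', j)" "tw_le (i, j) (i, j')" "tw_le (i', j) (i', j')" "tw_le (i, j') (i', j')" "tw_le (i, j) (i', j')"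
    using ij by (simp_all add: Tw_def tw_le_def)
  note h = is_functorD(4)[OF F tw(1,2) le(1)] is_functorD(4)[OF F tw(1,3) le(2)] is_functorD(4)[OF F tw(2,4) le(3)] is_functorD(4)[OF F tw(3,4) le(4)]
  have ob: "is_gset G (fst F p) \<and> finite (car (fst F p))" if "p \<in> Tw n" for p using is_functorD(2)[OF F that] by simp
  have "fibre_product (snd F (i, j) (i', j)) (snd F (i, j) (i, j')) (snd F (i', j) (i', j')) (snd F (i, j') (i', j'))
        (car (fst F (i, j))) (car (fst F (i', j))) (car (fst F (i, j')))"
  proof (cases "i = i' \<or> j' = j")
    case True
    have "\<forall>x\<in>car (fst F (i, j)). snd F (i', j) (i', j') (snd F (i, j) (i', j) x) = snd F (i, j') (i', j') (snd F (i, j) (i, j') x)"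
      using is_functorD(5)[OF F tw(1,2,4) le(1,3)] is_functorD(5)[OF F tw(1,3,4) le(2,4)] by (simp add: compose_eq_iff)
    moreover have "snd F (i, j) (i, j) = restrict id (car (fst F (i, j)))" "snd F (i', j) (i', j) = restrict id (car (fst F (i', j)))"
      "snd F (i, j') (i, j') = restrict id (car (fst F (i, j')))" using is_functorD(3)[OF F] tw by simp_all
    ultimately show ?thesis unfolding fibre_product_def using True h equivariantD(1) by (elim disjE) auto
  next
    case False
    then show ?thesis using ij by (intro sq) auto
  qed
  then show "cartesian (GFin G) (fst F (i, j)) (fst F (i', j)) (fst F (i, j')) (fst F (i', j'))
         (snd F (i, j) (i', j)) (snd F (i, j) (i, j')) (snd F (i', j) (i', j')) (snd F (i, j') (i', j'))"
    by (intro cartesian_GFinI) (use h ob tw in simp_all)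
qed

lemma span_A_eff:
  assumes "is_gset G X" "is_gset G A" "is_gset G S" "finite (car X)" "finite (car A)" "finite (car S)"
    "l \<in> equivariant_maps G A X" "r \<in> equivariant_maps G A S"
  shows "span X A S l r \<in> splx (A_eff G) 1"
proof -
  let ?F0 = "\<lambda>(i::nat, j::nat). if j = 0 then X else if i = 0 then A else S"
  let ?F1 = "\<lambda>p q. if p = q then restrict id (car (?F0 p)) else if snd q = 0 then l else r"
  have F: "is_functor (Tw 1) tw_le (GFin G) (span X A S l r)"
    unfolding span_def Let_def
  proof (rule GFin_functorI[OF tw_order])
    have c: "p = (0,0) \<or> p = (0,1) \<or> p = (1,1)" if "p \<in> Tw 1" for p using that Tw_1 by blast
    fix p assume p: "p \<in> Tw 1"
    show "is_gset G (?F0 p) \<and> finite (car (?F0 p))"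
      using c[OF p] assms by auto
    fix q assume q: "q \<in> Tw 1" "tw_le p q" "p \<noteq> q"
    have pq: "p = (0,1)" "q = (0,0) \<or> q = (1,1)" using c[OF p] c[OF q(1)] q(2,3) by (auto simp: tw_le_def)
    show "?F1 p q \<in> equivariant_maps G (?F0 p) (?F0 q)"
      using pq assms by auto
    fix r' x assume "r' \<in> Tw 1" "tw_le q r'" "q \<noteq> r'"
    then have False using pq(2) c[of r'] by (auto simp: tw_le_def)
    then show "?F1 p r' x = ?F1 q r' (?F1 p q x)" ..
  qed simp
  then show ?thesis using pullback_diagI[OF F] by (simp add: splx_A_eff)
qed

text \<open>The only strict square of a triangle expresses the apex \<open>P\<close> of the long
  span as the pull-back of \<open>A\<close> and \<open>B\<close> over the middle object: triangles
  are compositions of spans.\<close>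

lemma span_triangleD:
  fixes G :: "('g, 'r) monoid_scheme" and t :: "('g, 'u) span_simplex"
  assumes U: "infinite (UNIV :: 'u set)" and t: "t \<in> splx (A_eff G) 2"
    and f: "opr (A_eff G) 2 [0,1] t = span X0 A X1 l01 r01" "opr (A_eff G) 2 [1,2] t = span X1' B X2 l12 r12"
      "opr (A_eff G) 2 [0,2] t = span X0' P X2' l02 r02"
  obtains p q where "p \<in> equivariant_maps G P A" "q \<in> equivariant_maps G P B"
    "\<forall>y\<in>car P. l01 (p y) = l02 y \<and> r12 (q y) = r02 y \<and> r01 (p y) = l12 (q y)"
    "fibre_product p q r01 l12 (car P) (car A) (car B)"
proof -
  have F: "is_functor (Tw 2) tw_le (GFin G) t" "pullback_diag G 2 t" using t by (simp_all add: splx_A_eff)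
  note i = span_inject[OF trans[OF face_span[OF t, of 0 1, symmetric] f(1)]] span_inject[OF trans[OF face_span[OF t, of 1 2, symmetric] f(2)]]
    span_inject[OF trans[OF face_span[OF t, of 0 2, symmetric] f(3)]]
  have c: "cartesian (GFin G) (fst t (0,2)) (fst t (1,2)) (fst t (0,1)) (fst t (1,1))
      (snd t (0,2) (1,2)) (snd t (0,2) (0,1)) (snd t (1,2) (1,1)) (snd t (0,1) (1,1))"
    using F(2) unfolding pullback_diag_def by simp
  have tw: "p \<in> Tw 2" if "p \<in> {(0,0),(0,1),(1,1),(0,2),(1,2),(2,2)}" for p using that Tw_2 by simp
  have "snd t (0,2) (0,0) = Cmp (GFin G) (fst t (0,2)) (snd t (0,1) (0,0)) (snd t (0,2) (0,1))"
    "snd t (0,2) (2,2) = Cmp (GFin G) (fst t (0,2)) (snd t (1,2) (2,2)) (snd t (0,2) (1,2))"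
    by (intro is_functorD(5)[OF F(1)] tw; simp add: tw_le_def)+
  then have e: "l02 = compose (car P) l01 (snd t (0,2) (0,1))" "r02 = compose (car P) r12 (snd t (0,2) (1,2))"
    using i by simp_all
  have "fibre_product (snd t (0,2) (1,2)) (snd t (0,2) (0,1)) l12 r01 (car P) (car B) (car A)"
    using cartesian_GFin_fibre_product[OF U c] i by simp
  then have fp: "fibre_product (snd t (0,2) (0,1)) (snd t (0,2) (1,2)) r01 l12 (car P) (car A) (car B)"
    by (rule fibre_product_sym)
  then have "\<forall>y\<in>car P. r01 (snd t (0,2) (0,1) y) = l12 (snd t (0,2) (1,2) y)" unfolding fibre_product_def by blast
  then show ?thesis
    by (intro that[of "snd t (0,2) (0,1)" "snd t (0,2) (1,2)"] fp) (use cartesianD(5,6)[OF c] i e in \<open>auto simp: compose_def\<close>)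
qed

lemma span_triangleI:
  fixes G :: "('g, 'r) monoid_scheme" and X0 X1 X2 A B P :: "('g, 'u) gset"
  assumes g: "is_gset G X0" "is_gset G X1" "is_gset G X2" "is_gset G A" "is_gset G B" "is_gset G P"
    and fin: "finite (car X0)" "finite (car X1)" "finite (car X2)" "finite (car A)" "finite (car B)" "finite (car P)"
    and m: "l01 \<in> equivariant_maps G A X0" "r01 \<in> equivariant_maps G A X1" "l12 \<in> equivariant_maps G B X1" "r12 \<in> equivariant_maps G B X2"
      "p \<in> equivariant_maps G P A" "q \<in> equivariant_maps G P B" "l02 \<in> equivariant_maps G P X0" "r02 \<in> equivariant_maps G P X2"
    and e: "\<forall>y\<in>car P. l01 (p y) = l02 y \<and> r12 (q y) = r02 y \<and> r01 (p y) = l12 (q y)"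
    and fp: "fibre_product p q r01 l12 (car P) (car A) (car B)"
  obtains t where "t \<in> splx (A_eff G) 2" "opr (A_eff G) 2 [0,1] t = span X0 A X1 l01 r01"
    "opr (A_eff G) 2 [1,2] t = span X1 B X2 l12 r12" "opr (A_eff G) 2 [0,2] t = span X0 P X2 l02 r02"
proof -
  define F0 where "F0 = (\<lambda>a. if a = (0::nat,0::nat) then X0 else if a = (0,1) then A else if a = (1,1) then X1 else
    if a = (1,2) then B else if a = (2,2) then X2 else P)"
  \<comment> \<open>The one arrow not among the data leads from (0,2) to (1,1); it is the diagonal
    of the pull-back square.\<close>
  define F1 where "F1 = (\<lambda>a b. if a = b then restrict id (car (F0 a)) else
    if a = (0,1) then (if b = (0,0) then l01 else r01) else if a = (1,2) then (if b = (1,1) then l12 else r12) else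
    if b = (0,1) then p else if b = (1,2) then q else if b = (0,0) then l02 else if b = (2,2) then r02 else compose (car P) r01 p)"
  define t where "t = mk_diag (Tw 2) tw_le F0 F1"
  have st: "a = (0,1) \<and> (b = (0,0) \<or> b = (1,1)) \<or> a = (1,2) \<and> (b = (1,1) \<or> b = (2,2)) \<or>
      a = (0,2) \<and> (b = (0,0) \<or> b = (0,1) \<or> b = (1,1) \<or> b = (1,2) \<or> b = (2,2))"
    if "a \<in> Tw 2" "b \<in> Tw 2" "tw_le a b" "a \<noteq> b" for a b
    using that unfolding Tw_2 tw_le_def by auto
  have F: "is_functor (Tw 2) tw_le (GFin G) t"
    unfolding t_def
  proof (rule GFin_functorI[OF tw_order])
    fix a assume "a \<in> Tw 2"
    show "is_gset G (F0 a) \<and> finite (car (F0 a))" using g fin by (simp add: F0_def)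
    show "F1 a a = restrict id (car (F0 a))" by (simp add: F1_def)
  next
    fix a b assume "a \<in> Tw 2" "b \<in> Tw 2" "tw_le a b" "a \<noteq> b"
    from st[OF this] show "F1 a b \<in> equivariant_maps G (F0 a) (F0 b)"
      using m equivariant_comp[OF g(6) m(5,2)] by (elim disjE conjE) (simp_all add: F0_def F1_def)
  next
    fix a b c x assume ab: "a \<in> Tw 2" "b \<in> Tw 2" "c \<in> Tw 2" "tw_le a b" "tw_le b c" "a \<noteq> b" "b \<noteq> c" and x: "x \<in> car (F0 a)"
    have "a = (0,2) \<and> (b = (0,1) \<and> (c = (0,0) \<or> c = (1,1)) \<or> b = (1,2) \<and> (c = (1,1) \<or> c = (2,2)))"
      using st[OF ab(1,2,4,6)] st[OF ab(2,3,5,7)] by auto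
    then show "F1 a c x = F1 b c (F1 a b x)"
      using e x by (elim disjE conjE) (simp_all add: F0_def F1_def compose_def)
  qed
  have tv: "fst t a = F0 a" "b \<in> Tw 2 ==> tw_le a b ==> snd t a b = F1 a b" if "a \<in> Tw 2" for a b using that by (simp_all add: t_def)
  have "pullback_diag G 2 t"
  proof (rule pullback_diagI[OF F])
    fix i i' j' j :: nat assume "i < i'" "i' \<le> j'" "j' < j" "j \<le> 2"
    then have "i = 0" "i' = 1" "j' = 1" "j = 2" by auto
    then show "fibre_product (snd t (i, j) (i', j)) (snd t (i, j) (i, j')) (snd t (i', j) (i', j')) (snd t (i, j') (i', j'))
        (car (fst t (i, j))) (car (fst t (i', j))) (car (fst t (i, j')))"
      using fibre_product_sym[OF fp] by (simp add: tv Tw_def tw_le_def F0_def F1_def)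
  qed
  then have t: "t \<in> splx (A_eff G) 2" using F by (simp add: splx_A_eff)
  show ?thesis
    by (rule that[OF t]) (simp_all add: face_span[OF t], simp_all add: tv Tw_def tw_le_def F0_def F1_def)
qed

section \<open>Coproducts in the effective Burnside category\<close>

lemma rv2: "rv 2 [0,1] = [1,2]" "rv 2 [1,2] = [0,1]" "rv 2 [0,2] = [0,2]" "rv 1 [0] = [1]" "rv 1 [1] = [0]" "rv 1 [0,0] = [1,1]" "rv 0 [0,0] = [0,0]" "rv 0 [0] = [0]"
  by (simp_all add: rv_def)

lemma obj_A_eff: "is_gset G X ==> finite (car X) ==> obj X \<in> splx (A_eff G) 0"
proof -
  assume X: "is_gset G X" "finite (car X)"
  have F: "is_functor (Tw 0) tw_le (GFin G) (obj X)" unfolding obj_def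
    by (rule GFin_functorI[OF tw_order]) (use X in \<open>auto simp: Tw_0\<close>)
  show ?thesis using F pullback_diagI[OF F] by (simp add: splx_A_eff)
qed

lemma span_faces:
  assumes s: "span X A S l r \<in> splx (A_eff G) 1"
  shows "opr (A_eff G) 1 [0] (span X A S l r) = obj X" "opr (A_eff G) 1 [1] (span X A S l r) = obj S"
    "opr (A_eff G) 1 [0,0] (span X A S l r) = span X X X (restrict id (car X)) (restrict id (car X))"
    "opr (A_eff G) 1 [1,1] (span X A S l r) = span S S S (restrict id (car S)) (restrict id (car S))"
proof -
  have F: "is_functor (Tw 1) tw_le (GFin G) (span X A S l r)" using s by (simp add: splx_A_eff)
  have tw: "(0,0) \<in> Tw 1" "(1,1) \<in> Tw 1" by (simp_all add: Tw_def)
  show "opr (A_eff G) 1 [0] (span X A S l r) = obj X" "opr (A_eff G) 1 [1] (span X A S l r) = obj S"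
    using face_obj[OF s] by (simp_all only: span_simps)
  show "opr (A_eff G) 1 [0,0] (span X A S l r) = span X X X (restrict id (car X)) (restrict id (car X))"
    "opr (A_eff G) 1 [1,1] (span X A S l r) = span S S S (restrict id (car S)) (restrict id (car S))"
    using face_span[OF s, of 0 0] face_span[OF s, of 1 1] is_functorD(3)[OF F tw(1)] is_functorD(3)[OF F tw(2)]
    by (simp_all only: span_simps GFin_simps order_refl le0 simp_thms)
qed

lemma obj_degenerate:
  assumes "is_gset G X" "finite (car X)"
  shows "opr (A_eff G) 0 [0,0] (obj X) = span X X X (restrict id (car X)) (restrict id (car X))"
  using face_span[OF obj_A_eff[OF assms], of 0 0] by (simp add: obj_def Tw_0 tw_le_def)

lemma obj_inject: "obj X = obj Y ==> X = Y"
  by (metis (no_types, lifting) fst_mk_diag insertI1 obj_def Tw_0)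

text \<open>
  Projecting \<open>X\<close> to the summand \<open>S k\<close> by the cocone that is the identity at \<open>k\<close> and empty elsewhere
  exhibits every point of \<open>S k\<close> as a point of \<open>A k\<close> that no other point of the \<open>A j\<close> meets in \<open>X\<close>.
\<close>

lemma coprod_spans_section:
  fixes G :: "('g, 'r) monoid_scheme" and X :: "('g, 'u) gset" and A S :: "'k => ('g, 'u) gset"
  assumes U: "infinite (UNIV :: 'u set)" and X: "is_gset G X" "finite (car X)"
    and AS: "\<And>j. j \<in> J ==> is_gset G (A j)" "\<And>j. j \<in> J ==> finite (car (A j))" "\<And>j. j \<in> J ==> is_gset G (S j)" "\<And>j. j \<in> J ==> finite (car (S j))"
      "\<And>j. j \<in> J ==> \<pi> j \<in> equivariant_maps G (A j) X" "\<And>j. j \<in> J ==> \<gamma> j \<in> equivariant_maps G (A j) (S j)"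
    and cp: "coprod (op_sset (A_eff G)) J (obj X) (\<lambda>j. span X (A j) (S j) (\<pi> j) (\<gamma> j))" and k: "k \<in> J"
  shows "\<exists>q. q \<in> equivariant_maps G (S k) (A k) \<and> (\<forall>s\<in>car (S k). \<gamma> k (q s) = s) \<and>
    (\<forall>s\<in>car (S k). \<forall>j\<in>J. \<forall>a\<in>car (A j). \<pi> j a = \<pi> k (q s) \<longrightarrow> j = k \<and> a = q s)"
proof -
  let ?A = "A_eff G :: ('g, 'u) span_simplex sset"
  let ?i = "restrict id (car (S k))"
  let ?e = "\<lambda>j. span X (A j) (S j) (\<pi> j) (\<gamma> j)"
  have opA: "is_sset (op_sset ?A)" by (rule is_sset_op_sset[OF is_sset_A_eff])
  \<comment> \<open>A span through the empty G-set plays the role of a zero morphism.\<close>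
  define Em where "Em = gsub G (S k) {}"
  have Em: "is_gset G Em" "car Em = {}"
    unfolding Em_def by (rule is_gset_gsub[OF AS(3)[OF k]]) (simp_all add: gsub_def)
  have z: "restrict id {} \<in> equivariant_maps G Em Y" for Y :: "('g, 'u) gset"
    by (rule equivariantI) (simp_all add: Em(2) restrict_def)
  define e' where "e' = (\<lambda>j. if j = k then span (S k) (S k) (S k) ?i ?i else span (S k) Em (S j) (restrict id {}) (restrict id {}))"
  have e: "?e j \<in> splx ?A 1" if "j \<in> J" for j by (rule span_A_eff[OF X(1) AS(1,3)[OF that] X(2) AS(2,4,5,6)[OF that]])
  have e': "e' j \<in> splx ?A 1" "opr ?A 1 [0] (e' j) = obj (S k)" "opr ?A 1 [1] (e' j) = obj (S j)" if j: "j \<in> J" for j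
  proof -
    have s1: "span (S k) (S k) (S k) ?i ?i \<in> splx ?A 1"
      by (intro span_A_eff AS(3,4)[OF k] equivariant_id)
    have s2: "span (S k) Em (S j) (restrict id {}) (restrict id {}) \<in> splx ?A 1"
      by (intro span_A_eff AS(3,4)[OF k] AS(3,4)[OF j] Em(1) z) (simp add: Em(2))
    have "e' j = (if j = k then span (S k) (S k) (S k) ?i ?i else span (S k) Em (S j) (restrict id {}) (restrict id {}))"
      by (simp add: e'_def)
    then show "e' j \<in> splx ?A 1" "opr ?A 1 [0] (e' j) = obj (S k)" "opr ?A 1 [1] (e' j) = obj (S j)"
      using s1 s2 span_faces(1,2)[OF s1] span_faces(1,2)[OF s2] by (simp_all split: if_splits)
  qed
  obtain w where w: "w \<in> splx (op_sset ?A) 1" "\<forall>j\<in>J. \<exists>t\<in>splx (op_sset ?A) 2. opr (op_sset ?A) 2 [0,1] t = ?e j \<and>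
      opr (op_sset ?A) 2 [1,2] t = w \<and> opr (op_sset ?A) 2 [0,2] t = e' j"
  proof (rule coprod_lift[OF opA cp, of "obj (S k)" e'])
    show "obj X \<in> splx (op_sset ?A) 0" "obj (S k) \<in> splx (op_sset ?A) 0"
      using obj_A_eff[OF X] obj_A_eff[OF AS(3,4)[OF k]] by simp_all
    show "\<forall>j\<in>J. ?e j \<in> splx (op_sset ?A) 1 \<and> opr (op_sset ?A) 1 [1] (?e j) = obj X"
      using e span_faces(1)[OF e] by (simp only: opr_op_sset rv2 splx_op_sset) simp
    show "\<forall>j\<in>J. e' j \<in> splx (op_sset ?A) 1 \<and> opr (op_sset ?A) 1 [1] (e' j) = obj (S k) \<and>
        opr (op_sset ?A) 1 [0] (e' j) = opr (op_sset ?A) 1 [0] (?e j)"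
      using e' span_faces(2)[OF e] by (simp only: opr_op_sset rv2 splx_op_sset) simp
  qed (rule that)
  \<comment> \<open>The map induced from \<open>X\<close> to \<open>S k\<close> in the opposite
    category is a span through some \<open>B\<close>; its composite with a leg is a pull-back over
    \<open>X\<close>.\<close>
  define B where "B = fst w (0,1)"
  obtain S0 S1 l r where w_span: "w = span S0 B S1 l r"
    using span_eqI[OF refl refl refl refl refl, of G w] w(1) unfolding B_def by (auto simp: splx_A_eff)
  have tri: "\<exists>t\<in>splx ?A 2. opr ?A 2 [0,1] t = span S0 B S1 l r \<and> opr ?A 2 [1,2] t = ?e j \<and> opr ?A 2 [0,2] t = e' j" if "j \<in> J" for j
    using bspec[OF w(2) that] unfolding opr_op_sset rv2 splx_op_sset w_span by blast
  obtain t where t: "t \<in> splx ?A 2" "opr ?A 2 [0,1] t = span S0 B S1 l r" "opr ?A 2 [1,2] t = ?e k" "opr ?A 2 [0,2] t = span (S k) (S k) (S k) ?i ?i"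
    using tri[OF k] by (auto simp: e'_def)
  obtain p q where pq: "p \<in> equivariant_maps G (S k) B" "q \<in> equivariant_maps G (S k) (A k)"
    "\<forall>y\<in>car (S k). l (p y) = ?i y \<and> \<gamma> k (q y) = ?i y \<and> r (p y) = \<pi> k (q y)"
    "fibre_product p q r (\<pi> k) (car (S k)) (car B) (car (A k))"
    by (rule span_triangleD[OF U t])
  have "j = k \<and> a = q s" if s: "s \<in> car (S k)" and j: "j \<in> J" and a: "a \<in> car (A j)" "\<pi> j a = \<pi> k (q s)" for s j a
  proof -
    \<comment> \<open>\<open>p s\<close> and \<open>a\<close> lie over the same point of
      \<open>X\<close> and so give a point of the pull-back, which is empty for \<open>j\<close>
      different from \<open>k\<close>.\<close>
    have ps: "p s \<in> car B" "r (p s) = \<pi> j a" using equivariantD(1)[OF pq(1) s] pq(3) s a(2) by simp_all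
    have jk: "j = k"
    proof (rule ccontr)
      assume "j \<noteq> k"
      then obtain t' where t': "t' \<in> splx ?A 2" "opr ?A 2 [0,1] t' = span S0 B S1 l r" "opr ?A 2 [1,2] t' = ?e j"
        "opr ?A 2 [0,2] t' = span (S k) Em (S j) (restrict id {}) (restrict id {})"
        using tri[OF j] by (auto simp: e'_def)
      obtain p' q' where "fibre_product p' q' r (\<pi> j) (car Em) (car B) (car (A j))"
        by (rule span_triangleD[OF U t'])
      then show False using ps a(1) Em(2) unfolding fibre_product_def by blast
    qed
    have "\<exists>!y. y \<in> car (S k) \<and> p y = p s \<and> q y = a"
      using pq(4) ps a(1) jk unfolding fibre_product_def by blast
    then obtain y where y: "y \<in> car (S k)" "p y = p s" "q y = a" by blast
    \<comment> \<open>\<open>l\<close> after \<open>p\<close> is the identity of \<open>S k\<close>,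
      so \<open>p\<close> is injective there and the point found is \<open>s\<close>.\<close>
    have "y = l (p y)" "s = l (p s)" using pq(3) y(1) s by simp_all
    then show ?thesis using y jk by simp
  qed
  then show ?thesis using pq(2,3) by (intro exI[of _ q]) auto
qed

text \<open>
  The disjoint union \<open>Y\<close> of the \<open>A j\<close>, mapped to \<open>X\<close> by \<open>\<pi>\<close> on one side and by \<open>\<pi> \<circ> q \<circ> \<gamma>\<close> on the
  other, restricts to the given spans, so it is isomorphic to the identity span of \<open>X\<close>.
\<close>

lemma coprod_spans:
  fixes G :: "('g, 'r) monoid_scheme" and X :: "('g, 'u) gset" and A S :: "'k => ('g, 'u) gset"
  assumes U: "infinite (UNIV :: 'u set)" and X: "is_gset G X" "finite (car X)"
    and AS: "\<And>j. j \<in> J ==> is_gset G (A j)" "\<And>j. j \<in> J ==> finite (car (A j))" "\<And>j. j \<in> J ==> is_gset G (S j)" "\<And>j. j \<in> J ==> finite (car (S j))"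
      "\<And>j. j \<in> J ==> \<pi> j \<in> equivariant_maps G (A j) X" "\<And>j. j \<in> J ==> \<gamma> j \<in> equivariant_maps G (A j) (S j)"
    and cp: "coprod (op_sset (A_eff G)) J (obj X) (\<lambda>j. span X (A j) (S j) (\<pi> j) (\<gamma> j))"
  shows "\<forall>j\<in>J. bij_betw (\<gamma> j) (car (A j)) (car (S j))"
    and "bij_betw (\<lambda>(j, a). \<pi> j a) (SIGMA j:J. car (A j)) (car X)"
    and "finite {j \<in> J. car (S j) \<noteq> {}}"
proof -
  let ?A = "A_eff G :: ('g, 'u) span_simplex sset"
  let ?e = "\<lambda>j. span X (A j) (S j) (\<pi> j) (\<gamma> j)"
  let ?i = "restrict id (car X)"
  have opA: "is_sset (op_sset ?A)" by (rule is_sset_op_sset[OF is_sset_A_eff])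
  interpret group G by (rule group_of_gset[OF X(1)])
  have e: "?e j \<in> splx ?A 1" if "j \<in> J" for j by (rule span_A_eff[OF X(1) AS(1,3)[OF that] X(2) AS(2,4,5,6)[OF that]])
  have "\<forall>k\<in>J. \<exists>q. q \<in> equivariant_maps G (S k) (A k) \<and> (\<forall>s\<in>car (S k). \<gamma> k (q s) = s) \<and>
    (\<forall>s\<in>car (S k). \<forall>j\<in>J. \<forall>a\<in>car (A j). \<pi> j a = \<pi> k (q s) \<longrightarrow> j = k \<and> a = q s)"
  proof
    fix k assume k: "k \<in> J"
    show "\<exists>q. q \<in> equivariant_maps G (S k) (A k) \<and> (\<forall>s\<in>car (S k). \<gamma> k (q s) = s) \<and>
      (\<forall>s\<in>car (S k). \<forall>j\<in>J. \<forall>a\<in>car (A j). \<pi> j a = \<pi> k (q s) \<longrightarrow> j = k \<and> a = q s)"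
      by (rule coprod_spans_section[OF U X _ _ _ _ _ _ cp k]) (use AS in simp_all)
  qed
  then obtain q where q: "\<forall>k\<in>J. q k \<in> equivariant_maps G (S k) (A k) \<and> (\<forall>s\<in>car (S k). \<gamma> k (q k s) = s) \<and>
    (\<forall>s\<in>car (S k). \<forall>j\<in>J. \<forall>a\<in>car (A j). \<pi> j a = \<pi> k (q k s) \<longrightarrow> j = k \<and> a = q k s)"
    by (elim bchoice[THEN exE]) (rule that)
  have qe: "q k \<in> equivariant_maps G (S k) (A k)" if "k \<in> J" for k using q that by blast
  have qs: "\<gamma> k (q k s) = s" if "k \<in> J" "s \<in> car (S k)" for k s using q that by blast
  have qu: "j = k" "a = q k s" if "k \<in> J" "s \<in> car (S k)" "j \<in> J" "a \<in> car (A j)" "\<pi> j a = \<pi> k (q k s)" for j k s a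
    using q that by blast+
  have qc: "q k s \<in> car (A k)" if "k \<in> J" "s \<in> car (S k)" for k s by (rule equivariantD(1)[OF qe[OF that(1)] that(2)])
  have gc: "\<gamma> k a \<in> car (S k)" "\<pi> k a \<in> car X" if "k \<in> J" "a \<in> car (A k)" for k a
    using equivariantD(1)[OF AS(6)[OF that(1)] that(2)] equivariantD(1)[OF AS(5)[OF that(1)] that(2)] by simp_all
  define J' where "J' = {j \<in> J. car (S j) \<noteq> {}}"
  \<comment> \<open>One point for each non-empty \<open>S j\<close>. By uniqueness their images in
    \<open>X\<close> are distinct, and \<open>X\<close> is finite.\<close>
  define s0 where "s0 = (\<lambda>j. SOME s. s \<in> car (S j))"
  have s0: "j \<in> J" "s0 j \<in> car (S j)" if "j \<in> J'" for j using that someI_ex[of "\<lambda>s. s \<in> car (S j)"] by (auto simp: J'_def s0_def)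
  have "inj_on (\<lambda>j. \<pi> j (q j (s0 j))) J'"
    by (rule inj_onI) (use qu(1) s0 qc in blast)
  moreover have "(\<lambda>j. \<pi> j (q j (s0 j))) ` J' \<subseteq> car X" using gc(2) qc s0 by auto
  ultimately show J': "finite {j \<in> J. car (S j) \<noteq> {}}" using X(2) inj_on_finite unfolding J'_def by blast
  define W where "W = (SIGMA j:J. car (A j))"
  \<comment> \<open>\<open>A j\<close> maps to \<open>S j\<close>, so it is empty whenever
    \<open>S j\<close> is; the disjoint union thus has finitely many non-empty summands.\<close>
  have "W \<subseteq> (SIGMA j:J'. car (A j))" using gc(1) by (auto simp: W_def J'_def)
  moreover have "finite (SIGMA j:J'. car (A j))" by (rule finite_SigmaI) (use J' AS(2) in \<open>auto simp: J'_def\<close>)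
  ultimately have Wfin: "finite W" by (rule finite_subset)
  define WG where "WG = \<lparr>car = W, act = (\<lambda>g\<in>carrier G. \<lambda>p\<in>W. (fst p, act (A (fst p)) g (snd p)))\<rparr>"
  have WG: "is_gset G WG"
  proof (rule is_gsetI[OF is_group])
    fix g p assume g: "g \<in> carrier G" and p: "p \<in> car WG"
    then show "act WG g p \<in> car WG" using gsetD(1)[OF AS(1)] by (auto simp: WG_def W_def)
    fix h assume h: "h \<in> carrier G"
    show "act WG (g \<otimes>\<^bsub>G\<^esub> h) p = act WG g (act WG h p)"
      using gsetD(1)[OF AS(1) h] gsetD(3)[OF AS(1) g h] g h p by (auto simp: WG_def W_def)
  next
    fix p assume "p \<in> car WG"
    then show "act WG \<one>\<^bsub>G\<^esub> p = p" using gsetD(2)[OF AS(1)] by (auto simp: WG_def W_def)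
  qed (auto simp: WG_def)
  have cW: "car WG = W" by (simp add: WG_def)
  obtain Y :: "('g, 'u) gset" and i where Y: "is_gset G Y" "car Y = i ` car WG" "inj_on i (car WG)"
    "\<forall>g\<in>carrier G. \<forall>p\<in>car WG. act Y g (i p) = i (act WG g p)"
    by (rule gset_realize[OF WG _ U]) (use Wfin cW in auto)
  have iY: "i (j, a) \<in> car Y" if "j \<in> J" "a \<in> car (A j)" for j a using Y(2) cW that by (auto simp: W_def)
  have Yi: "\<exists>j a. y = i (j, a) \<and> j \<in> J \<and> a \<in> car (A j)" if "y \<in> car Y" for y using Y(2) cW that by (auto simp: W_def)
  have ii: "i (j, a) = i (k, b) \<longleftrightarrow> j = k \<and> a = b" if "j \<in> J" "a \<in> car (A j)" "k \<in> J" "b \<in> car (A k)" for j a k b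
    using inj_on_eq_iff[OF Y(3), of "(j, a)" "(k, b)"] that by (simp add: cW W_def)
  have ia: "act Y g (i (j, a)) = i (j, act (A j) g a)" if "g \<in> carrier G" "j \<in> J" "a \<in> car (A j)" for g j a
    using bspec[OF bspec[OF Y(4) that(1)], of "(j, a)"] that by (simp add: WG_def W_def)
  define lam where "lam = (\<lambda>y\<in>car Y. case inv_into W i y of (j, a) => \<pi> j a)"
  define rho where "rho = (\<lambda>y\<in>car Y. case inv_into W i y of (j, a) => \<pi> j (q j (\<gamma> j a)))"
  have inv: "inv_into W i (i (j, a)) = (j, a)" if "j \<in> J" "a \<in> car (A j)" for j a
    by (rule inv_into_f_f) (use Y(3) cW that in \<open>auto simp: W_def\<close>)
  have lr: "lam (i (j, a)) = \<pi> j a" "rho (i (j, a)) = \<pi> j (q j (\<gamma> j a))" if "j \<in> J" "a \<in> car (A j)" for j a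
    using inv[OF that] iY[OF that] by (simp_all add: lam_def rho_def)
  have lam: "lam \<in> equivariant_maps G Y X"
  proof (rule equivariantI)
    fix y assume "y \<in> car Y"
    then obtain j a where y: "y = i (j, a)" "j \<in> J" "a \<in> car (A j)" using Yi by blast
    show "lam y \<in> car X" using y lr gc by simp
    show "lam (act Y g y) = act X g (lam y)" if g: "g \<in> carrier G" for g
      using y g ia lr gsetD(1)[OF AS(1)[OF y(2)] g y(3)] equivariantD(2)[OF AS(5)[OF y(2)] g y(3)] by simp
  qed (simp add: lam_def)
  have rho: "rho \<in> equivariant_maps G Y X"
  proof (rule equivariantI)
    fix y assume "y \<in> car Y"
    then obtain j a where y: "y = i (j, a)" "j \<in> J" "a \<in> car (A j)" using Yi by blast
    show "rho y \<in> car X" using y lr gc qc by simp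
    show "rho (act Y g y) = act X g (rho y)" if g: "g \<in> carrier G" for g
      using y g ia lr gsetD(1)[OF AS(1)[OF y(2)] g y(3)] equivariantD(2)[OF AS(6)[OF y(2)] g y(3)]
        equivariantD(2)[OF qe[OF y(2)] g gc(1)[OF y(2,3)]] equivariantD(2)[OF AS(5)[OF y(2)] g qc[OF y(2) gc(1)[OF y(2,3)]]] by simp
  qed (simp add: rho_def)
  have Yf: "finite (car Y)" using Y(2) Wfin cW by simp
  have t1: "\<exists>t\<in>splx (op_sset ?A) 2. opr (op_sset ?A) 2 [0,1] t = ?e j \<and> opr (op_sset ?A) 2 [1,2] t = span X Y X lam rho \<and>
      opr (op_sset ?A) 2 [0,2] t = ?e j" if j: "j \<in> J" for j
  proof -
    define p where "p = (\<lambda>a\<in>car (A j). i (j, a))"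
    define q' where "q' = (\<lambda>a\<in>car (A j). q j (\<gamma> j a))"
    have p: "p \<in> equivariant_maps G (A j) Y"
      by (rule equivariantI) (use iY ia gsetD(1)[OF AS(1)[OF j]] j in \<open>auto simp: p_def\<close>)
    have q': "q' \<in> equivariant_maps G (A j) (A j)"
      by (rule equivariantI) (use qc gc gsetD(1)[OF AS(1)[OF j]] j equivariantD(2)[OF AS(6)[OF j]] equivariantD(2)[OF qe[OF j]] in \<open>auto simp: q'_def\<close>)
    have e2: "\<forall>y\<in>car (A j). lam (p y) = \<pi> j y \<and> \<gamma> j (q' y) = \<gamma> j y \<and> rho (p y) = \<pi> j (q' y)"
      using lr j qs gc by (simp add: p_def q'_def)
    \<comment> \<open>The right leg of \<open>Y\<close> takes values of the form
      \<open>\<pi> k (q k s)\<close>, which only the summand \<open>k\<close> meets; so the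
      pull-back of \<open>Y\<close> with \<open>A j\<close> is \<open>A j\<close> itself.\<close>
    have fp: "fibre_product p q' rho (\<pi> j) (car (A j)) (car Y) (car (A j))"
      unfolding fibre_product_def
    proof (intro conjI ballI impI)
      show "rho (p y) = \<pi> j (q' y)" if "y \<in> car (A j)" for y using e2 that by simp
      fix y a assume y: "y \<in> car Y" and a: "a \<in> car (A j)" "rho y = \<pi> j a"
      obtain k b where kb: "y = i (k, b)" "k \<in> J" "b \<in> car (A k)" using Yi[OF y] by blast
      have u: "j = k" "a = q k (\<gamma> k b)"
        using qu[OF kb(2) gc(1)[OF kb(2,3)] j a(1)] a(2) lr(2)[OF kb(2,3)] kb(1) by simp_all
      show "\<exists>!c. c \<in> car (A j) \<and> p c = y \<and> q' c = a"
      proof (rule ex1I[of _ b])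
        show "b \<in> car (A j) \<and> p b = y \<and> q' b = a" using u kb by (simp add: p_def q'_def)
        show "c = b" if c: "c \<in> car (A j) \<and> p c = y \<and> q' c = a" for c
        proof -
          have c': "c \<in> car (A j)" "p c = y" using c by simp_all
          have "i (j, c) = i (k, b)" using c' kb(1) by (simp add: p_def)
          then show ?thesis using ii[OF j _ kb(2,3), of c] c by blast
        qed
      qed
    qed
    obtain t where t: "t \<in> splx ?A 2" "opr ?A 2 [0,1] t = span X Y X lam rho" "opr ?A 2 [1,2] t = ?e j" "opr ?A 2 [0,2] t = ?e j"
      by (rule span_triangleI[OF X(1) X(1) AS(3)[OF j] Y(1) AS(1)[OF j] AS(1)[OF j] X(2) X(2) AS(4)[OF j] Yf AS(2)[OF j] AS(2)[OF j]
          lam rho AS(5)[OF j] AS(6)[OF j] p q' AS(5)[OF j] AS(6)[OF j] e2 fp])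
    show ?thesis unfolding opr_op_sset rv2 splx_op_sset
      by (rule bexI[OF _ t(1)]) (intro conjI t(2-4))
  qed
  have t2: "\<exists>t\<in>splx (op_sset ?A) 2. opr (op_sset ?A) 2 [0,1] t = ?e j \<and> opr (op_sset ?A) 2 [1,2] t = span X X X ?i ?i \<and>
      opr (op_sset ?A) 2 [0,2] t = ?e j" if j: "j \<in> J" for j
  proof -
    have a: "[0,0,1] \<in> splx (Delta 1) 2" by (simp add: Delta_iff)
    show ?thesis unfolding opr_op_sset rv2 splx_op_sset
      by (rule bexI[of _ "opr ?A 1 [0,0,1] (?e j)"])
         (use is_ssetD(2)[OF is_sset_A_eff e[OF j] a] is_ssetD(3)[OF is_sset_A_eff e[OF j] a, of "[0,1]" 1]
            is_ssetD(3)[OF is_sset_A_eff e[OF j] a, of "[1,2]" 1] is_ssetD(3)[OF is_sset_A_eff e[OF j] a, of "[0,2]" 1]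
            is_ssetD(1)[OF is_sset_A_eff e[OF j]] span_faces(3)[OF e[OF j]] in \<open>simp_all add: Delta_iff upt_Suc\<close>)
  qed
  have sY: "span X Y X lam rho \<in> splx ?A 1" by (rule span_A_eff[OF X(1) Y(1) X(1) X(2) Yf X(2) lam rho])
  have sX: "span X X X ?i ?i \<in> splx ?A 1" by (intro span_A_eff X equivariant_id)
  \<comment> \<open>The span through \<open>Y\<close> and the identity of \<open>X\<close> both
    restrict to the given legs, so uniqueness provides a triangle between them.\<close>
  obtain s where s: "s \<in> splx (op_sset ?A) 2" "opr (op_sset ?A) 2 [0,1] s = opr (op_sset ?A) 0 [0,0] (obj X)"
    "opr (op_sset ?A) 2 [1,2] s = span X X X ?i ?i" "opr (op_sset ?A) 2 [0,2] s = span X Y X lam rho"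
  proof (rule coprod_unique[OF opA cp, of "span X Y X lam rho" "span X X X ?i ?i" ?e])
    show "obj X \<in> splx (op_sset ?A) 0" using obj_A_eff[OF X] by simp
    show "\<forall>j\<in>J. ?e j \<in> splx (op_sset ?A) 1" using e by simp
    show "span X Y X lam rho \<in> splx (op_sset ?A) 1" "span X X X ?i ?i \<in> splx (op_sset ?A) 1" using sY sX by simp_all
    show "opr (op_sset ?A) 1 [0] (span X Y X lam rho) = obj X" "opr (op_sset ?A) 1 [0] (span X X X ?i ?i) = obj X"
      "opr (op_sset ?A) 1 [1] (span X Y X lam rho) = opr (op_sset ?A) 1 [1] (span X X X ?i ?i)"
      unfolding opr_op_sset rv2 span_faces(1,2)[OF sY] span_faces(1,2)[OF sX] by (rule refl)+
  qed (use t1 t2 in blast)+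
  have s': "s \<in> splx ?A 2" "opr ?A 2 [0,1] s = span X X X ?i ?i" "opr ?A 2 [1,2] s = span X X X ?i ?i" "opr ?A 2 [0,2] s = span X Y X lam rho"
    using s unfolding opr_op_sset rv2 splx_op_sset obj_degenerate[OF X] by simp_all
  obtain p' q' where pq: "p' \<in> equivariant_maps G Y X" "q' \<in> equivariant_maps G Y X"
    "\<forall>y\<in>car Y. ?i (p' y) = lam y \<and> ?i (q' y) = rho y \<and> ?i (p' y) = ?i (q' y)"
    "fibre_product p' q' ?i ?i (car Y) (car X) (car X)"
    by (rule span_triangleD[OF U s'])
  \<comment> \<open>The triangle presents \<open>Y\<close> as the composite of two identity spans,
    so both of its legs coincide with the projection \<open>p'\<close>.\<close>
  have eq: "lam y = rho y" "p' y = lam y" if "y \<in> car Y" for y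
    using bspec[OF pq(3) that] equivariantD(1)[OF pq(1) that] by auto
  \<comment> \<open>\<open>q j\<close> was a right inverse of \<open>\<gamma> j\<close>; equality of
    the two legs makes it a left inverse as well.\<close>
  have qg: "q j (\<gamma> j a) = a" if "j \<in> J" "a \<in> car (A j)" for j a
  proof -
    have "\<pi> j a = \<pi> j (q j (\<gamma> j a))" using eq(1)[OF iY[OF that]] lr[OF that] by simp
    from qu(2)[OF that(1) gc(1)[OF that] that this] show ?thesis by simp
  qed
  show "\<forall>j\<in>J. bij_betw (\<gamma> j) (car (A j)) (car (S j))"
  proof
    fix j assume "j \<in> J"
    then show "bij_betw (\<gamma> j) (car (A j)) (car (S j))"
      by (intro bij_betwI[where g = "q j"]) (use gc qc qg qs in auto)
  qed
  show "bij_betw (\<lambda>(j, a). \<pi> j a) (SIGMA j:J. car (A j)) (car X)"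
    unfolding bij_betw_def
  proof
    show "inj_on (\<lambda>(j, a). \<pi> j a) (SIGMA j:J. car (A j))"
    proof (rule inj_onI, clarify)
      fix j a k b assume h: "j \<in> J" "a \<in> car (A j)" "k \<in> J" "b \<in> car (A k)" "\<pi> j a = \<pi> k b"
      have "\<pi> j a = \<pi> k (q k (\<gamma> k b))" using h(5) qg[OF h(3,4)] by simp
      from qu[OF h(3) gc(1)[OF h(3,4)] h(1,2) this] show "j = k \<and> a = b" using qg[OF h(3,4)] by simp
    qed
    have "x \<in> (\<lambda>(j, a). \<pi> j a) ` (SIGMA j:J. car (A j))" if x: "x \<in> car X" for x
    proof -
      obtain y where y: "y \<in> car Y" "p' y = x" using pq(4) x unfolding fibre_product_def by blast
      obtain j a where ja: "y = i (j, a)" "j \<in> J" "a \<in> car (A j)" using Yi[OF y(1)] by blast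
      have "x = \<pi> j a" using eq(2)[OF y(1)] y(2) ja lr by simp
      then show ?thesis using ja by force
    qed
    then show "(\<lambda>(j, a). \<pi> j a) ` (SIGMA j:J. car (A j)) = car X" using gc by auto
  qed
qed

section \<open>Excision for finite G-sets\<close>

text \<open>Without legs the condition is the filling of spheres that start at \<open>x\<close>, up
  to lowering the vertices by one.\<close>

lemma coprod_empty:
  assumes C: "is_sset C" and x: "initial C x" shows "coprod C {} x e"
  unfolding coprod_def
proof (intro allI impI, elim conjE)
  fix n :: nat and g f assume n: "0 < n" and g: "cmap C (bcx n) g" "g [1] = x"
  let ?\<sigma> = "{1..Suc n}"
  have "?\<sigma> \<notin> bcx n" "\<And>\<tau>. \<tau> \<subset> ?\<sigma> ==> \<tau> \<noteq> {} ==> \<tau> \<in> bcx n" by (auto simp: bcx_def)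
  then obtain h where h: "cmap C (insert ?\<sigma> (bcx n)) h" "\<forall>l\<in>chains (bcx n). h l = g l"
    using initial_cell[OF C subcomplex_bcx g(1), of ?\<sigma> 1 "Suc n"] n g(2) x by auto
  let ?L = "[1..<Suc (Suc n)]"
  have L: "?L \<in> chains (insert ?\<sigma> (bcx n))" "length ?L - 1 = n" by (auto simp: chains_def atLeastLessThanSuc_atLeastAtMost)
  have "opr C n (map (\<lambda>i. i - 1) l) (h ?L) = g l" if l: "l \<in> chains (bcx n)" for l
  proof -
    have s: "sorted l" "l \<noteq> []" "set l \<subset> ?\<sigma>" using l by (auto simp: chains_def bcx_def)
    have "\<forall>i\<in>set l. i - 1 \<le> n"
    proof
      fix i assume "i \<in> set l"
      then have "i \<in> ?\<sigma>" using s(3) by blast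
      then have "i \<le> Suc n" by simp
      then show "i - 1 \<le> n" by linarith
    qed
    then have "set (map (\<lambda>i. i - 1) l) \<subseteq> {..n}" by auto
    moreover have "sorted (map (\<lambda>i. i - 1) l)" using s(1) by (auto simp: sorted_iff_nth_mono intro!: diff_le_mono)
    ultimately have d: "map (\<lambda>i. i - 1) l \<in> splx (Delta n) (length l - 1)" using s(2) by (simp add: Delta_iff)
    have "i \<in> set l ==> ?L ! (i - 1) = i" for i
    proof -
      assume "i \<in> set l"
      then have "1 \<le> i" "i \<le> Suc n" using s(3) by auto
      then show ?thesis by (subst nth_upt) auto
    qed
    then have "map (nth ?L) (map (\<lambda>i. i - 1) l) = l" by (simp add: map_idI)
    then show ?thesis using cmapD(2)[OF h(1) L(1), of "map (\<lambda>i. i - 1) l"] d h(2) l L(2) by (simp del: map_map)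
  qed
  moreover have "h ?L \<in> splx C n" using cmapD(1)[OF h(1) L(1)] L(2) by simp
  ultimately show "\<exists>s t. s \<in> splx C n \<and> (\<forall>l\<in>chains (bcx n). opr C n (map (\<lambda>i. i - 1) l) s = g l) \<and>
      (\<forall>j\<in>{}. t j \<in> splx C (Suc n) \<and> (\<forall>l\<in>chains (hcx n). opr C (Suc n) l (t j) = f j l) \<and> opr C (Suc n) [1..<Suc (Suc n)] (t j) = s)"
    by blast
qed

section \<open>Invariant subsets and their inclusions\<close>

definition invar :: "('g, 'r) monoid_scheme => ('g, 'u) gset => 'u set => bool" where
  "invar G X Y \<longleftrightarrow> Y \<subseteq> car X \<and> (\<forall>g\<in>carrier G. \<forall>x\<in>Y. act X g x \<in> Y)"

lemma invarD: "invar G X Y ==> Y \<subseteq> car X" "invar G X Y ==> g \<in> carrier G ==> x \<in> Y ==> act X g x \<in> Y"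
  by (auto simp: invar_def)

lemma gsub_simps [simp]: "car (gsub G X Y) = Y" "g \<in> carrier G ==> act (gsub G X Y) g = restrict (act X g) Y"
  by (simp_all add: gsub_def)

lemma is_gset_invar: "is_gset G X ==> invar G X Y ==> is_gset G (gsub G X Y)"
  by (rule is_gset_gsub) (auto simp: invar_def)

lemma gsub_gsub: "Z \<subseteq> Y ==> gsub G (gsub G X Y) Z = gsub G X Z"
  by (auto simp: gsub_def restrict_def fun_eq_iff)

lemma gsub_car:
  fixes X :: "('g, 'u) gset"
  assumes X: "is_gset G X" shows "gsub G X (car X) = X"
  by (rule gset_eqI[OF is_gset_gsub[OF X] X]) (use gsetD(1)[OF X] in auto)

text \<open>Makes the subspaces in the excision axiom discrete spaces again, so that the values of
  its diagram take the form \<open>inc\<close>.\<close>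

lemma subspace_min_min: "Y \<subseteq> car X ==> subspace G (min_min X) Y = min_min (gsub G X Y)"
  unfolding subspace_def min_min_def gsub_def by (auto simp: Fpow_def)

lemma gsub_inclusion:
  assumes "is_gset G X" "invar G X Y" "invar G X Z" "Y \<subseteq> Z"
  shows "restrict id Y \<in> equivariant_maps G (gsub G X Y) (gsub G X Z)"
  by (rule equivariantI) (use assms(4) invarD(2)[OF assms(2)] in auto)

lemma Ob_GBornCoarse [simp]: "Ob (GBornCoarse G) = {X. is_gspace G X}"
  by (simp add: GBornCoarse_def)

abbreviation inc :: "('g, 'r) monoid_scheme => ('g, 'u) gset => 'u set list => ('g, 'u) space_chain" where
  "inc G X Ys \<equiv> incl_chain (map (\<lambda>Y. min_min (gsub G X Y)) Ys)"

lemma inc_nerve: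
  fixes X :: "('g, 'u) gset"
  assumes X: "is_gset G X" "finite (car X)" and Ys: "length Ys = Suc n" "\<forall>Y\<in>set Ys. invar G X Y" "sorted_wrt (\<subseteq>) Ys"
  shows "inc G X Ys \<in> splx (nerve (GBornCoarse G)) n"
    and "\<alpha> \<in> splx (Delta n) m ==> opr (nerve (GBornCoarse G)) n \<alpha> (inc G X Ys) = inc G X (map (nth Ys) \<alpha>)"
proof -
  let ?Xs = "map (\<lambda>Y. min_min (gsub G X Y)) Ys"
  have iv: "invar G X (Ys ! i)" if "i \<le> n" for i using Ys(1,2) that by simp
  have le: "Ys ! i \<subseteq> Ys ! j" if "i \<le> j" "j \<le> n" for i j
    using sorted_wrt_nth_less[OF Ys(3), of i j] that Ys(1) by (cases "i = j") auto
  have ca: "car (?Xs ! i) = Ys ! i" if "i \<le> n" for i using that Ys(1) by simp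
  have P: "{..<length ?Xs} = {..n}" using Ys(1) by auto
  have "is_functor {..n} (\<le>) (GBornCoarse G) (mk_diag {..n} (\<le>) (nth ?Xs) (\<lambda>i j. restrict id (car (?Xs ! i))))"
  proof (rule is_functorI)
    show "reflp_on {..n} (\<le>)" "transp_on {..n} (\<le>)" by (auto simp: reflp_on_def transp_on_def)
    fix i assume i: "i \<in> {..n}"
    show "?Xs ! i \<in> Ob (GBornCoarse G)"
      using is_gspace_min_min[OF is_gset_invar[OF X(1) iv]] i Ys(1) by simp
    show "restrict id (car (?Xs ! i)) = Idn (GBornCoarse G) (?Xs ! i)" by (simp add: GBornCoarse_def)
    fix j assume j: "j \<in> {..n}" "i \<le> j"
    have fin: "finite (car (gsub G X (Ys ! i)))" using finite_subset[OF invarD(1)[OF iv] X(2)] i by simp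
    have m: "restrict id (Ys ! i) \<in> equivariant_maps G (gsub G X (Ys ! i)) (gsub G X (Ys ! j))"
      by (rule gsub_inclusion[OF X(1)]) (use i j iv le in auto)
    show "restrict id (car (?Xs ! i)) \<in> Hom (GBornCoarse G) (?Xs ! i) (?Xs ! j)"
      using m min_min_map[OF m fin] i j Ys(1) by (simp add: GBornCoarse_def min_min_equivariant)
  next
    fix i j k assume ijk: "i \<in> {..n}" "j \<in> {..n}" "k \<in> {..n}" "i \<le> j" "j \<le> k"
    then show "restrict id (car (?Xs ! i)) = Cmp (GBornCoarse G) (?Xs ! i) (restrict id (car (?Xs ! j))) (restrict id (car (?Xs ! i)))"
      using le[of i j] ca[of i] ca[of j] by (auto simp: GBornCoarse_def compose_def fun_eq_iff restrict_def)
  qed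
  then show "inc G X Ys \<in> splx (nerve (GBornCoarse G)) n" by (simp add: nerve_def incl_chain_def P[simplified])
  assume a: "\<alpha> \<in> splx (Delta n) m"
  have l: "length \<alpha> - 1 = m" "{..<length (map (\<lambda>Y. min_min (gsub G X Y)) (map (nth Ys) \<alpha>))} = {..m}" "length \<alpha> = Suc m"
    using a by (auto simp: Delta_iff)
  have an: "\<alpha> ! p \<le> n" if "p \<le> m" for p by (rule Delta_nth(1)[OF a that])
  then have al: "\<alpha> ! p < length Ys" if "p \<le> m" for p using that Ys(1) by (simp add: less_Suc_eq_le)
  show "opr (nerve (GBornCoarse G)) n \<alpha> (inc G X Ys) = inc G X (map (nth Ys) \<alpha>)"
    unfolding nerve_def incl_chain_def sset.simps reindex_def l(1,2) P
    by (rule mk_diag_cong) (use an al l(3) Delta_nth(2)[OF a] in auto)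
qed

lemma inc_faces:
  fixes X :: "('g, 'u) gset"
  assumes X: "is_gset G X" "finite (car X)" and H: "sset_map (nerve (GBornCoarse G)) C H"
    and Ys: "length Ys = Suc n" "\<forall>Y\<in>set Ys. invar G X Y" "sorted_wrt (\<subseteq>) Ys"
  shows "H n (inc G X Ys) \<in> splx C n"
    and "\<alpha> \<in> splx (Delta n) m ==> opr C n \<alpha> (H n (inc G X Ys)) = H m (inc G X (map (nth Ys) \<alpha>))"
  using sset_mapD[OF H inc_nerve(1)[OF X Ys]] inc_nerve(2)[OF X Ys] by auto

text \<open>The big family consists of the single subset \<open>W\<close>, so both colimits in the square are trivial.\<close>

lemma excision_two:
  fixes X :: "('g, 'u) gset" and C :: "'c sset"
  assumes Q: "quasi_category C" and CH: "coarse_homology G C H"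
    and X: "is_gset G X" "finite (car X)" and Z: "invar G X Z" and W: "invar G X W" and ZW: "Z \<inter> W = {}" "Z \<union> W = car X"
  shows "coprod C UNIV (H 0 (inc G X [car X])) (\<lambda>t. if t then H 1 (inc G X [W, car X]) else H 1 (inc G X [Z, car X]))"
proof -
  have C: "is_sset C" using Q by (simp add: quasi_category_def)
  have H: "sset_map (nerve (GBornCoarse G)) C H" using CH by (simp add: coarse_homology_def)
  \<comment> \<open>A single index, taken from the type in which the excision axiom draws its index
    posets.\<close>
  define I :: "('u \<times> 'u) set set" where "I = {{}}"
  define po :: "('u \<times> 'u) set => ('u \<times> 'u) set => bool" where "po = (\<subseteq>)"
  have ob: "min_min X \<in> Ob (GBornCoarse G)" using is_gspace_min_min[OF X(1)] by simp
  have inv: "invariant_subset G (min_min X) Z" "invariant_subset G (min_min X) W"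
    using Z W unfolding invariant_subset_def by (auto simp: invar_def)
  have "thicken U W \<subseteq> W" if "U \<in> ent (min_min X)" for U using that by (auto simp: thicken_def)
  then have "complementary_pair G (min_min X) Z I po (\<lambda>_. W)"
    unfolding complementary_pair_def big_family_def filtered_poset_def using inv ZW
    by (auto simp: I_def po_def reflp_on_def antisymp_on_def transp_on_def)
  then obtain q where q: "excision_square G C H (min_min X) Z I po (\<lambda>_. W) q" "pushout_square C q"
    using CH ob unfolding coarse_homology_def by meson
  define R where "R = pnerve ((At ` I \<union> {Colim, Top}) \<times> (UNIV :: bool set)) (prod_le (adjoin2_le po) (\<le>))"
  let ?sp = "excision_space G (min_min X) Z (\<lambda>_. W)"
  obtain D where D: "sset_map R C D" "\<forall>n. \<forall>l\<in>splx R n. Colim \<notin> fst ` set l \<longrightarrow> D n l = H n (incl_chain (map ?sp l))"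
    "\<forall>a. colimit_cocone (pnerve I po) C (chain_cocone (\<lambda>i. (At i, a)) (Colim, a) D)"
    "q = (\<lambda>n l. D n (map (\<lambda>(a, b). (if b = 0 then Colim else Top, a \<noteq> 0)) l))"
    using q(1) unfolding excision_square_def Let_def R_def by blast
  have sub: "?sp (At {}, False) = min_min (gsub G X {})" "?sp (At {}, True) = min_min (gsub G X W)"
    "?sp (Top, False) = min_min (gsub G X Z)" "?sp (Top, True) = min_min (gsub G X (car X))"
    using subspace_min_min[of "{}" X G] subspace_min_min[OF invarD(1)[OF Z], of G] subspace_min_min[OF invarD(1)[OF W], of G] ZW(1) gsub_car[OF X(1)]
    by simp_all
  have po: "po {} {}" by (simp add: po_def)
  have R1: "[(At {}, a), (Colim, a)] \<in> splx R 1" "[(At {}, True), (Colim, True), (Top, True)] \<in> splx R 2"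
    "[(At {}, True), (Top, True)] \<in> splx R 1" "[(Top, False), (Top, True)] \<in> splx R 1" "[(Top, True)] \<in> splx R 0"
    "[(Colim, a)] \<in> splx R 0" "[(At {}, a)] \<in> splx R 0" "[(Colim, True), (Top, True)] \<in> splx R 1" for a
    using po by (simp_all add: R_def splx_pnerve I_def prod_le_def)
  have opR: "opr R n \<alpha> l = map (nth l) \<alpha>" for n \<alpha> l by (simp add: R_def opr_pnerve)
  \<comment> \<open>A colimit over one point is a coproduct with a single leg; in this form the
    colimit corners are compared with the values at actual spaces.\<close>
  have D1: "coprod C {()} (D 0 [(Colim, a)]) (\<lambda>_. D 1 [(At {}, a), (Colim, a)])" for a
  proof -
    have "is_sset (pnerve I po)" by (rule is_sset_pnerve) (simp add: reflp_on_def po_def)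
    moreover have "splx (pnerve I po) m = (\<lambda>_::unit. replicate (Suc m) {}) ` {()}" for m
    proof -
      have "l = replicate (Suc m) {}" if "length l = Suc m" "set l \<subseteq> {{}}" for l :: "('u \<times> 'u) set list"
        by (rule replicate_eqI) (use that in auto)
      moreover have "sorted_wrt po (replicate (Suc m) {})" by (induction m) (simp_all add: po_def)
      ultimately show ?thesis by (auto simp: splx_pnerve I_def)
    qed
    moreover have "opr (pnerve I po) n \<alpha> (replicate (Suc n) {}) = replicate (Suc m) {}" if "\<alpha> \<in> splx (Delta n) m" for n m \<alpha>
    proof -
      have "\<forall>i\<in>set \<alpha>. i < Suc n" using that by (auto simp: Delta_iff)
      then have "map (nth (replicate (Suc n) {})) \<alpha> = map (\<lambda>_. {}) \<alpha>" by (intro map_cong) (simp_all del: replicate_Suc)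
      then show ?thesis using that by (simp add: opr_pnerve Delta_iff map_replicate_const del: replicate_Suc)
    qed
    ultimately have "coprod C {()} (chain_cocone (\<lambda>i. (At i, a)) (Colim, a) D 0 (JRight [0]))
        (\<lambda>j. chain_cocone (\<lambda>i. (At i, a)) (Colim, a) D 1 (JMix 0 (replicate (Suc 0) {}) [0]))"
      using D(3) by (intro colimit_cocone_coprod[where rep = "\<lambda>m _. replicate (Suc m) {}" and lab = "\<lambda>_. ()"]) auto
    then show ?thesis by simp
  qed
  have face: "opr C n \<alpha> (D n l) = D m (map (nth l) \<alpha>)" if "l \<in> splx R n" "\<alpha> \<in> splx (Delta n) m" for n m l \<alpha>
    using sset_mapD(2)[OF D(1) that] by (simp add: opR)
  have DH: "D n l = H n (incl_chain (map ?sp l))" if "l \<in> splx R n" "Colim \<notin> fst ` set l" for n l using D(2) that by blast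
  \<comment> \<open>As \<open>Z\<close> and \<open>W\<close> are disjoint, this corner is the
    colimit of the value at the empty space, a zero object.\<close>
  have "initial C (D 0 [(Colim, False)])"
  proof (rule coprod_initial[OF C D1])
    show "D 0 [(Colim, False)] \<in> splx C 0" by (rule sset_mapD(1)[OF D(1) R1(6)])
    show "D 1 [(At {}, False), (Colim, False)] \<in> splx C 1" by (rule sset_mapD(1)[OF D(1) R1(1)])
    show "opr C 1 [1] (D 1 [(At {}, False), (Colim, False)]) = D 0 [(Colim, False)]"
      using face[OF R1(1), of "[1]" 0] by (simp add: Delta_iff)
    have iv: "invar G X {}" by (simp add: invar_def)
    have "zero_object C (H 0 (incl_chain [min_min (gsub G X {})]))"
      using CH is_gspace_min_min[OF is_gset_invar[OF X(1) iv]] unfolding coarse_homology_def by simp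
    moreover have "opr C 1 [0] (D 1 [(At {}, False), (Colim, False)]) = H 0 (incl_chain [min_min (gsub G X {})])"
      using face[OF R1(1), of "[0]" 0] DH[OF R1(7), of False] sub by (simp add: Delta_iff)
    ultimately show "initial C (opr C 1 [0] (D 1 [(At {}, False), (Colim, False)]))" by (simp add: zero_object_def)
  qed
  then have "initial C (q 0 [(0,0)])" by (simp add: D(4))
  from pushout_coprod[OF C q(2) this]
  have c2: "coprod C UNIV (D 0 [(Top, True)]) (\<lambda>t. if t then D 1 [(Colim, True), (Top, True)] else D 1 [(Top, False), (Top, True)])"
    by (simp add: D(4) cong: if_cong)
  \<comment> \<open>Composing coproducts replaces the leg from the colimit corner by the leg from
    \<open>W\<close>; the triangle relating the two belongs to the excision diagram.\<close>
  define e' where "e' = (\<lambda>s :: unit + bool. if s = Inr False then D 1 [(Top, False), (Top, True)] else D 1 [(At {}, True), (Top, True)])"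
  have "coprod C ({()} <+> (UNIV - {True})) (D 0 [(Top, True)]) e'"
    by (rule coprod_comp[OF Q D1[of True] c2, of True "\<lambda>_. D 2 [(At {}, True), (Colim, True), (Top, True)]"])
       (use sset_mapD(1)[OF D(1) R1(2)] sset_mapD(1)[OF D(1) R1(8)] face[OF R1(2), of "[0,1]" 1] face[OF R1(2), of "[1,2]" 1] face[OF R1(2), of "[0,2]" 1]
          face[OF R1(8), of "[0]" 0] face[OF R1(8), of "[1]" 0] in \<open>simp_all add: Delta_iff e'_def\<close>)
  then have "coprod C UNIV (D 0 [(Top, True)]) (\<lambda>t. if t then D 1 [(At {}, True), (Top, True)] else D 1 [(Top, False), (Top, True)])"
    by (rule coprod_reindex[where \<phi> = "\<lambda>t. if t then Inl () else Inr False" and \<psi> = "\<lambda>s. s = Inl ()"]) (auto simp: e'_def)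
  moreover have "D 0 [(Top, True)] = H 0 (inc G X [car X])" "D 1 [(At {}, True), (Top, True)] = H 1 (inc G X [W, car X])"
    "D 1 [(Top, False), (Top, True)] = H 1 (inc G X [Z, car X])"
    using DH[OF R1(5)] DH[OF R1(3)] DH[OF R1(4)] sub by simp_all
  ultimately show ?thesis by (simp cong: if_cong)
qed

text \<open>Excision splits \<open>Y k\<close> off from the union \<open>W\<close> of the others,
  and the decomposition of \<open>W\<close> is composed with this splitting. Excision is applied
  inside the union of the subsets, which need not be all of \<open>X\<close>.\<close>

lemma excision_finite:
  fixes X :: "('g, 'u) gset" and C :: "'c sset"
  assumes Q: "quasi_category C" and CH: "coarse_homology G C H"
    and X: "is_gset G X" "finite (car X)" and J: "finite J"
    and Y: "\<And>j. j \<in> J ==> invar G X (Y j)" and disj: "\<And>j k. j \<in> J ==> k \<in> J ==> j \<noteq> k ==> Y j \<inter> Y k = {}"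
  shows "coprod C J (H 0 (inc G X [\<Union>j\<in>J. Y j])) (\<lambda>j. H 1 (inc G X [Y j, \<Union>j\<in>J. Y j]))"
  using J Y disj
proof (induction J rule: finite_induct)
  case empty
  have C: "is_sset C" using Q by (simp add: quasi_category_def)
  have iv: "invar G X {}" by (simp add: invar_def)
  have "zero_object C (H 0 (inc G X [{}]))"
    using CH is_gspace_min_min[OF is_gset_invar[OF X(1) iv]] unfolding coarse_homology_def by simp
  then have "initial C (H 0 (inc G X [{}]))" by (simp add: zero_object_def)
  from coprod_empty[OF C this] show ?case by simp
next
  case (insert k J)
  have H: "sset_map (nerve (GBornCoarse G)) C H" using CH by (simp add: coarse_homology_def)
  define W where "W = (\<Union>j\<in>J. Y j)"
  define V where "V = Y k \<union> W"
  have Yj: "invar G X (Y j)" if "j \<in> insert k J" for j by (rule insert.prems(1)[OF that])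
  have W: "invar G X W" using Yj unfolding W_def invar_def by blast
  have V: "invar G X V" using W Yj[of k] unfolding V_def invar_def by blast
  have IH: "coprod C J (H 0 (inc G X [W])) (\<lambda>j. H 1 (inc G X [Y j, W]))"
    unfolding W_def by (rule insert.IH) (use insert.prems in auto)
  have dj: "Y k \<inter> W = {}" using insert.prems(2)[of k] insert.hyps(2) unfolding W_def by blast
  have XV: "is_gset G (gsub G X V)" "finite (car (gsub G X V))"
    using is_gset_invar[OF X(1) V] finite_subset[OF invarD(1)[OF V] X(2)] by simp_all
  have iV: "invar G (gsub G X V) T" if "invar G X T" "T \<subseteq> V" for T
    using that by (auto simp: invar_def)
  have ss: "Y k \<subseteq> V" "W \<subseteq> V" by (auto simp: V_def)
  have u: "Y k \<union> W = car (gsub G X V)" by (simp add: V_def)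
  \<comment> \<open>A subset of the union gives the same discrete space whether it is cut out of the
    union or out of \<open>X\<close>.\<close>
  have i: "inc G (gsub G X V) [W, car (gsub G X V)] = inc G X [W, V]" "inc G (gsub G X V) [Y k, car (gsub G X V)] = inc G X [Y k, V]"
    "inc G (gsub G X V) [car (gsub G X V)] = inc G X [V]"
    using ss by (simp_all add: gsub_gsub)
  have c2: "coprod C UNIV (H 0 (inc G X [V])) (\<lambda>t. if t then H 1 (inc G X [W, V]) else H 1 (inc G X [Y k, V]))"
    using excision_two[OF Q CH XV iV[OF Yj[of k] ss(1)] iV[OF W ss(2)] dj u] unfolding i by simp
  define e' where "e' = (\<lambda>s. case s of Inl j => H 1 (inc G X [Y j, V]) | Inr (b :: bool) => H 1 (inc G X [Y k, V]))"
  note f = inc_faces[OF X H]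
  have "coprod C (J <+> (UNIV - {True})) (H 0 (inc G X [V])) e'"
  proof (rule coprod_comp[OF Q IH c2, of True "\<lambda>j. H 2 (inc G X [Y j, W, V])"])
    fix j assume j: "j \<in> J"
    have s: "length [Y j, W, V] = Suc 2" "\<forall>T\<in>set [Y j, W, V]. invar G X T" "sorted_wrt (\<subseteq>) [Y j, W, V]"
      using Yj[of j] j W V by (auto simp: V_def W_def)
    show "H 2 (inc G X [Y j, W, V]) \<in> splx C 2" by (rule f(1)[OF s])
    show "opr C 2 [0,1] (H 2 (inc G X [Y j, W, V])) = H 1 (inc G X [Y j, W])"
      "opr C 2 [1,2] (H 2 (inc G X [Y j, W, V])) = (if True then H 1 (inc G X [W, V]) else H 1 (inc G X [Y k, V]))"
      "opr C 2 [0,2] (H 2 (inc G X [Y j, W, V])) = e' (Inl j)"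
      using f(2)[OF s, of "[0,1]" 1] f(2)[OF s, of "[1,2]" 1] f(2)[OF s, of "[0,2]" 1] by (simp_all add: Delta_iff e'_def)
  next
    have s: "length [W, V] = Suc 1" "\<forall>T\<in>set [W, V]. invar G X T" "sorted_wrt (\<subseteq>) [W, V]" using W V by (auto simp: V_def)
    show "(if True then H 1 (inc G X [W, V]) else H 1 (inc G X [Y k, V])) \<in> splx C 1"
      "opr C 1 [0] (if True then H 1 (inc G X [W, V]) else H 1 (inc G X [Y k, V])) = H 0 (inc G X [W])"
      "opr C 1 [1] (if True then H 1 (inc G X [W, V]) else H 1 (inc G X [Y k, V])) = H 0 (inc G X [V])"
      using f(1)[OF s] f(2)[OF s, of "[0]" 0] f(2)[OF s, of "[1]" 0] by (simp_all add: Delta_iff)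
  qed (auto simp: e'_def)
  then have "coprod C (insert k J) (H 0 (inc G X [V])) (\<lambda>j. H 1 (inc G X [Y j, V]))"
    by (rule coprod_reindex[where \<phi> = "\<lambda>j. if j = k then Inr False else Inl j" and \<psi> = "\<lambda>s. case s of Inl j => j | Inr b => k"])
       (use insert.hyps(2) in \<open>auto simp: e'_def\<close>)
  then show ?case by (simp add: V_def W_def)
qed

section \<open>The Mackey functor of a coarse homology theory\<close>

text \<open>A set has finite image under an inclusion exactly if it is finite, so for inclusions of
  discrete spaces \<open>iota\<close> does not change the bornology.\<close>

lemma pull_born_min_min:
  assumes "car A \<subseteq> car X"
  shows "pull_born (restrict id (car A)) (min_min A) (min_min X) = min_min A"
proof -
  have "B \<subseteq> car A \<and> restrict id (car A) ` B \<in> Fpow (car X) \<longleftrightarrow> B \<in> Fpow (car A)" for B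
  proof (cases "B \<subseteq> car A")
    case True
    then have "restrict id (car A) ` B = B" by (force simp: image_iff)
    then show ?thesis using True assms unfolding Fpow_def by auto
  qed (simp add: Fpow_def)
  then have "{B. B \<subseteq> car A \<and> restrict id (car A) ` B \<in> Fpow (car X)} = Fpow (car A)" by blast
  then show ?thesis by (simp add: pull_born_def min_min_def)
qed

lemma EM_obj: "EM E 0 (obj X) = E 0 (iota 0 (incl_chain [min_min X]))"
proof -
  have "M_functor 0 (duality 0 (obj X)) = iota 0 (incl_chain [min_min X])"
    unfolding M_functor_def duality_def reindex_def obj_def iota_def incl_chain_def
    by (rule mk_diag_cong) (auto simp: Tw_0 pull_born_min_min tw_le_def)
  then show ?thesis by (simp add: EM_def)
qed

text \<open>The backward leg of the span is the identity, so the transfer is trivial.\<close>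

lemma EM_inclusion:
  fixes X :: "('g, 'u) gset"
  assumes X: "is_gset G X" and Y: "Y \<subseteq> car X"
  shows "EM E 1 (span X (gsub G X Y) (gsub G X Y) (restrict id Y) (restrict id Y)) = E 1 (iota 1 (inc G X [Y, car X]))"
proof -
  let ?A = "gsub G X Y"
  have p: "pull_born (restrict id Y) (min_min ?A) (min_min ?A) = min_min ?A" "pull_born (restrict id Y) (min_min ?A) (min_min X) = min_min ?A"
    "pull_born (restrict id (car X)) (min_min X) (min_min X) = min_min X"
    using pull_born_min_min[of ?A ?A] pull_born_min_min[of ?A X] pull_born_min_min[of X X] Y by simp_all
  have c: "p = (0,0) \<or> p = (0,1) \<or> p = (1,1)" if "p \<in> Tw 1" for p using that Tw_1 by blast
  have s: "snd (span X ?A ?A (restrict id Y) (restrict id Y)) (0,0) (0,0) = restrict id (car X)"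
    "snd (span X ?A ?A (restrict id Y) (restrict id Y)) (1,1) (1,1) = restrict id Y"
    "snd (span X ?A ?A (restrict id Y) (restrict id Y)) (0,1) (0,1) = restrict id Y"
    by (simp_all add: span_def Let_def Tw_def tw_le_def)
  \<comment> \<open>Duality exchanges the legs, so the inclusion into \<open>X\<close> becomes the
    forward one.\<close>
  define D where "D = duality 1 (span X ?A ?A (restrict id Y) (restrict id Y))"
  have D: "fst D (0,0) = ?A" "fst D (0,1) = ?A" "fst D (1,1) = X" "snd D (0,0) (0,0) = restrict id Y" "snd D (0,1) (0,1) = restrict id Y"
    "snd D (0,1) (0,0) = restrict id Y" "snd D (0,1) (1,1) = restrict id Y" "snd D (1,1) (1,1) = restrict id (car X)"
    unfolding D_def duality_def reindex_def
    using span_simps[of X ?A ?A "restrict id Y" "restrict id Y"] s by (simp_all add: Tw_def tw_le_def)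
  define F where "F = incl_chain [min_min ?A, min_min X]"
  have F: "fst F 0 = min_min ?A" "fst F 1 = min_min X" "snd F 0 0 = restrict id Y" "snd F 0 1 = restrict id Y" "snd F 1 1 = restrict id (car X)"
    unfolding F_def incl_chain_def by (simp_all add: numeral_2_eq_2)
  have "M_functor 1 D = iota 1 F"
    unfolding M_functor_def iota_def
  proof (rule mk_diag_cong)
    fix q assume "q \<in> Tw 1"
    from c[OF this] show "min_min (fst D q) = (case q of (i, j) => pull_born (snd F i j) (fst F i) (fst F j))"
      using D F p by (elim disjE) (simp_all only: prod.case)
    fix q' assume "q' \<in> Tw 1" "tw_le q q'"
    with c[OF \<open>q \<in> Tw 1\<close>] c[OF \<open>q' \<in> Tw 1\<close>]
    show "snd D q q' = (case q of (i, j) => \<lambda>(i', j'). snd F i i') q'"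
      using D F by (elim disjE) (simp_all add: tw_le_def)
  qed
  moreover have "inc G X [Y, car X] = F" by (simp add: F_def gsub_car[OF X])
  ultimately show ?thesis by (simp add: EM_def D_def)
qed

text \<open>A triangle of spans is read in the opposite category with its outer faces exchanged.\<close>

lemma EM_triangle:
  fixes G :: "('g, 'r) monoid_scheme" and t :: "('g, 'u) span_simplex"
  assumes EM: "sset_map (op_sset (A_eff G)) C (EM E)" and t: "t \<in> splx (A_eff G) 2"
  shows "EM E 2 t \<in> splx C 2" "opr C 2 [0,1] (EM E 2 t) = EM E 1 (opr (A_eff G) 2 [1,2] t)"
    "opr C 2 [1,2] (EM E 2 t) = EM E 1 (opr (A_eff G) 2 [0,1] t)" "opr C 2 [0,2] (EM E 2 t) = EM E 1 (opr (A_eff G) 2 [0,2] t)"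
proof -
  have t': "t \<in> splx (op_sset (A_eff G)) 2" using t by simp
  show "EM E 2 t \<in> splx C 2" by (rule sset_mapD(1)[OF EM t'])
  show "opr C 2 [0,1] (EM E 2 t) = EM E 1 (opr (A_eff G) 2 [1,2] t)"
    "opr C 2 [1,2] (EM E 2 t) = EM E 1 (opr (A_eff G) 2 [0,1] t)" "opr C 2 [0,2] (EM E 2 t) = EM E 1 (opr (A_eff G) 2 [0,2] t)"
    using sset_mapD(2)[OF EM t', of "[0,1]" 1] sset_mapD(2)[OF EM t', of "[1,2]" 1] sset_mapD(2)[OF EM t', of "[0,2]" 1]
    unfolding opr_op_sset rv2 by (simp_all add: Delta_iff)
qed

text \<open>
  If \<open>\<gamma>\<close> is bijective and \<open>\<pi>\<close> is injective, then \<open>\<pi> \<circ> \<gamma>\<inverse>\<close> identifies \<open>S\<close> with the image of \<open>\<pi>\<close>; the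
  two triangles express this in the effective Burnside category.
\<close>

lemma span_retract:
  fixes G :: "('g, 'r) monoid_scheme" and X A S :: "('g, 'u) gset"
  assumes X: "is_gset G X" "finite (car X)" and A: "is_gset G A" "finite (car A)" and S: "is_gset G S" "finite (car S)"
    and \<pi>: "\<pi> \<in> equivariant_maps G A X" "inj_on \<pi> (car A)" and \<gamma>: "\<gamma> \<in> equivariant_maps G A S" "bij_betw \<gamma> (car A) (car S)"
  defines "Y \<equiv> \<pi> ` car A" and "B \<equiv> gsub G X (\<pi> ` car A)"
  shows "invar G X Y"
    and "\<exists>t\<in>splx (A_eff G) 2. opr (A_eff G) 2 [0,1] t = span X A S \<pi> \<gamma> \<and> opr (A_eff G) 2 [1,2] t = span S A B \<gamma> \<pi> \<and>
      opr (A_eff G) 2 [0,2] t = span X B B (restrict id Y) (restrict id Y)"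
    and "\<exists>t\<in>splx (A_eff G) 2. opr (A_eff G) 2 [0,1] t = span S A B \<gamma> \<pi> \<and>
      opr (A_eff G) 2 [0,2] t = span S S S (restrict id (car S)) (restrict id (car S))"
proof -
  show iv: "invar G X Y"
    using equivariantD(1,2)[OF \<pi>(1)] gsetD(1)[OF A(1)] by (auto simp: invar_def Y_def) (metis image_eqI)
  have B: "is_gset G B" "finite (car B)" "car B = Y"
    using is_gset_invar[OF X(1) iv] A(2) by (simp_all add: B_def Y_def)
  have \<pi>B: "\<pi> \<in> equivariant_maps G A B"
    by (rule equivariantI) (use equivariantD[OF \<pi>(1)] in \<open>auto simp: B_def\<close>)
  have iX: "restrict id Y \<in> equivariant_maps G B X" "restrict id Y \<in> equivariant_maps G B B"
    using iv invarD[OF iv] by (auto intro!: equivariantI simp: B_def Y_def[symmetric])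
  \<comment> \<open>The inverse of \<pi> on its image. It and the inverse \<open>s\<close> of
    \<gamma> below serve as projections of the two pull-backs, which are diagonal because \<gamma>
    and \<pi> are injective.\<close>
  define p where "p = (\<lambda>y\<in>Y. inv_into (car A) \<pi> y)"
  have p: "p (\<pi> a) = a" if "a \<in> car A" for a using that \<pi>(2) by (simp add: p_def Y_def)
  have pe: "p \<in> equivariant_maps G B A"
  proof (rule equivariantI)
    fix y assume "y \<in> car B"
    then obtain a where a: "a \<in> car A" "y = \<pi> a" by (auto simp: B(3) Y_def)
    show "p y \<in> car A" using a p by simp
    show "p (act B g y) = act A g (p y)" if g: "g \<in> carrier G" for g
    proof -
      have "act B g y = \<pi> (act A g a)" using equivariantD(2)[OF \<pi>B g a(1)] a by simp
      then show ?thesis using a p gsetD(1)[OF A(1) g a(1)] by simp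
    qed
  qed (simp add: p_def B(3))
  define s where "s = (\<lambda>y\<in>car S. inv_into (car A) \<gamma> y)"
  have s: "s (\<gamma> a) = a" if "a \<in> car A" for a
    using that \<gamma>(2) bij_betw_inv_into_left[OF \<gamma>(2) that] equivariantD(1)[OF \<gamma>(1) that] by (simp add: s_def)
  have Sa: "\<exists>a\<in>car A. y = \<gamma> a" if "y \<in> car S" for y using \<gamma>(2) that by (auto simp: bij_betw_def)
  have se: "s \<in> equivariant_maps G S A"
  proof (rule equivariantI)
    fix y assume "y \<in> car S"
    then obtain a where a: "a \<in> car A" "y = \<gamma> a" using Sa by blast
    show "s y \<in> car A" using a s by simp
    show "s (act S g y) = act A g (s y)" if g: "g \<in> carrier G" for g
    proof -
      have "act S g y = \<gamma> (act A g a)" using equivariantD(2)[OF \<gamma>(1) g a(1)] a by simp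
      then show ?thesis using a s gsetD(1)[OF A(1) g a(1)] by simp
    qed
  qed (simp add: s_def)
  have \<gamma>i: "a = b" if "a \<in> car A" "b \<in> car A" "\<gamma> a = \<gamma> b" for a b using \<gamma>(2) that by (auto simp: bij_betw_def inj_on_def)
  have e1: "\<forall>y\<in>car B. \<pi> (p y) = restrict id Y y \<and> \<pi> (p y) = restrict id Y y \<and> \<gamma> (p y) = \<gamma> (p y)"
    using p by (auto simp: B(3) Y_def)
  have f1: "fibre_product p p \<gamma> \<gamma> (car B) (car A) (car A)"
    unfolding fibre_product_def
  proof (intro conjI ballI impI)
    fix a b assume ab: "a \<in> car A" "b \<in> car A" "\<gamma> a = \<gamma> b"
    then have "a = b" by (rule \<gamma>i)
    then show "\<exists>!y. y \<in> car B \<and> p y = a \<and> p y = b"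
      by (intro ex1I[of _ "\<pi> a"]) (use ab p in \<open>auto simp: B(3) Y_def\<close>)
  qed simp
  obtain t1 where t1: "t1 \<in> splx (A_eff G) 2" "opr (A_eff G) 2 [0,1] t1 = span X A S \<pi> \<gamma>" "opr (A_eff G) 2 [1,2] t1 = span S A B \<gamma> \<pi>"
    "opr (A_eff G) 2 [0,2] t1 = span X B B (restrict id Y) (restrict id Y)"
    by (rule span_triangleI[OF X(1) S(1) B(1) A(1) A(1) B(1) X(2) S(2) B(2) A(2) A(2) B(2) \<pi>(1) \<gamma>(1) \<gamma>(1) \<pi>B pe pe iX e1 f1])
  show "\<exists>t\<in>splx (A_eff G) 2. opr (A_eff G) 2 [0,1] t = span X A S \<pi> \<gamma> \<and> opr (A_eff G) 2 [1,2] t = span S A B \<gamma> \<pi> \<and>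
      opr (A_eff G) 2 [0,2] t = span X B B (restrict id Y) (restrict id Y)"
    by (rule bexI[OF _ t1(1)]) (intro conjI t1(2-4))
  have sg: "\<gamma> (s y) = y" if "y \<in> car S" for y using Sa[OF that] s by force
  have e2: "\<forall>y\<in>car S. \<gamma> (s y) = restrict id (car S) y \<and> \<gamma> (s y) = restrict id (car S) y \<and> \<pi> (s y) = \<pi> (s y)"
    using sg by simp
  have f2: "fibre_product s s \<pi> \<pi> (car S) (car A) (car A)"
    unfolding fibre_product_def
  proof (intro conjI ballI impI)
    fix a b assume ab: "a \<in> car A" "b \<in> car A" "\<pi> a = \<pi> b"
    then have "a = b" using \<pi>(2) by (simp add: inj_on_def)
    then show "\<exists>!y. y \<in> car S \<and> s y = a \<and> s y = b"
      by (intro ex1I[of _ "\<gamma> a"]) (use ab s sg equivariantD(1)[OF \<gamma>(1)] in auto)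
  qed simp
  have iS: "restrict id (car S) \<in> equivariant_maps G S S" by (rule equivariant_id[OF S(1)])
  obtain t2 where t2: "t2 \<in> splx (A_eff G) 2" "opr (A_eff G) 2 [0,1] t2 = span S A B \<gamma> \<pi>" "opr (A_eff G) 2 [1,2] t2 = span B A S \<pi> \<gamma>"
    "opr (A_eff G) 2 [0,2] t2 = span S S S (restrict id (car S)) (restrict id (car S))"
    by (rule span_triangleI[OF S(1) B(1) S(1) A(1) A(1) S(1) S(2) B(2) S(2) A(2) A(2) S(2) \<gamma>(1) \<pi>B \<pi>B \<gamma>(1) se se iS iS e2 f2])
  show "\<exists>t\<in>splx (A_eff G) 2. opr (A_eff G) 2 [0,1] t = span S A B \<gamma> \<pi> \<and>
      opr (A_eff G) 2 [0,2] t = span S S S (restrict id (car S)) (restrict id (car S))"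
    by (rule bexI[OF _ t2(1)]) (intro conjI t2(2,4))
qed

lemma preserves_coproducts_EM:
  fixes G :: "('g, 'r) monoid_scheme" and C :: "'c sset" and E :: "nat => ('g, 'u) tr_simplex => 'c"
  assumes U: "infinite (UNIV :: 'u set)" and Q: "quasi_category C" and E: "coarse_homology_with_transfers G C E"
    and cc: "colimit_cocone (discrete J) (op_sset (A_eff G)) c"
  shows "colimit_cocone (discrete J) C (\<lambda>n x. EM E n (c n x))"
proof -
  let ?A = "A_eff G :: ('g, 'u) span_simplex sset"
  have C: "is_sset C" using Q by (simp add: quasi_category_def)
  have EM: "sset_map (op_sset ?A) C (EM E)" by (rule sset_map_EM[OF U]) (use E in \<open>simp add: coarse_homology_with_transfers_def\<close>)
  have CH: "coarse_homology G C (\<lambda>n F. E n (iota n F))" using E by (simp add: coarse_homology_with_transfers_def)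
  have cm: "sset_map (sjoin (discrete J) (Delta 0)) (op_sset ?A) c" by (rule colimit_cocone_sset_map[OF is_sset_discrete cc])
  have cs: "sset_map (sjoin (discrete J) (Delta 0)) C (\<lambda>n x. EM E n (c n x))"
    using sset_mapD[OF cm] sset_mapD[OF EM] by (simp add: sset_map_def)
  have cp: "coprod (op_sset ?A) J (c 0 (JRight [0])) (\<lambda>j. c 1 (JMix 0 j [0]))"
    by (rule colimit_cocone_coprod[OF is_sset_discrete _ _ _ cc, where rep = "\<lambda>m j. j" and lab = id]) (auto simp: discrete_def)
  have z: "[0] \<in> splx (Delta 0) 0" by (simp add: Delta_iff)
  have jx: "JRight [0] \<in> splx (sjoin (discrete J) (Delta 0)) 0" using z by (simp add: splx_sjoin)
  have je: "JMix 0 j [0] \<in> splx (sjoin (discrete J) (Delta 0)) 1" if "j \<in> J" for j using that z by (simp add: splx_sjoin discrete_def)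
  define x where "x = c 0 (JRight [0])"
  define e where "e = (\<lambda>j. c 1 (JMix 0 j [0]))"
  have x: "x \<in> splx ?A 0" using sset_mapD(1)[OF cm jx] by (simp add: x_def)
  have e: "e j \<in> splx ?A 1" if "j \<in> J" for j using sset_mapD(1)[OF cm je[OF that]] by (simp add: e_def)
  \<comment> \<open>The cone point is the vertex 1 of a leg in the join, hence the vertex 0 of the
    span, because operators are reversed in the opposite.\<close>
  have e0: "opr ?A 1 [0] (e j) = x" if "j \<in> J" for j
  proof -
    have "opr (sjoin (discrete J) (Delta 0)) 1 [1] (JMix 0 j [0]) = JRight [0]"
      by (simp add: opr_sjoin join_opr.simps opr_pnerve)
    then have "c 0 (JRight [0]) = opr (op_sset ?A) 1 [1] (c 1 (JMix 0 j [0]))"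
      using sset_mapD(2)[OF cm je[OF that], of "[1]" 0] by (simp add: Delta_iff)
    then show ?thesis unfolding opr_op_sset rv2 by (simp add: x_def e_def)
  qed
  define X where "X = fst x (0,0)"
  define A where "A = (\<lambda>j. fst (e j) (0,1))"
  define S where "S = (\<lambda>j. fst (e j) (1,1))"
  define \<pi> where "\<pi> = (\<lambda>j. snd (e j) (0,1) (0,0))"
  define \<gamma> where "\<gamma> = (\<lambda>j. snd (e j) (0,1) (1,1))"
  have xX: "x = obj X"
    using face_obj[OF x, of 0] is_ssetD(1)[OF is_sset_A_eff x] by (simp add: X_def upt_Suc)
  have Fe: "is_functor (Tw 1) tw_le (GFin G) (e j)" if "j \<in> J" for j using e[OF that] by (simp add: splx_A_eff)
  have eX: "fst (e j) (0,0) = X" if "j \<in> J" for j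
  proof -
    have "opr ?A 1 [0] (e j) = obj (fst (e j) (0,0))" by (rule face_obj[OF e[OF that]]) simp
    then have "obj (fst (e j) (0,0)) = obj X" using e0[OF that] xX by simp
    then show ?thesis by (rule obj_inject)
  qed
  have es: "e j = span X (A j) (S j) (\<pi> j) (\<gamma> j)" if "j \<in> J" for j
    by (rule span_eqI[OF eX[OF that] _ _ _ _ Fe[OF that]]) (simp_all add: A_def S_def \<pi>_def \<gamma>_def)
  have tw: "(0,0) \<in> Tw 0" "(0,0) \<in> Tw 1" "(0,1) \<in> Tw 1" "(1,1) \<in> Tw 1" "tw_le (0,1) (0,0)" "tw_le (0,1) (1,1)" by (simp_all add: Tw_def tw_le_def)
  have X: "is_gset G X" "finite (car X)"
  proof -
    have "is_functor (Tw 0) tw_le (GFin G) x" using x by (simp add: splx_A_eff)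
    from is_functorD(2)[OF this tw(1)] show "is_gset G X" "finite (car X)" by (simp_all add: X_def)
  qed
  have AS: "is_gset G (A j)" "finite (car (A j))" "is_gset G (S j)" "finite (car (S j))"
      "\<pi> j \<in> equivariant_maps G (A j) X" "\<gamma> j \<in> equivariant_maps G (A j) (S j)" if "j \<in> J" for j
    using is_functorD(2)[OF Fe[OF that] tw(3)] is_functorD(2)[OF Fe[OF that] tw(4)] is_functorD(4)[OF Fe[OF that] tw(3,2,5)]
      is_functorD(4)[OF Fe[OF that] tw(3,4,6)] eX[OF that] by (simp_all add: A_def S_def \<pi>_def \<gamma>_def)
  have cp': "coprod (op_sset ?A) J (obj X) (\<lambda>j. span X (A j) (S j) (\<pi> j) (\<gamma> j))"
    using cp unfolding x_def[symmetric] xX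
    by (rule coprod_reindex[where \<phi> = id and \<psi> = id]) (simp_all add: es[symmetric] e_def)
  have st: "\<forall>j\<in>J. bij_betw (\<gamma> j) (car (A j)) (car (S j))"
    "bij_betw (\<lambda>(j, a). \<pi> j a) (SIGMA j:J. car (A j)) (car X)" "finite {j \<in> J. car (S j) \<noteq> {}}"
    by (rule coprod_spans[OF U X _ _ _ _ _ _ cp'], (rule AS, assumption)+)+
  define J' where "J' = {j \<in> J. car (S j) \<noteq> {}}"
  define Y where "Y = (\<lambda>j. \<pi> j ` car (A j))"
  have \<gamma>b: "bij_betw (\<gamma> j) (car (A j)) (car (S j))" if "j \<in> J" for j using st(1) that by blast
  have \<pi>i: "j = k \<and> a = b" if "j \<in> J" "a \<in> car (A j)" "k \<in> J" "b \<in> car (A k)" "\<pi> j a = \<pi> k b" for j a k b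
    using inj_onD[OF bij_betw_imp_inj_on[OF st(2)], of "(j, a)" "(k, b)"] that by auto
  have \<pi>inj: "inj_on (\<pi> j) (car (A j))" if "j \<in> J" for j using \<pi>i that by (auto intro: inj_onI)
  have iv: "invar G X (Y j)" if "j \<in> J" for j
    unfolding Y_def by (rule span_retract(1)[OF X AS(1-4)[OF that] AS(5)[OF that] \<pi>inj[OF that] AS(6)[OF that] \<gamma>b[OF that]])
  \<comment> \<open>Indices with empty \<open>S j\<close> contribute no point to \<open>X\<close>,
    so the finitely many others already cover it.\<close>
  have UY: "(\<Union>j\<in>J'. Y j) = car X"
  proof -
    have "y \<in> (\<Union>j\<in>J'. Y j)" if "y \<in> car X" for y
    proof -
      have "y \<in> (\<lambda>(j, a). \<pi> j a) ` (SIGMA j:J. car (A j))" using bij_betw_imp_surj_on[OF st(2)] that by simp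
      then obtain z where z: "y = (case z of (j, a) => \<pi> j a)" "z \<in> (SIGMA j:J. car (A j))" by (rule imageE)
      obtain j a where "z = (j, a)" by (cases z)
      then have ja: "j \<in> J" "a \<in> car (A j)" "y = \<pi> j a" using z by auto
      then have "j \<in> J'" using equivariantD(1)[OF AS(6)[OF ja(1)] ja(2)] by (auto simp: J'_def)
      then show ?thesis using ja by (auto simp: Y_def)
    qed
    then show ?thesis using iv invarD(1) by (fastforce simp: J'_def)
  qed
  have "coprod C J' (E 0 (iota 0 (inc G X [\<Union>j\<in>J'. Y j]))) (\<lambda>j. E 1 (iota 1 (inc G X [Y j, \<Union>j\<in>J'. Y j])))"
  proof (rule excision_finite[OF Q CH X])
    show "finite J'" unfolding J'_def by (rule st(3))
    show "invar G X (Y j)" if "j \<in> J'" for j using iv that by (simp add: J'_def)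
    show "Y j \<inter> Y k = {}" if "j \<in> J'" "k \<in> J'" "j \<noteq> k" for j k
      using \<pi>i[of j _ k] that by (auto simp: Y_def J'_def)
  qed
  then have "coprod C J' (EM E 0 x) (\<lambda>j. E 1 (iota 1 (inc G X [Y j, car X])))"
    unfolding UY by (simp add: xX EM_obj gsub_car[OF X(1)])
  then have "coprod C J' (EM E 0 x) (\<lambda>j. EM E 1 (e j))"
  \<comment> \<open>In \<open>C\<close> the map \<open>v\<close> leads from the value at the image
    \<open>Y j\<close> to the value at \<open>S j\<close>. The first triangle of
    \<open>span_retract\<close> factors the inclusion leg through it, the second gives its
    section.\<close>
  proof (rule coprod_retract[OF Q, where v = "\<lambda>j. EM E 1 (span (S j) (A j) (gsub G X (Y j)) (\<gamma> j) (\<pi> j))"])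
    fix j assume "j \<in> J'"
    then have j: "j \<in> J" by (simp add: J'_def)
    note r = span_retract(2,3)[OF X AS(1-4)[OF j] AS(5)[OF j] \<pi>inj[OF j] AS(6)[OF j] \<gamma>b[OF j], folded Y_def]
    have YX: "\<pi> j ` car (A j) \<subseteq> car X" using invarD(1)[OF iv[OF j]] by (simp add: Y_def)
    obtain t1 where t1: "t1 \<in> splx ?A 2" "opr ?A 2 [0,1] t1 = e j" "opr ?A 2 [1,2] t1 = span (S j) (A j) (gsub G X (Y j)) (\<gamma> j) (\<pi> j)"
      "opr ?A 2 [0,2] t1 = span X (gsub G X (Y j)) (gsub G X (Y j)) (restrict id (Y j)) (restrict id (Y j))"
      using r(1) unfolding es[OF j] Y_def by blast
    have "EM E 1 (opr ?A 2 [0,2] t1) = E 1 (iota 1 (inc G X [Y j, car X]))"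
      unfolding t1(4) by (rule EM_inclusion[OF X(1)]) (use YX in \<open>simp add: Y_def\<close>)
    then show "\<exists>r\<in>splx C 2. opr C 2 [0,1] r = EM E 1 (span (S j) (A j) (gsub G X (Y j)) (\<gamma> j) (\<pi> j)) \<and>
        opr C 2 [1,2] r = EM E 1 (e j) \<and> opr C 2 [0,2] r = E 1 (iota 1 (inc G X [Y j, car X]))"
      using EM_triangle[OF EM t1(1)] t1(2,3) by (intro bexI[of _ "EM E 2 t1"]) simp_all
    obtain t2 where t2: "t2 \<in> splx ?A 2" "opr ?A 2 [0,1] t2 = span (S j) (A j) (gsub G X (Y j)) (\<gamma> j) (\<pi> j)"
      "opr ?A 2 [0,2] t2 = span (S j) (S j) (S j) (restrict id (car (S j))) (restrict id (car (S j)))"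
      using r(2) unfolding Y_def by blast
    have e': "e j \<in> splx (op_sset ?A) 1" using e[OF j] by simp
    have "opr C 1 [0,0] (EM E 1 (e j)) = EM E 1 (opr (op_sset ?A) 1 [0,0] (e j))"
      using sset_mapD(2)[OF EM e', of "[0,0]" 1] by (simp add: Delta_iff)
    also have "\<dots> = EM E 1 (opr ?A 2 [0,2] t2)"
      unfolding opr_op_sset rv2 t2(3) using span_faces(4)[OF e[OF j, unfolded es[OF j]]] es[OF j] by simp
    finally show "\<exists>t\<in>splx C 2. opr C 2 [1,2] t = EM E 1 (span (S j) (A j) (gsub G X (Y j)) (\<gamma> j) (\<pi> j)) \<and>
        opr C 2 [0,2] t = opr C 1 [0,0] (EM E 1 (e j))"
      using EM_triangle[OF EM t2(1)] t2(2) by (intro bexI[of _ "EM E 2 t2"]) simp_all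
  qed
  then have "coprod C J (EM E 0 x) (\<lambda>j. EM E 1 (e j))"
  \<comment> \<open>The remaining legs start at the value of an empty space, which is a zero
    object.\<close>
  proof (rule coprod_extend_initial[OF C])
    show "J' \<subseteq> J" by (auto simp: J'_def)
    fix j assume "j \<in> J - J'"
    then have j: "j \<in> J" "car (S j) = {}" by (auto simp: J'_def)
    have e': "e j \<in> splx (op_sset ?A) 1" using e[OF j(1)] by simp
    have "opr C 1 [0] (EM E 1 (e j)) = EM E 0 (opr (op_sset ?A) 1 [0] (e j))"
      using sset_mapD(2)[OF EM e', of "[0]" 0] by (simp add: Delta_iff)
    also have "\<dots> = EM E 0 (obj (S j))"
      unfolding opr_op_sset rv2 using span_faces(2)[OF e[OF j(1), unfolded es[OF j(1)]]] es[OF j(1)] by simp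
    finally have "opr C 1 [0] (EM E 1 (e j)) = E 0 (iota 0 (incl_chain [min_min (S j)]))" by (simp add: EM_obj)
    moreover have "zero_object C (E 0 (iota 0 (incl_chain [min_min (S j)])))"
      using CH is_gspace_min_min[OF AS(3)[OF j(1)]] j(2) unfolding coarse_homology_def by simp
    ultimately show "initial C (opr C 1 [0] (EM E 1 (e j)))" by (simp add: zero_object_def)
  qed
  then show ?thesis
    by (intro coprod_colimit_cocone[OF C cs]) (simp add: x_def e_def)
qed

theorem corollary4p7:
  fixes G :: "('g, 'r) monoid_scheme"
    and C :: "'c sset"
    and E :: "nat => ('g, 'u) tr_simplex => 'c"
  assumes "group G" and "finite (carrier G)"
    and "infinite (UNIV :: 'u set)"
    and "quasi_category C" and "stable C" and "cocomplete TYPE('u small) C"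
    and "coarse_homology_with_transfers G C E"
  shows "EM E \<in> Mack G C"
proof -
  have "sset_map (op_sset (A_eff G)) C (EM E)"
    by (rule sset_map_EM[OF assms(3)]) (use assms(7) in \<open>simp add: coarse_homology_with_transfers_def\<close>)
  moreover have "preserves_coproducts TYPE('u small) (op_sset (A_eff G)) C (EM E)"
    unfolding preserves_coproducts_def using preserves_coproducts_EM[OF assms(3,4,7)] by blast
  ultimately show ?thesis by (simp add: Mack_def)
qed

end
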